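(* Fix a root system $\Phi$ of finite or affine type. The assignment $(c,\alpha,\beta)\mapsto(\alpha\|\beta)_c$, defined for Coxeter elements $c$ and $\alpha,\beta\in\Phi_c$, is the unique function satisfying the following properties for all Coxeter elements $c$: (i) $(-\alpha_i\|\beta)_c=[\beta:\alpha_i]$ for every simple root $\alpha_i$ and $\beta\in\Phi_c$; (ii) $(\beta\|-\alpha_i)_c=[\beta^\vee:\alpha_i^\vee]$ for every simple root $\alpha_i$ and $\beta\in\Phi_c$; (iii) $(\alpha\|\beta)_c=(\alpha\|\beta)_c^{\circ}$ for $\alpha,\beta\in\Upsilon^{\mathrm{re}}_c$; (iv) $(\delta\|\alpha)_c=(\alpha\|\delta)_c=0$ for $\alpha\in\Upsilon^{\mathrm{re}}_c\cup\{\delta\}$; (v) $(\alpha\|\beta)_c=(\sigma_s\alpha\|\sigma_s\beta)_{scs}$ for $\alpha,\beta\in\Phi_c$ and $s$ initial or final in $c$. (In finite type, (iii) and (iv) are vacuous.)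
   Context: $A=[a_{ij}]$ is an $n\times n$ symmetrizable Cartan matrix (finite or affine type) with symmetrizing constants $d_i$; $V$ has basis of simple roots $\Pi=\{\alpha_1,\dots,\alpha_n\}$, co-roots $\alpha_i^\vee=d_i^{-1}\alpha_i$, symmetric form $K(\alpha_i^\vee,\alpha_j)=a_{ij}$, reflections $s_i(v)=v-K(\alpha_i^\vee,v)\alpha_i$, $S=\{s_i\}$. $\Phi$ is the root system, $\Phi^+$ the positive roots, $[v:\alpha_i]$ and $[v:\alpha_i^\vee]$ the coordinates of $v$ in the root and co-root bases, $[x]_+=\max(x,0)$. For a real root $\beta$, $\beta^\vee=\frac2{K(\beta,\beta)}\beta$. A Coxeter element $c$ is a product of all elements of $S$ in some order; $s$ is initial/final in $c$ if $c$ has a reduced word beginning/ending with $s$. For each $c$, index simple roots so that $c=s_1\cdots s_n$ in the formulas below. $\sigma_s$ on $-\Pi\cup\Phi^+$: $\sigma_s(\alpha)=\alpha$ for $\alpha\in-\Pi\setminus\{-\alpha_s\}$ and $\sigma_s(\alpha)=s\alpha$ otherwise. Finite type: $\Phi_c=\Phi^+\cup-\Pi$, $\Upsilon^{\mathrm{re}}_c=\emptyset$, and $(\alpha\|\beta)_c=\max[(\alpha\|\beta)^{\to}_c,(\alpha\|\beta)^{\leftarrow}_c]$ with $(\alpha\|\beta)_c^{\to}=-\sum_{i}[\alpha^\vee:\alpha_i^\vee][\beta:\alpha_i]-\sum_{1\le j<i\le n}a_{ij}[\alpha^\vee:\alpha_i^\vee]_+[\beta:\alpha_j]_+$ and $(\alpha\|\beta)_c^{\leftarrow}=-\sum_{i}[\alpha^\vee:\alpha_i^\vee][\beta:\alpha_i]-\sum_{1\le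 i<j\le n}a_{ij}[\alpha^\vee:\alpha_i^\vee]_+[\beta:\alpha_j]_+$ (with $(-\alpha_i)^\vee=-\alpha_i^\vee$). Affine type: $\delta$ is the positive imaginary root closest to $0$, $\delta^\vee$ the positive imaginary root closest to $0$ of the dual root system (Cartan matrix $A^T$). With $\alpha_{\mathrm{aff}}$ the affine simple root, $V_{\mathrm{fin}}$ the span of the other simple roots, $\Phi_{\mathrm{fin}}=\Phi\cap V_{\mathrm{fin}}$: $\gamma_c\in V_{\mathrm{fin}}$ is the unique vector with $c\gamma_c=\gamma_c+\delta$, $U_c=\{v:K(\gamma_c,v)=0\}$, $\Upsilon_c=\Phi\cap U_c$, $\Upsilon^{\mathrm{re}}_c$ the positive real roots of $U_c$ whose $c$-orbit contains a root of $\Phi_{\mathrm{fin}}$, and $\Phi_c=-\Pi\cup(\Phi^+\setminus U_c)\cup\Upsilon^{\mathrm{re}}_c\cup\{\delta\}$. The real roots of $\Upsilon_c$ form a root system with irreducible components of affine type A; $\Pi_c$ is the unique minimal subset of $\Upsilon_c\cap\Phi^+$ whose nonnegative span contains $\Upsilon_c\cap\Phi^+$, partitioned among components. The tube support $\mathrm{Supp}_{\Pi_c}(\beta)$ of a real root $\beta\in\Upsilon_c$ is the set of elements of $\Pi_c$ with nonzero coefficient in its unique expansion in simple roots of its component; for a set take the union; a set is component-full if its tube support contains all simple roots of some component. $\beta_j\in\Pi_c$ is adjacent to $\alpha$ if $\beta_j\in\mathrm{Supp}_{\Pi_c}(c\alpha)\cup\mathrm{Supp}_{\Pi_c}(c^{-1}\alpha)$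 and $\beta_j\notin\mathrm{Supp}_{\Pi_c}(\alpha)$; $\mathrm{adj}(\alpha,\beta)$ is the number of elements of $\mathrm{Supp}_{\Pi_c}(\beta)$ adjacent to $\alpha$. $(\alpha\|\beta)^\circ_c=-1$ if $\alpha=\beta$; $=0$ if one of $\mathrm{Supp}_{\Pi_c}(\alpha),\mathrm{Supp}_{\Pi_c}(\beta)$ is properly contained in the other; $=\mathrm{adj}(\alpha,\beta)$ otherwise. The compatibility degree is $(\alpha\|\beta)_c=\mathrm{adj}(\alpha,\beta)$ if $\alpha,\beta\in\Upsilon^{\mathrm{re}}_c$ and $\{\alpha,\beta\}$ is component-full, and $\max[(\alpha\|\beta)^{\to}_c,(\alpha\|\beta)^{\leftarrow}_c]$ (formulas above) otherwise. *)

theory Defs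
  imports "HOL-Analysis.Analysis"
begin

text \<open>The index set of simple roots is a finite type 'i (n = CARD('i)).
  Vectors of V are represented by their coordinates in the basis of simple roots:
  v $ i = [v : alpha_i].  The Cartan matrix is A :: 'i => 'i => int, with
  symmetrizing constants d :: 'i => real.\<close>

definition GCM :: "('i::finite \<Rightarrow> 'i \<Rightarrow> int) \<Rightarrow> bool" where
  "GCM A \<longleftrightarrow> (\<forall>i. A i i = 2) \<and> (\<forall>i j. i \<noteq> j \<longrightarrow> A i j \<le> 0)
      \<and> (\<forall>i j. A i j = 0 \<longleftrightarrow> A j i = 0)"

definition symmetrizing :: "('i::finite \<Rightarrow> 'i \<Rightarrow> int) \<Rightarrow> ('i \<Rightarrow> real) \<Rightarrow> bool" where
  "symmetrizing A d \<longleftrightarrow> (\<forall>i. d i > 0) \<and> (\<forall>i j. d i * of_int (A i j) = d j * of_int (A j i))"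

text \<open>Simple root alpha_i, and the symmetric form K with K(alpha_i^vee, alpha_j) = a_ij,
  alpha_i^vee = d_i^{-1} alpha_i, i.e. K(alpha_i, alpha_j) = d_i a_ij.\<close>

definition sroot :: "'i::finite \<Rightarrow> real ^ 'i" where
  "sroot i = axis i 1"

definition Kf :: "('i::finite \<Rightarrow> 'i \<Rightarrow> int) \<Rightarrow> ('i \<Rightarrow> real) \<Rightarrow> real ^ 'i \<Rightarrow> real ^ 'i \<Rightarrow> real" where
  "Kf A d u v = (\<Sum>i\<in>UNIV. \<Sum>j\<in>UNIV. u $ i * d i * of_int (A i j) * v $ j)"

text \<open>Coordinates in the co-root basis: [v : alpha_i^vee] = d_i [v : alpha_i].\<close>

definition cocoords :: "('i::finite \<Rightarrow> real) \<Rightarrow> real ^ 'i \<Rightarrow> real ^ 'i" where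
  "cocoords d v = (\<chi> i. d i * v $ i)"

text \<open>Simple reflection s_i(v) = v - K(alpha_i^vee, v) alpha_i.\<close>

definition srefl :: "('i::finite \<Rightarrow> 'i \<Rightarrow> int) \<Rightarrow> 'i \<Rightarrow> real ^ 'i \<Rightarrow> real ^ 'i" where
  "srefl A i v = v - (\<Sum>j\<in>UNIV. of_int (A i j) * v $ j) *\<^sub>R sroot i"

definition wprod :: "('i::finite \<Rightarrow> 'i \<Rightarrow> int) \<Rightarrow> 'i list \<Rightarrow> real ^ 'i \<Rightarrow> real ^ 'i" where
  "wprod A ws = foldr (\<lambda>i f. srefl A i \<circ> f) ws id"

definition weyl :: "('i::finite \<Rightarrow> 'i \<Rightarrow> int) \<Rightarrow> (real ^ 'i \<Rightarrow> real ^ 'i) set" where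
  "weyl A = range (wprod A)"

definition pos_form_definite :: "('i::finite \<Rightarrow> 'i \<Rightarrow> int) \<Rightarrow> ('i \<Rightarrow> real) \<Rightarrow> bool" where
  "pos_form_definite A d \<longleftrightarrow> (\<forall>v. v \<noteq> 0 \<longrightarrow> Kf A d v v > 0)"

definition indecomposable :: "('i::finite \<Rightarrow> 'i \<Rightarrow> int) \<Rightarrow> bool" where
  "indecomposable A \<longleftrightarrow> \<not> (\<exists>I. I \<noteq> {} \<and> I \<noteq> UNIV \<and> (\<forall>i\<in>I. \<forall>j. j \<notin> I \<longrightarrow> A i j = 0))"

definition finite_type :: "('i::finite \<Rightarrow> 'i \<Rightarrow> int) \<Rightarrow> ('i \<Rightarrow> real) \<Rightarrow> bool" where
  "finite_type A d \<longleftrightarrow> GCM A \<and> symmetrizing A d \<and> pos_form_definite A d"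

definition affine_type :: "('i::finite \<Rightarrow> 'i \<Rightarrow> int) \<Rightarrow> ('i \<Rightarrow> real) \<Rightarrow> bool" where
  "affine_type A d \<longleftrightarrow> GCM A \<and> symmetrizing A d \<and> indecomposable A
      \<and> (\<forall>v. Kf A d v v \<ge> 0) \<and> \<not> pos_form_definite A d"

definition real_roots :: "('i::finite \<Rightarrow> 'i \<Rightarrow> int) \<Rightarrow> (real ^ 'i) set" where
  "real_roots A = {w (sroot i) | w i. w \<in> weyl A}"

text \<open>Imaginary roots (affine type): the nonzero integer vectors in the radical,
  i.e. the nonzero integer multiples of delta.  (Empty in finite type.)\<close>

definition imag_roots :: "('i::finite \<Rightarrow> 'i \<Rightarrow> int) \<Rightarrow> (real ^ 'i) set" where
  "imag_roots A = {v. v \<noteq> 0 \<and> (\<forall>i. v $ i \<in> \<int>) \<and> (\<forall>i. (\<Sum>j\<in>UNIV. of_int (A i j) * v $ j) = 0)}"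

definition roots :: "('i::finite \<Rightarrow> 'i \<Rightarrow> int) \<Rightarrow> (real ^ 'i) set" where
  "roots A = real_roots A \<union> imag_roots A"

definition nonneg :: "real ^ 'i::finite \<Rightarrow> bool" where
  "nonneg v \<longleftrightarrow> (\<forall>i. v $ i \<ge> 0)"

definition pos_roots :: "('i::finite \<Rightarrow> 'i \<Rightarrow> int) \<Rightarrow> (real ^ 'i) set" where
  "pos_roots A = {v \<in> roots A. nonneg v}"

definition neg_simples :: "(real ^ 'i::finite) set" where
  "neg_simples = {- sroot i | i. True}"

definition delta :: "('i::finite \<Rightarrow> 'i \<Rightarrow> int) \<Rightarrow> real ^ 'i" where
  "delta A = (THE v. v \<in> imag_roots A \<and> nonneg v
      \<and> (\<forall>w \<in> imag_roots A. nonneg w \<longrightarrow> norm v \<le> norm w))"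

text \<open>delta^vee, in co-root coordinates: the positive imaginary root closest to 0 of the
  dual root system (Cartan matrix A^T, simple roots alpha_i^vee).\<close>

definition delta_vee_cocoords :: "('i::finite \<Rightarrow> 'i \<Rightarrow> int) \<Rightarrow> real ^ 'i" where
  "delta_vee_cocoords A = delta (\<lambda>i j. A j i)"

text \<open>Co-root coordinates [beta^vee : alpha_i^vee] of beta^vee.  For real roots
  beta^vee = 2 beta / K(beta,beta); for the imaginary root delta, beta^vee = delta^vee
  (more generally (k delta)^vee = k delta^vee).\<close>

definition coroot_cocoords :: "('i::finite \<Rightarrow> 'i \<Rightarrow> int) \<Rightarrow> ('i \<Rightarrow> real) \<Rightarrow> real ^ 'i \<Rightarrow> real ^ 'i" where
  "coroot_cocoords A d \<beta> =
     (if \<beta> \<in> imag_roots A then (THE k. \<beta> = k *\<^sub>R delta A) *\<^sub>R delta_vee_cocoords A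
      else cocoords d ((2 / Kf A d \<beta> \<beta>) *\<^sub>R \<beta>))"

definition coxeter :: "('i::finite \<Rightarrow> 'i \<Rightarrow> int) \<Rightarrow> (real ^ 'i \<Rightarrow> real ^ 'i) \<Rightarrow> bool" where
  "coxeter A c \<longleftrightarrow> (\<exists>\<pi>. distinct \<pi> \<and> set \<pi> = UNIV \<and> wprod A \<pi> = c)"

definition reduced :: "('i::finite \<Rightarrow> 'i \<Rightarrow> int) \<Rightarrow> 'i list \<Rightarrow> bool" where
  "reduced A w \<longleftrightarrow> (\<forall>w'. wprod A w' = wprod A w \<longrightarrow> length w \<le> length w')"

definition initial :: "('i::finite \<Rightarrow> 'i \<Rightarrow> int) \<Rightarrow> 'i \<Rightarrow> (real ^ 'i \<Rightarrow> real ^ 'i) \<Rightarrow> bool" where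
  "initial A s c \<longleftrightarrow> (\<exists>w. reduced A w \<and> wprod A w = c \<and> w \<noteq> [] \<and> hd w = s)"

definition final :: "('i::finite \<Rightarrow> 'i \<Rightarrow> int) \<Rightarrow> 'i \<Rightarrow> (real ^ 'i \<Rightarrow> real ^ 'i) \<Rightarrow> bool" where
  "final A s c \<longleftrightarrow> (\<exists>w. reduced A w \<and> wprod A w = c \<and> w \<noteq> [] \<and> last w = s)"

definition conj_by :: "('i::finite \<Rightarrow> 'i \<Rightarrow> int) \<Rightarrow> 'i \<Rightarrow> (real ^ 'i \<Rightarrow> real ^ 'i) \<Rightarrow> real ^ 'i \<Rightarrow> real ^ 'i" where
  "conj_by A s c = srefl A s \<circ> c \<circ> srefl A s"

definition sigma :: "('i::finite \<Rightarrow> 'i \<Rightarrow> int) \<Rightarrow> 'i \<Rightarrow> real ^ 'i \<Rightarrow> real ^ 'i" where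
  "sigma A s \<alpha> = (if \<alpha> \<in> neg_simples \<and> \<alpha> \<noteq> - sroot s then \<alpha> else srefl A s \<alpha>)"

text \<open>A reduced word c = s_1 ... s_n used to index the simple roots.\<close>

definition cox_word :: "('i::finite \<Rightarrow> 'i \<Rightarrow> int) \<Rightarrow> (real ^ 'i \<Rightarrow> real ^ 'i) \<Rightarrow> 'i list" where
  "cox_word A c = (SOME \<pi>. distinct \<pi> \<and> set \<pi> = UNIV \<and> wprod A \<pi> = c)"

definition before :: "'i list \<Rightarrow> 'i \<Rightarrow> 'i \<Rightarrow> bool" where
  "before \<pi> j i \<longleftrightarrow> (\<exists>p q. p < q \<and> q < length \<pi> \<and> \<pi> ! p = j \<and> \<pi> ! q = i)"

definition pplus :: "real \<Rightarrow> real" where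
  "pplus x = max x 0"

definition compat_to :: "('i::finite \<Rightarrow> 'i \<Rightarrow> int) \<Rightarrow> ('i \<Rightarrow> real) \<Rightarrow> (real ^ 'i \<Rightarrow> real ^ 'i)
    \<Rightarrow> real ^ 'i \<Rightarrow> real ^ 'i \<Rightarrow> real" where
  "compat_to A d c \<alpha> \<beta> =
     - (\<Sum>i\<in>UNIV. coroot_cocoords A d \<alpha> $ i * \<beta> $ i)
     - (\<Sum>i\<in>UNIV. \<Sum>j\<in>UNIV. if before (cox_word A c) j i
          then of_int (A i j) * pplus (coroot_cocoords A d \<alpha> $ i) * pplus (\<beta> $ j) else 0)"

definition compat_from :: "('i::finite \<Rightarrow> 'i \<Rightarrow> int) \<Rightarrow> ('i \<Rightarrow> real) \<Rightarrow> (real ^ 'i \<Rightarrow> real ^ 'i)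
    \<Rightarrow> real ^ 'i \<Rightarrow> real ^ 'i \<Rightarrow> real" where
  "compat_from A d c \<alpha> \<beta> =
     - (\<Sum>i\<in>UNIV. coroot_cocoords A d \<alpha> $ i * \<beta> $ i)
     - (\<Sum>i\<in>UNIV. \<Sum>j\<in>UNIV. if before (cox_word A c) i j
          then of_int (A i j) * pplus (coroot_cocoords A d \<alpha> $ i) * pplus (\<beta> $ j) else 0)"

text \<open>aff is the index of the affine simple root; V_fin = {v. v $ aff = 0}.\<close>

definition gamma :: "('i::finite \<Rightarrow> 'i \<Rightarrow> int) \<Rightarrow> 'i \<Rightarrow> (real ^ 'i \<Rightarrow> real ^ 'i) \<Rightarrow> real ^ 'i" where
  "gamma A aff c = (THE g. g $ aff = 0 \<and> c g = g + delta A)"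

definition U_c :: "('i::finite \<Rightarrow> 'i \<Rightarrow> int) \<Rightarrow> ('i \<Rightarrow> real) \<Rightarrow> 'i \<Rightarrow> (real ^ 'i \<Rightarrow> real ^ 'i) \<Rightarrow> (real ^ 'i) set" where
  "U_c A d aff c = {v. Kf A d (gamma A aff c) v = 0}"

definition Upsilon :: "('i::finite \<Rightarrow> 'i \<Rightarrow> int) \<Rightarrow> ('i \<Rightarrow> real) \<Rightarrow> 'i \<Rightarrow> (real ^ 'i \<Rightarrow> real ^ 'i) \<Rightarrow> (real ^ 'i) set" where
  "Upsilon A d aff c = roots A \<inter> U_c A d aff c"

definition c_orbit :: "(real ^ 'i::finite \<Rightarrow> real ^ 'i) \<Rightarrow> real ^ 'i \<Rightarrow> (real ^ 'i) set" where
  "c_orbit c \<beta> = {(c ^^ m) \<beta> | m. True} \<union> {(inv c ^^ m) \<beta> | m. True}"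

definition Phi_fin :: "('i::finite \<Rightarrow> 'i \<Rightarrow> int) \<Rightarrow> 'i \<Rightarrow> (real ^ 'i) set" where
  "Phi_fin A aff = {v \<in> roots A. v $ aff = 0}"

definition Upsilon_re :: "('i::finite \<Rightarrow> 'i \<Rightarrow> int) \<Rightarrow> ('i \<Rightarrow> real) \<Rightarrow> 'i \<Rightarrow> (real ^ 'i \<Rightarrow> real ^ 'i) \<Rightarrow> (real ^ 'i) set" where
  "Upsilon_re A d aff c =
     (if affine_type A d then
        {\<beta> \<in> real_roots A. nonneg \<beta> \<and> \<beta> \<in> U_c A d aff c
           \<and> (\<exists>\<gamma> \<in> c_orbit c \<beta>. \<gamma> \<in> Phi_fin A aff)}
      else {})"

definition Phi_c :: "('i::finite \<Rightarrow> 'i \<Rightarrow> int) \<Rightarrow> ('i \<Rightarrow> real) \<Rightarrow> 'i \<Rightarrow> (real ^ 'i \<Rightarrow> real ^ 'i) \<Rightarrow> (real ^ 'i) set" where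
  "Phi_c A d aff c =
     (if affine_type A d then
        neg_simples \<union> (pos_roots A - U_c A d aff c) \<union> Upsilon_re A d aff c \<union> {delta A}
      else pos_roots A \<union> neg_simples)"

definition nnspan :: "(real ^ 'i::finite) set \<Rightarrow> (real ^ 'i) set" where
  "nnspan P = {(\<Sum>x\<in>F. f x *\<^sub>R x) | F f. finite F \<and> F \<subseteq> P \<and> (\<forall>x. f x \<ge> 0)}"

definition Pi_c :: "('i::finite \<Rightarrow> 'i \<Rightarrow> int) \<Rightarrow> ('i \<Rightarrow> real) \<Rightarrow> 'i \<Rightarrow> (real ^ 'i \<Rightarrow> real ^ 'i) \<Rightarrow> (real ^ 'i) set" where
  "Pi_c A d aff c =
     (let X = Upsilon A d aff c \<inter> pos_roots A in
      THE P. P \<subseteq> X \<and> X \<subseteq> nnspan P \<and> (\<forall>Q. Q \<subset> P \<longrightarrow> \<not> X \<subseteq> nnspan Q))"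

text \<open>Irreducible components of the root system of the real roots of Upsilon_c, given by
  their sets of simple roots: classes of Pi_c under the connectivity relation
  K(x,y) \<noteq> 0.\<close>

definition tube_comps :: "('i::finite \<Rightarrow> 'i \<Rightarrow> int) \<Rightarrow> ('i \<Rightarrow> real) \<Rightarrow> 'i \<Rightarrow> (real ^ 'i \<Rightarrow> real ^ 'i) \<Rightarrow> (real ^ 'i) set set" where
  "tube_comps A d aff c =
     (let P = Pi_c A d aff c;
          R = (\<lambda>x y. x \<in> P \<and> y \<in> P \<and> Kf A d x y \<noteq> 0) in
      {{y \<in> P. R\<^sup>*\<^sup>* x y} | x. x \<in> P})"

definition tube_supp :: "('i::finite \<Rightarrow> 'i \<Rightarrow> int) \<Rightarrow> ('i \<Rightarrow> real) \<Rightarrow> 'i \<Rightarrow> (real ^ 'i \<Rightarrow> real ^ 'i) \<Rightarrow> real ^ 'i \<Rightarrow> (real ^ 'i) set" where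
  "tube_supp A d aff c \<beta> =
     (THE S. \<exists>C \<in> tube_comps A d aff c. \<exists>f. \<beta> = (\<Sum>x\<in>C. f x *\<^sub>R x) \<and> S = {x \<in> C. f x \<noteq> 0})"

definition tube_supp_set :: "('i::finite \<Rightarrow> 'i \<Rightarrow> int) \<Rightarrow> ('i \<Rightarrow> real) \<Rightarrow> 'i \<Rightarrow> (real ^ 'i \<Rightarrow> real ^ 'i) \<Rightarrow> (real ^ 'i) set \<Rightarrow> (real ^ 'i) set" where
  "tube_supp_set A d aff c X = (\<Union>\<beta>\<in>X. tube_supp A d aff c \<beta>)"

definition component_full :: "('i::finite \<Rightarrow> 'i \<Rightarrow> int) \<Rightarrow> ('i \<Rightarrow> real) \<Rightarrow> 'i \<Rightarrow> (real ^ 'i \<Rightarrow> real ^ 'i) \<Rightarrow> (real ^ 'i) set \<Rightarrow> bool" where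
  "component_full A d aff c X \<longleftrightarrow> (\<exists>C \<in> tube_comps A d aff c. C \<subseteq> tube_supp_set A d aff c X)"

definition adjacent :: "('i::finite \<Rightarrow> 'i \<Rightarrow> int) \<Rightarrow> ('i \<Rightarrow> real) \<Rightarrow> 'i \<Rightarrow> (real ^ 'i \<Rightarrow> real ^ 'i) \<Rightarrow> real ^ 'i \<Rightarrow> real ^ 'i \<Rightarrow> bool" where
  "adjacent A d aff c \<alpha> x \<longleftrightarrow> x \<in> Pi_c A d aff c
      \<and> x \<in> tube_supp A d aff c (c \<alpha>) \<union> tube_supp A d aff c (inv c \<alpha>)
      \<and> x \<notin> tube_supp A d aff c \<alpha>"

definition adj :: "('i::finite \<Rightarrow> 'i \<Rightarrow> int) \<Rightarrow> ('i \<Rightarrow> real) \<Rightarrow> 'i \<Rightarrow> (real ^ 'i \<Rightarrow> real ^ 'i) \<Rightarrow> real ^ 'i \<Rightarrow> real ^ 'i \<Rightarrow> real" where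
  "adj A d aff c \<alpha> \<beta> = real (card {x \<in> tube_supp A d aff c \<beta>. adjacent A d aff c \<alpha> x})"

definition compat_circ :: "('i::finite \<Rightarrow> 'i \<Rightarrow> int) \<Rightarrow> ('i \<Rightarrow> real) \<Rightarrow> 'i \<Rightarrow> (real ^ 'i \<Rightarrow> real ^ 'i) \<Rightarrow> real ^ 'i \<Rightarrow> real ^ 'i \<Rightarrow> real" where
  "compat_circ A d aff c \<alpha> \<beta> =
     (if \<alpha> = \<beta> then -1
      else if tube_supp A d aff c \<alpha> \<subset> tube_supp A d aff c \<beta>
              \<or> tube_supp A d aff c \<beta> \<subset> tube_supp A d aff c \<alpha> then 0
      else adj A d aff c \<alpha> \<beta>)"

definition compat :: "('i::finite \<Rightarrow> 'i \<Rightarrow> int) \<Rightarrow> ('i \<Rightarrow> real) \<Rightarrow> 'i \<Rightarrow> (real ^ 'i \<Rightarrow> real ^ 'i) \<Rightarrow> real ^ 'i \<Rightarrow> real ^ 'i \<Rightarrow> real" where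
  "compat A d aff c \<alpha> \<beta> =
     (if \<alpha> \<in> Upsilon_re A d aff c \<and> \<beta> \<in> Upsilon_re A d aff c \<and> component_full A d aff c {\<alpha>, \<beta>}
      then adj A d aff c \<alpha> \<beta>
      else max (compat_to A d c \<alpha> \<beta>) (compat_from A d c \<alpha> \<beta>))"

definition satisfies_props :: "('i::finite \<Rightarrow> 'i \<Rightarrow> int) \<Rightarrow> ('i \<Rightarrow> real) \<Rightarrow> 'i
    \<Rightarrow> ((real ^ 'i \<Rightarrow> real ^ 'i) \<Rightarrow> real ^ 'i \<Rightarrow> real ^ 'i \<Rightarrow> real) \<Rightarrow> bool" where
  "satisfies_props A d aff f \<longleftrightarrow> (\<forall>c. coxeter A c \<longrightarrow>
     (\<forall>i \<beta>. \<beta> \<in> Phi_c A d aff c \<longrightarrow> f c (- sroot i) \<beta> = \<beta> $ i)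
   \<and> (\<forall>i \<beta>. \<beta> \<in> Phi_c A d aff c \<longrightarrow> f c \<beta> (- sroot i) = coroot_cocoords A d \<beta> $ i)
   \<and> (\<forall>\<alpha> \<beta>. \<alpha> \<in> Upsilon_re A d aff c \<and> \<beta> \<in> Upsilon_re A d aff c
          \<longrightarrow> f c \<alpha> \<beta> = compat_circ A d aff c \<alpha> \<beta>)
   \<and> (affine_type A d \<longrightarrow> (\<forall>\<alpha>. \<alpha> \<in> Upsilon_re A d aff c \<union> {delta A}
          \<longrightarrow> f c (delta A) \<alpha> = 0 \<and> f c \<alpha> (delta A) = 0))
   \<and> (\<forall>\<alpha> \<beta> s. \<alpha> \<in> Phi_c A d aff c \<and> \<beta> \<in> Phi_c A d aff c \<and> (initial A s c \<or> final A s c)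
          \<longrightarrow> f c \<alpha> \<beta> = f (conj_by A s c) (sigma A s \<alpha>) (sigma A s \<beta>)))"

end

theory Submission
  imports Defs
begin

text \<open>
  Let \<open>E\<close> be the Euler form of a Coxeter element \<open>c = s\<^sub>1 \<dots> s\<^sub>n\<close>.  On positive roots the two
  halves of the compatibility degree are \<open>- E(\<alpha>\<^sup>\<or>, \<beta>)\<close> and \<open>- E(\<beta>, \<alpha>\<^sup>\<or>)\<close>; moreover
  \<open>E(c u, v) = - E(v, u)\<close>, and conjugating \<open>c\<close> by an initial letter \<open>s\<close> while applying \<open>s\<close> to both
  arguments leaves \<open>E\<close> unchanged.  This yields (v).  A root outside \<open>U\<^sub>c\<close> satisfies
  \<open>c\<^sup>m \<beta> = \<beta> + t \<delta>\<close> with \<open>t \<noteq> 0\<close>, so some sequence of such moves turns it into a negative simple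
  root, which yields uniqueness.

  Property (iii) needs the structure of \<open>\<Upsilon>\<^sub>c\<close>.  Its indecomposable positive roots are permuted by
  \<open>c\<close>, and integrality shows that inside a \<open>c\<close>-orbit each \<open>x\<close> is joined only to \<open>c\<^sup>j x\<close> and
  \<open>c\<^sup>-\<^sup>j x\<close> for a single \<open>j\<close>.  To see that \<open>j = 1\<close>, choose a node \<open>s\<close> for which
  \<open>\<delta> - \<delta>\<^sub>s \<alpha>\<^sub>s\<close> is a multiple of a root \<open>\<theta>\<close> (a special vertex of the fundamental alcove) and rotate
  \<open>s\<close> to the front of \<open>c\<close>.  The remaining nodes are of finite type, where moves carry the
  \<open>E\<close>-perpendicular of \<open>\<theta>\<close> to a standard parabolic; hence its simple roots pair nonpositively under
  \<open>E\<close>.  They span \<open>U\<^sub>c\<close> modulo \<open>\<delta>\<close>, which is incompatible with \<open>j \<ge> 2\<close>.  So every orbit is a cyclic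
  diagram on which \<open>c\<close> is the rotation by one step, the elements of \<open>\<Upsilon>\<^sup>r\<^sup>e\<^sub>c\<close> are sums over proper
  arcs, and (iii) becomes a computation with intervals.
\<close>

section \<open>The form and the real roots\<close>

text \<open>No classification of diagrams enters. That E depends on \<open>c\<close> alone matters
  because the degree is computed from a chosen word: two candidate forms differ by an antisymmetric
  form that vanishes on the image of \<open>c - 1\<close>, whose codimension is at most one, so they
  agree. The symmetric form cannot exclude a step \<open>j > 1\<close>, since a cycle traversed with
  a larger step is still a union of cycles. E can: E(x, c^n x) > 0 for 0 \<le> n < j. Hence of two
  orbit elements at a positive distance below \<open>j\<close>, one has a nonzero coordinate at the
  special node, because elements with zero coordinate there pair nonpositively. The spanning
  statement pulls the other way: along each chain of step \<open>j\<close> at most one element has a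
  nonzero coordinate at that node. The two branches in the definition of the degree correspond to
  whether the cycle can be cut open. A point outside both arcs turns them into intervals on which E
  telescopes; when the arcs cover the orbit there is no such point, and the degree is the adjacency
  count by definition.\<close>

locale cartan =
  fixes A :: "'i::finite \<Rightarrow> 'i \<Rightarrow> int" and d :: "'i \<Rightarrow> real"
  assumes gcm: "GCM A" and symm: "symmetrizing A d"
begin

abbreviation K where "K \<equiv> Kf A d"
abbreviation S where "S \<equiv> srefl A"

text \<open>The value of the i-th simple coroot on \<open>v\<close>. It involves \<open>A\<close>
  but not \<open>d\<close>, so it is integral on integral vectors.\<close>

definition pairing :: "'i \<Rightarrow> real ^ 'i \<Rightarrow> real" where
  "pairing i v = (\<Sum>j\<in>UNIV. of_int (A i j) * v $ j)"

lemma A_diag [simp]: "A i i = 2"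
  using gcm by (simp add: GCM_def)

lemma A_off: "i \<noteq> j \<Longrightarrow> A i j \<le> 0"
  using gcm by (simp add: GCM_def)

lemma A_zero_iff: "A i j = 0 \<longleftrightarrow> A j i = 0"
  using gcm[unfolded GCM_def, THEN conjunct2, THEN conjunct2, rule_format] .

lemma d_pos: "d i > 0"
  using symm by (simp add: symmetrizing_def)

lemma d_sym: "d i * of_int (A i j) = d j * of_int (A j i)"
  using symm by (simp add: symmetrizing_def)

lemma sroot_nth [simp]: "sroot i $ j = (if j = i then 1 else 0)"
  by (simp add: sroot_def axis_def)

lemma pairing_linear: "linear (pairing i)"
  unfolding pairing_def
  by (rule linearI) (simp_all add: algebra_simps sum.distrib sum_distrib_left)

lemma pairing_simps [simp]:
  "pairing i (u + v) = pairing i u + pairing i v" "pairing i (u - v) = pairing i u - pairing i v"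
  "pairing i (c *\<^sub>R v) = c * pairing i v" "pairing i (- v) = - pairing i v" "pairing i 0 = 0"
  using linear_add[OF pairing_linear] linear_diff[OF pairing_linear] linear_scale[OF pairing_linear]
    linear_neg[OF pairing_linear] linear_0[OF pairing_linear] by auto

lemma pairing_sroot [simp]: "pairing i (sroot j) = of_int (A i j)"
  by (simp add: pairing_def if_distrib cong: if_cong)

lemma K_alt: "K u v = (\<Sum>i\<in>UNIV. u $ i * (d i * pairing i v))"
  unfolding Kf_def pairing_def by (simp add: sum_distrib_left mult.assoc)

lemma K_sym: "K u v = K v u"
proof -
  have "K u v = (\<Sum>i\<in>UNIV. \<Sum>j\<in>UNIV. v $ j * d j * of_int (A j i) * u $ i)"
    unfolding Kf_def
    by (intro sum.cong refl) (metis (no_types, lifting) d_sym mult.assoc mult.commute)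
  also have "\<dots> = K v u"
    unfolding Kf_def by (rule sum.swap)
  finally show ?thesis .
qed

lemma K_linear_right: "linear (K u)"
  unfolding K_alt
  by (rule linearI) (simp_all add: algebra_simps sum.distrib sum_distrib_left)

lemma K_right [simp]:
  "K u (v + w) = K u v + K u w" "K u (v - w) = K u v - K u w"
  "K u (c *\<^sub>R v) = c * K u v" "K u (- v) = - K u v" "K u 0 = 0"
  using linear_add[OF K_linear_right] linear_diff[OF K_linear_right]
    linear_scale[OF K_linear_right] linear_neg[OF K_linear_right] linear_0[OF K_linear_right]
  by auto

lemma K_left [simp]:
  "K (v + w) u = K v u + K w u" "K (v - w) u = K v u - K w u"
  "K (c *\<^sub>R v) u = c * K v u" "K (- v) u = - K v u" "K 0 u = 0"
  by (simp_all add: K_sym[of _ u])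

lemma K_sum_right: "K u (sum g B) = (\<Sum>x\<in>B. K u (g x))"
  by (rule linear_sum[OF K_linear_right])

lemma K_sum_left: "K (sum g B) u = (\<Sum>x\<in>B. K (g x) u)"
  by (simp add: K_sym[of _ u] K_sum_right)

lemma K_sroot [simp]: "K (sroot i) v = d i * pairing i v"
  by (simp add: K_alt if_distrib[of "\<lambda>x. x * _"] cong: if_cong)

lemma K_sroot_right: "K v (sroot i) = d i * pairing i v"
  by (simp add: K_sym[of v])

lemma S_eq: "S i v = v - pairing i v *\<^sub>R sroot i"
  by (simp add: srefl_def pairing_def)

lemma S_nth: "S i v $ j = v $ j - (if j = i then pairing i v else 0)"
  by (simp add: S_eq)

lemma S_linear: "linear (S i)"
  by (rule linearI) (simp_all add: S_eq algebra_simps)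

lemma S_simps [simp]:
  "S i (u + v) = S i u + S i v" "S i (u - v) = S i u - S i v"
  "S i (c *\<^sub>R v) = c *\<^sub>R S i v" "S i (- v) = - S i v" "S i 0 = 0"
  using linear_add[OF S_linear] linear_diff[OF S_linear] linear_scale[OF S_linear]
    linear_neg[OF S_linear] linear_0[OF S_linear] by auto

lemma S_sroot [simp]: "S i (sroot i) = - sroot i"
  by (simp add: S_eq vec_eq_iff)

lemma S_S [simp]: "S i (S i v) = v"
proof -
  have "pairing i (S i v) = - pairing i v" by (simp add: S_eq)
  then show ?thesis by (simp add: S_eq)
qed

lemma K_S [simp]: "K (S i u) (S i v) = K u v"
  by (simp add: S_eq K_sroot_right algebra_simps)

lemma K_S_left: "K (S i u) v = K u (S i v)"
  using K_S[of i u "S i v"] by simp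

lemma S_inj: "S i u = S i v \<longleftrightarrow> u = v"
  by (metis S_S)

section \<open>Words in the simple reflections\<close>

lemma wprod_Nil [simp]: "wprod A [] = id"
  by (simp add: wprod_def)

lemma wprod_Cons [simp]: "wprod A (i # w) v = S i (wprod A w v)"
  by (simp add: wprod_def)

lemma wprod_append [simp]: "wprod A (w @ w') v = wprod A w (wprod A w' v)"
  by (induction w) auto

lemma wprod_append_fun: "wprod A (w @ w') = wprod A w \<circ> wprod A w'"
  by (simp add: fun_eq_iff)

lemma wprod_linear: "linear (wprod A w)"
proof (induction w)
  case Nil show ?case using linear_id by (simp add: id_def)
next
  case (Cons i w)
  have "wprod A (i # w) = S i \<circ> wprod A w" by (simp add: fun_eq_iff)
  then show ?case using linear_compose[OF Cons S_linear] by metis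
qed

lemma wprod_simps [simp]:
  "wprod A w (u + v) = wprod A w u + wprod A w v" "wprod A w (u - v) = wprod A w u - wprod A w v"
  "wprod A w (c *\<^sub>R v) = c *\<^sub>R wprod A w v" "wprod A w (- v) = - wprod A w v" "wprod A w 0 = 0"
  using linear_add[OF wprod_linear] linear_diff[OF wprod_linear] linear_scale[OF wprod_linear]
    linear_neg[OF wprod_linear] linear_0[OF wprod_linear] by auto

lemma wprod_rev [simp]: "wprod A (rev w) (wprod A w v) = v"
  by (induction w arbitrary: v) auto

lemma wprod_rev' [simp]: "wprod A w (wprod A (rev w) v) = v"
  using wprod_rev[of "rev w" v] by simp

lemma K_wprod [simp]: "K (wprod A w u) (wprod A w v) = K u v"
  by (induction w) auto

lemma bij_wprod: "bij (wprod A w)"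
  by (metis bijI' wprod_rev wprod_rev')

lemma inv_wprod: "inv (wprod A w) = wprod A (rev w)"
  by (rule inv_unique_comp) (simp_all add: fun_eq_iff)

definition integral_vec :: "real ^ 'i \<Rightarrow> bool" where
  "integral_vec v \<longleftrightarrow> (\<forall>i. v $ i \<in> \<int>)"

lemma integral_pairing: "integral_vec v \<Longrightarrow> pairing i v \<in> \<int>"
  unfolding pairing_def integral_vec_def by (intro Ints_sum Ints_mult) auto

lemma integral_S: "integral_vec v \<Longrightarrow> integral_vec (S i v)"
  unfolding integral_vec_def[of "S i v"] using integral_pairing[of v i]
  by (auto simp: S_nth integral_vec_def intro!: Ints_diff)

lemma integral_wprod: "integral_vec v \<Longrightarrow> integral_vec (wprod A w v)"
  by (induction w) (auto intro: integral_S)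

lemma integral_sroot [simp]: "integral_vec (sroot i)"
  by (simp add: integral_vec_def)

section \<open>Real roots, coroots and integrality\<close>

lemma real_rootsE:
  assumes "\<beta> \<in> real_roots A"
  obtains w i where "\<beta> = wprod A w (sroot i)"
  using assms by (auto simp: real_roots_def weyl_def)

lemma real_rootsI: "wprod A w (sroot i) \<in> real_roots A"
  by (auto simp: real_roots_def weyl_def)

lemma sroot_real [simp]: "sroot i \<in> real_roots A"
  using real_rootsI[of "[]" i] by simp

lemma wprod_real: "\<beta> \<in> real_roots A \<Longrightarrow> wprod A w \<beta> \<in> real_roots A"
  by (metis real_rootsE real_rootsI wprod_append)

lemma S_real: "\<beta> \<in> real_roots A \<Longrightarrow> S i \<beta> \<in> real_roots A"
  using wprod_real[of \<beta> "[i]"] by simp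

lemma S_real_iff [simp]: "S i \<beta> \<in> real_roots A \<longleftrightarrow> \<beta> \<in> real_roots A"
  by (metis S_S S_real)

lemma minus_real: "\<beta> \<in> real_roots A \<Longrightarrow> - \<beta> \<in> real_roots A"
proof (elim real_rootsE)
  fix w i assume "\<beta> = wprod A w (sroot i)"
  then have "- \<beta> = wprod A (w @ [i]) (sroot i)" by simp
  then show ?thesis by (metis real_rootsI)
qed

lemma minus_real_iff [simp]: "- \<beta> \<in> real_roots A \<longleftrightarrow> \<beta> \<in> real_roots A"
  using minus_real[of \<beta>] minus_real[of "- \<beta>"] by auto

lemma real_integral: "\<beta> \<in> real_roots A \<Longrightarrow> integral_vec \<beta>"
  by (elim real_rootsE) (simp add: integral_wprod)

lemma real_norm_pos: "\<beta> \<in> real_roots A \<Longrightarrow> K \<beta> \<beta> > 0"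
  by (elim real_rootsE) (simp add: d_pos)

lemma real_nonzero: "\<beta> \<in> real_roots A \<Longrightarrow> \<beta> \<noteq> 0"
  using real_norm_pos by fastforce

text \<open>The pairing of the coroot of \<open>x\<close> with \<open>y\<close>, extending
  \<open>pairing\<close> from simple roots to all real roots.\<close>

definition cartan_int :: "real ^ 'i \<Rightarrow> real ^ 'i \<Rightarrow> real" where
  "cartan_int x y = 2 * K x y / K x x"

lemma cartan_int_simps [simp]:
  "cartan_int x (u + v) = cartan_int x u + cartan_int x v" "cartan_int x (u - v) = cartan_int x u - cartan_int x v"
  "cartan_int x (c *\<^sub>R v) = c * cartan_int x v" "cartan_int x (- v) = - cartan_int x v" "cartan_int x 0 = 0"
  by (simp_all add: cartan_int_def add_divide_distrib diff_divide_distrib algebra_simps)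

lemma cartan_int_wprod: "cartan_int (wprod A w x) (wprod A w y) = cartan_int x y"
  by (simp add: cartan_int_def)

lemma cartan_int_sroot [simp]: "cartan_int (sroot i) v = pairing i v"
  using d_pos[of i] by (simp add: cartan_int_def)

lemma cartan_int_self: "x \<in> real_roots A \<Longrightarrow> cartan_int x x = 2"
  using real_norm_pos[of x] by (simp add: cartan_int_def)

text \<open>Weyl group invariance moves \<open>x\<close> to a simple root, where the value is a
  \<open>pairing\<close> with an integral vector.\<close>

lemma cartan_int_integral: "x \<in> real_roots A \<Longrightarrow> integral_vec y \<Longrightarrow> cartan_int x y \<in> \<int>"
proof (elim real_rootsE)
  fix w i assume y: "integral_vec y" and x: "x = wprod A w (sroot i)"
  have "cartan_int x y = cartan_int (sroot i) (wprod A (rev w) y)"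
    using cartan_int_wprod[of w "sroot i" "wprod A (rev w) y"] x by simp
  then show ?thesis by (simp add: integral_pairing integral_wprod y)
qed

definition reflect :: "real ^ 'i \<Rightarrow> real ^ 'i \<Rightarrow> real ^ 'i" where
  "reflect x y = y - cartan_int x y *\<^sub>R x"

lemma reflect_wprod: "reflect (wprod A w x) (wprod A w y) = wprod A w (reflect x y)"
  by (simp add: reflect_def cartan_int_wprod)

lemma reflect_real: "x \<in> real_roots A \<Longrightarrow> y \<in> real_roots A \<Longrightarrow> reflect x y \<in> real_roots A"
proof -
  assume "x \<in> real_roots A" and y: "y \<in> real_roots A"
  then obtain w i where x: "x = wprod A w (sroot i)" by (elim real_rootsE)
  have "reflect x y = wprod A w (reflect (sroot i) (wprod A (rev w) y))"
    using reflect_wprod[of w "sroot i" "wprod A (rev w) y"] x by simp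
  also have "reflect (sroot i) (wprod A (rev w) y) = S i (wprod A (rev w) y)"
    by (simp add: reflect_def S_eq)
  finally show ?thesis using y by (simp add: wprod_real)
qed

text \<open>In the coroot basis the coroot of \<open>w (sroot i)\<close> has coordinates d_j x_j /
  d_i. Under a reflection they change by the transposed Cartan matrix, which is again integral, so
  integrality survives induction on the word.\<close>

lemma coroot_integral:
  assumes "\<beta> \<in> real_roots A"
  shows "2 / K \<beta> \<beta> * (d j * \<beta> $ j) \<in> \<int>"
proof -
  obtain w i where b: "\<beta> = wprod A w (sroot i)" using assms by (elim real_rootsE)
  have "\<forall>j. d j * wprod A w (sroot i) $ j / d i \<in> \<int>"
  proof (induction w)
    case Nil show ?case using d_pos[of i] by simp
  next
    case (Cons k w)
    let ?u = "wprod A w (sroot i)"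
    have "d k * pairing k ?u / d i = (\<Sum>j\<in>UNIV. of_int (A j k) * (d j * ?u $ j / d i))"
      unfolding pairing_def sum_distrib_left sum_divide_distrib
    proof (rule sum.cong)
      fix j
      have "d k * (of_int (A k j) * ?u $ j) = (d k * of_int (A k j)) * ?u $ j" by simp
      also have "\<dots> = (d j * of_int (A j k)) * ?u $ j" by (simp only: d_sym[of k j])
      finally show "d k * (of_int (A k j) * ?u $ j) / d i = of_int (A j k) * (d j * ?u $ j / d i)"
        by (simp add: mult.commute mult.left_commute)
    qed simp
    also have "\<dots> \<in> \<int>" using Cons by (intro Ints_sum Ints_mult) auto
    finally have "d k * pairing k ?u / d i \<in> \<int>" .
    then show ?case using Cons
      by (auto simp: S_nth right_diff_distrib diff_divide_distrib)
  qed
  then show ?thesis using b d_pos[of i] by (simp add: field_simps)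
qed

text \<open>Reducedness of the root system. After moving \<beta> to a simple root, integral root
  coordinates make \<open>t\<close> an integer, and integral coroot coordinates make
  \<open>1 / t\<close> one.\<close>

lemma real_proportional:
  assumes "\<beta> \<in> real_roots A" "t *\<^sub>R \<beta> \<in> real_roots A"
  shows "t = 1 \<or> t = -1"
proof -
  have 1: "2 * t \<in> \<int>" if "\<beta> \<in> real_roots A" "t *\<^sub>R \<beta> \<in> real_roots A" for \<beta> t
    using cartan_int_integral[OF that(1) real_integral[OF that(2)]] cartan_int_self[OF that(1)]
    by (simp add: mult.commute)
  obtain w i where b: "\<beta> = wprod A w (sroot i)" using assms by (elim real_rootsE)
  have r: "t *\<^sub>R sroot i \<in> real_roots A"
    using wprod_real[OF assms(2), of "rev w"] b by simp
  have t0: "t \<noteq> 0" using real_nonzero[OF r] by auto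
  have "t \<in> \<int>" using real_integral[OF r] by (auto simp: integral_vec_def split: if_splits)
  moreover have "1 / t \<in> \<int>"
    using coroot_integral[OF r, of i] d_pos[of i] t0 by (simp add: field_simps power2_eq_square)
  ultimately obtain m n :: int where mn: "t = m" "1 / t = n" by (auto elim!: Ints_cases)
  then have "real_of_int m * n = 1" using t0 by (metis nonzero_mult_div_cancel_left times_divide_eq_right mult.right_neutral)
  then have "m * n = 1" by (metis of_int_1 of_int_eq_iff of_int_mult)
  then have "m = 1 \<or> m = -1" by (metis zmult_eq_1_iff)
  then show ?thesis using mn by auto
qed

end

section \<open>Signs of real roots\<close>

context cartan begin

definition len :: "'i set \<Rightarrow> (real ^ 'i \<Rightarrow> real ^ 'i) \<Rightarrow> nat" where
  "len X f = (LEAST k. \<exists>w. set w \<subseteq> X \<and> length w = k \<and> wprod A w = f)"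

lemma len_le: "set w \<subseteq> X \<Longrightarrow> len X (wprod A w) \<le> length w"
  unfolding len_def by (rule Least_le) blast

lemma len_word:
  assumes "set w \<subseteq> X"
  obtains w' where "set w' \<subseteq> X" "length w' = len X (wprod A w)" "wprod A w' = wprod A w"
proof -
  have "\<exists>w'. set w' \<subseteq> X \<and> length w' = len X (wprod A w) \<and> wprod A w' = wprod A w"
    unfolding len_def by (rule LeastI_ex) (use assms in blast)
  then show ?thesis using that by blast
qed

lemma nonneg_scale: "nonneg v \<Longrightarrow> c \<ge> 0 \<Longrightarrow> nonneg (c *\<^sub>R v)"
  by (auto simp: nonneg_def)

lemma nonneg_sroot [simp]: "nonneg (sroot i)"
  by (simp add: nonneg_def)

lemma real_multiple_sroot:
  assumes "u \<in> real_roots A" "nonneg u" "\<And>j. j \<noteq> i \<Longrightarrow> u $ j = 0"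
  shows "u = sroot i"
proof -
  have u: "u = (u $ i) *\<^sub>R sroot i" using assms(3) by (auto simp: vec_eq_iff)
  then have "u $ i = 1 \<or> u $ i = -1"
    using real_proportional[of "sroot i" "u $ i"] assms(1) by simp
  moreover have "u $ i \<ge> 0" using assms(2) by (simp add: nonneg_def)
  ultimately show ?thesis using u by auto
qed

text \<open>\<open>S i\<close> changes only the coordinate at \<open>i\<close>, so every other
  coordinate is both nonnegative and nonpositive; reducedness then leaves
  \<open>sroot i\<close>.\<close>

lemma sign_change:
  assumes "u \<in> real_roots A" "nonneg u" "nonneg (- S i u)"
  shows "u = sroot i"
proof (rule real_multiple_sroot[OF assms(1,2)])
  fix j assume "j \<noteq> i"
  then have "S i u $ j = u $ j" by (simp add: S_nth)
  moreover have "u $ j \<ge> 0" "- (S i u $ j) \<ge> 0"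
    using assms(2,3) unfolding nonneg_def by (auto simp del: neg_0_le_iff_le)
  ultimately show "u $ j = 0" by simp
qed

text \<open>The exchange condition. Reading the word from the right, the image of
  \<open>sroot s\<close> turns negative at some letter; just before, it is the simple root of that
  letter, so the letter can be deleted against \<open>s\<close>. The sign statement is a hypothesis
  over the alphabet \<open>X\<close>, so that rank two is available before signs are known in
  general.\<close>

lemma exchange_word:
  assumes "set w \<subseteq> X" "s \<in> X"
    and sgn: "\<And>u. set u \<subseteq> X \<Longrightarrow>
      nonneg (wprod A u (sroot s)) \<or> nonneg (- wprod A u (sroot s))"
    and "nonneg (- wprod A w (sroot s))"
  shows "\<exists>w'. set w' \<subseteq> X \<and> length w' < length w \<and> wprod A w' = wprod A (w @ [s])"
  using assms(1,4)
proof (induction w)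
  case Nil
  then have "- (1::real) \<ge> 0" unfolding nonneg_def by (metis id_apply sroot_nth uminus_apply vector_uminus_component wprod_Nil)
  then show ?case by simp
next
  case (Cons i w)
  let ?u = "wprod A w (sroot s)"
  show ?case
  proof (cases "nonneg (- ?u)")
    case True
    with Cons obtain w' where w': "set w' \<subseteq> X" "length w' < length w"
      "wprod A w' = wprod A (w @ [s])" by (auto simp del: wprod_append)
    then have "wprod A (i # w') = wprod A ((i # w) @ [s])" by (auto simp: fun_eq_iff)
    then show ?thesis using w' Cons(2)
      by (intro exI[of _ "i # w'"]) auto
  next
    case False
    then have "nonneg ?u" using sgn[of w] Cons by auto
    then have u: "?u = sroot i"
      using sign_change[of ?u i] real_rootsI[of w s] Cons(3) by simp
    have "wprod A w (S s v) = S i (wprod A w v)" for v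
    proof -
      have "wprod A w (S s v) = reflect ?u (wprod A w v)"
        by (simp only: reflect_wprod) (simp add: reflect_def S_eq)
      then show ?thesis by (simp add: u) (simp add: reflect_def S_eq)
    qed
    then have "wprod A w = wprod A ((i # w) @ [s])" by (auto simp: fun_eq_iff)
    moreover have "set w \<subseteq> X" "length w < length (i # w)" using Cons(2) by simp_all
    ultimately show ?thesis by blast
  qed
qed

lemma wprod_nth_outside: "j \<notin> set w \<Longrightarrow> wprod A w v $ j = v $ j"
  by (induction w) (auto simp: S_nth)

text \<open>Mixed signs are excluded by the norm. With integer coordinates x, y of opposite signs
  the square terms give at least 2 d_s + 2 d_t and the mixed term is nonnegative, but the norm of
  \<open>b\<close> is 2 d_s.\<close>

lemma rank_two_sign:
  assumes "set u \<subseteq> {s, t}" "s \<noteq> t"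
  shows "nonneg (wprod A u (sroot s)) \<or> nonneg (- wprod A u (sroot s))"
proof (rule ccontr)
  assume neg: "\<not> ?thesis"
  define b where "b = wprod A u (sroot s)"
  have b0: "b $ j = 0" if "j \<noteq> s" "j \<noteq> t" for j
    using that assms(1) wprod_nth_outside[of j u "sroot s"] by (auto simp: b_def)
  define x y where "x = b $ s" and "y = b $ t"
  have b: "b = x *\<^sub>R sroot s + y *\<^sub>R sroot t"
    using b0 assms(2) by (auto simp: vec_eq_iff x_def y_def)
  have int: "x \<in> \<int>" "y \<in> \<int>"
    using integral_wprod[of "sroot s" u] by (auto simp: integral_vec_def b_def x_def y_def)
  have "\<not> (x \<ge> 0 \<and> y \<ge> 0)" "\<not> (x \<le> 0 \<and> y \<le> 0)"
    using neg b0 unfolding b_def[symmetric] nonneg_def x_def y_def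
    by (metis order_refl, metis neg_0_le_iff_le order_refl vector_uminus_component)
  then have xy: "x * y < 0" by (metis linorder_not_le mult_le_0_iff zero_le_mult_iff mult_neg_pos mult_pos_neg order_less_imp_le)
  then have "x \<noteq> 0" "y \<noteq> 0" by auto
  then have sq: "x\<^sup>2 \<ge> 1" "y\<^sup>2 \<ge> 1"
    using int Ints_nonzero_abs_ge1[of x] Ints_nonzero_abs_ge1[of y]
    by (auto simp: power2_ge_1_iff)
  have "K b b = 2 * d s * x\<^sup>2 + 2 * d t * y\<^sup>2 + x * y * (d s * of_int (A s t) + d t * of_int (A t s))"
    unfolding b by (simp add: power2_eq_square algebra_simps)
  moreover have "x * y * (d s * of_int (A s t) + d t * of_int (A t s)) \<ge> 0"
    using xy A_off[of s t] A_off[of t s] assms(2) d_pos[of s] d_pos[of t]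
    by (intro mult_nonpos_nonpos[of "x * y"] add_nonpos_nonpos mult_nonneg_nonpos[of "d _"]) (auto intro: less_imp_le)
  moreover have "2 * d s * x\<^sup>2 \<ge> 2 * d s * 1" "2 * d t * y\<^sup>2 \<ge> 2 * d t * 1"
    using sq d_pos[of s] d_pos[of t] by (intro mult_left_mono; simp)+
  moreover have "K b b = 2 * d s" unfolding b_def by simp
  ultimately show False using d_pos[of t] by linarith
qed

text \<open>The classical reduction to rank two: factor the element as \<open>v u\<close> with
  \<open>u\<close> in the dihedral group of \<open>s\<close> and a last letter \<open>t\<close>,
  lengths adding and \<open>v\<close> as short as possible. Induction makes \<open>v\<close>
  nonnegative on both simple roots, and \<open>u\<close> sends \<open>sroot s\<close> to a
  nonnegative combination of them.\<close>

lemma nonneg_wprod_sroot: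
  assumes "len UNIV (wprod A w) = n" "len UNIV (wprod A (w @ [s])) \<ge> n"
  shows "nonneg (wprod A w (sroot s))"
  using assms
proof (induction n arbitrary: w s rule: less_induct)
  case (less n w s)
  obtain w0 where w0: "length w0 = n" "wprod A w0 = wprod A w"
    using len_word[of w UNIV] less.prems(1) by auto
  have min: "n \<le> length w'" if "wprod A w' = wprod A w" for w'
    using len_le[of w' UNIV] that less.prems(1) by simp
  show ?case
  proof (cases "w0 = []")
    case True
    then have "wprod A w = id" using w0 by simp
    then show ?thesis by simp
  next
    case False
    then obtain w1 t where w1: "w0 = w1 @ [t]" by (metis rev_exhaust)
    have "t \<noteq> s"
    proof
      assume "t = s"
      then have "wprod A w1 = wprod A (w @ [s])"
        using w0(2) unfolding w1 wprod_append_fun by (auto simp: fun_eq_iff) (metis S_S)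
      then show False using less.prems(2) len_le[of w1 UNIV] w0(1) w1 by (simp del: wprod_append)
    qed
    \<comment> \<open>\<open>Q k\<close> records such a factorization with \<open>v\<close> of
      length \<open>k\<close>. Stripping the final \<open>t\<close> gives \<open>Q (n - 1)\<close>,
      so the least \<open>k\<close> is below \<open>n\<close> and induction applies to
      \<open>v\<close>.\<close>
    define Q where "Q k \<longleftrightarrow> (\<exists>v u. set u \<subseteq> {s, t} \<and> wprod A (v @ u) = wprod A w \<and> length v = k
      \<and> length v + length u = n)" for k
    have Q0: "Q (n - 1)"
      unfolding Q_def using w0 w1 by (intro exI[of _ w1] exI[of _ "[t]"]) auto
    define k where "k = (LEAST k. Q k)"
    have "Q k" unfolding k_def using Q0 by (rule LeastI)
    then obtain v u where vu: "set u \<subseteq> {s, t}" "wprod A (v @ u) = wprod A w" "length v = k"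
      "length v + length u = n" unfolding Q_def by blast
    have kn: "k < n" using Least_le[of Q, OF Q0] w0 w1 unfolding k_def by auto
    have lv: "len UNIV (wprod A v) = k"
    proof -
      obtain v' where v': "length v' = len UNIV (wprod A v)" "wprod A v' = wprod A v"
        using len_word[of v UNIV] by auto
      have "wprod A (v' @ u) = wprod A w" using v' vu(2) by (simp add: wprod_append_fun)
      from min[OF this] show ?thesis using v' vu(3,4) len_le[of v UNIV] by simp
    qed
    \<comment> \<open>If multiplication by \<open>x\<close> shortened \<open>v\<close>, shifting
      \<open>x\<close> into the dihedral factor would contradict the minimality of
      \<open>k\<close>.\<close>
    have step: "nonneg (wprod A v (sroot x))" if x: "x \<in> {s, t}" for x
    proof (rule less.IH[OF kn lv], rule ccontr)
      assume "\<not> k \<le> len UNIV (wprod A (v @ [x]))"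
      then obtain v' where v': "length v' < k" "wprod A v' = wprod A (v @ [x])"
        using len_word[of "v @ [x]" UNIV] by (metis linorder_not_le subset_UNIV)
      have e: "wprod A (v' @ x # u) = wprod A w"
        using v'(2) vu(2) by (auto simp: fun_eq_iff)
      have "Q (length v')"
        unfolding Q_def using e vu x min[OF e] v'(1)
        by (intro exI[of _ v'] exI[of _ "x # u"]) auto
      then have "k \<le> length v'" unfolding k_def by (rule Least_le)
      then show False using v' by simp
    qed
    define b where "b = wprod A u (sroot s)"
    \<comment> \<open>Otherwise the exchange condition in rank two shortens \<open>u s\<close>, and
      with it \<open>w s\<close>, below length \<open>n\<close>.\<close>
    have "nonneg b"
    proof (rule ccontr)
      assume "\<not> nonneg b"
      then have "nonneg (- wprod A u (sroot s))"
        using rank_two_sign[OF vu(1)] \<open>t \<noteq> s\<close> unfolding b_def by blast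
      from exchange_word[OF vu(1) _ _ this] rank_two_sign[of _ s t] \<open>t \<noteq> s\<close>
      obtain u' where u': "length u' < length u" "wprod A u' = wprod A (u @ [s])" by (auto simp del: wprod_append)
      have "wprod A (v @ u') = wprod A (w @ [s])"
        using u'(2) vu(2) by (auto simp: fun_eq_iff)
      then have "n \<le> length (v @ u')"
        using less.prems(2) len_le[of "v @ u'" UNIV] by (simp del: wprod_append)
      then show False using u'(1) vu(4) by simp
    qed
    have b0: "b $ j = 0" if "j \<noteq> s" "j \<noteq> t" for j
      using that vu(1) wprod_nth_outside[of j u "sroot s"] by (auto simp: b_def)
    have b: "b = (b $ s) *\<^sub>R sroot s + (b $ t) *\<^sub>R sroot t"
      using b0 \<open>t \<noteq> s\<close> by (auto simp: vec_eq_iff)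
    have "wprod A w (sroot s) = wprod A v b"
      unfolding b_def using vu(2) by (metis wprod_append)
    also have "\<dots> = (b $ s) *\<^sub>R wprod A v (sroot s) + (b $ t) *\<^sub>R wprod A v (sroot t)"
      by (subst b) simp
    finally show ?thesis
      using step \<open>nonneg b\<close> by (auto simp: nonneg_def intro!: add_nonneg_nonneg mult_nonneg_nonneg)
  qed
qed

text \<open>If \<open>s\<close> shortens \<open>w\<close>, the criterion applies to
  \<open>w s\<close> instead, which maps \<open>sroot s\<close> to -\<beta>.\<close>

theorem root_sign:
  assumes "\<beta> \<in> real_roots A"
  shows "nonneg \<beta> \<or> nonneg (- \<beta>)"
proof -
  obtain w s where b: "\<beta> = wprod A w (sroot s)" using assms by (elim real_rootsE)
  show ?thesis
  proof (cases "len UNIV (wprod A (w @ [s])) \<ge> len UNIV (wprod A w)")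
    case True
    then show ?thesis using nonneg_wprod_sroot[OF refl True] b by simp
  next
    case False
    have "wprod A ((w @ [s]) @ [s]) = wprod A w" by (auto simp: fun_eq_iff)
    then have "nonneg (wprod A (w @ [s]) (sroot s))"
      using nonneg_wprod_sroot[OF refl, of "w @ [s]" s] False by (simp del: wprod_append)
    then show ?thesis using b by simp
  qed
qed

lemma S_pos:
  assumes "\<beta> \<in> real_roots A" "nonneg \<beta>" "\<beta> \<noteq> sroot i"
  shows "nonneg (S i \<beta>)"
  using root_sign[of "S i \<beta>"] sign_change[OF assms(1,2)] assms by auto

lemma minus_sroot_not_nonneg [simp]: "\<not> nonneg (- sroot i)"
  by (simp add: nonneg_def)

end

section \<open>The Euler form of a word\<close>

lemma before_Nil [simp]: "\<not> before [] j i"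
  by (simp add: before_def)

lemma before_Cons: "before (s # \<rho>) j i \<longleftrightarrow> (j = s \<and> i \<in> set \<rho>) \<or> before \<rho> j i"
proof
  assume "before (s # \<rho>) j i"
  then obtain p q where pq: "p < q" "q < length (s # \<rho>)" "(s # \<rho>) ! p = j" "(s # \<rho>) ! q = i"
    unfolding before_def by blast
  then obtain q' where q: "q = Suc q'" by (cases q) auto
  show "(j = s \<and> i \<in> set \<rho>) \<or> before \<rho> j i"
  proof (cases p)
    case 0 then show ?thesis using pq q by auto
  next
    case (Suc p')
    then have "before \<rho> j i" using pq q unfolding before_def by (intro exI[of _ p'] exI[of _ q']) auto
    then show ?thesis ..
  qed
next
  assume "(j = s \<and> i \<in> set \<rho>) \<or> before \<rho> j i"
  then show "before (s # \<rho>) j i"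
  proof
    assume "j = s \<and> i \<in> set \<rho>"
    then obtain q where "q < length \<rho>" "\<rho> ! q = i" "j = s" by (auto simp: in_set_conv_nth)
    then show ?thesis unfolding before_def by (intro exI[of _ 0] exI[of _ "Suc q"]) auto
  next
    assume "before \<rho> j i"
    then obtain p q where "p < q" "q < length \<rho>" "\<rho> ! p = j" "\<rho> ! q = i" unfolding before_def by blast
    then show ?thesis unfolding before_def by (intro exI[of _ "Suc p"] exI[of _ "Suc q"]) auto
  qed
qed

lemma before_in_set: "before \<rho> j i \<Longrightarrow> j \<in> set \<rho> \<and> i \<in> set \<rho>"
  by (induction \<rho>) (auto simp: before_Cons)

lemma before_snoc: "before (\<rho> @ [s]) j i \<longleftrightarrow> (i = s \<and> j \<in> set \<rho>) \<or> before \<rho> j i"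
  by (induction \<rho>) (auto simp: before_Cons)

lemma before_total: "i \<noteq> j \<Longrightarrow> i \<in> set \<rho> \<Longrightarrow> j \<in> set \<rho> \<Longrightarrow> before \<rho> i j \<or> before \<rho> j i"
  by (induction \<rho>) (auto simp: before_Cons)

lemma before_asym: "distinct \<rho> \<Longrightarrow> before \<rho> i j \<Longrightarrow> \<not> before \<rho> j i"
  by (induction \<rho>) (auto simp: before_Cons dest: before_in_set)

lemma before_irrefl: "distinct \<rho> \<Longrightarrow> \<not> before \<rho> i i"
  using before_asym[of \<rho> i i] by auto

context cartan begin

text \<open>Up to the factor relating \<open>\<alpha>\<close> to its coroot, \<open>euler \<pi> \<alpha> \<beta>\<close> and \<open>euler \<pi> \<beta> \<alpha>\<close> are the negatives of
  the two expressions in the compatibility degree of positive roots.\<close>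

definition euler_coeff :: "'i list \<Rightarrow> 'i \<Rightarrow> 'i \<Rightarrow> real" where
  "euler_coeff \<pi> i j = (if i = j then d i else 0) + (if before \<pi> j i then d i * of_int (A i j) else 0)"

definition euler :: "'i list \<Rightarrow> real ^ 'i \<Rightarrow> real ^ 'i \<Rightarrow> real" where
  "euler \<pi> u v = (\<Sum>i\<in>UNIV. \<Sum>j\<in>UNIV. u $ i * euler_coeff \<pi> i j * v $ j)"

lemma euler_linear_right: "linear (euler \<pi> u)"
  unfolding euler_def
  by (rule linearI) (simp_all add: algebra_simps sum.distrib sum_distrib_left)

lemma euler_linear_left: "linear (\<lambda>u. euler \<pi> u v)"
  unfolding euler_def
  by (rule linearI) (simp_all add: algebra_simps sum.distrib sum_distrib_left)

lemma euler_right [simp]: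
  "euler \<pi> u (v + w) = euler \<pi> u v + euler \<pi> u w" "euler \<pi> u (v - w) = euler \<pi> u v - euler \<pi> u w"
  "euler \<pi> u (c *\<^sub>R v) = c * euler \<pi> u v" "euler \<pi> u (- v) = - euler \<pi> u v" "euler \<pi> u 0 = 0"
  using linear_add[OF euler_linear_right] linear_diff[OF euler_linear_right]
    linear_scale[OF euler_linear_right] linear_neg[OF euler_linear_right] linear_0[OF euler_linear_right]
  by auto

lemma euler_left [simp]:
  "euler \<pi> (v + w) u = euler \<pi> v u + euler \<pi> w u" "euler \<pi> (v - w) u = euler \<pi> v u - euler \<pi> w u"
  "euler \<pi> (c *\<^sub>R v) u = c * euler \<pi> v u" "euler \<pi> (- v) u = - euler \<pi> v u" "euler \<pi> 0 u = 0"
  using linear_add[OF euler_linear_left] linear_diff[OF euler_linear_left]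
    linear_scale[OF euler_linear_left] linear_neg[OF euler_linear_left] linear_0[OF euler_linear_left]
  by auto

lemma euler_sum_right: "euler \<pi> u (sum g B) = (\<Sum>x\<in>B. euler \<pi> u (g x))"
  by (rule linear_sum[OF euler_linear_right])

lemma euler_sum_left: "euler \<pi> (sum g B) u = (\<Sum>x\<in>B. euler \<pi> (g x) u)"
  by (rule linear_sum[OF euler_linear_left])

lemma euler_sroot_left: "euler \<pi> (sroot i) v = (\<Sum>j\<in>UNIV. euler_coeff \<pi> i j * v $ j)"
proof -
  have "(\<Sum>k\<in>UNIV. \<Sum>j\<in>UNIV. sroot i $ k * euler_coeff \<pi> k j * v $ j)
    = (\<Sum>k\<in>UNIV. if k = i then \<Sum>j\<in>UNIV. euler_coeff \<pi> k j * v $ j else 0)"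
    by (intro sum.cong refl) auto
  then show ?thesis by (simp add: euler_def)
qed

lemma euler_sroot_right: "euler \<pi> u (sroot j) = (\<Sum>i\<in>UNIV. u $ i * euler_coeff \<pi> i j)"
proof -
  have "(\<Sum>k\<in>UNIV. u $ i * euler_coeff \<pi> i k * sroot j $ k)
    = (\<Sum>k\<in>UNIV. if k = j then u $ i * euler_coeff \<pi> i k else 0)" for i
    by (intro sum.cong refl) auto
  then show ?thesis by (simp add: euler_def)
qed

lemma euler_sroot: "euler \<pi> (sroot i) (sroot j) = euler_coeff \<pi> i j"
proof -
  have "(\<Sum>k\<in>UNIV. euler_coeff \<pi> i k * sroot j $ k) = (\<Sum>k\<in>UNIV. if k = j then euler_coeff \<pi> i k else 0)"
    by (intro sum.cong refl) auto
  then show ?thesis by (simp add: euler_sroot_left)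
qed

lemma euler_Cons:
  assumes "s \<notin> set \<rho>"
  shows "euler (s # \<rho>) u v = euler \<rho> u v + v $ s * (\<Sum>i\<in>set \<rho>. d i * of_int (A i s) * u $ i)"
proof -
  have e: "euler_coeff (s # \<rho>) i j = euler_coeff \<rho> i j + (if j = s then if i \<in> set \<rho> then d i * of_int (A i s) else 0 else 0)" for i j
    using assms before_in_set[of \<rho> j i] by (auto simp: before_Cons euler_coeff_def)
  have "euler (s # \<rho>) u v = euler \<rho> u v + (\<Sum>i\<in>UNIV. \<Sum>j\<in>UNIV. if j = s then
      (if i \<in> set \<rho> then v $ s * (d i * of_int (A i s) * u $ i) else 0) else 0)"
    unfolding euler_def sum.distrib[symmetric]
    by (intro sum.cong refl) (simp add: e algebra_simps)
  also have "\<dots> = euler \<rho> u v + (\<Sum>i\<in>UNIV. if i \<in> set \<rho> then v $ s * (d i * of_int (A i s) * u $ i) else 0)"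
    by simp
  finally show ?thesis
    by (simp add: sum.If_cases sum_distrib_left)
qed

lemma euler_snoc:
  assumes "s \<notin> set \<rho>"
  shows "euler (\<rho> @ [s]) u v = euler \<rho> u v + u $ s * (\<Sum>j\<in>set \<rho>. d s * of_int (A s j) * v $ j)"
proof -
  have e: "euler_coeff (\<rho> @ [s]) i j = euler_coeff \<rho> i j + (if i = s then if j \<in> set \<rho> then d s * of_int (A s j) else 0 else 0)" for i j
    using assms before_in_set[of \<rho> j i] by (auto simp: before_snoc euler_coeff_def)
  have "euler (\<rho> @ [s]) u v = euler \<rho> u v + (\<Sum>i\<in>UNIV. \<Sum>j\<in>UNIV. if i = s then
      (if j \<in> set \<rho> then u $ s * (d s * of_int (A s j) * v $ j) else 0) else 0)"
    unfolding euler_def sum.distrib[symmetric]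
    by (intro sum.cong refl) (simp add: e algebra_simps)
  also have "\<dots> = euler \<rho> u v + (\<Sum>j\<in>UNIV. if j \<in> set \<rho> then u $ s * (d s * of_int (A s j) * v $ j) else 0)"
    by (subst sum.swap) simp
  finally show ?thesis
    by (simp add: sum.If_cases sum_distrib_left)
qed

text \<open>The span of the simple roots indexed by \<open>J\<close>. Keeping the support explicit
  lets the same lemmas on E serve full Coxeter words and words in a proper subset of the
  letters.\<close>

definition supp_in :: "'i set \<Rightarrow> real ^ 'i \<Rightarrow> bool" where
  "supp_in J v \<longleftrightarrow> (\<forall>j. j \<notin> J \<longrightarrow> v $ j = 0)"

lemma supp_in_UNIV [simp]: "supp_in UNIV v"
  by (simp add: supp_in_def)

lemma supp_in_scale: "supp_in J v \<Longrightarrow> supp_in J (c *\<^sub>R v)"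
  by (auto simp: supp_in_def)

lemma supp_in_sum: "(\<And>x. x \<in> B \<Longrightarrow> supp_in J (g x)) \<Longrightarrow> supp_in J (sum g B)"
  by (induction B rule: infinite_finite_induct) (auto simp: supp_in_def)

lemma supp_in_S: "i \<in> J \<Longrightarrow> supp_in J v \<Longrightarrow> supp_in J (S i v)"
  by (auto simp: supp_in_def S_nth)

lemma supp_in_wprod: "set w \<subseteq> J \<Longrightarrow> supp_in J v \<Longrightarrow> supp_in J (wprod A w v)"
  by (induction w) (auto intro: supp_in_S)

lemma pairing_supp:
  assumes "s \<notin> set \<rho>" "supp_in (insert s (set \<rho>)) v"
  shows "(\<Sum>j\<in>set \<rho>. d s * of_int (A s j) * v $ j) = d s * (pairing s v - 2 * v $ s)"
    and "(\<Sum>i\<in>set \<rho>. d i * of_int (A i s) * v $ i) = d s * (pairing s v - 2 * v $ s)"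
proof -
  have "pairing s v = (\<Sum>j\<in>insert s (set \<rho>). of_int (A s j) * v $ j)"
    unfolding pairing_def using assms(2) by (intro sum.mono_neutral_right) (auto simp: supp_in_def)
  then show 1: "(\<Sum>j\<in>set \<rho>. d s * of_int (A s j) * v $ j) = d s * (pairing s v - 2 * v $ s)"
    using assms(1) by (simp add: sum_distrib_left mult.assoc)
  show "(\<Sum>i\<in>set \<rho>. d i * of_int (A i s) * v $ i) = d s * (pairing s v - 2 * v $ s)"
    unfolding 1[symmetric] by (intro sum.cong refl) (simp add: d_sym[of s])
qed

text \<open>The words \<open>s # \<rho>\<close> and \<open>\<rho> @ [s]\<close> share the form of
  \<rho> and differ by a correction at \<open>s\<close>. As \<open>S s\<close> changes only that
  coordinate, both sides reduce to an identity between the coordinates at \<open>s\<close> and the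
  pairings with \<open>s\<close>.\<close>

lemma euler_move:
  assumes "s \<notin> set \<rho>" "supp_in (insert s (set \<rho>)) u" "supp_in (insert s (set \<rho>)) v"
  shows "euler (\<rho> @ [s]) (S s u) (S s v) = euler (s # \<rho>) u v"
proof -
  have no: "\<not> before \<rho> j s" "\<not> before \<rho> s j" for j
    using before_in_set[of \<rho>] assms(1) by blast+
  \<comment> \<open>The diagonal of \<open>euler_coeff\<close> runs over all indices, not only over
    the letters of the word, so \<open>sroot s\<close> still pairs with itself.\<close>
  have a: "euler \<rho> (sroot s) w = d s * w $ s" "euler \<rho> w (sroot s) = d s * w $ s" for w
    by (simp_all add: euler_sroot_left euler_sroot_right euler_coeff_def no if_distrib[of "\<lambda>x. x * _"]
        if_distrib[of "\<lambda>x. _ * x"] mult.commute cong: if_cong)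
  have "(\<Sum>j\<in>set \<rho>. d s * of_int (A s j) * S s v $ j) = (\<Sum>j\<in>set \<rho>. d s * of_int (A s j) * v $ j)"
    using assms(1) by (intro sum.cong refl) (auto simp: S_nth)
  then have "euler (\<rho> @ [s]) (S s u) (S s v)
      = euler \<rho> (S s u) (S s v) + (u $ s - pairing s u) * (d s * (pairing s v - 2 * v $ s))"
    unfolding euler_snoc[OF assms(1)] using pairing_supp(1)[OF assms(1,3)] by (simp add: S_nth)
  also have "\<dots> = euler \<rho> u v + v $ s * (d s * (pairing s u - 2 * u $ s))"
    by (simp add: S_eq a algebra_simps)
  also have "\<dots> = euler (s # \<rho>) u v"
    unfolding euler_Cons[OF assms(1)] pairing_supp(2)[OF assms(1,2)] ..
  finally show ?thesis .
qed

text \<open>Nothing stands before the first letter, so its row of E is diagonal. For the last letter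
  the same holds for its column.\<close>

lemma euler_Cons_sroot: "s \<notin> set \<rho> \<Longrightarrow> euler (s # \<rho>) (sroot s) v = d s * v $ s"
proof -
  assume s: "s \<notin> set \<rho>"
  have no: "\<not> before (s # \<rho>) j s" for j
    using s before_in_set[of \<rho>] by (auto simp: before_Cons)
  show ?thesis
    by (simp add: euler_sroot_left euler_sroot_right euler_coeff_def no if_distrib[of "\<lambda>x. x * _"]
        if_distrib[of "\<lambda>x. _ * x"] mult.commute cong: if_cong)
qed

lemma euler_snoc_sroot: "s \<notin> set \<rho> \<Longrightarrow> euler (\<rho> @ [s]) v (sroot s) = d s * v $ s"
proof -
  assume s: "s \<notin> set \<rho>"
  have no: "\<not> before (\<rho> @ [s]) s i" for i
    using s before_in_set[of \<rho>] by (auto simp: before_snoc)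
  show ?thesis
    by (simp add: euler_sroot_left euler_sroot_right euler_coeff_def no if_distrib[of "\<lambda>x. x * _"]
        if_distrib[of "\<lambda>x. _ * x"] mult.commute cong: if_cong)
qed

text \<open>The identity that ties \<open>c\<close> to E: as E symmetrizes to K, it is equivalent to
  E(c u, v) = - E(v, u). The induction removes the first letter; the vector \<open>w\<close> moved
  by the remaining letters has no coordinate at \<open>s\<close>, so the correction for
  \<open>s\<close> is governed by the pairing alone.\<close>

lemma euler_wprod_diff:
  assumes "distinct \<pi>" "supp_in (set \<pi>) v"
  shows "euler \<pi> (wprod A \<pi> u - u) v = - K u v"
  using assms
proof (induction \<pi> arbitrary: v)
  case Nil
  then have "v = 0" by (simp add: supp_in_def vec_eq_iff)
  then show ?case by simp
next
  case (Cons s \<rho>)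
  then have s: "s \<notin> set \<rho>" by simp
  define w where "w = wprod A \<rho> u - u"
  define v' where "v' = v - v $ s *\<^sub>R sroot s"
  have v: "v = v' + v $ s *\<^sub>R sroot s" by (simp add: v'_def)
  have v's: "supp_in (set \<rho>) v'" using Cons.prems(2) by (auto simp: v'_def supp_in_def)
  have wsupp: "supp_in (set \<rho>) w"
    unfolding w_def supp_in_def by (simp add: wprod_nth_outside)
  have ws: "w $ s = 0" using wsupp s by (simp add: supp_in_def)
  have no: "\<not> before \<rho> s j" for j
    using before_in_set[of \<rho>] s by blast
  have z: "euler \<rho> w (sroot s) = 0"
    unfolding euler_sroot_right using ws no by (intro sum.neutral) (auto simp: euler_coeff_def)
  have IH: "euler \<rho> w v' = - K u v'" using Cons.IH[OF _ v's] Cons.prems by (simp add: w_def)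
  have "wprod A (s # \<rho>) u - u = w - pairing s (wprod A \<rho> u) *\<^sub>R sroot s"
    by (simp add: S_eq w_def)
  then have "euler (s # \<rho>) (wprod A (s # \<rho>) u - u) v =
     euler (s # \<rho>) w v - pairing s (wprod A \<rho> u) * (d s * v $ s)"
    by (simp add: euler_Cons_sroot[OF s])
  also have "euler (s # \<rho>) w v = euler \<rho> w v + v $ s * (d s * pairing s w)"
    unfolding euler_Cons[OF s]
    using pairing_supp(2)[OF s, of w] wsupp ws by (auto simp: supp_in_def)
  also have "euler \<rho> w v = euler \<rho> w v'" by (subst v) (simp add: z)
  also have "pairing s w = pairing s (wprod A \<rho> u) - pairing s u" by (simp add: w_def)
  finally have "euler (s # \<rho>) (wprod A (s # \<rho>) u - u) v = - K u v' - v $ s * (d s * pairing s u)"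
    using IH by (simp add: algebra_simps)
  also have "\<dots> = - K u v" by (subst (2) v) (simp add: K_sroot_right)
  finally show ?case .
qed

lemma euler_symmetrize:
  assumes "distinct \<pi>" "supp_in (set \<pi>) u" "supp_in (set \<pi>) v"
  shows "euler \<pi> u v + euler \<pi> v u = K u v"
proof -
  have "euler \<pi> v u = (\<Sum>i\<in>UNIV. \<Sum>j\<in>UNIV. v $ j * euler_coeff \<pi> j i * u $ i)"
    unfolding euler_def by (rule sum.swap)
  then have "euler \<pi> u v + euler \<pi> v u =
      (\<Sum>i\<in>UNIV. \<Sum>j\<in>UNIV. u $ i * euler_coeff \<pi> i j * v $ j + v $ j * euler_coeff \<pi> j i * u $ i)"
    by (simp add: euler_def sum.distrib)
  also have "\<dots> = (\<Sum>i\<in>UNIV. (\<Sum>j\<in>UNIV. u $ i * d i * of_int (A i j) * v $ j))"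
  proof (intro sum.cong refl)
    fix i j
    show "u $ i * euler_coeff \<pi> i j * v $ j + v $ j * euler_coeff \<pi> j i * u $ i
      = u $ i * d i * of_int (A i j) * v $ j"
    proof (cases "i = j")
      case True then show ?thesis using before_irrefl[OF assms(1)] by (simp add: euler_coeff_def)
    next
      case False
      show ?thesis
      proof (cases "i \<in> set \<pi> \<and> j \<in> set \<pi>")
        case True
        then show ?thesis
          using False before_total[of i j \<pi>] before_asym[OF assms(1), of i j] before_asym[OF assms(1), of j i]
            d_sym[of j i] by (auto simp: euler_coeff_def)
      next
        case F: False
        then have "u $ i = 0 \<or> v $ j = 0" using assms(2,3) by (auto simp: supp_in_def)
        then show ?thesis by auto
      qed
    qed
  qed
  finally show ?thesis by (simp add: Kf_def)
qed

end

section \<open>The imaginary root and Coxeter words\<close>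

text \<open>Simultaneous Dirichlet approximation makes q v so close to an integer vector
  \<open>P\<close> that M P, an integer vector, has entries below 1 in absolute value and so
  vanishes.\<close>

lemma integer_kernel_vector:
  fixes M :: "'i::finite \<Rightarrow> 'i \<Rightarrow> int" and v :: "real ^ 'i"
  assumes ker: "\<And>i. (\<Sum>j\<in>UNIV. of_int (M i j) * v $ j) = 0" and v1: "v $ a \<ge> 1"
  obtains p :: "'i \<Rightarrow> int" where "\<And>i. (\<Sum>j\<in>UNIV. M i j * p j) = 0" "p a > 0"
proof -
  obtain h where h: "bij_betw h {0..<CARD('i)} (UNIV :: 'i set)"
    using ex_bij_betw_nat_finite[of "UNIV :: 'i set"] by auto
  \<comment> \<open>\<open>N\<close> exceeds every row sum of absolute values of \<open>M\<close>,
    so an error below 1/N per coordinate stays below 1 after applying \<open>M\<close>.\<close>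
  define N where "N = nat (\<Sum>i\<in>UNIV. \<Sum>j\<in>UNIV. \<bar>M i j\<bar>) + 1"
  obtain q p where q: "0 < q" and qp: "\<And>k. k < CARD('i) \<Longrightarrow> \<bar>of_int q * v $ h k - of_int (p k)\<bar> < 1 / N"
    by (rule Dirichlet_approx_simult[of N "CARD('i)" "\<lambda>k. v $ h k"]) (auto simp: N_def)
  define P where "P j = p (inv_into {0..<CARD('i)} h j)" for j
  have P: "\<bar>of_int q * v $ j - of_int (P j)\<bar> < 1 / N" for j
  proof -
    have "j \<in> h ` {0..<CARD('i)}" using h by (simp add: bij_betw_def)
    then have "inv_into {0..<CARD('i)} h j \<in> {0..<CARD('i)}" "h (inv_into {0..<CARD('i)} h j) = j"
      by (rule inv_into_into, rule f_inv_into_f)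
    then show ?thesis using qp[of "inv_into {0..<CARD('i)} h j"] by (simp add: P_def)
  qed
  have "(\<Sum>j\<in>UNIV. M i j * P j) = 0" for i
  proof -
    have "(\<Sum>j\<in>UNIV. of_int (M i j) * (of_int (P j) - of_int q * v $ j)) =
       (\<Sum>j\<in>UNIV. of_int (M i j) * real_of_int (P j)) - of_int q * (\<Sum>j\<in>UNIV. of_int (M i j) * v $ j)"
      by (simp add: algebra_simps sum_subtractf sum_distrib_left)
    then have "\<bar>of_int (\<Sum>j\<in>UNIV. M i j * P j)\<bar> =
        \<bar>\<Sum>j\<in>UNIV. of_int (M i j) * (of_int (P j) - of_int q * v $ j)\<bar>"
      using ker[of i] by simp
    also have "\<dots> \<le> (\<Sum>j\<in>UNIV. \<bar>of_int (M i j) * (of_int (P j) - of_int q * v $ j)\<bar>)"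
      by (rule sum_abs)
    also have "\<dots> \<le> (\<Sum>j\<in>UNIV. of_int \<bar>M i j\<bar> * (1 / N))"
    proof (rule sum_mono)
      fix j
      have "\<bar>of_int (P j) - of_int q * v $ j\<bar> \<le> 1 / N" using P[of j] by (simp add: abs_minus_commute)
      then show "\<bar>of_int (M i j) * (of_int (P j) - of_int q * v $ j)\<bar> \<le> of_int \<bar>M i j\<bar> * (1 / N)"
        unfolding abs_mult of_int_abs by (rule mult_left_mono) simp
    qed
    also have "\<dots> = of_int (\<Sum>j\<in>UNIV. \<bar>M i j\<bar>) / N"
      by (simp add: sum_divide_distrib)
    also have "\<dots> < 1"
    proof -
      have "(\<Sum>j\<in>UNIV. \<bar>M i j\<bar>) \<le> (\<Sum>i\<in>UNIV. \<Sum>j\<in>UNIV. \<bar>M i j\<bar>)"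
        by (rule member_le_sum[where f="\<lambda>i. \<Sum>j\<in>UNIV. \<bar>M i j\<bar>"]) (auto intro: sum_nonneg)
      then have "(\<Sum>j\<in>UNIV. \<bar>M i j\<bar>) < int N" by (simp add: N_def)
      then have "real_of_int (\<Sum>j\<in>UNIV. \<bar>M i j\<bar>) < real N"
        by (metis of_int_less_iff of_int_of_nat_eq)
      then show ?thesis by (simp add: N_def)
    qed
    finally show ?thesis by linarith
  qed
  moreover have "P a > 0"
  proof -
    have "of_int q * v $ a \<ge> 1 * 1" using q v1 by (intro mult_mono) auto
    moreover have "1 / real N \<le> 1" by (simp add: N_def)
    ultimately have "real_of_int (P a) > 0" using P[of a] by linarith
    then show ?thesis by simp
  qed
  ultimately show ?thesis using that by blast
qed

text \<open>The integral multiples of \<open>p\<close> form a discrete group, generated by its least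
  positive element, and comparing norms identifies that element with \<open>delta\<close>. The
  matrix is arbitrary because both \<open>A\<close> and its transpose are used.\<close>

lemma delta_properties:
  fixes M :: "'i::finite \<Rightarrow> 'i \<Rightarrow> int" and p :: "real ^ 'i"
  assumes ker: "\<And>v. (\<forall>i. (\<Sum>j\<in>UNIV. of_int (M i j) * v $ j) = 0) \<longleftrightarrow> (\<exists>t. v = t *\<^sub>R p)"
    and pos: "\<And>i. p $ i > 0"
  shows "\<exists>t > 0. delta M = t *\<^sub>R p"
    and "\<And>i. delta M $ i \<in> \<int>"
    and "\<And>v. v \<in> imag_roots M \<Longrightarrow> \<exists>k::int. k \<noteq> 0 \<and> v = of_int k *\<^sub>R delta M"
proof -
  obtain a :: 'i where True by blast
  define T where "T = {t. t > 0 \<and> (\<forall>i. t * p $ i \<in> \<int>)}"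
  have im: "v \<in> imag_roots M \<longleftrightarrow> (\<exists>t. t \<noteq> 0 \<and> v = t *\<^sub>R p \<and> (\<forall>i. t * p $ i \<in> \<int>))" for v
  proof -
    have "p \<noteq> 0" using pos[of a] by auto
    then show ?thesis unfolding imag_roots_def using ker[of v] by auto
  qed
  have imn: "v \<in> imag_roots M \<and> nonneg v \<longleftrightarrow> (\<exists>t\<in>T. v = t *\<^sub>R p)" for v
  proof -
    have "nonneg (t *\<^sub>R p) \<longleftrightarrow> t \<ge> 0" for t
      using pos[of a] less_imp_le[OF pos] by (auto simp: nonneg_def zero_le_mult_iff) (meson linorder_not_le)
    then show ?thesis unfolding im T_def by (intro iffI; elim conjE exE bexE) (auto simp: less_le)
  qed
  have "T \<noteq> {}"
  proof -
    have ker0: "(\<Sum>j\<in>UNIV. of_int (M i j) * ((1 / p $ a) *\<^sub>R p) $ j) = 0" for i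
      using ker[of "(1 / p $ a) *\<^sub>R p"] by blast
    obtain q :: "'i \<Rightarrow> int" where q: "\<And>i. (\<Sum>j\<in>UNIV. M i j * q j) = 0" "q a > 0"
      by (rule integer_kernel_vector[of M "(1 / p $ a) *\<^sub>R p" a]) (use ker0 pos[of a] in auto)
    define v :: "real ^ 'i" where "v = (\<chi> j. of_int (q j))"
    have "(\<Sum>j\<in>UNIV. of_int (M i j) * v $ j) = 0" for i
    proof -
      have "(\<Sum>j\<in>UNIV. of_int (M i j) * v $ j) = real_of_int (\<Sum>j\<in>UNIV. M i j * q j)" by (simp add: v_def)
      then show ?thesis using q(1) by simp
    qed
    then obtain t where t: "v = t *\<^sub>R p" using ker[of v] by blast
    then have ti: "t * p $ i = of_int (q i)" for i by (metis v_def vec_lambda_beta vector_scaleR_component real_scaleR_def)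
    have "t > 0" using ti[of a] q(2) pos[of a] by (metis of_int_0_less_iff zero_less_mult_pos2)
    then have "t \<in> T" using ti by (auto simp: T_def)
    then show ?thesis by blast
  qed
  \<comment> \<open>For \<open>t\<close> in \<open>T\<close> the coordinate at \<open>a\<close> is a
    natural number, so well-ordering provides a least element of \<open>T\<close>.\<close>
  define N where "N = (\<lambda>t. nat \<lfloor>t * p $ a\<rfloor>) ` T"
  have Nt: "real (nat \<lfloor>t * p $ a\<rfloor>) = t * p $ a" if "t \<in> T" for t
    using that pos[of a] by (auto simp: T_def elim!: Ints_cases)
  obtain t0 where t0: "t0 \<in> T" "\<And>t. t \<in> T \<Longrightarrow> t0 \<le> t"
  proof -
    obtain t1 where "t1 \<in> T" using \<open>T \<noteq> {}\<close> by blast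
    then have "\<exists>n. n \<in> N" unfolding N_def by blast
    then have "(LEAST n. n \<in> N) \<in> N" by (rule LeastI_ex)
    then obtain t0 where t0: "t0 \<in> T" "nat \<lfloor>t0 * p $ a\<rfloor> = (LEAST n. n \<in> N)" unfolding N_def by auto
    have "t0 \<le> t" if "t \<in> T" for t
    proof -
      have "nat \<lfloor>t0 * p $ a\<rfloor> \<le> nat \<lfloor>t * p $ a\<rfloor>"
        unfolding t0(2) using that by (intro Least_le) (auto simp: N_def)
      then have "t0 * p $ a \<le> t * p $ a" using Nt[OF that] Nt[OF t0(1)] by linarith
      then show ?thesis using pos[of a] by simp
    qed
    then show ?thesis using that t0 by blast
  qed
  have np: "norm p > 0" using pos[of a] by auto
  have dlt: "delta M = t0 *\<^sub>R p"
    unfolding delta_def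
  proof (rule the_equality)
    show "t0 *\<^sub>R p \<in> imag_roots M \<and> nonneg (t0 *\<^sub>R p) \<and>
      (\<forall>w\<in>imag_roots M. nonneg w \<longrightarrow> norm (t0 *\<^sub>R p) \<le> norm w)"
    proof (intro conjI ballI impI)
      show "t0 *\<^sub>R p \<in> imag_roots M" "nonneg (t0 *\<^sub>R p)" using imn t0 by blast+
      fix w assume "w \<in> imag_roots M" "nonneg w"
      then obtain t where t: "t \<in> T" "w = t *\<^sub>R p" using imn by blast
      then show "norm (t0 *\<^sub>R p) \<le> norm w"
        using t0(2)[OF t(1)] t0(1) by (auto simp: T_def intro!: mult_right_mono)
    qed
  next
    fix v assume v: "v \<in> imag_roots M \<and> nonneg v \<and> (\<forall>w\<in>imag_roots M. nonneg w \<longrightarrow> norm v \<le> norm w)"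
    then obtain t where t: "t \<in> T" "v = t *\<^sub>R p" using imn by blast
    have "norm v \<le> norm (t0 *\<^sub>R p)" using v imn t0(1) by blast
    then have "t \<le> t0" using t t0(1) np by (auto simp: T_def)
    then show "v = t0 *\<^sub>R p" using t t0(2)[OF t(1)] by simp
  qed
  show "\<exists>t > 0. delta M = t *\<^sub>R p" using dlt t0(1) by (auto simp: T_def)
  show "delta M $ i \<in> \<int>" for i using dlt t0(1) by (auto simp: T_def)
  fix v assume "v \<in> imag_roots M"
  then obtain t where t: "t \<noteq> 0" "v = t *\<^sub>R p" "\<And>i. t * p $ i \<in> \<int>" using im by blast
  have t0p: "t0 > 0" "\<And>i. t0 * p $ i \<in> \<int>" using t0(1) by (auto simp: T_def)
  \<comment> \<open>Division with remainder: r p is integral and 0 \<le> r < t0, so minimality of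
    \<open>t0\<close> gives r = 0.\<close>
  define k where "k = \<lfloor>t / t0\<rfloor>"
  define r where "r = t - of_int k * t0"
  have r: "0 \<le> r" "r < t0"
  proof -
    have "of_int k \<le> t / t0" "t / t0 < of_int k + 1" unfolding k_def by linarith+
    then show "0 \<le> r" "r < t0" using t0p(1) by (simp_all add: r_def field_simps)
  qed
  have "r * p $ i \<in> \<int>" for i
    using t(3)[of i] t0p(2)[of i] unfolding r_def by (auto simp: left_diff_distrib mult.assoc intro!: Ints_diff Ints_mult)
  then have "r = 0" using r t0(2)[of r] by (force simp: T_def)
  then have "t = of_int k * t0" by (simp add: r_def)
  then show "\<exists>k::int. k \<noteq> 0 \<and> v = of_int k *\<^sub>R delta M" using t dlt by (intro exI[of _ k]) auto
qed

section \<open>Semidefinite forms and their radical\<close>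

locale cartan_semidefinite = cartan A d
  for A :: "'i::finite \<Rightarrow> 'i \<Rightarrow> int" and d :: "'i \<Rightarrow> real" +
  assumes psd: "\<And>v. Kf A d v v \<ge> 0"
begin

lemma K_cauchy: "(K u v)\<^sup>2 \<le> K u u * K v v"
proof -
  have f: "0 \<le> K u u + 2 * t * K u v + t\<^sup>2 * K v v" for t
    using psd[of "u + t *\<^sub>R v"] by (simp add: K_sym[of v u] algebra_simps power2_eq_square)
  show ?thesis
  proof (cases "K v v = 0")
    case True
    have "K u v = 0"
    proof (rule ccontr)
      assume n: "K u v \<noteq> 0"
      have "K u u + 2 * (- (K u u + 1) / (2 * K u v)) * K u v = - 1"
        using n by (simp add: field_simps)
      then show False using f[of "- (K u u + 1) / (2 * K u v)"] True by simp
    qed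
    then show ?thesis using True by simp
  next
    case False
    then have p: "K v v > 0" using psd[of v] by linarith
    have "0 \<le> (K u u + 2 * (- K u v / K v v) * K u v + (- K u v / K v v)\<^sup>2 * K v v) * K v v"
      using f[of "- K u v / K v v"] p by (intro mult_nonneg_nonneg) auto
    also have "\<dots> = K u u * K v v - (K u v)\<^sup>2"
      using p by (simp add: field_simps power2_eq_square)
    finally show ?thesis by simp
  qed
qed

lemma rad_K: "K v v = 0 \<Longrightarrow> K v u = 0" "K v v = 0 \<Longrightarrow> K u v = 0"
  using K_cauchy[of v u] K_cauchy[of u v] by auto

lemma rad_pairing: "K v v = 0 \<Longrightarrow> pairing i v = 0"
  using rad_K(2)[of v "sroot i"] d_pos[of i] by simp

lemma pairing_rad: "(\<And>i. pairing i v = 0) \<Longrightarrow> K v v = 0"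
  by (simp add: K_alt)

end

text \<open>Common ground of the two types: the radical is zero in finite type and the line of
  \<delta> in affine type.\<close>

locale cartan_psd = cartan_semidefinite A d
  for A :: "'i::finite \<Rightarrow> 'i \<Rightarrow> int" and d :: "'i \<Rightarrow> real" +
  assumes rad1: "\<exists>r. \<forall>v. Kf A d v v = 0 \<longrightarrow> (\<exists>t. v = t *\<^sub>R r)"
begin

text \<open>Write \<open>f\<close> as the inner product with \<open>a\<close> and project
  \<open>a\<close> to the range of the Gram matrix \<open>M\<close>. The orthogonal remainder
  \<open>z\<close> has K(z, z) = 0, so \<open>f\<close> vanishes on it, which forces z = 0.\<close>

lemma K_represents:
  assumes f: "linear f" and f0: "\<And>v. K v v = 0 \<Longrightarrow> f v = (0::real)"
  obtains g where "\<And>v. f v = K g v"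
proof -
  define M :: "real ^ 'i \<Rightarrow> real ^ 'i" where "M v = (\<chi> i. d i * pairing i v)" for v
  have KM: "K u v = u \<bullet> M v" for u v by (simp add: K_alt M_def inner_vec_def)
  have linM: "linear M" by (rule linearI) (simp_all add: M_def vec_eq_iff algebra_simps)
  define a where "a = adjoint f 1"
  have fa: "f v = a \<bullet> v" for v
    using adjoint_works[OF f, of v 1] by (simp add: a_def inner_commute)
  obtain y z where yz: "y \<in> span (range M)" "\<And>w. w \<in> span (range M) \<Longrightarrow> orthogonal z w" "a = y + z"
    using orthogonal_subspace_decomp_exists[of "range M" a] by blast
  have sp: "span (range M) = range M"
    using linear_subspace_image[OF linM subspace_UNIV] by (simp add: span_eq_iff)
  have "K z z = 0" using yz(2)[of "M z"] sp by (simp add: KM orthogonal_def)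
  then have "a \<bullet> z = 0" using f0[of z] fa by simp
  moreover have "y \<bullet> z = 0" using yz(1,2) by (auto simp: orthogonal_def inner_commute)
  ultimately have "z = 0" using yz(3) by (simp add: inner_add_left)
  then obtain g where "a = M g" using yz sp by auto
  then have "f v = K g v" for v by (simp add: fa K_sym[of g v] KM[of v] inner_commute)
  then show ?thesis using that by blast
qed

section \<open>Coxeter words and the nondegeneracy of E\<close>

definition is_cox_word :: "'i list \<Rightarrow> bool" where
  "is_cox_word \<pi> \<longleftrightarrow> distinct \<pi> \<and> set \<pi> = UNIV"

lemma cox_length: "is_cox_word \<pi> \<Longrightarrow> length \<pi> = CARD('i)"
  using distinct_card[of \<pi>] by (simp add: is_cox_word_def)

lemma cox_ConsD: "is_cox_word (s # \<rho>) \<Longrightarrow> s \<notin> set \<rho>" "is_cox_word (s # \<rho>) \<Longrightarrow> insert s (set \<rho>) = UNIV"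
  by (auto simp: is_cox_word_def)

lemma cox_rotate: "is_cox_word (s # \<rho>) \<longleftrightarrow> is_cox_word (\<rho> @ [s])"
  by (auto simp: is_cox_word_def)

lemma euler_add: "is_cox_word \<pi> \<Longrightarrow> euler \<pi> u v + euler \<pi> v u = K u v"
  by (rule euler_symmetrize) (auto simp: is_cox_word_def)

lemma euler_self: "is_cox_word \<pi> \<Longrightarrow> euler \<pi> u u = K u u / 2"
  using euler_add[of \<pi> u u] by simp

lemma euler_cox: "is_cox_word \<pi> \<Longrightarrow> euler \<pi> (wprod A \<pi> u) v = - euler \<pi> v u"
  using euler_wprod_diff[of \<pi> v u] euler_add[of \<pi> u v] by (simp add: is_cox_word_def)

lemma euler_cox_cox: "is_cox_word \<pi> \<Longrightarrow> euler \<pi> (wprod A \<pi> u) (wprod A \<pi> v) = euler \<pi> u v"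
  by (simp add: euler_cox)

text \<open>In the order of the word E is triangular, with the positive numbers \<open>d i\<close>
  on the diagonal.\<close>

lemma euler_nondegenerate:
  assumes "distinct \<pi>" "supp_in (set \<pi>) w" "\<And>v. supp_in (set \<pi>) v \<Longrightarrow> euler \<pi> w v = 0"
  shows "w = 0"
  using assms
proof (induction \<pi> arbitrary: w)
  case Nil
  then show ?case by (simp add: supp_in_def vec_eq_iff)
next
  case (Cons s \<rho>)
  then have s: "s \<notin> set \<rho>" by simp
  define w' where "w' = w - w $ s *\<^sub>R sroot s"
  have w: "w = w' + w $ s *\<^sub>R sroot s" by (simp add: w'_def)
  have w's: "supp_in (set \<rho>) w'" using Cons.prems(2) by (auto simp: w'_def supp_in_def)
  have "w' = 0"
  proof (rule Cons.IH[OF _ w's])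
    fix v assume v: "supp_in (set \<rho>) v"
    then have vs: "v $ s = 0" using s by (simp add: supp_in_def)
    have "supp_in (set (s # \<rho>)) v" using v by (auto simp: supp_in_def)
    then have "euler (s # \<rho>) w v = 0" by (rule Cons.prems(3))
    moreover have "euler (s # \<rho>) w v = euler (s # \<rho>) w' v + w $ s * (d s * v $ s)"
      by (subst w) (simp add: euler_Cons_sroot[OF s])
    moreover have "euler (s # \<rho>) w' v = euler \<rho> w' v" using vs by (simp add: euler_Cons[OF s])
    ultimately show "euler \<rho> w' v = 0" using vs by simp
  qed (use Cons.prems in simp)
  then have "w = w $ s *\<^sub>R sroot s" using w by simp
  moreover have "euler (s # \<rho>) w (sroot s) = 0" by (rule Cons.prems(3)) (simp add: supp_in_def)
  ultimately have "w $ s * (d s * 1) = 0"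
    using euler_Cons_sroot[OF s, of "sroot s"] by (metis euler_left(3) sroot_nth)
  then have "w $ s = 0" using d_pos[of s] by simp
  then show ?case using \<open>w = w $ s *\<^sub>R sroot s\<close> by simp
qed

lemma euler_nondegenerate_cox: "is_cox_word \<pi> \<Longrightarrow> (\<And>v. euler \<pi> w v = 0) \<Longrightarrow> w = 0"
  by (rule euler_nondegenerate[of \<pi>]) (auto simp: is_cox_word_def)

lemma cox_fixed: "is_cox_word \<pi> \<Longrightarrow> wprod A \<pi> u = u \<Longrightarrow> K u u = 0"
  using euler_wprod_diff[of \<pi> u u] by (simp add: is_cox_word_def)

text \<open>By the identity for c u - u, a vector is in the image of c - 1 once its functional under
  E is represented by K, and functionals vanishing on the radical are.\<close>

lemma range_cox_diff:
  assumes "is_cox_word \<pi>" "\<And>v. K v v = 0 \<Longrightarrow> euler \<pi> w v = 0"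
  obtains u where "wprod A \<pi> u - u = w"
proof -
  obtain g where g: "\<And>v. euler \<pi> w v = K g v" using K_represents[OF euler_linear_right assms(2)] by blast
  have "euler \<pi> (wprod A \<pi> (- g) - (- g) - w) v = 0" for v
    using euler_wprod_diff[of \<pi> v "- g"] g[of v] assms(1) by (simp add: is_cox_word_def)
  from euler_nondegenerate_cox[OF assms(1) this] show ?thesis using that[of "- g"] by simp
qed

text \<open>Both forms satisfy E(c u - u, v) = - K(u, v), so their difference \<open>D\<close>
  vanishes in its first argument on the image of c - 1, of codimension at most one. Both symmetrize
  to K, so \<open>D\<close> is antisymmetric, and an antisymmetric form of rank at most one is
  zero.\<close>

lemma euler_word_independent:
  assumes "is_cox_word \<pi>" "is_cox_word \<pi>'" "wprod A \<pi> = wprod A \<pi>'"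
  shows "euler \<pi> = euler \<pi>'"
proof -
  define D where "D u v = euler \<pi> u v - euler \<pi>' u v" for u v
  have anti: "D u v = - D v u" for u v
    using euler_add[OF assms(1), of u v] euler_add[OF assms(2), of u v] by (simp add: D_def)
  obtain r where r: "\<And>v. K v v = 0 \<Longrightarrow> \<exists>t. v = t *\<^sub>R r" using rad1 by blast
  have z: "D w v = 0" if "euler \<pi> w r = 0" for w v
  proof -
    have "euler \<pi> w v = 0" if "K v v = 0" for v
      using r[OF that] \<open>euler \<pi> w r = 0\<close> by auto
    then obtain u where "wprod A \<pi> u - u = w" using range_cox_diff[OF assms(1)] by blast
    then show ?thesis
      using euler_wprod_diff[of \<pi> v u] euler_wprod_diff[of \<pi>' v u] assms by (simp add: D_def is_cox_word_def)
  qed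
  have "D u v = 0" for u v
  proof (cases "\<exists>w. euler \<pi> w r \<noteq> 0")
    case False then show ?thesis using z by blast
  next
    case True
    then obtain w0 where w0: "euler \<pi> w0 r \<noteq> 0" by blast
    \<comment> \<open>The coordinate of \<open>u\<close> along \<open>w0\<close> modulo the
      hyperplane on which E(u, r) = 0.\<close>
    define k where "k u = euler \<pi> u r / euler \<pi> w0 r" for u
    have dec: "D u v = k u * D w0 v" for u v
    proof -
      have "D (u - k u *\<^sub>R w0) v = 0" using w0 by (intro z) (simp add: k_def)
      then show ?thesis by (simp add: D_def algebra_simps)
    qed
    have "D w0 w0 = 0" using anti[of w0 w0] by simp
    have "D w0 v = - (k v * D w0 w0)" using anti[of w0 v] dec[of v w0] by simp
    then show ?thesis using dec[of u v] \<open>D w0 w0 = 0\<close> by simp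
  qed
  then show ?thesis by (simp add: D_def fun_eq_iff)
qed

lemma coxeter_wordE:
  assumes "coxeter A c"
  obtains \<pi> where "is_cox_word \<pi>" "wprod A \<pi> = c"
  using assms by (auto simp: coxeter_def is_cox_word_def)

lemma cox_word:
  assumes "coxeter A c"
  shows "is_cox_word (cox_word A c)" "wprod A (cox_word A c) = c"
proof -
  have "\<exists>\<pi>. distinct \<pi> \<and> set \<pi> = UNIV \<and> wprod A \<pi> = c" using assms by (simp add: coxeter_def)
  from someI_ex[OF this] show "is_cox_word (cox_word A c)" "wprod A (cox_word A c) = c"
    by (auto simp: is_cox_word_def cox_word_def)
qed

lemma coxeter_wprod: "is_cox_word \<pi> \<Longrightarrow> coxeter A (wprod A \<pi>)"
  by (auto simp: coxeter_def is_cox_word_def)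

lemma euler_cox_word: "is_cox_word \<pi> \<Longrightarrow> euler (cox_word A (wprod A \<pi>)) = euler \<pi>"
  by (rule euler_word_independent) (simp_all add: cox_word coxeter_wprod)

text \<open>A word avoiding \<open>j\<close> preserves the coordinate at \<open>j\<close>. The
  Coxeter element changes that coordinate from 1 to -1 on the vector obtained from
  \<open>sroot j\<close> by undoing the letters after \<open>j\<close>.\<close>

lemma cox_word_letters:
  assumes "is_cox_word \<pi>" "wprod A w = wprod A \<pi>"
  shows "set w = UNIV"
proof (rule ccontr)
  assume "set w \<noteq> UNIV"
  then obtain j where j: "j \<notin> set w" by auto
  obtain a b where ab: "\<pi> = a @ j # b" using assms(1) split_list[of j \<pi>] by (auto simp: is_cox_word_def)
  then have jab: "j \<notin> set a" "j \<notin> set b" using assms(1) by (auto simp: is_cox_word_def)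
  define v where "v = wprod A (rev b) (sroot j)"
  have "wprod A \<pi> v $ j = S j (wprod A b v) $ j"
    using jab by (simp add: ab wprod_nth_outside)
  also have "\<dots> = - 1" by (simp add: v_def)
  finally have "v $ j = - 1" using wprod_nth_outside[OF j, of v] assms(2) by simp
  moreover have "v $ j = 1" unfolding v_def using jab by (simp add: wprod_nth_outside)
  ultimately show False by simp
qed

text \<open>A reduced word is no longer than \<pi> and contains every letter, so it lists each
  letter once. This turns initial and final letters into first and last letters of Coxeter
  words.\<close>

lemma cox_min_word:
  assumes "is_cox_word \<pi>" "wprod A w = wprod A \<pi>" "reduced A w"
  shows "is_cox_word w"
proof -
  have "length w \<le> length \<pi>" using assms(2,3) unfolding reduced_def by metis
  then have "length w \<le> CARD('i)" using cox_length[OF assms(1)] by simp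
  moreover have "set w = UNIV" by (rule cox_word_letters[OF assms(1,2)])
  ultimately show ?thesis unfolding is_cox_word_def using card_distinct[of w] card_length[of w] by simp
qed

lemma cox_reduced: "is_cox_word \<pi> \<Longrightarrow> reduced A \<pi>"
  unfolding reduced_def using cox_word_letters[of \<pi>] cox_length[of \<pi>] card_length by metis

lemma initialE:
  assumes "coxeter A c" "initial A s c"
  obtains \<rho> where "is_cox_word (s # \<rho>)" "wprod A (s # \<rho>) = c"
proof -
  obtain \<pi> where p: "is_cox_word \<pi>" "wprod A \<pi> = c" using assms(1) by (rule coxeter_wordE)
  obtain w where w: "reduced A w" "wprod A w = c" "w \<noteq> []" "hd w = s"
    using assms(2) by (auto simp: initial_def)
  have "is_cox_word w" using cox_min_word[of \<pi> w] p w by simp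
  then show ?thesis using that[of "tl w"] w by (metis list.collapse)
qed

lemma finalE:
  assumes "coxeter A c" "final A s c"
  obtains \<rho> where "is_cox_word (s # \<rho>)" "wprod A (\<rho> @ [s]) = c"
proof -
  obtain \<pi> where p: "is_cox_word \<pi>" "wprod A \<pi> = c" using assms(1) by (rule coxeter_wordE)
  obtain w where w: "reduced A w" "wprod A w = c" "w \<noteq> []" "last w = s"
    using assms(2) by (auto simp: final_def)
  have "is_cox_word w" using cox_min_word[of \<pi> w] p w by simp
  moreover have "w = butlast w @ [s]" using w by (metis append_butlast_last_id)
  ultimately show ?thesis using that[of "butlast w"] w(2) cox_rotate by metis
qed

lemma initialI: "is_cox_word (s # \<rho>) \<Longrightarrow> initial A s (wprod A (s # \<rho>))"
  unfolding initial_def by (intro exI[of _ "s # \<rho>"]) (simp del: wprod_Cons add: cox_reduced)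

lemma finalI: "is_cox_word (s # \<rho>) \<Longrightarrow> final A s (wprod A (\<rho> @ [s]))"
  unfolding final_def using cox_rotate[of s \<rho>]
  by (intro exI[of _ "\<rho> @ [s]"]) (simp del: wprod_append add: cox_reduced)

lemma conj_by_initial: "conj_by A s (wprod A (s # \<rho>)) = wprod A (\<rho> @ [s])"
  by (simp add: conj_by_def fun_eq_iff)

lemma conj_by_final: "conj_by A s (wprod A (\<rho> @ [s])) = wprod A (s # \<rho>)"
  by (simp add: conj_by_def fun_eq_iff)

lemma euler_move_cox:
  "is_cox_word (s # \<rho>) \<Longrightarrow> euler (\<rho> @ [s]) (S s u) (S s v) = euler (s # \<rho>) u v"
  using euler_move[of s \<rho> u v] cox_ConsD[of s \<rho>] by simp

end

section \<open>Orbits of roots under a Coxeter element\<close>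

lemma finite_bounded_integer_vectors:
  "finite {v :: real ^ 'i::finite. (\<forall>i. v $ i \<in> \<int>) \<and> (\<forall>i. \<bar>v $ i\<bar> \<le> B)}"
proof -
  define N where "N = \<lceil>B\<rceil>"
  have "{v :: real ^ 'i. (\<forall>i. v $ i \<in> \<int>) \<and> (\<forall>i. \<bar>v $ i\<bar> \<le> B)}
      \<subseteq> (\<lambda>g. \<chi> i. of_int (g i)) ` (PiE UNIV (\<lambda>_. {- N..N}))"
  proof
    fix v :: "real ^ 'i"
    assume "v \<in> {v. (\<forall>i. v $ i \<in> \<int>) \<and> (\<forall>i. \<bar>v $ i\<bar> \<le> B)}"
    then have v: "\<And>i. v $ i \<in> \<int>" "\<And>i. \<bar>v $ i\<bar> \<le> B" by auto
    have e: "of_int \<lfloor>v $ i\<rfloor> = v $ i" for i using v(1)[of i] by (auto elim: Ints_cases)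
    have "\<lfloor>v $ i\<rfloor> \<in> {- N..N}" for i
    proof -
      have "\<bar>real_of_int \<lfloor>v $ i\<rfloor>\<bar> \<le> of_int N" using v(2)[of i] e[of i] unfolding N_def by linarith
      then have "\<bar>\<lfloor>v $ i\<rfloor>\<bar> \<le> N" by linarith
      then show ?thesis by auto
    qed
    then show "v \<in> (\<lambda>g. \<chi> i. of_int (g i)) ` (PiE UNIV (\<lambda>_. {- N..N}))"
      by (intro image_eqI[of _ _ "\<lambda>i. \<lfloor>v $ i\<rfloor>"]) (auto simp: vec_eq_iff e)
  qed
  then show ?thesis by (rule finite_subset) (intro finite_imageI finite_PiE; simp)
qed

context cartan_semidefinite begin

text \<open>Compactness of the unit sphere in the coordinate subspace bounds K below by a positive
  multiple of the squared norm, leaving finitely many integral points.\<close>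

lemma finite_integral_norm:
  assumes pd: "\<And>v. supp_in J v \<Longrightarrow> v \<noteq> 0 \<Longrightarrow> K v v > 0"
  shows "finite {v. integral_vec v \<and> supp_in J v \<and> K v v \<le> N}"
proof -
  define V where "V = {v :: real ^ 'i. supp_in J v \<and> norm v = 1}"
  have cont: "continuous_on X (\<lambda>v. K v v)" for X
    unfolding Kf_def by (intro continuous_intros)
  have "V = sphere 0 1 \<inter> (\<Inter>j\<in>- J. {v. v $ j = 0})" by (auto simp: V_def supp_in_def)
  then have "compact V"
    by (auto intro!: compact_Int_closed closed_INT closed_Collect_eq continuous_intros)
  have "\<exists>m>0. \<forall>v. supp_in J v \<longrightarrow> m * (norm v)\<^sup>2 \<le> K v v"
  proof (cases "V = {}")
    case True
    have "v = 0" if "supp_in J v" for v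
    proof (rule ccontr)
      assume "v \<noteq> 0"
      then have "(1 / norm v) *\<^sub>R v \<in> V" using that by (simp add: V_def supp_in_scale)
      then show False using True by simp
    qed
    then show ?thesis by (intro exI[of _ 1]) (auto dest!: \<open>\<And>v. supp_in J v \<Longrightarrow> v = 0\<close>)
  next
    case False
    obtain v0 where v0: "v0 \<in> V" "\<And>v. v \<in> V \<Longrightarrow> K v0 v0 \<le> K v v"
      using continuous_attains_inf[OF \<open>compact V\<close> False cont] by blast
    have "K v0 v0 > 0" using v0(1) by (intro pd) (auto simp: V_def)
    moreover have "K v0 v0 * (norm v)\<^sup>2 \<le> K v v" if "supp_in J v" for v
    proof (cases "v = 0")
      case False
      then have "K v0 v0 \<le> K ((1 / norm v) *\<^sub>R v) ((1 / norm v) *\<^sub>R v)"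
        using that by (intro v0(2)) (simp add: V_def supp_in_scale)
      also have "\<dots> = K v v / (norm v)\<^sup>2" by (simp add: power2_eq_square)
      finally show ?thesis using False by (simp add: field_simps)
    qed simp
    ultimately show ?thesis by blast
  qed
  then obtain m where m: "m > 0" "\<And>v. supp_in J v \<Longrightarrow> m * (norm v)\<^sup>2 \<le> K v v" by blast
  have "\<bar>v $ i\<bar> \<le> sqrt (N / m)" if "supp_in J v" "K v v \<le> N" for v i
  proof -
    have "(norm v)\<^sup>2 \<le> N / m" using m(1) m(2)[OF that(1)] that(2) by (simp add: field_simps)
    then have "norm v \<le> sqrt (N / m)" by (simp add: real_le_rsqrt)
    then show ?thesis using component_le_norm_cart[of v i] by linarith
  qed
  then have "{v. integral_vec v \<and> supp_in J v \<and> K v v \<le> N}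
     \<subseteq> {v. (\<forall>i. v $ i \<in> \<int>) \<and> (\<forall>i. \<bar>v $ i\<bar> \<le> sqrt (N / m))}"
    by (auto simp: integral_vec_def)
  then show ?thesis by (rule finite_subset) (rule finite_bounded_integer_vectors)
qed

lemma real_norm_bound: "\<exists>N. \<forall>x \<in> real_roots A. K x x \<le> N"
proof (intro exI ballI)
  fix x assume "x \<in> real_roots A"
  then obtain w i where "x = wprod A w (sroot i)" by (elim real_rootsE)
  then have "K x x = 2 * d i" by simp
  also have "\<dots> \<le> (\<Sum>i\<in>UNIV. 2 * d i)"
    using d_pos by (intro member_le_sum) (auto intro: less_imp_le)
  finally show "K x x \<le> (\<Sum>i\<in>UNIV. 2 * d i)" .
qed

lemma funpow_linear: "linear f \<Longrightarrow> linear (f ^^ n)" for f :: "real ^ 'i \<Rightarrow> real ^ 'i"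
  by (induction n) (auto intro: linear_compose simp: linear_id[unfolded id_def] id_def)

lemma funpow_wprod: "(wprod A w ^^ n) = wprod A (concat (replicate n w))"
  by (induction n) (auto simp: fun_eq_iff)

lemma funpow_real: "x \<in> real_roots A \<Longrightarrow> (wprod A w ^^ n) x \<in> real_roots A"
  by (simp add: funpow_wprod wprod_real)

lemma funpow_K: "K ((wprod A w ^^ n) u) ((wprod A w ^^ n) v) = K u v"
  by (simp add: funpow_wprod)

lemma funpow_simps:
  "(wprod A w ^^ n) (u + v) = (wprod A w ^^ n) u + (wprod A w ^^ n) v"
  "(wprod A w ^^ n) (u - v) = (wprod A w ^^ n) u - (wprod A w ^^ n) v"
  "(wprod A w ^^ n) (c *\<^sub>R v) = c *\<^sub>R (wprod A w ^^ n) v"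
  by (simp_all add: funpow_wprod)

lemma funpow_inj: "(wprod A w ^^ n) u = (wprod A w ^^ n) v \<longleftrightarrow> u = v"
  unfolding funpow_wprod using bij_wprod bij_is_inj inj_eq by metis

lemma funpow_rev: "(wprod A (rev w) ^^ n) ((wprod A w ^^ n) v) = v"
proof (induction n arbitrary: v)
  case (Suc n)
  have "(wprod A (rev w) ^^ Suc n) ((wprod A w ^^ Suc n) v)
      = (wprod A (rev w) ^^ n) (wprod A (rev w) (wprod A w ((wprod A w ^^ n) v)))"
    by (simp add: funpow_swap1)
  then show ?case using Suc by simp
qed simp

lemma finite_order_positive_definite:
  assumes pd: "\<And>v. supp_in (set \<rho>) v \<Longrightarrow> v \<noteq> 0 \<Longrightarrow> K v v > 0"
    and x: "x \<in> real_roots A" "supp_in (set \<rho>) x"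
  shows "\<exists>m>0. (wprod A \<rho> ^^ m) x = x"
proof -
  let ?c = "wprod A \<rho>"
  have "\<exists>k l. k < l \<and> (?c ^^ k) x = (?c ^^ l) x"
  proof (rule ccontr)
    assume "\<not> ?thesis"
    then have "inj (\<lambda>k. (?c ^^ k) x)" by (intro injI) (metis linorder_neqE_nat)
    moreover have "range (\<lambda>k. (?c ^^ k) x) \<subseteq> {v. integral_vec v \<and> supp_in (set \<rho>) v \<and> K v v \<le> K x x}"
      using x real_integral
      by (auto simp: funpow_wprod intro!: integral_wprod supp_in_wprod)
    ultimately show False
      using finite_integral_norm[OF pd, where N = "K x x"] infinite_UNIV_nat
      by (meson finite_subset finite_imageD)
  qed
  then obtain k l where kl: "k < l" "(?c ^^ k) x = (?c ^^ l) x" by blast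
  have "(?c ^^ l) x = (?c ^^ k) ((?c ^^ (l - k)) x)"
    using kl(1) by (metis add_diff_inverse_nat comp_apply funpow_add less_imp_not_less)
  then have "(?c ^^ (l - k)) x = x" using kl(2) funpow_inj by metis
  then show ?thesis using kl(1) by (intro exI[of _ "l - k"]) auto
qed

lemma orbit_sum_fixed:
  assumes "(wprod A \<rho> ^^ m) x = x"
  shows "wprod A \<rho> (\<Sum>k<m. (wprod A \<rho> ^^ k) x) = (\<Sum>k<m. (wprod A \<rho> ^^ k) x)"
proof -
  have "wprod A \<rho> (\<Sum>k<m. (wprod A \<rho> ^^ k) x) = (\<Sum>k<m. (wprod A \<rho> ^^ Suc k) x)"
    by (simp add: linear_sum[OF wprod_linear])
  also have "\<dots> = (\<Sum>k<Suc m. (wprod A \<rho> ^^ k) x) - x"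
    by (subst sum.lessThan_Suc_shift) simp
  also have "\<dots> = (\<Sum>k<m. (wprod A \<rho> ^^ k) x)" using assms by simp
  finally show ?thesis .
qed

text \<open>The orbit sum is fixed, hence null for K, hence zero in the definite case; a vanishing
  sum of nonnegative vectors would force x = 0. The reversed word appears because a full turn of
  source moves applies the inverse Coxeter element.\<close>

lemma positive_definite_orbit_negative:
  assumes dis: "distinct \<rho>" and pd: "\<And>v. supp_in (set \<rho>) v \<Longrightarrow> v \<noteq> 0 \<Longrightarrow> K v v > 0"
    and x: "x \<in> real_roots A" "supp_in (set \<rho>) x"
  shows "\<exists>k. \<not> nonneg ((wprod A (rev \<rho>) ^^ k) x)"
proof -
  let ?c = "wprod A (rev \<rho>)"
  obtain m where m: "m > 0" "(?c ^^ m) x = x"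
    using finite_order_positive_definite[of "rev \<rho>" x] pd x by auto
  define y where "y = (\<Sum>k<m. (?c ^^ k) x)"
  have "?c y = y" using orbit_sum_fixed[OF m(2)] by (simp add: y_def)
  have ys: "supp_in (set \<rho>) y"
    unfolding y_def using x(2)
    by (intro supp_in_sum) (auto simp: funpow_wprod intro!: supp_in_wprod split: if_splits)
  have "K y y = 0"
    using euler_wprod_diff[of "rev \<rho>" y y] dis ys \<open>?c y = y\<close> by simp
  then have "y = 0" using pd[OF ys] by force
  show ?thesis
  proof (rule ccontr)
    assume "\<not> ?thesis"
    then have nn: "nonneg ((?c ^^ k) x)" for k by blast
    have "x $ i = 0" for i
    proof -
      have "(\<Sum>k<m. (?c ^^ k) x $ i) = 0" using \<open>y = 0\<close> by (simp add: y_def vec_eq_iff)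
      then have "\<forall>k\<in>{..<m}. (?c ^^ k) x $ i = 0"
        using nn by (subst (asm) sum_nonneg_eq_0_iff) (auto simp: nonneg_def)
      then show ?thesis using m(1) by force
    qed
    then show False using real_nonzero[OF x(1)] by (simp add: vec_eq_iff)
  qed
qed

section \<open>Source and sink moves on pairs of a word and a vector\<close>

definition source_move :: "'i list \<times> (real ^ 'i) \<Rightarrow> 'i list \<times> (real ^ 'i)" where
  "source_move p = (tl (fst p) @ [hd (fst p)], S (hd (fst p)) (snd p))"

definition sink_move :: "'i list \<times> (real ^ 'i) \<Rightarrow> 'i list \<times> (real ^ 'i)" where
  "sink_move p = (last (fst p) # butlast (fst p), S (last (fst p)) (snd p))"

lemma source_move_Cons [simp]: "source_move (s # \<rho>, x) = (\<rho> @ [s], S s x)"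
  by (simp add: source_move_def)

lemma sink_move_snoc [simp]: "sink_move (\<rho> @ [s], x) = (s # \<rho>, S s x)"
  by (simp add: sink_move_def)

lemma source_move_word: "(source_move ^^ length a) (a @ b, x) = (b @ a, wprod A (rev a) x)"
proof (induction a arbitrary: b x)
  case (Cons s a)
  have "(source_move ^^ length (s # a)) ((s # a) @ b, x) = (source_move ^^ length a) (a @ (b @ [s]), S s x)"
    by (simp add: funpow_swap1)
  then show ?case using Cons[of "b @ [s]" "S s x"] by simp
qed simp

lemma sink_move_word: "(sink_move ^^ length a) (b @ a, x) = (a @ b, wprod A a x)"
proof (induction a arbitrary: b x rule: rev_induct)
  case (snoc s a)
  have "(sink_move ^^ length (a @ [s])) (b @ a @ [s], x) = (sink_move ^^ length a) ((s # b) @ a, S s x)"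
    using sink_move_snoc[of "b @ a" s x] by (simp add: funpow_swap1 del: sink_move_snoc)
  then show ?case using snoc[of "s # b" "S s x"] by simp
qed simp

text \<open>Translates iterates of the inverse Coxeter element into moves: after each full turn the
  word is back in its original order.\<close>

lemma source_move_words: "(source_move ^^ (k * length a)) (a, x) = (a, (wprod A (rev a) ^^ k) x)"
proof (induction k arbitrary: x)
  case (Suc k)
  have "Suc k * length a = k * length a + length a" by simp
  then have "(source_move ^^ (Suc k * length a)) (a, x) = (source_move ^^ (k * length a)) ((source_move ^^ length a) (a, x))"
    by (simp only: funpow_add comp_apply)
  also have "(source_move ^^ length a) (a, x) = (a, wprod A (rev a) x)" using source_move_word[of a "[]" x] by simp
  finally show ?case using Suc by (simp add: funpow_swap1)
qed simp

lemma sink_move_words: "(sink_move ^^ (k * length a)) (a, x) = (a, (wprod A a ^^ k) x)"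
proof (induction k arbitrary: x)
  case (Suc k)
  have "Suc k * length a = k * length a + length a" by simp
  then have "(sink_move ^^ (Suc k * length a)) (a, x) = (sink_move ^^ (k * length a)) ((sink_move ^^ length a) (a, x))"
    by (simp only: funpow_add comp_apply)
  also have "(sink_move ^^ length a) (a, x) = (a, wprod A a x)" using sink_move_word[of a "[]" x] by simp
  finally show ?case using Suc by (simp add: funpow_swap1)
qed simp

text \<open>A Perron-Frobenius argument: at an index outside the support of \<open>p\<close> the
  vanishing pairing is a sum of terms of one sign, so no edge leaves the support.\<close>

lemma radical_positive:
  assumes "indecomposable A" "nonneg p" "K p p = 0" "p $ a > 0"
  shows "p $ i > 0"
proof -
  define I where "I = {i. p $ i > 0}"
  have z: "p $ i = 0" if "i \<notin> I" for i
    using that assms(2) by (auto simp: I_def nonneg_def order_antisym)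
  have "A i j = 0" if "i \<in> I" "j \<notin> I" for i j
  proof -
    have "(\<Sum>k\<in>UNIV. - (of_int (A j k) * p $ k)) = 0"
      using rad_pairing[OF assms(3), of j] by (simp add: pairing_def sum_negf)
    moreover have "- (of_int (A j k) * p $ k) \<ge> 0" for k
      using z[OF that(2)] A_off[of j k] assms(2)
      by (cases "k = j") (auto simp: nonneg_def mult_nonpos_nonneg)
    ultimately have "- (of_int (A j i) * p $ i) = 0"
      by (subst (asm) sum_nonneg_eq_0_iff) auto
    then show ?thesis using that(1) A_zero_iff[of i j] by (auto simp: I_def)
  qed
  then have "I = {} \<or> I = UNIV" using assms(1) unfolding indecomposable_def by metis
  then show ?thesis using assms(4) by (auto simp: I_def)
qed

text \<open>Off-diagonal entries are nonpositive, so taking absolute values does not increase K, and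
  a null vector may be taken nonnegative, hence positive. Subtracting from another null vector the
  largest multiple of it that leaves a nonnegative vector kills one coordinate, and therefore
  all.\<close>

lemma radical_vector:
  assumes ind: "indecomposable A" and npd: "\<not> pos_form_definite A d"
  obtains p where "\<And>i. p $ i > 0" "\<And>v. K v v = 0 \<longleftrightarrow> (\<exists>t. v = t *\<^sub>R p)"
proof -
  obtain v where v: "v \<noteq> 0" "K v v = 0"
    using npd psd unfolding pos_form_definite_def by (metis order_less_le)
  define p :: "real ^ 'i" where "p = (\<chi> i. \<bar>v $ i\<bar>)"
  have "K p p \<le> K v v"
    unfolding Kf_def
  proof (intro sum_mono)
    fix i j
    show "p $ i * d i * of_int (A i j) * p $ j \<le> v $ i * d i * of_int (A i j) * v $ j"
    proof (cases "i = j")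
      case True then show ?thesis by (simp add: p_def abs_mult_self_eq mult.assoc mult.left_commute)
    next
      case False
      have "(d i * of_int (A i j)) * (\<bar>v $ i\<bar> * \<bar>v $ j\<bar>) \<le> (d i * of_int (A i j)) * (v $ i * v $ j)"
        using A_off[OF False] d_pos[of i]
        by (intro mult_left_mono_neg) (auto simp: abs_mult[symmetric] mult_nonneg_nonpos less_imp_le)
      then show ?thesis by (simp add: p_def mult.assoc mult.left_commute)
    qed
  qed
  then have p0: "K p p = 0" using v psd[of p] by simp
  obtain a where "v $ a \<noteq> 0" using v(1) by (auto simp: vec_eq_iff)
  then have "p $ a > 0" by (simp add: p_def)
  have pp: "p $ i > 0" for i
    using radical_positive[OF ind _ p0 \<open>p $ a > 0\<close>] by (simp add: p_def nonneg_def)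
  have "\<exists>t. u = t *\<^sub>R p" if u: "K u u = 0" for u
  proof -
    define t where "t = Min (range (\<lambda>i. u $ i / p $ i))"
    have "t \<in> range (\<lambda>i. u $ i / p $ i)" unfolding t_def by (rule Min_in) auto
    then obtain b where b: "t = u $ b / p $ b" by blast
    have tl: "t \<le> u $ i / p $ i" for i unfolding t_def by (rule Min_le) auto
    define w where "w = u - t *\<^sub>R p"
    have wn: "nonneg w" using tl pp by (simp add: w_def nonneg_def field_simps)
    have w0: "K w w = 0" using u p0 rad_K(1)[OF u, of p] by (simp add: w_def K_sym[of p u])
    have wb: "w $ b = 0" using pp[of b] by (simp add: w_def b)
    have "w = 0"
    proof (rule ccontr)
      assume "w \<noteq> 0"
      then obtain e where "w $ e > 0" using wn by (auto simp: vec_eq_iff nonneg_def order_less_le)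
      from radical_positive[OF ind wn w0 this, of b] wb show False by simp
    qed
    then show ?thesis by (auto simp: w_def)
  qed
  moreover have "K (t *\<^sub>R p) (t *\<^sub>R p) = 0" for t using p0 by simp
  ultimately show ?thesis using that[OF pp] by blast
qed

end

section \<open>Affine type: real roots modulo the imaginary root\<close>

locale affine_cartan = cartan A d
  for A :: "'i::finite \<Rightarrow> 'i \<Rightarrow> int" and d :: "'i \<Rightarrow> real" +
  fixes aff :: 'i
  assumes affine: "affine_type A d" and delta_aff: "delta A $ aff = 1"
begin

sublocale cartan_semidefinite A d
  by unfold_locales (use affine in \<open>simp add: affine_type_def\<close>)

abbreviation D where "D \<equiv> delta A"

lemma delta_facts:
  shows D_pos: "D $ i > 0" and D_integral: "integral_vec D"
    and rad_iff: "K v v = 0 \<longleftrightarrow> (\<exists>t. v = t *\<^sub>R D)"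
    and imagE: "v \<in> imag_roots A \<Longrightarrow> \<exists>k::int. k \<noteq> 0 \<and> v = of_int k *\<^sub>R D"
    and delta_vee: "\<exists>t>0. delta_vee_cocoords A = t *\<^sub>R cocoords d D"
proof -
  have ind: "indecomposable A" "\<not> pos_form_definite A d" using affine by (auto simp: affine_type_def)
  obtain p where p: "\<And>i. p $ i > 0" "\<And>v. K v v = 0 \<longleftrightarrow> (\<exists>t. v = t *\<^sub>R p)"
    using radical_vector[OF ind] by blast
  have kr: "(\<forall>i. (\<Sum>j\<in>UNIV. of_int (A i j) * v $ j) = 0) \<longleftrightarrow> K v v = 0" for v
    using rad_pairing[of v] pairing_rad[of v] by (auto simp: pairing_def)
  have ker: "(\<forall>i. (\<Sum>j\<in>UNIV. of_int (A i j) * v $ j) = 0) \<longleftrightarrow> (\<exists>t. v = t *\<^sub>R p)" for v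
    using kr[of v] p(2)[of v] by simp
  note dp = delta_properties[OF ker p(1)]
  obtain t where t: "t > 0" "D = t *\<^sub>R p" using dp(1) by blast
  show "D $ i > 0" using t p(1)[of i] by simp
  show "integral_vec D" using dp(2) by (simp add: integral_vec_def)
  have pD: "p = (1 / t) *\<^sub>R D" using t by simp
  show rad: "K v v = 0 \<longleftrightarrow> (\<exists>t. v = t *\<^sub>R D)" for v
    unfolding p(2) pD scaleR_scaleR using t(1)
    by (metis nonzero_eq_divide_eq mult.commute divide_self_if mult.right_neutral less_irrefl times_divide_eq_right)
  show "v \<in> imag_roots A \<Longrightarrow> \<exists>k::int. k \<noteq> 0 \<and> v = of_int k *\<^sub>R D" by (rule dp(3))
  \<comment> \<open>Rescaling by \<open>d\<close> carries the kernel of \<open>A\<close> to the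
    kernel of its transpose, because d_i a_ij = d_j a_ji.\<close>
  define q where "q = cocoords d p"
  have qp: "q $ i > 0" for i using p(1)[of i] d_pos[of i] by (simp add: q_def cocoords_def)
  have kerT: "(\<forall>i. (\<Sum>j\<in>UNIV. of_int (A j i) * v $ j) = 0) \<longleftrightarrow> (\<exists>t. v = t *\<^sub>R q)" for v
  proof -
    have dnz: "d i \<noteq> 0" for i using d_pos[of i] by simp
    define w :: "real ^ 'i" where "w = (\<chi> i. v $ i / d i)"
    have vw: "v $ j = d j * w $ j" for j using d_pos[of j] by (simp add: w_def)
    have "(\<Sum>j\<in>UNIV. of_int (A j i) * v $ j) = d i * (\<Sum>j\<in>UNIV. of_int (A i j) * w $ j)" for i
      unfolding sum_distrib_left
      by (intro sum.cong refl) (metis (no_types, lifting) vw d_sym mult.assoc mult.commute)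
    then have "(\<forall>i. (\<Sum>j\<in>UNIV. of_int (A j i) * v $ j) = 0) \<longleftrightarrow> (\<forall>i. (\<Sum>j\<in>UNIV. of_int (A i j) * w $ j) = 0)"
      by (simp add: dnz)
    also have "\<dots> \<longleftrightarrow> (\<exists>t. w = t *\<^sub>R p)" by (rule ker)
    also have "\<dots> \<longleftrightarrow> (\<exists>t. v = t *\<^sub>R q)"
    proof -
      have "w = t *\<^sub>R p \<longleftrightarrow> v = t *\<^sub>R q" for t
        by (simp add: vec_eq_iff q_def cocoords_def vw mult.left_commute[of t] dnz)
      then show ?thesis by simp
    qed
    finally show ?thesis .
  qed
  obtain u where u: "u > 0" "delta (\<lambda>i j. A j i) = u *\<^sub>R q"
    using delta_properties(1)[OF kerT qp] by blast
  have "q = (1 / t) *\<^sub>R cocoords d D"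
    using t by (simp add: q_def cocoords_def vec_eq_iff)
  then show "\<exists>t>0. delta_vee_cocoords A = t *\<^sub>R cocoords d D"
    using u t(1) by (intro exI[of _ "u / t"]) (simp add: delta_vee_cocoords_def)
qed

lemma D_nonneg: "nonneg D"
  using D_pos by (simp add: nonneg_def less_imp_le)

lemma K_D [simp]: "K D v = 0" "K v D = 0"
  using rad_iff[of D] rad_K[of D v] by (metis scaleR_one)+

lemma pairing_D [simp]: "pairing i D = 0"
  using rad_pairing[of D i] by simp

lemma S_D [simp]: "S i D = D"
  by (simp add: S_eq)

lemma wprod_D [simp]: "wprod A w D = D"
  by (induction w) auto

lemma D_not_real [simp]: "t *\<^sub>R D \<notin> real_roots A"
  using real_norm_pos[of "t *\<^sub>R D"] by auto

sublocale cartan_psd A d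
  by unfold_locales (use rad_iff in blast)

text \<open>Null vectors are multiples of D, and D has no zero coordinate.\<close>

lemma positive_definite_proper:
  assumes "J \<noteq> UNIV" "supp_in J v" "v \<noteq> 0"
  shows "K v v > 0"
proof (rule ccontr)
  assume "\<not> K v v > 0"
  then have "K v v = 0" using psd[of v] by linarith
  then obtain t where t: "v = t *\<^sub>R D" using rad_iff by blast
  obtain j where "j \<notin> J" using assms(1) by blast
  then have "t * D $ j = 0" using assms(2) t by (auto simp: supp_in_def)
  then show False using D_pos[of j] t assms(3) by simp
qed

text \<open>Subtracting \<open>x $ aff\<close> times D keeps integrality and norm and lands in the
  hyperplane of zero affine coordinate, where K is definite; norms of real roots are
  bounded.\<close>

lemma finite_roots_mod_D:
  "finite ((\<lambda>x. x - x $ aff *\<^sub>R D) ` real_roots A)"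
proof -
  obtain N where N: "\<forall>x \<in> real_roots A. K x x \<le> N" using real_norm_bound by blast
  have "(\<lambda>x. x - x $ aff *\<^sub>R D) ` real_roots A
      \<subseteq> {v. integral_vec v \<and> supp_in (- {aff}) v \<and> K v v \<le> N}"
  proof (clarify, intro conjI)
    fix x assume x: "x \<in> real_roots A"
    show "integral_vec (x - x $ aff *\<^sub>R D)"
      using real_integral[OF x] D_integral by (auto simp: integral_vec_def)
    show "supp_in (- {aff}) (x - x $ aff *\<^sub>R D)" by (simp add: supp_in_def delta_aff)
    show "K (x - x $ aff *\<^sub>R D) (x - x $ aff *\<^sub>R D) \<le> N" using N x by simp
  qed
  moreover have "finite {v. integral_vec v \<and> supp_in (- {aff}) v \<and> K v v \<le> N}"
    by (rule finite_integral_norm) (rule positive_definite_proper[of "- {aff}"], auto)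
  ultimately show ?thesis by (rule finite_subset)
qed

text \<open>Modulo D the orbit is finite, so two iterates agree up to a multiple of D; as
  \<open>c\<close> fixes D, the coincidence can be shifted back to \<open>x\<close>.\<close>

lemma cox_power_return:
  assumes x: "x \<in> real_roots A"
  shows "\<exists>m>0. \<exists>t. (wprod A \<pi> ^^ m) x = x + t *\<^sub>R D"
proof -
  let ?c = "wprod A \<pi>"
  let ?h = "\<lambda>k. (?c ^^ k) x - (?c ^^ k) x $ aff *\<^sub>R D"
  have "\<exists>k l. k < l \<and> ?h k = ?h l"
  proof (rule ccontr)
    assume "\<not> ?thesis"
    then have "inj ?h" by (intro injI) (metis linorder_neqE_nat)
    moreover have "range ?h \<subseteq> (\<lambda>x. x - x $ aff *\<^sub>R D) ` real_roots A"
      using x funpow_real by blast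
    ultimately show False
      using finite_roots_mod_D infinite_UNIV_nat by (meson finite_subset finite_imageD)
  qed
  then obtain k l where kl: "k < l" "?h k = ?h l" by blast
  define t where "t = (?c ^^ l) x $ aff - (?c ^^ k) x $ aff"
  have "(?c ^^ l) x = (?c ^^ k) x + t *\<^sub>R D"
    using kl(2) by (simp add: t_def algebra_simps)
  also have "t *\<^sub>R D = (?c ^^ k) (t *\<^sub>R D)" by (simp add: funpow_wprod)
  finally have "(?c ^^ l) x = (?c ^^ k) (x + t *\<^sub>R D)" by (simp add: funpow_simps)
  moreover have "(?c ^^ l) x = (?c ^^ k) ((?c ^^ (l - k)) x)"
    using kl(1) by (metis add_diff_inverse_nat comp_apply funpow_add less_imp_not_less)
  ultimately have "(?c ^^ (l - k)) x = x + t *\<^sub>R D" using funpow_inj by metis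
  then show ?thesis using kl(1) by (intro exI[of _ "l - k"]) auto
qed

lemma euler_D_D: "is_cox_word \<pi> \<Longrightarrow> euler \<pi> D D = 0"
  by (simp add: euler_self)

lemma euler_D_swap: "is_cox_word \<pi> \<Longrightarrow> euler \<pi> v D = - euler \<pi> D v"
  using euler_add[of \<pi> v D] by simp

lemma euler_D_cox: "is_cox_word \<pi> \<Longrightarrow> euler \<pi> D (wprod A \<pi> v) = euler \<pi> D v"
  using euler_cox_cox[of \<pi> D v] by simp

lemma euler_D_funpow: "is_cox_word \<pi> \<Longrightarrow> euler \<pi> D ((wprod A \<pi> ^^ k) v) = euler \<pi> D v"
  by (induction k) (simp_all add: euler_D_cox)

lemma fixed_multiple_D: "is_cox_word \<pi> \<Longrightarrow> wprod A \<pi> y = y \<Longrightarrow> \<exists>t. y = t *\<^sub>R D"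
  using cox_fixed[of \<pi> y] rad_iff by blast

text \<open>If t = 0, the orbit sum is fixed and so a multiple of D, on which E(D, _) vanishes,
  while E(D, _) is constant along the orbit. Conversely the sum T over one period satisfies c T = T
  + t D; when E(D, x) = 0 this gives K(T, T) = - t E(D, T) = 0, so T is fixed and t = 0.\<close>

lemma return_outside:
  assumes "is_cox_word \<pi>" "m > 0" "(wprod A \<pi> ^^ m) x = x + t *\<^sub>R D"
  shows "t = 0 \<longleftrightarrow> euler \<pi> D x = 0"
proof
  assume "t = 0"
  then have m: "(wprod A \<pi> ^^ m) x = x" using assms by simp
  obtain u where u: "(\<Sum>k<m. (wprod A \<pi> ^^ k) x) = u *\<^sub>R D"
    using fixed_multiple_D[OF assms(1) orbit_sum_fixed[OF m]] by blast
  have "euler \<pi> D (\<Sum>k<m. (wprod A \<pi> ^^ k) x) = m * euler \<pi> D x"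
    by (simp add: euler_sum_right euler_D_funpow assms(1))
  then show "euler \<pi> D x = 0" using u assms(1,2) by (simp add: euler_D_D)
next
  assume e: "euler \<pi> D x = 0"
  show "t = 0"
  proof (rule ccontr)
    assume "t \<noteq> 0"
    define T where "T = (\<Sum>j<m. (wprod A \<pi> ^^ j) x)"
    have "wprod A \<pi> T = T + t *\<^sub>R D"
    proof -
      have "wprod A \<pi> T = (\<Sum>k<m. (wprod A \<pi> ^^ Suc k) x)"
        by (simp add: T_def linear_sum[OF wprod_linear])
      also have "\<dots> = (\<Sum>k<Suc m. (wprod A \<pi> ^^ k) x) - x"
        by (subst sum.lessThan_Suc_shift) simp
      finally show ?thesis using assms(3) by (simp add: T_def)
    qed
    then have "euler \<pi> (t *\<^sub>R D) T = - K T T"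
      using euler_wprod_diff[of \<pi> T T] assms(1) by (simp add: is_cox_word_def)
    moreover have "euler \<pi> D T = 0"
      by (simp add: T_def euler_sum_right euler_D_funpow assms(1) e)
    ultimately have "K T T = 0" by simp
    then obtain r where "T = r *\<^sub>R D" using rad_iff by blast
    then have "wprod A \<pi> T = T" by simp
    then show False using \<open>wprod A \<pi> T = T + t *\<^sub>R D\<close> \<open>t \<noteq> 0\<close> D_pos[of aff] by (auto simp: vec_eq_iff)
  qed
qed

text \<open>The orbit drifts by a nonzero \<open>t D\<close> per period. Depending on the sign of
  \<open>t\<close>, the affine coordinate becomes negative under powers of \<open>c\<close> or of
  its inverse.\<close>

lemma orbit_negative:
  assumes "is_cox_word \<pi>" "x \<in> real_roots A" "euler \<pi> D x \<noteq> 0"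
  shows "\<exists>k. \<not> nonneg ((wprod A \<pi> ^^ k) x) \<or> \<not> nonneg ((wprod A (rev \<pi>) ^^ k) x)"
proof -
  obtain m t where mt: "m > 0" "(wprod A \<pi> ^^ m) x = x + t *\<^sub>R D"
    using cox_power_return[OF assms(2)] by blast
  then have t: "t \<noteq> 0" using return_outside[OF assms(1) mt] assms(3) by blast
  have p: "(wprod A \<pi> ^^ (k * m)) x = x + (k * t) *\<^sub>R D" for k
  proof (induction k)
    case (Suc k)
    have "(wprod A \<pi> ^^ (Suc k * m)) x = (wprod A \<pi> ^^ m) ((wprod A \<pi> ^^ (k * m)) x)"
      by (simp add: funpow_add)
    also have "\<dots> = (wprod A \<pi> ^^ m) x + (k * t) *\<^sub>R D"
      unfolding Suc by (simp add: funpow_wprod)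
    finally show ?case using mt(2) by (simp add: algebra_simps)
  qed simp
  have q: "(wprod A (rev \<pi>) ^^ (k * m)) x = x - (k * t) *\<^sub>R D" for k
  proof -
    have "x = (wprod A \<pi> ^^ (k * m)) (x - (k * t) *\<^sub>R D)"
    proof -
      have "(wprod A \<pi> ^^ (k * m)) (x - (k * t) *\<^sub>R D) = (wprod A \<pi> ^^ (k * m)) x - (k * t) *\<^sub>R D"
        by (simp add: funpow_wprod)
      then show ?thesis using p[of k] by simp
    qed
    then show ?thesis by (metis funpow_rev)
  qed
  obtain k :: nat where k: "real k * \<bar>t\<bar> > x $ aff" using t reals_Archimedean3[of "\<bar>t\<bar>"] by auto
  show ?thesis
  proof (cases "t > 0")
    case True
    then have "(wprod A (rev \<pi>) ^^ (k * m)) x $ aff < 0" using k by (simp add: q delta_aff)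
    then show ?thesis by (auto simp: nonneg_def not_le)
  next
    case False
    then have "(wprod A \<pi> ^^ (k * m)) x $ aff < 0" using k t by (simp add: p delta_aff)
    then show ?thesis by (auto simp: nonneg_def not_le)
  qed
qed

end

section \<open>Moves and the compatibility degree\<close>

context cartan_psd begin

definition maxdeg :: "(real ^ 'i \<Rightarrow> real ^ 'i) \<Rightarrow> real ^ 'i \<Rightarrow> real ^ 'i \<Rightarrow> real" where
  "maxdeg c \<alpha> \<beta> = max (compat_to A d c \<alpha> \<beta>) (compat_from A d c \<alpha> \<beta>)"

definition coroot :: "real ^ 'i \<Rightarrow> real ^ 'i" where
  "coroot = coroot_cocoords A d"

text \<open>The factor from the rescaled coordinates d_i x_i to coroot coordinates. For D it depends
  on the normalization of the dual imaginary root, of which only proportionality is recorded, hence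
  the choice.\<close>

definition coscale :: "real ^ 'i \<Rightarrow> real" where
  "coscale x = (if x \<in> real_roots A then 2 / K x x else (SOME t. t > 0 \<and> coroot x = t *\<^sub>R cocoords d x))"

text \<open>Treats positive real roots and D uniformly; the second alternative describes vectors
  fixed by every reflection.\<close>

definition good :: "real ^ 'i \<Rightarrow> bool" where
  "good x \<longleftrightarrow> nonneg x \<and> (x \<in> real_roots A \<or>
     (\<forall>i. pairing i x = 0) \<and> (\<exists>t>0. coroot x = t *\<^sub>R cocoords d x))"

lemma real_not_imag: "x \<in> real_roots A \<Longrightarrow> x \<notin> imag_roots A"
proof
  assume x: "x \<in> real_roots A" and "x \<in> imag_roots A"
  then have "pairing i x = 0" for i by (simp add: imag_roots_def pairing_def)
  then show False using pairing_rad[of x] real_norm_pos[OF x] by simp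
qed

lemma cocoords_scale: "cocoords d (t *\<^sub>R x) = t *\<^sub>R cocoords d x"
  by (simp add: cocoords_def vec_eq_iff)

lemma coroot_real: "x \<in> real_roots A \<Longrightarrow> coroot x = (2 / K x x) *\<^sub>R cocoords d x"
  by (simp add: coroot_def coroot_cocoords_def real_not_imag cocoords_scale)

lemma coroot_good: "good x \<Longrightarrow> coroot x = coscale x *\<^sub>R cocoords d x" "good x \<Longrightarrow> coscale x > 0"
proof -
  assume x: "good x"
  have "coroot x = coscale x *\<^sub>R cocoords d x \<and> coscale x > 0"
  proof (cases "x \<in> real_roots A")
    case True
    then show ?thesis using real_norm_pos[OF True] by (simp add: coscale_def coroot_real)
  next
    case False
    then have "\<exists>t. t > 0 \<and> coroot x = t *\<^sub>R cocoords d x" using x by (auto simp: good_def)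
    from someI_ex[OF this] show ?thesis using False by (simp add: coscale_def)
  qed
  then show "coroot x = coscale x *\<^sub>R cocoords d x" "coscale x > 0" by auto
qed

lemma good_nonneg: "good x \<Longrightarrow> nonneg x"
  by (simp add: good_def)

lemma good_real: "x \<in> real_roots A \<Longrightarrow> nonneg x \<Longrightarrow> good x"
  by (simp add: good_def)

lemma good_sroot [simp]: "good (sroot i)"
  by (simp add: good_real)

lemma coscale_sroot [simp]: "coscale (sroot i) = 1 / d i"
  using d_pos[of i] by (simp add: coscale_def)

lemma good_S:
  assumes "good x" "x \<noteq> sroot s"
  shows "good (S s x)" "coscale (S s x) = coscale x"
proof -
  have "good (S s x) \<and> coscale (S s x) = coscale x"
  proof (cases "x \<in> real_roots A")
    case True
    then show ?thesis using S_pos[OF True _ assms(2)] assms(1) by (simp add: good_def coscale_def)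
  next
    case False
    then have "S s x = x" using assms(1) by (simp add: good_def S_eq)
    then show ?thesis using assms(1) by simp
  qed
  then show "good (S s x)" "coscale (S s x) = coscale x" by auto
qed

lemma coroot_nth_good: "good x \<Longrightarrow> coroot x $ i = coscale x * d i * x $ i"
  by (simp add: coroot_good(1) cocoords_def)

lemma good_nth: "good x \<Longrightarrow> x $ i \<ge> 0"
  by (simp add: good_def nonneg_def)

lemma coroot_minus_sroot: "coroot (- sroot i) = - sroot i"
proof -
  have "coroot (- sroot i) = (1 / d i) *\<^sub>R cocoords d (- sroot i)"
    using coroot_real[of "- sroot i"] by simp
  then show ?thesis using d_pos[of i] by (simp add: cocoords_def vec_eq_iff)
qed

text \<open>The positive parts of a negative simple root vanish, so both halves of the maximum
  reduce to the same single sum.\<close>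

lemma maxdeg_minus_left: "maxdeg c (- sroot i) \<beta> = \<beta> $ i"
proof -
  have c: "coroot_cocoords A d (- sroot i) = - sroot i" using coroot_minus_sroot by (simp add: coroot_def)
  have p: "pplus ((- sroot i) $ k) = 0" for k :: 'i by (simp add: pplus_def)
  have "- (\<Sum>k\<in>UNIV. (- sroot i) $ k * \<beta> $ k) = \<beta> $ i"
    by (simp add: sum_negf if_distrib[of "\<lambda>x. x * _"] cong: if_cong)
  then show ?thesis by (simp add: maxdeg_def compat_to_def compat_from_def c p cong: if_cong del: vector_uminus_component)
qed

lemma maxdeg_minus_right: "maxdeg c \<alpha> (- sroot i) = coroot \<alpha> $ i"
proof -
  have p: "pplus ((- sroot i) $ k) = 0" for k :: 'i by (simp add: pplus_def)
  have "- (\<Sum>k\<in>UNIV. coroot \<alpha> $ k * (- sroot i) $ k) = coroot \<alpha> $ i"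
    by (simp add: sum_negf if_distrib[of "\<lambda>x. _ * x"] cong: if_cong)
  then show ?thesis
    by (simp add: maxdeg_def compat_to_def compat_from_def coroot_def p cong: if_cong del: vector_uminus_component)
qed

text \<open>Coordinates of good vectors are nonnegative, so the truncations disappear and the two
  halves are E with its arguments in either order. Any word \<pi> may replace the chosen
  \<open>cox_word\<close> because E depends only on the Coxeter element.\<close>

lemma maxdeg_good:
  assumes "good \<alpha>" "good \<beta>" "is_cox_word \<pi>"
  shows "maxdeg (wprod A \<pi>) \<alpha> \<beta> = max (- coscale \<alpha> * euler \<pi> \<alpha> \<beta>) (- coscale \<alpha> * euler \<pi> \<beta> \<alpha>)"
proof -
  define w where "w = cox_word A (wprod A \<pi>)"
  have E: "euler w = euler \<pi>" using euler_cox_word[OF assms(3)] by (simp add: w_def)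
  have dw: "distinct w"
    using cox_word(1)[OF coxeter_wprod[OF assms(3)]] by (simp add: w_def is_cox_word_def)
  have pp: "pplus (coroot \<alpha> $ i) = coscale \<alpha> * d i * \<alpha> $ i" "pplus (\<beta> $ i) = \<beta> $ i" for i
    using good_nth[OF assms(1), of i] good_nth[OF assms(2), of i] coroot_good(2)[OF assms(1)] d_pos[of i]
    by (simp_all add: pplus_def coroot_nth_good[OF assms(1)])
  have diag: "(\<Sum>i\<in>UNIV. \<Sum>j\<in>UNIV. if i = j then g i j else 0) = (\<Sum>i\<in>UNIV. g i i)"
    for g :: "'i \<Rightarrow> 'i \<Rightarrow> real" by simp
  have "compat_to A d (wprod A \<pi>) \<alpha> \<beta> = - coscale \<alpha> * euler w \<alpha> \<beta>"
  proof -
    have "coscale \<alpha> * euler w \<alpha> \<beta> = (\<Sum>i\<in>UNIV. \<Sum>j\<in>UNIV. (if i = j then coroot \<alpha> $ i * \<beta> $ j else 0)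
       + (if before w j i then of_int (A i j) * pplus (coroot \<alpha> $ i) * pplus (\<beta> $ j) else 0))"
      unfolding euler_def sum_distrib_left pp
      by (intro sum.cong refl) (auto simp: euler_coeff_def coroot_nth_good[OF assms(1)] algebra_simps)
    then show ?thesis
      unfolding compat_to_def w_def[symmetric] coroot_def[symmetric] sum.distrib diag by simp
  qed
  moreover have "compat_from A d (wprod A \<pi>) \<alpha> \<beta> = - coscale \<alpha> * euler w \<beta> \<alpha>"
  proof -
    have "coscale \<alpha> * euler w \<beta> \<alpha> = coscale \<alpha> * (\<Sum>i\<in>UNIV. \<Sum>j\<in>UNIV. \<beta> $ j * euler_coeff w j i * \<alpha> $ i)"
      unfolding euler_def by (subst sum.swap) rule
    also have "\<dots> = (\<Sum>i\<in>UNIV. \<Sum>j\<in>UNIV. (if i = j then coroot \<alpha> $ i * \<beta> $ j else 0)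
       + (if before w i j then of_int (A i j) * pplus (coroot \<alpha> $ i) * pplus (\<beta> $ j) else 0))"
      unfolding sum_distrib_left pp
    proof (intro sum.cong refl)
      fix i j
      have "coscale \<alpha> * (\<beta> $ j * (d j * of_int (A j i)) * \<alpha> $ i) = of_int (A i j) * (coscale \<alpha> * d i * \<alpha> $ i) * \<beta> $ j"
        unfolding d_sym[of j i] by (simp add: algebra_simps)
      then show "coscale \<alpha> * (\<beta> $ j * euler_coeff w j i * \<alpha> $ i) = (if i = j then coroot \<alpha> $ i * \<beta> $ j else 0)
        + (if before w i j then of_int (A i j) * (coscale \<alpha> * d i * \<alpha> $ i) * \<beta> $ j else 0)"
        by (auto simp: euler_coeff_def coroot_nth_good[OF assms(1)] algebra_simps)
    qed
    finally show ?thesis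
      unfolding compat_from_def w_def[symmetric] coroot_def[symmetric] sum.distrib diag by simp
  qed
  ultimately show ?thesis by (simp add: maxdeg_def E)
qed

lemma good_not_neg: "good x \<Longrightarrow> x \<notin> neg_simples"
  using good_nonneg[of x] by (auto simp: neg_simples_def)

lemma sigma_good: "good x \<Longrightarrow> sigma A s x = S s x"
  using good_not_neg by (simp add: sigma_def)

lemma minus_sroot_eq [simp]: "- sroot i = (- sroot j :: real ^ 'i) \<longleftrightarrow> i = j"
proof
  assume "- sroot i = (- sroot j :: real ^ 'i)"
  then have "sroot i $ i = (sroot j :: real ^ 'i) $ i" by (metis neg_equal_iff_equal)
  then show "i = j" by (simp split: if_splits)
qed simp

lemma sroot_eq [simp]: "sroot i = (sroot j :: real ^ 'i) \<longleftrightarrow> i = j"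
  using minus_sroot_eq[of i j] by (simp del: minus_sroot_eq)

lemma sigma_minus: "sigma A s (- sroot i) = (if i = s then sroot s else - sroot i)"
  by (auto simp: sigma_def neg_simples_def)

text \<open>An ambient set for \<open>Phi_c\<close> that does not depend on \<open>c\<close> and on
  which every \<open>sigma A s\<close> is an involution.\<close>

definition almost_positive :: "(real ^ 'i) set" where
  "almost_positive = neg_simples \<union> Collect good"

lemma almost_positiveE:
  assumes "x \<in> almost_positive"
  obtains (neg) i where "x = - sroot i" "i \<noteq> s" | (negs) "x = - sroot s"
    | (simple) "x = sroot s" | (pos) "good x" "x \<noteq> sroot s"
  using assms by (auto simp: almost_positive_def neg_simples_def)

lemma sigma_almost_positive: "x \<in> almost_positive \<Longrightarrow> sigma A s x \<in> almost_positive"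
  by (erule almost_positiveE[of x s])
    (auto simp: sigma_minus sigma_good almost_positive_def neg_simples_def good_S)

lemma sigma_sigma: "x \<in> almost_positive \<Longrightarrow> sigma A s (sigma A s x) = x"
  by (erule almost_positiveE[of x s])
    (auto simp: sigma_minus sigma_good good_S)

text \<open>For a first letter one half is, up to a positive factor, minus the coordinate of \<beta>
  at \<open>s\<close>, the other the coordinate of \<open>S s \<beta>\<close>. Both vectors are
  nonnegative, so the latter is the maximum; it is the degree against \<open>- sroot s\<close> after
  the move.\<close>

lemma maxdeg_sroot_first:
  assumes "is_cox_word (s # \<rho>)" "good \<beta>" "\<beta> \<noteq> sroot s"
  shows "maxdeg (wprod A (s # \<rho>)) (sroot s) \<beta> = S s \<beta> $ s"
    and "maxdeg (wprod A (s # \<rho>)) \<beta> (sroot s) = coroot (S s \<beta>) $ s"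
proof -
  have e1: "euler (s # \<rho>) (sroot s) \<beta> = d s * \<beta> $ s"
    using euler_Cons_sroot[of s \<rho> \<beta>] cox_ConsD(1)[OF assms(1)] by simp
  have e2: "euler (s # \<rho>) \<beta> (sroot s) = - d s * (S s \<beta> $ s)"
    using euler_add[OF assms(1), of "sroot s" \<beta>] e1 by (simp add: S_nth algebra_simps)
  have n: "S s \<beta> $ s \<ge> 0" "\<beta> $ s \<ge> 0"
    using good_nth good_S(1)[OF assms(2,3)] assms(2) by blast+
  show "maxdeg (wprod A (s # \<rho>)) (sroot s) \<beta> = S s \<beta> $ s"
    unfolding maxdeg_good[OF good_sroot assms(2,1)] e1 e2 using n d_pos[of s] by simp
  have "coscale \<beta> * (d s * (S s \<beta> $ s)) \<ge> 0" "coscale \<beta> * (d s * \<beta> $ s) \<ge> 0"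
    using n d_pos[of s] coroot_good(2)[OF assms(2)] by simp_all
  then show "maxdeg (wprod A (s # \<rho>)) \<beta> (sroot s) = coroot (S s \<beta>) $ s"
    unfolding maxdeg_good[OF assms(2) good_sroot assms(1)] e1 e2
      coroot_nth_good[OF good_S(1)[OF assms(2,3)]] good_S(2)[OF assms(2,3)]
    by (simp add: mult.assoc)
qed

lemma maxdeg_sroot_last:
  assumes "is_cox_word (s # \<rho>)" "good \<beta>" "\<beta> \<noteq> sroot s"
  shows "maxdeg (wprod A (\<rho> @ [s])) (sroot s) \<beta> = S s \<beta> $ s"
    and "maxdeg (wprod A (\<rho> @ [s])) \<beta> (sroot s) = coroot (S s \<beta>) $ s"
proof -
  have cx: "is_cox_word (\<rho> @ [s])" using assms(1) cox_rotate by blast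
  have e1: "euler (\<rho> @ [s]) \<beta> (sroot s) = d s * \<beta> $ s"
    using euler_snoc_sroot[of s \<rho> \<beta>] cox_ConsD(1)[OF assms(1)] by simp
  have e2: "euler (\<rho> @ [s]) (sroot s) \<beta> = - d s * (S s \<beta> $ s)"
    using euler_add[OF cx, of "sroot s" \<beta>] e1 by (simp add: S_nth algebra_simps)
  have n: "S s \<beta> $ s \<ge> 0" "\<beta> $ s \<ge> 0"
    using good_nth good_S(1)[OF assms(2,3)] assms(2) by blast+
  show "maxdeg (wprod A (\<rho> @ [s])) (sroot s) \<beta> = S s \<beta> $ s"
    unfolding maxdeg_good[OF good_sroot assms(2) cx] e1 e2 using n d_pos[of s] by simp
  have "coscale \<beta> * (d s * (S s \<beta> $ s)) \<ge> 0" "coscale \<beta> * (d s * \<beta> $ s) \<ge> 0"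
    using n d_pos[of s] coroot_good(2)[OF assms(2)] by simp_all
  then show "maxdeg (wprod A (\<rho> @ [s])) \<beta> (sroot s) = coroot (S s \<beta>) $ s"
    unfolding maxdeg_good[OF assms(2) good_sroot cx] e1 e2
      coroot_nth_good[OF good_S(1)[OF assms(2,3)]] good_S(2)[OF assms(2,3)]
    by (simp add: mult.assoc)
qed

lemma maxdeg_sroot_self: "is_cox_word \<pi> \<Longrightarrow> maxdeg (wprod A \<pi>) (sroot s) (sroot s) = - 1"
  unfolding maxdeg_good[OF good_sroot good_sroot] using d_pos[of s] by (simp add: maxdeg_good euler_self)

lemma coroot_sroot: "coroot (sroot s) $ i = (if i = s then 1 else 0)"
  using d_pos[of s] by (simp add: coroot_nth_good)

lemma coroot_S_nth: "good x \<Longrightarrow> x \<noteq> sroot s \<Longrightarrow> i \<noteq> s \<Longrightarrow> coroot (S s x) $ i = coroot x $ i"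
  by (simp add: coroot_nth_good good_S S_nth)

text \<open>For two good vectors other than \<open>sroot s\<close> this is the invariance of E. The
  simple root \<open>sroot s\<close> becomes negative under the move, and the explicit values for a
  first or last letter take over.\<close>

theorem maxdeg_move:
  assumes "is_cox_word (s # \<rho>)" "\<alpha> \<in> almost_positive" "\<beta> \<in> almost_positive"
  shows "maxdeg (wprod A (s # \<rho>)) \<alpha> \<beta> = maxdeg (wprod A (\<rho> @ [s])) (sigma A s \<alpha>) (sigma A s \<beta>)"
proof -
  have cx: "is_cox_word (\<rho> @ [s])" using assms(1) cox_rotate by blast
  note simps = maxdeg_minus_left maxdeg_minus_right sigma_minus sigma_good coroot_sroot coroot_minus_sroot S_nth
    maxdeg_sroot_first[OF assms(1)] maxdeg_sroot_last[OF assms(1)] maxdeg_sroot_self[OF assms(1)]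
    maxdeg_sroot_self[OF cx] coroot_S_nth good_S
  show ?thesis
  proof (rule almost_positiveE[OF assms(2), of s]; rule almost_positiveE[OF assms(3), of s])
    assume a: "good \<alpha>" "\<alpha> \<noteq> sroot s" and b: "good \<beta>" "\<beta> \<noteq> sroot s"
    show ?thesis
      unfolding sigma_good[OF a(1)] sigma_good[OF b(1)] maxdeg_good[OF a(1) b(1) assms(1)]
        maxdeg_good[OF good_S(1)[OF a] good_S(1)[OF b] cx] good_S(2)[OF a] euler_move_cox[OF assms(1)] ..
  next
    assume a: "good \<alpha>" "\<alpha> \<noteq> sroot s" and b: "\<beta> = - sroot s"
    have "S s \<alpha> \<noteq> sroot s"
      using a minus_sroot_not_nonneg good_nonneg by (metis S_S S_sroot)
    then show ?thesis using a b by (simp add: simps del: wprod_Cons wprod_append)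
  next
    assume a: "\<alpha> = - sroot s" and b: "good \<beta>" "\<beta> \<noteq> sroot s"
    have "S s \<beta> \<noteq> sroot s"
      using b minus_sroot_not_nonneg good_nonneg by (metis S_S S_sroot)
    then show ?thesis using a b by (simp add: simps del: wprod_Cons wprod_append)
  qed (auto simp: simps simp del: wprod_Cons wprod_append)
qed

text \<open>Induction over source moves: a relation that pulls back along each move and holds when
  its first argument is a negative simple root holds for every root made negative by the moves.
  \<open>P\<close> is the ambient set, which varies with the word.\<close>

lemma reach:
  assumes closed: "\<And>s \<rho> \<alpha>. is_cox_word (s # \<rho>) \<Longrightarrow> \<alpha> \<in> P (s # \<rho>) \<Longrightarrow> sigma A s \<alpha> \<in> P (\<rho> @ [s])"
    and inv: "\<And>s \<rho> \<alpha> \<beta>. is_cox_word (s # \<rho>) \<Longrightarrow> \<alpha> \<in> P (s # \<rho>) \<Longrightarrow> \<beta> \<in> P (s # \<rho>) \<Longrightarrow>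
      Q (\<rho> @ [s]) (sigma A s \<alpha>) (sigma A s \<beta>) \<Longrightarrow> Q (s # \<rho>) \<alpha> \<beta>"
    and base: "\<And>\<pi> i \<beta>. is_cox_word \<pi> \<Longrightarrow> \<beta> \<in> P \<pi> \<Longrightarrow> Q \<pi> (- sroot i) \<beta>"
    and "is_cox_word \<pi>" "x \<in> real_roots A" "nonneg x" "x \<in> P \<pi>" "\<beta> \<in> P \<pi>"
    and "\<not> nonneg (snd ((source_move ^^ n) (\<pi>, x)))"
  shows "Q \<pi> x \<beta>"
  using assms(4-)
proof (induction n arbitrary: \<pi> x \<beta>)
  case 0 then show ?case by simp
next
  case (Suc n)
  show ?case
  proof (cases \<pi>)
    case Nil then show ?thesis using Suc.prems(1) by (auto simp: is_cox_word_def)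
  next
    case (Cons s \<rho>)
    have cx: "is_cox_word (s # \<rho>)" "is_cox_word (\<rho> @ [s])" using Suc.prems(1) Cons cox_rotate by auto
    have P: "x \<in> P (s # \<rho>)" "\<beta> \<in> P (s # \<rho>)" using Suc.prems Cons by auto
    note P' = closed[OF cx(1) P(1)] closed[OF cx(1) P(2)]
    have sx: "sigma A s x = S s x" using Suc.prems by (simp add: sigma_good good_real)
    have "Q (\<rho> @ [s]) (sigma A s x) (sigma A s \<beta>)"
    \<comment> \<open>A positive root turns negative only at its own simple reflection, and there
      \<open>sigma\<close> yields \<open>- sroot s\<close>, the base case.\<close>
    proof (cases "x = sroot s")
      case True
      then show ?thesis using base[OF cx(2) P'(2)] sx by simp
    next
      case False
      show ?thesis unfolding sx
      proof (rule Suc.IH[OF cx(2)])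
        show "S s x \<in> real_roots A" using Suc.prems by simp
        show "nonneg (S s x)" using Suc.prems False by (simp add: S_pos)
        show "\<not> nonneg (snd ((source_move ^^ n) (\<rho> @ [s], S s x)))"
          using Suc.prems(6) Cons by (simp add: funpow_swap1)
      qed (use P' sx in auto)
    qed
    then show ?thesis using inv[OF cx(1) P] Cons by simp
  qed
qed

text \<open>The mirror image for sink moves; the drift of a root outside \<open>U_c\<close> decides
  which of the two applies.\<close>

lemma reach_back:
  assumes closed: "\<And>s \<rho> \<alpha>. is_cox_word (s # \<rho>) \<Longrightarrow> \<alpha> \<in> P (\<rho> @ [s]) \<Longrightarrow> sigma A s \<alpha> \<in> P (s # \<rho>)"
    and inv: "\<And>s \<rho> \<alpha> \<beta>. is_cox_word (s # \<rho>) \<Longrightarrow> \<alpha> \<in> P (\<rho> @ [s]) \<Longrightarrow> \<beta> \<in> P (\<rho> @ [s]) \<Longrightarrow>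
      Q (s # \<rho>) (sigma A s \<alpha>) (sigma A s \<beta>) \<Longrightarrow> Q (\<rho> @ [s]) \<alpha> \<beta>"
    and base: "\<And>\<pi> i \<beta>. is_cox_word \<pi> \<Longrightarrow> \<beta> \<in> P \<pi> \<Longrightarrow> Q \<pi> (- sroot i) \<beta>"
    and "is_cox_word \<pi>" "x \<in> real_roots A" "nonneg x" "x \<in> P \<pi>" "\<beta> \<in> P \<pi>"
    and "\<not> nonneg (snd ((sink_move ^^ n) (\<pi>, x)))"
  shows "Q \<pi> x \<beta>"
  using assms(4-)
proof (induction n arbitrary: \<pi> x \<beta>)
  case 0 then show ?case by simp
next
  case (Suc n)
  show ?case
  proof (cases \<pi> rule: rev_cases)
    case Nil then show ?thesis using Suc.prems(1) by (auto simp: is_cox_word_def)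
  next
    case (snoc \<rho> s)
    have cx: "is_cox_word (s # \<rho>)" "is_cox_word (\<rho> @ [s])" using Suc.prems(1) snoc cox_rotate by auto
    have P: "x \<in> P (\<rho> @ [s])" "\<beta> \<in> P (\<rho> @ [s])" using Suc.prems snoc by auto
    note P' = closed[OF cx(1) P(1)] closed[OF cx(1) P(2)]
    have sx: "sigma A s x = S s x" using Suc.prems by (simp add: sigma_good good_real)
    have "Q (s # \<rho>) (sigma A s x) (sigma A s \<beta>)"
    proof (cases "x = sroot s")
      case True
      then show ?thesis using base[OF cx(1) P'(2)] sx by simp
    next
      case False
      show ?thesis unfolding sx
      proof (rule Suc.IH[OF cx(1)])
        show "S s x \<in> real_roots A" using Suc.prems by simp
        show "nonneg (S s x)" using Suc.prems False by (simp add: S_pos)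
        show "\<not> nonneg (snd ((sink_move ^^ n) (s # \<rho>, S s x)))"
          using Suc.prems(6) snoc by (simp add: funpow_swap1)
      qed (use P' sx in auto)
    qed
    then show ?thesis using inv[OF cx(1) P] snoc by simp
  qed
qed

end

section \<open>The sets \<open>U_c\<close>, \<open>Upsilon_re\<close> and \<open>Phi_c\<close> under
  moves\<close>

context affine_cartan begin

text \<open>The vector \<gamma>_c exists because E(D, D) = 0 puts D in the image of c - 1, and it is
  unique because fixed vectors are multiples of D. The identity for c u - u turns K(\<gamma>_c, _)
  into - E(D, _), so \<gamma>_c itself is no longer mentioned afterwards.\<close>

lemma U_c_eq:
  assumes "is_cox_word \<pi>"
  shows "U_c A d aff (wprod A \<pi>) = {v. euler \<pi> D v = 0}"
proof -
  have "euler \<pi> D v = 0" if "K v v = 0" for v using that rad_iff euler_D_D[OF assms] by auto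
  then obtain u where u: "wprod A \<pi> u - u = D" using range_cox_diff[OF assms] by blast
  define g where "g = u - u $ aff *\<^sub>R D"
  have g: "g $ aff = 0" "wprod A \<pi> g = g + D"
    using u by (simp_all add: g_def delta_aff algebra_simps)
  have "gamma A aff (wprod A \<pi>) = g"
    unfolding gamma_def
  proof (rule the_equality)
    fix h assume h: "h $ aff = 0 \<and> wprod A \<pi> h = h + D"
    then have "wprod A \<pi> (h - g) = h - g" using g by simp
    then obtain t where t: "h - g = t *\<^sub>R D" using fixed_multiple_D[OF assms] by blast
    then have "(h - g) $ aff = t * D $ aff" by simp
    then have "t = 0" using h g by (simp add: delta_aff)
    then show "h = g" using t by simp
  qed (use g in simp)
  moreover have "euler \<pi> D v = - K g v" for v
    using euler_wprod_diff[of \<pi> v g] assms g by (simp add: is_cox_word_def)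
  ultimately show ?thesis by (auto simp: U_c_def)
qed

lemma return_inside:
  assumes "is_cox_word \<pi>" "x \<in> real_roots A" "euler \<pi> D x = 0"
  obtains m where "m > 0" "(wprod A \<pi> ^^ m) x = x"
proof -
  obtain m t where mt: "m > 0" "(wprod A \<pi> ^^ m) x = x + t *\<^sub>R D"
    using cox_power_return[OF assms(2)] by blast
  then show ?thesis using return_outside[OF assms(1) mt] assms(3) that by simp
qed

text \<open>On a periodic orbit negative powers are positive ones: with a period \<open>m\<close>,
  the inverse power \<open>j\<close> acts on \<open>x\<close> as the power
  \<open>j * m - j\<close>.\<close>

lemma c_orbit_eq:
  assumes "is_cox_word \<pi>" "x \<in> real_roots A" "euler \<pi> D x = 0"
  shows "c_orbit (wprod A \<pi>) x = range (\<lambda>k. (wprod A \<pi> ^^ k) x)"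
proof -
  let ?c = "wprod A \<pi>"
  obtain m where m: "m > 0" "(?c ^^ m) x = x" using return_inside[OF assms] by blast
  have mm: "(?c ^^ (j * m)) x = x" for j
    by (induction j) (simp_all add: funpow_add m(2))
  have "(inv ?c ^^ j) x = (?c ^^ (j * m - j)) x" for j
  proof -
    have "j \<le> j * m" using m(1) by simp
    then have "x = (?c ^^ j) ((?c ^^ (j * m - j)) x)"
      using mm[of j] by (metis comp_apply funpow_add le_add_diff_inverse)
    then show ?thesis unfolding inv_wprod by (metis funpow_rev)
  qed
  then show ?thesis unfolding c_orbit_def by auto
qed

definition tube :: "'i list \<Rightarrow> (real ^ 'i) set" where
  "tube \<pi> = {x \<in> real_roots A. nonneg x \<and> euler \<pi> D x = 0}"

lemma Upsilon_re_iff: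
  assumes "is_cox_word \<pi>"
  shows "\<beta> \<in> Upsilon_re A d aff (wprod A \<pi>) \<longleftrightarrow>
    \<beta> \<in> tube \<pi> \<and> (\<exists>k. (wprod A \<pi> ^^ k) \<beta> $ aff = 0)"
proof -
  have "(\<exists>\<gamma> \<in> c_orbit (wprod A \<pi>) \<beta>. \<gamma> \<in> Phi_fin A aff) \<longleftrightarrow> (\<exists>k. (wprod A \<pi> ^^ k) \<beta> $ aff = 0)"
    if "\<beta> \<in> tube \<pi>"
    using that funpow_real[of \<beta>] c_orbit_eq[OF assms, of \<beta>]
    by (auto simp: tube_def Phi_fin_def roots_def)
  then show ?thesis using affine by (auto simp: Upsilon_re_def U_c_eq[OF assms] tube_def)
qed

text \<open>Says that the simple root of a first letter is outside \<open>U_c\<close>. Hence the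
  reflection never meets, among tube roots, the one positive root it would make negative.\<close>

lemma euler_D_first: "is_cox_word (s # \<rho>) \<Longrightarrow> euler (s # \<rho>) D (sroot s) \<noteq> 0"
  using euler_D_swap[of "s # \<rho>" "sroot s"] euler_Cons_sroot[of s \<rho> D] cox_ConsD(1)[of s \<rho>]
    d_pos[of s] D_pos[of s] by (metis less_irrefl mult_eq_0_iff neg_0_equal_iff_equal)

lemma euler_D_last: "is_cox_word (s # \<rho>) \<Longrightarrow> euler (\<rho> @ [s]) D (sroot s) \<noteq> 0"
  using euler_snoc_sroot[of s \<rho> D] cox_ConsD(1)[of s \<rho>] d_pos[of s] D_pos[of s] by simp

lemma euler_D_move: "is_cox_word (s # \<rho>) \<Longrightarrow> euler (\<rho> @ [s]) D (S s v) = euler (s # \<rho>) D v"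
  using euler_move_cox[of s \<rho> D v] by simp

lemma tube_move: "is_cox_word (s # \<rho>) \<Longrightarrow> S s x \<in> tube (\<rho> @ [s]) \<longleftrightarrow> x \<in> tube (s # \<rho>)"
proof -
  assume c: "is_cox_word (s # \<rho>)"
  have "nonneg (S s x) \<longleftrightarrow> nonneg x" if x: "x \<in> real_roots A" "euler (s # \<rho>) D x = 0"
  proof
    have "x \<noteq> sroot s" using x(2) euler_D_first[OF c] by auto
    then show "nonneg x \<Longrightarrow> nonneg (S s x)" using S_pos x(1) by blast
    have "S s x \<noteq> sroot s" using x(2) euler_D_last[OF c] euler_D_move[OF c, of x] by auto
    then show "nonneg (S s x) \<Longrightarrow> nonneg x" using S_pos[of "S s x" s] x(1) by simp
  qed
  then show ?thesis by (auto simp: tube_def euler_D_move[OF c])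
qed

lemma funpow_move: "(wprod A (\<rho> @ [s]) ^^ k) (S s x) = S s ((wprod A (s # \<rho>) ^^ k) x)"
  by (induction k) simp_all

text \<open>Carrying the letters one by one from the front to the back composes to the inverse
  Coxeter element; the induction runs over splittings of the word.\<close>

lemma tube_cox: "is_cox_word \<pi> \<Longrightarrow> x \<in> tube \<pi> \<Longrightarrow> wprod A (rev \<pi>) x \<in> tube \<pi>"
proof -
  have "is_cox_word (a @ b) \<Longrightarrow> x \<in> tube (a @ b) \<Longrightarrow> wprod A (rev a) x \<in> tube (b @ a)" for a b x
  proof (induction a arbitrary: b x)
    case (Cons s a)
    then have "is_cox_word (s # (a @ b))" by simp
    moreover have "is_cox_word (a @ (b @ [s]))" using Cons.prems(1) cox_rotate[of s "a @ b"] by simp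
    ultimately show ?case using Cons.IH[of "b @ [s]" "S s x"] Cons.prems(2) tube_move[of s "a @ b" x] by simp
  qed simp
  from this[of \<pi> "[]" x] show "is_cox_word \<pi> \<Longrightarrow> x \<in> tube \<pi> \<Longrightarrow> wprod A (rev \<pi>) x \<in> tube \<pi>" by simp
qed

lemma tube_funpow: "is_cox_word \<pi> \<Longrightarrow> x \<in> tube \<pi> \<Longrightarrow> (wprod A \<pi> ^^ k) x \<in> tube \<pi>"
proof -
  assume c: "is_cox_word \<pi>" and x: "x \<in> tube \<pi>"
  have r: "(wprod A (rev \<pi>) ^^ j) x \<in> tube \<pi>" for j
    by (induction j) (simp_all add: x tube_cox[OF c])
  obtain m where m: "m > 0" "(wprod A \<pi> ^^ m) x = x"
    using return_inside[OF c] x by (auto simp: tube_def)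
  have mm: "(wprod A \<pi> ^^ (j * m)) x = x" for j
    by (induction j) (simp_all add: funpow_add m(2))
  have "k \<le> k * m" using m(1) by simp
  then have "x = (wprod A \<pi> ^^ (k * m - k)) ((wprod A \<pi> ^^ k) x)"
    using mm[of k] by (metis comp_apply funpow_add le_add_diff_inverse2)
  then have "(wprod A \<pi> ^^ k) x = (wprod A (rev \<pi>) ^^ (k * m - k)) x" by (metis funpow_rev)
  then show ?thesis using r by simp
qed

text \<open>The move alters the affine coordinate only for \<open>s = aff\<close>. Then no later
  letter of the word touches that coordinate, so \<open>S aff (c v)\<close> and \<open>v\<close>
  have equal affine coordinates, and the witness is shifted by one along the periodic orbit.\<close>

lemma Upsilon_re_move:
  assumes c: "is_cox_word (s # \<rho>)"
  shows "S s \<beta> \<in> Upsilon_re A d aff (wprod A (\<rho> @ [s])) \<longleftrightarrow> \<beta> \<in> Upsilon_re A d aff (wprod A (s # \<rho>))"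
proof -
  let ?c = "wprod A (s # \<rho>)"
  have c': "is_cox_word (\<rho> @ [s])" using c cox_rotate by blast
  have "(\<exists>k. S s ((?c ^^ k) \<beta>) $ aff = 0) \<longleftrightarrow> (\<exists>k. (?c ^^ k) \<beta> $ aff = 0)"
    if b: "\<beta> \<in> tube (s # \<rho>)"
  proof (cases "s = aff")
    case False
    then show ?thesis by (simp add: S_nth)
  next
    case True
    have e: "S s (?c v) $ aff = v $ aff" for v
      using True cox_ConsD(1)[OF c] by (simp add: wprod_nth_outside)
    obtain m where m: "m > 0" "(?c ^^ m) \<beta> = \<beta>"
      using return_inside[OF c] b by (auto simp: tube_def)
    show ?thesis
    proof
      assume "\<exists>k. S s ((?c ^^ k) \<beta>) $ aff = 0"
      then obtain k where k: "S s ((?c ^^ k) \<beta>) $ aff = 0" by blast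
      \<comment> \<open>Adding a period makes the predecessor available also for
        \<open>k = 0\<close>.\<close>
      have "(?c ^^ k) \<beta> = (?c ^^ (k + m)) \<beta>" by (simp add: funpow_add m(2))
      also have "\<dots> = ?c ((?c ^^ (k + m - 1)) \<beta>)"
        using m(1) by (metis Suc_diff_1 add_gr_0 comp_apply funpow.simps(2))
      finally have "(?c ^^ (k + m - 1)) \<beta> $ aff = 0" using k e by metis
      then show "\<exists>k. (?c ^^ k) \<beta> $ aff = 0" by blast
    next
      assume "\<exists>k. (?c ^^ k) \<beta> $ aff = 0"
      then obtain k where "(?c ^^ k) \<beta> $ aff = 0" by blast
      then have "S s ((?c ^^ Suc k) \<beta>) $ aff = 0" using e[of "(?c ^^ k) \<beta>"] by (simp del: wprod_Cons)
      then show "\<exists>k. S s ((?c ^^ k) \<beta>) $ aff = 0" by blast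
    qed
  qed
  then show ?thesis
    unfolding Upsilon_re_iff[OF c'] Upsilon_re_iff[OF c] funpow_move tube_move[OF c] by blast
qed

lemma good_D: "good D"
proof -
  have "D \<in> imag_roots A"
    using D_pos[of aff] D_integral pairing_D by (auto simp: imag_roots_def integral_vec_def pairing_def)
  moreover have "(THE k. D = k *\<^sub>R D) = 1"
    using D_pos[of aff] by (intro the_equality) (auto simp: vec_eq_iff dest!: spec[of _ aff])
  ultimately have "coroot D = delta_vee_cocoords A" by (simp add: coroot_def coroot_cocoords_def)
  then show ?thesis using delta_vee D_nonneg by (auto simp: good_def)
qed

lemma Phi_c_iff:
  assumes "is_cox_word \<pi>"
  shows "x \<in> Phi_c A d aff (wprod A \<pi>) \<longleftrightarrow> x \<in> neg_simples \<or> x = D \<or> x \<in> Upsilon_re A d aff (wprod A \<pi>)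
    \<or> (x \<in> real_roots A \<and> nonneg x \<and> euler \<pi> D x \<noteq> 0)"
proof -
  have "euler \<pi> D x = 0" if "x \<in> imag_roots A"
    using imagE[OF that] euler_D_D[OF assms] by auto
  then show ?thesis using affine by (auto simp: Phi_c_def pos_roots_def roots_def U_c_eq[OF assms])
qed

lemma Phi_c_almost_positive: "is_cox_word \<pi> \<Longrightarrow> x \<in> Phi_c A d aff (wprod A \<pi>) \<Longrightarrow> x \<in> almost_positive"
  using good_D by (auto simp: Phi_c_iff almost_positive_def Upsilon_re_iff tube_def good_real)

lemma Phi_c_move:
  assumes c: "is_cox_word (s # \<rho>)" and x: "x \<in> Phi_c A d aff (wprod A (s # \<rho>))"
  shows "sigma A s x \<in> Phi_c A d aff (wprod A (\<rho> @ [s]))"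
proof -
  have c': "is_cox_word (\<rho> @ [s])" using c cox_rotate by blast
  from x[unfolded Phi_c_iff[OF c]] show ?thesis
  proof (elim disjE conjE)
    assume "x \<in> neg_simples"
    then obtain i where "x = - sroot i" by (auto simp: neg_simples_def)
    then show ?thesis unfolding Phi_c_iff[OF c'] using euler_D_last[OF c]
      by (auto simp: sigma_minus neg_simples_def)
  next
    assume "x = D" then show ?thesis unfolding Phi_c_iff[OF c'] using sigma_good[OF good_D] by simp
  next
    assume u: "x \<in> Upsilon_re A d aff (wprod A (s # \<rho>))"
    then have "good x" by (simp add: Upsilon_re_iff[OF c] tube_def good_real)
    then show ?thesis unfolding Phi_c_iff[OF c'] using u Upsilon_re_move[OF c, of x]
      by (simp add: sigma_good del: wprod_Cons wprod_append)
  next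
    assume r: "x \<in> real_roots A" "nonneg x" "euler (s # \<rho>) D x \<noteq> 0"
    show ?thesis
    proof (cases "x = sroot s")
      case True then show ?thesis unfolding Phi_c_iff[OF c'] by (auto simp: sigma_good neg_simples_def)
    next
      case False
      then show ?thesis unfolding Phi_c_iff[OF c'] using r euler_D_move[OF c, of x]
        by (simp add: sigma_good good_real S_pos)
    qed
  qed
qed

lemma Phi_c_move_back:
  assumes c: "is_cox_word (s # \<rho>)" and x: "x \<in> Phi_c A d aff (wprod A (\<rho> @ [s]))"
  shows "sigma A s x \<in> Phi_c A d aff (wprod A (s # \<rho>))"
proof -
  have c': "is_cox_word (\<rho> @ [s])" using c cox_rotate by blast
  have m: "euler (s # \<rho>) D (S s y) = euler (\<rho> @ [s]) D y" for y using euler_D_move[OF c, of "S s y"] by simp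
  have m2: "S s y \<in> Upsilon_re A d aff (wprod A (s # \<rho>)) \<longleftrightarrow> y \<in> Upsilon_re A d aff (wprod A (\<rho> @ [s]))" for y
    using Upsilon_re_move[OF c, of "S s y"] by (simp del: wprod_Cons wprod_append)
  from x[unfolded Phi_c_iff[OF c']] show ?thesis
  proof (elim disjE conjE)
    assume "x \<in> neg_simples"
    then obtain i where "x = - sroot i" by (auto simp: neg_simples_def)
    then show ?thesis unfolding Phi_c_iff[OF c] using euler_D_first[OF c]
      by (auto simp: sigma_minus neg_simples_def)
  next
    assume "x = D" then show ?thesis unfolding Phi_c_iff[OF c] using sigma_good[OF good_D] by simp
  next
    assume u: "x \<in> Upsilon_re A d aff (wprod A (\<rho> @ [s]))"
    then have "good x" by (simp add: Upsilon_re_iff[OF c'] tube_def good_real)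
    then show ?thesis unfolding Phi_c_iff[OF c] using u m2[of x]
      by (simp add: sigma_good del: wprod_Cons wprod_append)
  next
    assume r: "x \<in> real_roots A" "nonneg x" "euler (\<rho> @ [s]) D x \<noteq> 0"
    show ?thesis
    proof (cases "x = sroot s")
      case True then show ?thesis unfolding Phi_c_iff[OF c] by (auto simp: sigma_good neg_simples_def)
    next
      case False
      then show ?thesis unfolding Phi_c_iff[OF c] using r m[of x]
        by (simp add: sigma_good good_real S_pos)
    qed
  qed
qed

end

section \<open>Perpendicular roots and special nodes\<close>

lemma nnspan_zero: "0 \<in> nnspan P"
  unfolding nnspan_def by (intro CollectI exI[of _ "{}"] exI[of _ "\<lambda>_. 0"]) auto

lemma nnspan_base: "x \<in> P \<Longrightarrow> x \<in> nnspan P"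
  unfolding nnspan_def by (intro CollectI exI[of _ "{x}"] exI[of _ "\<lambda>_. 1"]) auto

lemma nnspan_scale: "c \<ge> 0 \<Longrightarrow> v \<in> nnspan P \<Longrightarrow> c *\<^sub>R v \<in> nnspan P"
proof -
  assume c: "c \<ge> 0" and "v \<in> nnspan P"
  then obtain F f where F: "v = (\<Sum>x\<in>F. f x *\<^sub>R x)" "finite F" "F \<subseteq> P" "\<forall>x. f x \<ge> 0"
    by (auto simp: nnspan_def)
  then have "c *\<^sub>R v = (\<Sum>x\<in>F. (c * f x) *\<^sub>R x)" by (simp add: scaleR_sum_right)
  moreover have "\<forall>x. c * f x \<ge> 0" using F(4) c by simp
  ultimately show ?thesis unfolding nnspan_def using F(2,3)
    by (intro CollectI exI[of _ F] exI[of _ "\<lambda>x. c * f x"]) auto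
qed

lemma nnspan_add:
  assumes "u \<in> nnspan P" "v \<in> nnspan P"
  shows "u + v \<in> nnspan P"
proof -
  obtain F f where F: "u = (\<Sum>x\<in>F. f x *\<^sub>R x)" "finite F" "F \<subseteq> P" "\<forall>x. f x \<ge> 0"
    using assms(1) by (auto simp: nnspan_def)
  obtain G g where G: "v = (\<Sum>x\<in>G. g x *\<^sub>R x)" "finite G" "G \<subseteq> P" "\<forall>x. g x \<ge> 0"
    using assms(2) by (auto simp: nnspan_def)
  define h where "h x = (if x \<in> F then f x else 0) + (if x \<in> G then g x else 0)" for x
  have "(\<Sum>x\<in>F \<union> G. h x *\<^sub>R x) = (\<Sum>x\<in>F \<union> G. (if x \<in> F then f x else 0) *\<^sub>R x)
      + (\<Sum>x\<in>F \<union> G. (if x \<in> G then g x else 0) *\<^sub>R x)"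
    by (simp add: h_def scaleR_left_distrib sum.distrib)
  also have "(\<Sum>x\<in>F \<union> G. (if x \<in> F then f x else 0) *\<^sub>R x) = u"
    unfolding F(1) using F(2) G(2) by (intro sum.mono_neutral_cong_right) auto
  also have "(\<Sum>x\<in>F \<union> G. (if x \<in> G then g x else 0) *\<^sub>R x) = v"
    unfolding G(1) using F(2) G(2) by (intro sum.mono_neutral_cong_right) auto
  finally have "u + v = (\<Sum>x\<in>F \<union> G. h x *\<^sub>R x)" by simp
  moreover have "\<forall>x. h x \<ge> 0" using F(4) G(4) by (simp add: h_def)
  ultimately show ?thesis unfolding nnspan_def using F(2,3) G(2,3) by blast
qed

lemma nnspan_sum: "(\<And>x. x \<in> B \<Longrightarrow> g x \<in> nnspan P) \<Longrightarrow> sum g B \<in> nnspan P"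
  by (induction B rule: infinite_finite_induct) (auto intro: nnspan_zero nnspan_add)

lemma nnspan_linear_image:
  assumes "linear h" "v \<in> nnspan P"
  shows "h v \<in> nnspan (h ` P)"
proof -
  obtain F f where F: "v = (\<Sum>x\<in>F. f x *\<^sub>R x)" "finite F" "F \<subseteq> P" "\<forall>x. f x \<ge> 0"
    using assms(2) by (auto simp: nnspan_def)
  have "h v = (\<Sum>x\<in>F. f x *\<^sub>R h x)"
    unfolding F(1) using assms(1) by (simp add: linear_sum linear_scale)
  also have "\<dots> \<in> nnspan (h ` P)"
    using F by (intro nnspan_sum nnspan_scale nnspan_base) auto
  finally show ?thesis .
qed

context cartan_semidefinite begin

text \<open>A simple system for the roots in the right perpendicular of \<theta> under E,
  strengthened in two ways: the signs are required of E in both orders and not merely of K, and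
  \<Delta> spans the whole perpendicular linearly.\<close>

definition simple_system :: "'i list \<Rightarrow> real ^ 'i \<Rightarrow> (real ^ 'i) set \<Rightarrow> bool" where
  "simple_system \<rho> \<theta> \<Delta> \<longleftrightarrow>
     (\<forall>y\<in>\<Delta>. y \<in> real_roots A \<and> nonneg y \<and> supp_in (set \<rho>) y \<and> euler \<rho> \<theta> y = 0)
   \<and> (\<forall>y\<in>\<Delta>. \<forall>z\<in>\<Delta>. y \<noteq> z \<longrightarrow> euler \<rho> y z \<le> 0)
   \<and> (\<forall>z\<in>real_roots A. nonneg z \<longrightarrow> supp_in (set \<rho>) z \<longrightarrow> euler \<rho> \<theta> z = 0 \<longrightarrow> z \<in> nnspan \<Delta>)
   \<and> (\<forall>v. supp_in (set \<rho>) v \<longrightarrow> euler \<rho> \<theta> v = 0 \<longrightarrow> v \<in> span \<Delta>)"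

lemma supp_in_expand: "supp_in J v \<Longrightarrow> v = (\<Sum>j\<in>J. v $ j *\<^sub>R sroot j)"
proof -
  assume "supp_in J v"
  then have "(\<Sum>j\<in>J. v $ j *\<^sub>R sroot j) $ i = v $ i" for i
    by (auto simp: supp_in_def if_distrib cong: if_cong)
  then show ?thesis by (simp add: vec_eq_iff)
qed

text \<open>Pairing with the first simple root on the left reads off a coordinate, so the
  perpendicular of \<open>sroot t\<close> is spanned by the other simple roots.\<close>

lemma simple_system_sroot:
  assumes "t \<notin> set \<rho>" "distinct \<rho>"
  shows "simple_system (t # \<rho>) (sroot t) (sroot ` set \<rho>)"
proof -
  have E: "euler (t # \<rho>) (sroot t) v = d t * v $ t" for v by (rule euler_Cons_sroot[OF assms(1)])
  have z: "v = (\<Sum>j\<in>set \<rho>. v $ j *\<^sub>R sroot j)" if "supp_in (set (t # \<rho>)) v" "euler (t # \<rho>) (sroot t) v = 0" for v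
    using that d_pos[of t] by (intro supp_in_expand) (auto simp: E supp_in_def)
  have "v \<in> nnspan (sroot ` set \<rho>)" if "supp_in (set (t # \<rho>)) v" "euler (t # \<rho>) (sroot t) v = 0" "nonneg v" for v
    by (subst z[OF that(1,2)]) (intro nnspan_sum nnspan_scale nnspan_base; use that(3) in \<open>simp add: nonneg_def\<close>)
  moreover have "v \<in> span (sroot ` set \<rho>)" if "supp_in (set (t # \<rho>)) v" "euler (t # \<rho>) (sroot t) v = 0" for v
    by (subst z[OF that]) (intro span_sum span_scale span_base; simp)
  moreover have "euler (t # \<rho>) (sroot i) (sroot j) \<le> 0" if "sroot i \<noteq> (sroot j :: real ^ 'i)" for i j
    using that A_off[of i j] d_pos[of i] by (auto simp: euler_sroot euler_coeff_def mult_nonneg_nonpos)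
  ultimately show ?thesis
    unfolding simple_system_def using assms(1) by (auto simp: E) (auto simp: supp_in_def)
qed

text \<open>A simple root spans an extreme ray among nonnegative vectors and is the only positive
  real root on it.\<close>

lemma sroot_in_nnspan:
  assumes "sroot t \<in> nnspan \<Delta>" "\<And>y. y \<in> \<Delta> \<Longrightarrow> y \<in> real_roots A \<and> nonneg y"
  shows "sroot t \<in> \<Delta>"
proof -
  obtain F f where F: "sroot t = (\<Sum>x\<in>F. f x *\<^sub>R x)" "finite F" "F \<subseteq> \<Delta>" "\<forall>x. f x \<ge> 0"
    using assms(1) by (auto simp: nnspan_def)
  have "\<exists>y\<in>F. f y > 0"
  proof (rule ccontr)
    assume "\<not> ?thesis"
    then have "\<forall>y\<in>F. f y = 0" using F(4) by (meson order_antisym not_le_imp_less)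
    then have "sroot t = (0 :: real ^ 'i)" using F(1) by simp
    then show False using real_nonzero[of "sroot t"] by simp
  qed
  then obtain y where y: "y \<in> F" "f y > 0" by blast
  have yr: "y \<in> real_roots A" "nonneg y" using assms(2) y(1) F(3) by auto
  have "y = sroot t"
  proof (rule real_multiple_sroot[OF yr])
    fix j assume "j \<noteq> t"
    then have "(\<Sum>x\<in>F. f x * x $ j) = 0"
      using arg_cong[OF F(1), of "\<lambda>v. v $ j"] by simp
    moreover have "\<forall>x\<in>F. f x * x $ j \<ge> 0" using F(3,4) assms(2) by (auto simp: nonneg_def)
    ultimately have "f y * y $ j = 0"
      using y(1) F(2) by (subst (asm) sum_nonneg_eq_0_iff) auto
    then show "y $ j = 0" using y(2) by simp
  qed
  then show ?thesis using y(1) F(3) by blast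
qed

text \<open>If the real root \<open>\<theta>\<close> reaches a negative root under source moves, its right perpendicular
  for the Euler form is the standard parabolic obtained when \<open>\<theta>\<close> becomes the first simple root,
  and the sign condition survives undoing each move.\<close>

lemma simple_system_exists:
  assumes "distinct \<rho>" "\<theta> \<in> real_roots A" "nonneg \<theta>" "supp_in (set \<rho>) \<theta>"
    "\<not> nonneg (snd ((source_move ^^ n) (\<rho>, \<theta>)))"
  shows "\<exists>\<Delta>. simple_system \<rho> \<theta> \<Delta>"
  using assms
proof (induction n arbitrary: \<rho> \<theta>)
  case 0 then show ?case by simp
next
  case (Suc n)
  show ?case
  proof (cases \<rho>)
    case Nil
    then show ?thesis using Suc.prems real_nonzero[of \<theta>] by (auto simp: supp_in_def vec_eq_iff)
  next
    case (Cons t \<rho>')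
    have t: "t \<notin> set \<rho>'" "distinct \<rho>'" using Suc.prems(1) Cons by auto
    have J: "set (t # \<rho>') = insert t (set \<rho>')" "set (\<rho>' @ [t]) = insert t (set \<rho>')" by auto
    show ?thesis
    proof (cases "\<theta> = sroot t")
      case True
      then show ?thesis using simple_system_sroot[OF t] Cons by blast
    next
      case False
      let ?E = "euler (t # \<rho>')" and ?E' = "euler (\<rho>' @ [t])"
      define \<theta>' where "\<theta>' = S t \<theta>"
      have th: "supp_in (insert t (set \<rho>')) \<theta>" using Suc.prems(4) Cons by simp
      then have th': "supp_in (insert t (set \<rho>')) \<theta>'" unfolding \<theta>'_def by (intro supp_in_S) auto
      obtain \<Delta> where "simple_system (\<rho>' @ [t]) \<theta>' \<Delta>"
      proof -
        have "\<exists>\<Delta>. simple_system (\<rho>' @ [t]) \<theta>' \<Delta>"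
        proof (rule Suc.IH)
          show "distinct (\<rho>' @ [t])" using t by simp
          show "\<theta>' \<in> real_roots A" "nonneg \<theta>'"
            using Suc.prems False by (simp_all add: \<theta>'_def S_pos)
          show "supp_in (set (\<rho>' @ [t])) \<theta>'" using th' by simp
          show "\<not> nonneg (snd ((source_move ^^ n) (\<rho>' @ [t], \<theta>')))"
            using Suc.prems(5) Cons by (simp add: funpow_swap1 \<theta>'_def)
        qed
        then show ?thesis using that by blast
      qed
      then have D1: "\<And>y. y \<in> \<Delta> \<Longrightarrow> y \<in> real_roots A \<and> nonneg y \<and> supp_in (insert t (set \<rho>')) y \<and> ?E' \<theta>' y = 0"
        and D2: "\<And>y z. y \<in> \<Delta> \<Longrightarrow> z \<in> \<Delta> \<Longrightarrow> y \<noteq> z \<Longrightarrow> ?E' y z \<le> 0"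
        and D3: "\<And>z. z \<in> real_roots A \<Longrightarrow> nonneg z \<Longrightarrow> supp_in (insert t (set \<rho>')) z \<Longrightarrow> ?E' \<theta>' z = 0 \<Longrightarrow> z \<in> nnspan \<Delta>"
        and D4: "\<And>v. supp_in (insert t (set \<rho>')) v \<Longrightarrow> ?E' \<theta>' v = 0 \<Longrightarrow> v \<in> span \<Delta>"
        unfolding simple_system_def J by blast+
      have mvE: "?E u v = ?E' (S t u) (S t v)"
        if "supp_in (insert t (set \<rho>')) u" "supp_in (insert t (set \<rho>')) v" for u v
        using euler_move[OF t(1) that] by simp
      have sS: "supp_in (insert t (set \<rho>')) (S t v)" if "supp_in (insert t (set \<rho>')) v" for v
        using that by (intro supp_in_S) auto
      have st: "supp_in (insert t (set \<rho>')) (sroot t)" by (simp add: supp_in_def)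
      have mvth: "?E \<theta> v = ?E' \<theta>' (S t v)" if "supp_in (insert t (set \<rho>')) v" for v
        using mvE[OF th that] by (simp add: \<theta>'_def)
      show ?thesis
      \<comment> \<open>The critical root is \<open>sroot t\<close>, which the undone reflection
        makes negative. If it is not perpendicular to \<theta>', it is not in \<Delta>, and
        \<open>S t\<close> carries \<Delta> to positive roots.\<close>
      proof (cases "?E' \<theta>' (sroot t) = 0")
        case False
        have ne: "y \<noteq> sroot t" if "y \<in> \<Delta>" for y using D1[OF that] False by auto
        have "simple_system (t # \<rho>') \<theta> (S t ` \<Delta>)"
          unfolding simple_system_def J
        proof (intro conjI ballI impI allI)
          fix y assume "y \<in> S t ` \<Delta>"
          then obtain y' where y': "y' \<in> \<Delta>" "y = S t y'" by blast
          note y'D = D1[OF y'(1)]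
          show "y \<in> real_roots A" "nonneg y" "supp_in (insert t (set \<rho>')) y"
            using y'D ne[OF y'(1)] by (auto simp: y'(2) S_pos sS)
          show "?E \<theta> y = 0" using y'D mvth[of y] sS[of y'] by (simp add: y'(2))
          fix z assume "z \<in> S t ` \<Delta>" "y \<noteq> z"
          then obtain z' where z': "z' \<in> \<Delta>" "z = S t z'" by blast
          show "?E y z \<le> 0"
            using D2[OF y'(1) z'(1)] \<open>y \<noteq> z\<close> mvE[of y z] y'D D1[OF z'(1)] sS
            by (auto simp: y'(2) z'(2))
        next
          fix z assume z: "z \<in> real_roots A" "nonneg z" "supp_in (insert t (set \<rho>')) z" "?E \<theta> z = 0"
          have "z \<noteq> sroot t" using z(4) mvth[OF st] False by auto
          then have "S t z \<in> nnspan \<Delta>"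
            using z mvth[OF z(3)] by (intro D3) (auto simp: S_pos sS)
          from nnspan_linear_image[OF S_linear this, of t] show "z \<in> nnspan (S t ` \<Delta>)" by simp
        next
          fix v assume v: "supp_in (insert t (set \<rho>')) v" "?E \<theta> v = 0"
          then have "S t v \<in> span \<Delta>" using mvth[OF v(1)] by (intro D4) (auto simp: sS)
          then have "S t (S t v) \<in> S t ` span \<Delta>" by (rule imageI)
          then show "v \<in> span (S t ` \<Delta>)" using linear_span_image[OF S_linear, of t \<Delta>] by simp
        qed
        then show ?thesis using Cons by blast
      next
        case True
        \<comment> \<open>In this case reflecting at \<open>t\<close> does not alter the pairing
          with \<theta>', so \<Delta> serves unreflected and only its signs have to be rechecked for
          the rotated word.\<close>
        have tD: "sroot t \<in> \<Delta>"
          by (rule sroot_in_nnspan) (use D3[of "sroot t"] st True D1 in auto)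
        have E's: "?E' v (sroot t) = d t * v $ t" for v by (rule euler_snoc_sroot[OF t(1)])
        have Es: "?E (sroot t) v = d t * v $ t" for v by (rule euler_Cons_sroot[OF t(1)])
        \<comment> \<open>Pairing with the last simple root gives d_t y_t, which is nonpositive by
          the sign condition and nonnegative by positivity.\<close>
        have y0: "y $ t = 0" if "y \<in> \<Delta>" "y \<noteq> sroot t" for y
        proof -
          have "d t * y $ t \<le> 0" using D2[OF that(1) tD that(2)] E's[of y] by simp
          then have "y $ t \<le> 0" using d_pos[of t] by (simp add: mult_le_0_iff)
          then show ?thesis using D1[OF that(1)] by (auto simp: nonneg_def order_antisym)
        qed
        have thS: "?E \<theta> v = ?E' \<theta>' v" if "supp_in (insert t (set \<rho>')) v" for v
          using mvth[OF that] True by (simp add: S_eq)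
        have "simple_system (t # \<rho>') \<theta> \<Delta>"
          unfolding simple_system_def J
        proof (intro conjI ballI impI allI)
          fix y assume y: "y \<in> \<Delta>"
          show "y \<in> real_roots A" "nonneg y" "supp_in (insert t (set \<rho>')) y" "?E \<theta> y = 0"
            using D1[OF y] thS[of y] by auto
          fix z assume z: "z \<in> \<Delta>" "y \<noteq> z"
          show "?E y z \<le> 0"
          proof (cases "y = sroot t")
            case True
            then show ?thesis using y0[OF z(1)] z(2) by (simp add: Es)
          next
            case yt: False
            show ?thesis
            proof (cases "z = sroot t")
              case True
              have "?E y (sroot t) = K y (sroot t)"
                using euler_symmetrize[of "t # \<rho>'" y "sroot t"] t D1[OF y] st y0[OF y yt] by (simp add: Es)
              also have "\<dots> = d t * pairing t y" by (simp add: K_sroot_right)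
              also have "pairing t y \<le> 0"
                unfolding pairing_def
              proof (rule sum_nonpos)
                fix j show "of_int (A t j) * y $ j \<le> 0"
                  using A_off[of t j] y0[OF y yt] D1[OF y]
                  by (cases "j = t") (auto simp: nonneg_def mult_nonpos_nonneg)
              qed
              then have "d t * pairing t y \<le> 0" using d_pos[of t] by (simp add: mult_nonneg_nonpos)
              finally show ?thesis using True by simp
            next
              case False
              have "?E y z = ?E' y z"
                unfolding euler_Cons[OF t(1)] euler_snoc[OF t(1)] using y0[OF y yt] y0[OF z(1) False] by simp
              then show ?thesis using D2[OF y z] by simp
            qed
          qed
        next
          fix z assume "z \<in> real_roots A" "nonneg z" "supp_in (insert t (set \<rho>')) z" "?E \<theta> z = 0"
          then show "z \<in> nnspan \<Delta>" using thS[of z] by (intro D3) auto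
        next
          fix v assume "supp_in (insert t (set \<rho>')) v" "?E \<theta> v = 0"
          then show "v \<in> span \<Delta>" using thS[of v] by (intro D4) auto
        qed
        then show ?thesis using Cons by blast
      qed
    qed
  qed
qed

end

section \<open>Special vertices of the fundamental alcove\<close>

context affine_cartan begin

text \<open>Both Cartan integers are positive. If one is 1, a reflection produces the difference up
  to sign; if both are at least 2, the difference has norm at most 0 and lies in the
  radical.\<close>

lemma root_difference:
  assumes x: "x \<in> real_roots A" and y: "y \<in> real_roots A" and "K x y > 0"
  shows "x - y \<in> real_roots A \<or> (\<exists>t. x - y = t *\<^sub>R D)"
proof -
  have xx: "K x x > 0" "K y y > 0" using real_norm_pos x y by auto
  obtain a b :: int where ab: "cartan_int x y = a" "cartan_int y x = b"
    using cartan_int_integral[OF x real_integral[OF y]] cartan_int_integral[OF y real_integral[OF x]]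
    by (auto elim!: Ints_cases)
  have "cartan_int x y > 0" "cartan_int y x > 0" using assms(3) xx by (simp_all add: cartan_int_def K_sym[of y x])
  then have pos: "a > 0" "b > 0" using ab by auto
  consider "a = 1" | "b = 1" | "a \<ge> 2" "b \<ge> 2" using pos by linarith
  then show ?thesis
  proof cases
    case 1
    then have "reflect x y = y - x" using ab by (simp add: reflect_def)
    then show ?thesis using reflect_real[OF x y] minus_real[of "y - x"] by simp
  next
    case 2
    then have "reflect y x = x - y" using ab by (simp add: reflect_def)
    then show ?thesis using reflect_real[OF y x] by simp
  next
    case 3
    have "2 \<le> 2 * K x y / K x x" "2 \<le> 2 * K x y / K y y"
      using 3 ab by (simp_all add: cartan_int_def K_sym[of y x])
    then have "K x x \<le> K x y" "K y y \<le> K x y" using xx by (simp_all add: field_simps)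
    then have "K (x - y) (x - y) \<le> 0" by (simp add: K_sym[of y x])
    then have "K (x - y) (x - y) = 0" using psd[of "x - y"] by linarith
    then show ?thesis using rad_iff by blast
  qed
qed

text \<open>Modulo D there are finitely many classes of real roots, all nonzero, and finitely many
  hyperplanes do not cover the space.\<close>

lemma generic_functional:
  obtains g :: "real ^ 'i \<Rightarrow> real" where "linear g" "g D = 0" "\<And>\<beta>. \<beta> \<in> real_roots A \<Longrightarrow> g \<beta> \<noteq> 0"
proof -
  define R where "R = (\<lambda>x. x - x $ aff *\<^sub>R D) ` real_roots A"
  have "negligible (\<Union>v\<in>R. {a. v \<bullet> a = 0})"
  proof (intro negligible_Union, unfold R_def)
    show "finite ((\<lambda>v. {a. v \<bullet> a = 0}) ` (\<lambda>x. x - x $ aff *\<^sub>R D) ` real_roots A)"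
      using finite_roots_mod_D by (rule finite_imageI)
    fix T assume "T \<in> (\<lambda>v. {a. v \<bullet> a = 0}) ` (\<lambda>x. x - x $ aff *\<^sub>R D) ` real_roots A"
    then obtain x where x: "x \<in> real_roots A" "T = {a. (x - x $ aff *\<^sub>R D) \<bullet> a = 0}" by auto
    have "x - x $ aff *\<^sub>R D \<noteq> 0"
      using x(1) D_not_real[of "x $ aff"] by (metis eq_iff_diff_eq_0)
    then show "negligible T" unfolding x(2) by (intro negligible_hyperplane) simp
  qed
  then have "(\<Union>v\<in>R. {a. v \<bullet> a = 0}) \<noteq> UNIV" using non_negligible_UNIV by metis
  then obtain a where a: "\<And>v. v \<in> R \<Longrightarrow> v \<bullet> a \<noteq> 0" by blast
  define g where "g v = (v - v $ aff *\<^sub>R D) \<bullet> a" for v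
  have "linear g" by (rule linearI) (simp_all add: g_def algebra_simps inner_diff_left inner_add_left)
  moreover have "g D = 0" by (simp add: g_def delta_aff)
  moreover have "g \<beta> \<noteq> 0" if "\<beta> \<in> real_roots A" for \<beta> using a that by (auto simp: g_def R_def)
  ultimately show ?thesis using that by blast
qed

text \<open>A functional with f(D) = 1 is a point of the affine space that carries the hyperplane
  arrangement. The condition is the usual one for special points: every hyperplane has a parallel
  through the point. The factor \<open>t\<close> admits roots whose classes modulo D are
  proportional but not equal.\<close>

definition special :: "(real ^ 'i \<Rightarrow> real) \<Rightarrow> bool" where
  "special f \<longleftrightarrow> linear f \<and> f D = 1 \<and>
     (\<forall>\<beta>\<in>real_roots A. \<exists>\<beta>0\<in>real_roots A. \<exists>t u. f \<beta>0 = 0 \<and> \<beta> = t *\<^sub>R \<beta>0 + u *\<^sub>R D)"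

text \<open>Split a relation modulo D into its positive part \<open>u\<close> and negative part
  \<open>w\<close>. They agree modulo D, and K(u, w) \<le> 0 by obtuseness, so both are null; then
  \<open>g\<close>, positive on \<open>B\<close> and zero on D, kills all coefficients.\<close>

lemma independent_simple_classes:
  assumes g: "linear g" "g D = (0::real)" and fin: "finite B"
    and pos: "\<And>b. b \<in> B \<Longrightarrow> g b > 0" and obt: "\<And>b b'. b \<in> B \<Longrightarrow> b' \<in> B \<Longrightarrow> b \<noteq> b' \<Longrightarrow> K b b' \<le> 0"
  shows "independent (insert D B)"
proof -
  have key: "\<forall>b\<in>B. f b = 0" if e: "(\<Sum>b\<in>B. f b *\<^sub>R b) = r *\<^sub>R D" for f r
  proof -
    define u where "u = (\<Sum>b\<in>B. max (f b) 0 *\<^sub>R b)"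
    define w where "w = (\<Sum>b\<in>B. max (- f b) 0 *\<^sub>R b)"
    have "f b = max (f b) 0 - max (- f b) 0" for b by auto
    then have "u - w = (\<Sum>b\<in>B. f b *\<^sub>R b)"
      unfolding u_def w_def sum_subtractf[symmetric] by (metis scaleR_left_diff_distrib)
    then have uw: "u = w + r *\<^sub>R D" using e by (simp add: algebra_simps)
    have "K u w = (\<Sum>b\<in>B. \<Sum>b'\<in>B. max (f b) 0 * (max (- f b') 0 * K b b'))"
      unfolding u_def w_def K_sum_left by (simp add: K_sum_right sum_distrib_left mult.left_commute)
    also have "\<dots> \<le> 0"
    proof (intro sum_nonpos)
      fix b b' assume "b \<in> B" "b' \<in> B"
      then show "max (f b) 0 * (max (- f b') 0 * K b b') \<le> 0"
        using obt[of b b'] by (cases "b = b'") (auto simp: max_def mult_nonneg_nonpos mult_nonpos_nonpos)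
    qed
    finally have Kuw: "K u w \<le> 0" .
    have "K u u = K u w" "K w w = K u w" using uw by simp_all
    then have "K u u = 0" "K w w = 0" using Kuw psd[of u] psd[of w] by linarith+
    then have gz: "g u = 0" "g w = 0" using rad_iff linear_scale[OF g(1)] g(2) by (metis mult_zero_right real_scaleR_def)+
    have gs: "g (\<Sum>b\<in>B. h b *\<^sub>R b) = (\<Sum>b\<in>B. h b * g b)" for h
      using g(1) by (simp add: linear_sum linear_scale)
    have "\<forall>b\<in>B. max (f b) 0 * g b = 0" "\<forall>b\<in>B. max (- f b) 0 * g b = 0"
      using gz unfolding u_def w_def gs
      by (subst (asm) sum_nonneg_eq_0_iff; use fin pos in \<open>force intro: less_imp_le\<close>)+
    then show "\<forall>b\<in>B. f b = 0" using pos by (metis max.absorb_iff2 less_irrefl max.commute max_def mult_eq_0_iff neg_0_le_iff_le neg_equal_0_iff_equal linear)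
  qed
  have "independent B"
    unfolding independent_explicit using key[of _ 0] fin by auto
  moreover have "D \<notin> span B"
  proof
    assume "D \<in> span B"
    then obtain f where "D = (\<Sum>b\<in>B. f b *\<^sub>R b)" unfolding span_finite[OF fin] by auto
    then have "(\<Sum>b\<in>B. f b *\<^sub>R b) = 1 *\<^sub>R D" "(\<Sum>b\<in>B. f b *\<^sub>R b) = D" by simp_all
    then show False using key[of f 1] D_pos[of aff] by auto
  qed
  ultimately show ?thesis by (simp add: independent_insert)
qed

text \<open>Builds a base of the finite system of roots modulo D: positive roots for a generic
  \<open>g\<close>, the indecomposable ones among them in \<open>B\<close>, and one representative
  per class in \<open>B'\<close>. The functional that is 1 on D and 0 on \<open>B'\<close> is
  special because reflections in \<open>B'\<close> preserve its kernel and reach every class up to a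
  factor.\<close>

lemma special_exists: "\<exists>f. special f"
proof -
  obtain g :: "real ^ 'i \<Rightarrow> real" where g: "linear g" "g D = 0" "\<And>\<beta>. \<beta> \<in> real_roots A \<Longrightarrow> g \<beta> \<noteq> 0"
    using generic_functional by blast
  have gl: "g (u + v) = g u + g v" "g (u - v) = g u - g v" "g (c *\<^sub>R v) = c * g v" "g (- v) = - g v" for u v c
    using g(1) by (simp_all add: linear_add linear_diff linear_scale linear_neg)
  define P where "P = {\<beta> \<in> real_roots A. g \<beta> > 0}"
  define nf where "nf x = x - x $ aff *\<^sub>R D" for x :: "real ^ 'i"
  have gnf: "g (nf x) = g x" for x by (simp add: nf_def gl g(2))
  have "finite (g ` P)"
  proof -
    have "g ` P \<subseteq> g ` nf ` real_roots A" using gnf by (auto simp: P_def image_iff)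
    then show ?thesis using finite_roots_mod_D unfolding nf_def by (meson finite_imageI finite_subset)
  qed
  \<comment> \<open>Counting the values of \<open>g\<close> below \<open>g \<beta>\<close> turns the
    real-valued height into a natural number for induction.\<close>
  define rk where "rk \<beta> = card {v \<in> g ` P. v < g \<beta>}" for \<beta>
  have rk: "rk \<mu> < rk \<beta>" if "\<mu> \<in> P" "g \<mu> < g \<beta>" for \<mu> \<beta>
    unfolding rk_def using \<open>finite (g ` P)\<close> that by (intro psubset_card_mono) auto
  define B where "B = {\<beta> \<in> P. \<not> (\<exists>\<mu>\<in>P. \<exists>\<nu>\<in>P. \<exists>t. \<beta> = \<mu> + \<nu> + t *\<^sub>R D)}"
  have BP: "B \<subseteq> P" by (auto simp: B_def)
  have dec: "(\<exists>\<mu>\<in>P. \<exists>\<nu>\<in>P. \<exists>t. \<beta> = \<mu> + \<nu> + t *\<^sub>R D \<and> rk \<mu> < rk \<beta> \<and> rk \<nu> < rk \<beta>)"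
    if "\<beta> \<in> P" "\<beta> \<notin> B" for \<beta>
  proof -
    obtain \<mu> \<nu> t where m: "\<mu> \<in> P" "\<nu> \<in> P" "\<beta> = \<mu> + \<nu> + t *\<^sub>R D" using \<open>\<beta> \<in> P\<close> \<open>\<beta> \<notin> B\<close> by (auto simp: B_def)
    then have "g \<beta> = g \<mu> + g \<nu>" by (simp add: gl g(2))
    then have "g \<mu> < g \<beta>" "g \<nu> < g \<beta>" using m(1,2) by (auto simp: P_def)
    then show ?thesis using m rk by blast
  qed
  have obt: "\<exists>t. b - b' = t *\<^sub>R D" if "b \<in> B" "b' \<in> B" "K b b' > 0" for b b'
  proof (rule ccontr)
    assume n: "\<not> ?thesis"
    have r: "b \<in> real_roots A" "b' \<in> real_roots A" using that BP by (auto simp: P_def)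
    then have d: "b - b' \<in> real_roots A" using root_difference that(3) n by blast
    show False
    proof (cases "g (b - b') > 0")
      case True
      then have "b - b' \<in> P" using d by (simp add: P_def)
      moreover have "b = b' + (b - b') + 0 *\<^sub>R D" by simp
      ultimately show False using that BP unfolding B_def by blast
    next
      case False
      then have "b' - b \<in> P" using d g(3)[OF d] minus_real[OF d] by (auto simp: P_def gl)
      moreover have "b' = b + (b' - b) + 0 *\<^sub>R D" by simp
      ultimately show False using that BP unfolding B_def by blast
    qed
  qed
  define C where "C = nf ` B"
  define rep where "rep v = (SOME b. b \<in> B \<and> nf b = v)" for v
  have rep: "rep v \<in> B" "nf (rep v) = v" if "v \<in> C" for v
  proof -
    have "\<exists>b. b \<in> B \<and> nf b = v" using that by (auto simp: C_def)
    from someI_ex[OF this] show "rep v \<in> B" "nf (rep v) = v" by (auto simp: rep_def)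
  qed
  \<comment> \<open>Elements of \<open>B\<close> at an acute angle differ by a multiple of D, so
    keeping one per class makes the system obtuse.\<close>
  define B' where "B' = rep ` C"
  have "finite B'"
  proof -
    have "C \<subseteq> (\<lambda>x. x - x $ aff *\<^sub>R D) ` real_roots A" using BP by (auto simp: C_def nf_def P_def)
    then show ?thesis unfolding B'_def using finite_roots_mod_D by (meson finite_imageI finite_subset)
  qed
  have nfD: "nf (v + t *\<^sub>R D) = nf v" for v t by (simp add: nf_def delta_aff algebra_simps)
  have nfe: "\<exists>t. u = v + t *\<^sub>R D" if "nf u = nf v" for u v
    using that by (intro exI[of _ "u $ aff - v $ aff"]) (simp add: nf_def algebra_simps)
  have B'B: "B' \<subseteq> B" using rep by (auto simp: B'_def)
  have B'rep: "\<exists>b'\<in>B'. \<exists>t. b = b' + t *\<^sub>R D" if "b \<in> B" for b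
  proof -
    have "nf b \<in> C" using that by (auto simp: C_def)
    then have "rep (nf b) \<in> B'" "nf b = nf (rep (nf b))" using rep by (auto simp: B'_def)
    then show ?thesis using nfe by blast
  qed
  have B'inj: "b = b'" if "b \<in> B'" "b' \<in> B'" "b - b' = t *\<^sub>R D" for b b' t
  proof -
    have "b = b' + t *\<^sub>R D" using that(3) by (simp add: algebra_simps)
    then have "nf b = nf b'" using nfD by simp
    then show ?thesis using that(1,2) rep by (auto simp: B'_def)
  qed
  have indep: "independent (insert D B')"
  proof (rule independent_simple_classes[OF g(1,2) \<open>finite B'\<close>])
    show "g b > 0" if "b \<in> B'" for b using that B'B BP by (auto simp: P_def)
    show "K b b' \<le> 0" if "b \<in> B'" "b' \<in> B'" "b \<noteq> b'" for b b'
      using that obt[of b b'] B'inj B'B by (meson not_le_imp_less subsetD)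
  qed
  have DB: "D \<notin> B'" using B'B BP D_not_real[of 1] by (auto simp: P_def)
  obtain f where f: "linear f" "\<And>x. x \<in> insert D B' \<Longrightarrow> f x = (if x = D then 1 else (0::real))"
    using linear_independent_extend[OF indep, of "\<lambda>x. if x = D then 1 else 0"] by blast
  have fB: "f b = 0" if "b \<in> B'" for b using f(2)[of b] that DB by auto
  have fD: "f D = 1" using f(2)[of D] by simp
  have main: "\<exists>\<beta>0\<in>real_roots A. \<exists>t u. f \<beta>0 = 0 \<and> \<beta> = t *\<^sub>R \<beta>0 + u *\<^sub>R D" if "\<beta> \<in> P" for \<beta>
    using that
  proof (induction "rk \<beta>" arbitrary: \<beta> rule: less_induct)
    case less
    have br: "\<beta> \<in> real_roots A" using less.prems by (simp add: P_def)
    \<comment> \<open>Otherwise K(\<beta>, _) would be nonpositive on all of \<open>P\<close>, in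
      particular on \<beta>.\<close>
    have "\<exists>b\<in>B. K \<beta> b > 0"
    proof (rule ccontr)
      assume n: "\<not> ?thesis"
      have "K \<beta> \<mu> \<le> 0" if "\<mu> \<in> P" for \<mu>
        using that
      proof (induction "rk \<mu>" arbitrary: \<mu> rule: less_induct)
        case (less \<mu>)
        show ?case
        proof (cases "\<mu> \<in> B")
          case True then show ?thesis using n by (meson not_le_imp_less)
        next
          case False
          obtain \<nu> \<nu>' t where "\<nu> \<in> P" "\<nu>' \<in> P" "\<mu> = \<nu> + \<nu>' + t *\<^sub>R D" "rk \<nu> < rk \<mu>" "rk \<nu>' < rk \<mu>"
            using dec[OF less.prems False] by blast
          then show ?thesis using less.hyps[of \<nu>] less.hyps[of \<nu>'] by simp
        qed
      qed
      then show False using less.prems real_norm_pos[OF br] by (meson not_le)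
    qed
    then obtain b0 where b0: "b0 \<in> B" "K \<beta> b0 > 0" by blast
    obtain b e where b: "b \<in> B'" "b0 = b + e *\<^sub>R D" using B'rep[OF b0(1)] by blast
    have Kb: "K \<beta> b > 0" using b0(2) b(2) by simp
    have bB: "b \<in> real_roots A" "g b > 0" using b(1) B'B BP by (auto simp: P_def)
    show ?case
    proof (cases "\<exists>t u. \<beta> = t *\<^sub>R b + u *\<^sub>R D")
      case True
      then show ?thesis using bB fB[OF b(1)] by blast
    next
      case np: False
      \<comment> \<open>\<open>L\<close> is minus the sum of the coordinates along base elements
        other than \<open>b\<close>. Reflection in \<open>b\<close> preserves it, and it is negative
        on roots of \<open>P\<close> not proportional to \<open>b\<close> modulo D; so the reflected
        root stays in \<open>P\<close>.\<close>
      obtain L where L: "linear L" "\<And>x. x \<in> insert D B' \<Longrightarrow> L x = (if x = D \<or> x = b then 0 else - 1 :: real)"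
        using linear_independent_extend[OF indep, of "\<lambda>x. if x = D \<or> x = b then 0 else - 1"] by blast
      have Ll: "L (u + v) = L u + L v" "L (c *\<^sub>R v) = c * L v" "L (u - v) = L u - L v" "L (- v) = - L v" for u v c
        using L(1) by (simp_all add: linear_add linear_scale linear_diff linear_neg)
      have LD: "L D = 0" "L b = 0" using L(2)[of D] L(2)[of b] b(1) by auto
      have Lneg: "L \<mu> \<le> 0 \<and> (L \<mu> = 0 \<longrightarrow> (\<exists>t u. \<mu> = t *\<^sub>R b + u *\<^sub>R D))" if "\<mu> \<in> P" for \<mu>
        using that
      proof (induction "rk \<mu>" arbitrary: \<mu> rule: less_induct)
        case (less \<mu>)
        show ?case
        proof (cases "\<mu> \<in> B")
          case True
          then obtain b1 t where b1: "b1 \<in> B'" "\<mu> = b1 + t *\<^sub>R D" using B'rep by blast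
          then have "L \<mu> = L b1" by (simp add: Ll LD)
          moreover have "L b1 = (if b1 = b then 0 else - 1)" using L(2)[of b1] b1(1) DB by auto
          moreover have "\<mu> = 1 *\<^sub>R b1 + t *\<^sub>R D" using b1(2) by simp
          ultimately show ?thesis by (metis neg_le_0_iff_le order_refl zero_le_one zero_neq_neg_one)
        next
          case False
          obtain \<nu> \<nu>' t where n: "\<nu> \<in> P" "\<nu>' \<in> P" "\<mu> = \<nu> + \<nu>' + t *\<^sub>R D" "rk \<nu> < rk \<mu>" "rk \<nu>' < rk \<mu>"
            using dec[OF less.prems False] by blast
          note IH = less.hyps[OF n(4,1)] less.hyps[OF n(5,2)]
          have s: "L \<mu> = L \<nu> + L \<nu>'" using n(3) by (simp add: Ll LD)
          show ?thesis
          proof (intro conjI impI)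
            show "L \<mu> \<le> 0" using IH s by linarith
            assume "L \<mu> = 0"
            then have "L \<nu> = 0" "L \<nu>' = 0" using IH s by linarith+
            then obtain t1 u1 t2 u2 where "\<nu> = t1 *\<^sub>R b + u1 *\<^sub>R D" "\<nu>' = t2 *\<^sub>R b + u2 *\<^sub>R D" using IH by blast
            then have "\<mu> = (t1 + t2) *\<^sub>R b + (u1 + u2 + t) *\<^sub>R D" using n(3) by (simp add: algebra_simps)
            then show "\<exists>t u. \<mu> = t *\<^sub>R b + u *\<^sub>R D" by blast
          qed
        qed
      qed
      define \<beta>' where "\<beta>' = reflect b \<beta>"
      have a0: "cartan_int b \<beta> > 0" using Kb real_norm_pos[OF bB(1)] by (simp add: cartan_int_def K_sym[of b \<beta>])
      have b'r: "\<beta>' \<in> real_roots A" using reflect_real[OF bB(1) br] by (simp add: \<beta>'_def)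
      have "L \<beta>' = L \<beta>" by (simp add: \<beta>'_def reflect_def Ll LD)
      moreover have "L \<beta> \<le> 0" "L \<beta> \<noteq> 0" using Lneg[OF less.prems] np by blast+
      ultimately have "L \<beta>' < 0" by linarith
      have b'P: "\<beta>' \<in> P"
      proof (rule ccontr)
        assume "\<beta>' \<notin> P"
        then have "- \<beta>' \<in> P" using b'r g(3)[OF b'r] by (auto simp: P_def gl)
        from Lneg[OF this] show False using \<open>L \<beta>' < 0\<close> by (simp add: Ll)
      qed
      have "g \<beta>' < g \<beta>" using a0 bB(2) by (simp add: \<beta>'_def reflect_def gl)
      then have "rk \<beta>' < rk \<beta>" using rk b'P by blast
      from less.hyps[OF this b'P] obtain \<beta>0 t u where
        z: "\<beta>0 \<in> real_roots A" "f \<beta>0 = 0" "\<beta>' = t *\<^sub>R \<beta>0 + u *\<^sub>R D" by blast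
      have cpb: "cartan_int b b = 2" using cartan_int_self bB(1) by blast
      have lin: "reflect b (t *\<^sub>R \<beta>0 + u *\<^sub>R D) = t *\<^sub>R reflect b \<beta>0 + u *\<^sub>R D"
        by (simp add: reflect_def cartan_int_def algebra_simps)
      have "reflect b \<beta>' = \<beta>" by (simp add: \<beta>'_def reflect_def cpb)
      then have "\<beta> = t *\<^sub>R reflect b \<beta>0 + u *\<^sub>R D" using z(3) lin by simp
      moreover have "f (reflect b \<beta>0) = 0"
        using f(1) z(2) fB[OF b(1)] by (simp add: reflect_def linear_diff linear_scale)
      moreover have "reflect b \<beta>0 \<in> real_roots A" using reflect_real[OF bB(1) z(1)] .
      ultimately show ?thesis by blast
    qed
  qed
  have "\<exists>\<beta>0\<in>real_roots A. \<exists>t u. f \<beta>0 = 0 \<and> \<beta> = t *\<^sub>R \<beta>0 + u *\<^sub>R D" if "\<beta> \<in> real_roots A" for \<beta>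
  proof (cases "g \<beta> > 0")
    case True then show ?thesis using main that by (simp add: P_def)
  next
    case False
    then have "- \<beta> \<in> P" using that g(3)[OF that] by (auto simp: P_def gl)
    then obtain \<beta>0 t u where z: "\<beta>0 \<in> real_roots A" "f \<beta>0 = 0" "- \<beta> = t *\<^sub>R \<beta>0 + u *\<^sub>R D" using main by blast
    then have "\<beta> = (- t) *\<^sub>R \<beta>0 + (- u) *\<^sub>R D" by (metis add.inverse_inverse minus_add_distrib scaleR_minus_left)
    then show ?thesis using z by blast
  qed
  then have "special f" using f(1) fD by (simp add: special_def)
  then show ?thesis by blast
qed

text \<open>Within a class modulo D the value of \<open>f\<close> grows by 1 with each D, and
  positivity bounds the affine coordinate below, so each of the finitely many classes contributes
  finitely many roots.\<close>

lemma finite_negative_values: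
  assumes f: "linear f" "f D = (1::real)"
  shows "finite {\<beta> \<in> real_roots A. nonneg \<beta> \<and> f \<beta> < 0}"
proof -
  define R where "R = (\<lambda>x. x - x $ aff *\<^sub>R D) ` real_roots A"
  have fl: "f (u + v) = f u + f v" "f (c *\<^sub>R v) = c * f v" for u v c
    using f(1) by (simp_all add: linear_add linear_scale)
  have "{\<beta> \<in> real_roots A. nonneg \<beta> \<and> f \<beta> < 0}
      \<subseteq> (\<Union>v\<in>R. (\<lambda>k. v + of_nat k *\<^sub>R D) ` {..nat \<lceil>- f v\<rceil>})"
  proof
    fix \<beta> assume "\<beta> \<in> {\<beta> \<in> real_roots A. nonneg \<beta> \<and> f \<beta> < 0}"
    then have b: "\<beta> \<in> real_roots A" "nonneg \<beta>" "f \<beta> < 0" by auto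
    define v where "v = \<beta> - \<beta> $ aff *\<^sub>R D"
    have bv: "\<beta> = v + \<beta> $ aff *\<^sub>R D" by (simp add: v_def)
    have "\<beta> $ aff \<in> \<int>" "\<beta> $ aff \<ge> 0" using real_integral[OF b(1)] b(2) by (auto simp: integral_vec_def nonneg_def)
    then obtain k :: nat where k: "\<beta> $ aff = of_nat k" by (metis Ints_cases of_int_0_le_iff nonneg_int_cases of_int_of_nat_eq)
    have "f v + \<beta> $ aff < 0" using b(3) by (subst (asm) bv) (simp add: fl f(2))
    then have "k \<le> nat \<lceil>- f v\<rceil>" using k by linarith
    moreover have "v \<in> R" using b(1) by (auto simp: R_def v_def)
    ultimately show "\<beta> \<in> (\<Union>v\<in>R. (\<lambda>k. v + of_nat k *\<^sub>R D) ` {..nat \<lceil>- f v\<rceil>})"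
      using bv k by auto
  qed
  moreover have "finite R" using finite_roots_mod_D by (simp add: R_def)
  ultimately show ?thesis by (meson finite_UN finite_atMost finite_imageI finite_subset)
qed

lemma special_S:
  assumes "special f" shows "special (\<lambda>v. f (S i v))"
  unfolding special_def
proof (intro conjI ballI)
  show "linear (\<lambda>v. f (S i v))"
    using linear_compose[OF S_linear, of f i] assms by (simp add: special_def o_def)
  show "f (S i D) = 1" using assms by (simp add: special_def)
  fix \<beta> assume "\<beta> \<in> real_roots A"
  then have "S i \<beta> \<in> real_roots A" by simp
  then obtain \<beta>0 t u where z: "\<beta>0 \<in> real_roots A" "f \<beta>0 = 0" "S i \<beta> = t *\<^sub>R \<beta>0 + u *\<^sub>R D"
    using assms unfolding special_def by blast
  have "\<beta> = t *\<^sub>R S i \<beta>0 + u *\<^sub>R D" using arg_cong[OF z(3), of "S i"] by simp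
  then show "\<exists>\<beta>0\<in>real_roots A. \<exists>t u. f (S i \<beta>0) = 0 \<and> \<beta> = t *\<^sub>R \<beta>0 + u *\<^sub>R D"
    using z(1,2) by (intro bexI[of _ "S i \<beta>0"]) auto
qed

text \<open>Take a special \<open>f\<close> with the fewest positive real roots of negative value.
  If some simple root had negative value, composing with its reflection, which permutes the other
  positive real roots, would lower the count.\<close>

lemma special_dominant: "\<exists>f. special f \<and> (\<forall>i. f (sroot i) \<ge> 0)"
proof -
  define N where "N f = {\<beta> \<in> real_roots A. nonneg \<beta> \<and> f \<beta> < (0::real)}" for f
  obtain f0 where "special f0" using special_exists by blast
  then obtain f where f: "special f" "\<And>h. special h \<Longrightarrow> card (N f) \<le> card (N h)"
    using ex_has_least_nat[of special f0 "\<lambda>f. card (N f)"] by blast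
  have fl: "linear f" "f D = 1" using f(1) by (auto simp: special_def)
  have "f (sroot i) \<ge> 0" for i
  proof (rule ccontr)
    assume "\<not> ?thesis"
    then have neg: "f (sroot i) < 0" by simp
    let ?h = "\<lambda>v. f (S i v)"
    have fin: "finite (N f)" unfolding N_def by (rule finite_negative_values[OF fl])
    have "N ?h \<subseteq> S i ` (N f - {sroot i})"
    proof
      fix \<beta> assume "\<beta> \<in> N ?h"
      then have b: "\<beta> \<in> real_roots A" "nonneg \<beta>" "f (S i \<beta>) < 0" by (auto simp: N_def)
      have "\<beta> \<noteq> sroot i" using b(3) neg fl(1) by (auto simp: linear_neg)
      then have "nonneg (S i \<beta>)" using S_pos b by blast
      then have "S i \<beta> \<in> N f" using b by (simp add: N_def)
      moreover have "S i \<beta> \<noteq> sroot i" using b(2) by (metis S_S S_sroot minus_sroot_not_nonneg)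
      ultimately show "\<beta> \<in> S i ` (N f - {sroot i})" by (intro image_eqI[of _ _ "S i \<beta>"]) auto
    qed
    then have "card (N ?h) \<le> card (S i ` (N f - {sroot i}))" using fin by (intro card_mono) auto
    also have "\<dots> \<le> card (N f - {sroot i})" using fin by (intro card_image_le) auto
    also have "\<dots> < card (N f)" using fin neg by (intro card_Diff1_less) (simp_all add: N_def)
    finally show False using f(2)[OF special_S[OF f(1), of i]] by simp
  qed
  then show ?thesis using f(1) by blast
qed

text \<open>At a dominant special point choose \<open>s\<close> with f(sroot s) > 0. Modulo D this
  simple root is proportional to a positive root \<theta> with f(\<theta>) = 0, and dominance forces
  \<theta> to have coordinate 0 at \<open>s\<close>; comparing coordinates at \<open>s\<close> then
  fixes the multiple of D.\<close>

theorem special_node: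
  obtains s \<theta> k where "\<theta> \<in> real_roots A" "nonneg \<theta>" "\<theta> $ s = 0" "k > 0"
    "D - D $ s *\<^sub>R sroot s = k *\<^sub>R \<theta>"
proof -
  obtain f where f: "special f" and dom: "\<And>i. f (sroot i) \<ge> 0" using special_dominant by blast
  have fl: "linear f" "f D = 1" using f by (auto simp: special_def)
  have fe: "f v = (\<Sum>i\<in>UNIV. v $ i * f (sroot i))" for v
  proof -
    have "f v = f (\<Sum>i\<in>UNIV. v $ i *\<^sub>R sroot i)" using supp_in_expand[of UNIV v] by simp
    then show ?thesis using fl(1) by (simp add: linear_sum linear_scale)
  qed
  have "\<exists>s. f (sroot s) > 0"
  proof (rule ccontr)
    assume "\<not> ?thesis"
    then have "f (sroot i) = 0" for i using dom[of i] by (meson not_le_imp_less order_antisym)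
    then show False using fe[of D] fl(2) by simp
  qed
  then obtain s where s: "f (sroot s) > 0" by blast
  obtain \<theta>0 t0 u where th0: "\<theta>0 \<in> real_roots A" "f \<theta>0 = 0" "sroot s = t0 *\<^sub>R \<theta>0 + u *\<^sub>R D"
    using f sroot_real[of s] unfolding special_def by blast
  obtain \<theta> t where th: "\<theta> \<in> real_roots A" "nonneg \<theta>" "f \<theta> = 0" "sroot s = t *\<^sub>R \<theta> + u *\<^sub>R D"
  proof (cases "nonneg \<theta>0")
    case True then show ?thesis using that th0 by blast
  next
    case False
    then have "nonneg (- \<theta>0)" using root_sign[OF th0(1)] by blast
    then show ?thesis using that[of "- \<theta>0" "- t0"] th0 fl(1) by (simp add: linear_neg)
  qed
  have "(\<Sum>i\<in>UNIV. \<theta> $ i * f (sroot i)) = 0" using fe[of \<theta>] th(3) by simp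
  then have "\<theta> $ s * f (sroot s) = 0"
    using th(2) dom by (subst (asm) sum_nonneg_eq_0_iff) (auto simp: nonneg_def)
  then have ths: "\<theta> $ s = 0" using s by simp
  have "1 = u * D $ s" using arg_cong[OF th(4), of "\<lambda>v. v $ s"] ths by simp
  then have us: "D $ s * u = 1" by (simp add: mult.commute)
  define k where "k = - (D $ s * t)"
  have "D - D $ s *\<^sub>R sroot s = D - D $ s *\<^sub>R (t *\<^sub>R \<theta> + u *\<^sub>R D)" using th(4) by simp
  also have "\<dots> = k *\<^sub>R \<theta> + (1 - D $ s * u) *\<^sub>R D" by (simp add: k_def algebra_simps)
  finally have e: "D - D $ s *\<^sub>R sroot s = k *\<^sub>R \<theta>" using us by simp
  have "k > 0"
  proof (rule ccontr)
    assume "\<not> k > 0"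
    have "\<theta> $ i = 0" for i
    proof (cases "i = s")
      case False
      then have "D $ i = k * \<theta> $ i" using arg_cong[OF e, of "\<lambda>v. v $ i"] by simp
      moreover have "k * \<theta> $ i \<le> 0" using \<open>\<not> k > 0\<close> th(2) by (simp add: nonneg_def mult_nonpos_nonneg)
      ultimately show ?thesis using D_pos[of i] by simp
    qed (use ths in simp)
    then show False using real_nonzero[OF th(1)] by (simp add: vec_eq_iff)
  qed
  then show ?thesis using that th(1,2) ths e by blast
qed

end

section \<open>Indecomposable roots of a tube\<close>

context affine_cartan begin

definition tube_cone :: "'i list \<Rightarrow> (real ^ 'i) set" where
  "tube_cone \<pi> = tube \<pi> \<union> {of_nat k *\<^sub>R D | k. k \<ge> 1}"

text \<open>Indecomposability is visibly stable under moves, unlike the minimality that defines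
  \<open>Pi_c\<close>, with which it is identified later. Summands that are multiples of D count
  too.\<close>

definition Pi0 :: "'i list \<Rightarrow> (real ^ 'i) set" where
  "Pi0 \<pi> = {x \<in> tube \<pi>. \<not> (\<exists>y\<in>tube_cone \<pi>. \<exists>z\<in>tube_cone \<pi>. x = y + z)}"

lemma D_multiple_imag: "k \<ge> 1 \<Longrightarrow> of_nat k *\<^sub>R D \<in> imag_roots A"
proof -
  assume "k \<ge> 1"
  then have "(of_nat k *\<^sub>R D) $ aff \<noteq> 0" using D_pos[of aff] by simp
  then have "of_nat k *\<^sub>R D \<noteq> 0" by (metis zero_index)
  moreover have "(\<Sum>j\<in>UNIV. of_int (A i j) * (of_nat k *\<^sub>R D) $ j) = 0" for i
  proof -
    have "pairing i (of_nat k *\<^sub>R D) = 0" by simp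
    then show ?thesis by (simp only: pairing_def)
  qed
  ultimately show ?thesis using D_integral by (auto simp: imag_roots_def integral_vec_def)
qed

lemma tube_cone_eq:
  assumes "is_cox_word \<pi>"
  shows "Upsilon A d aff (wprod A \<pi>) \<inter> pos_roots A = tube_cone \<pi>"
proof (intro equalityI subsetI)
  fix x assume "x \<in> Upsilon A d aff (wprod A \<pi>) \<inter> pos_roots A"
  then have x: "x \<in> roots A" "euler \<pi> D x = 0" "nonneg x"
    by (auto simp: Upsilon_def pos_roots_def U_c_eq[OF assms])
  show "x \<in> tube_cone \<pi>"
  proof (cases "x \<in> real_roots A")
    case True then show ?thesis using x by (simp add: tube_cone_def tube_def)
  next
    case False
    then obtain k :: int where k: "k \<noteq> 0" "x = of_int k *\<^sub>R D" using x(1) imagE by (auto simp: roots_def)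
    have "of_int k * D $ aff \<ge> 0" using x(3) k(2) by (simp add: nonneg_def)
    then have "k > 0" using k(1) delta_aff by simp
    then have "x = of_nat (nat k) *\<^sub>R D" "nat k \<ge> 1" using k by auto
    then show ?thesis unfolding tube_cone_def by blast
  qed
next
  fix x assume "x \<in> tube_cone \<pi>"
  then show "x \<in> Upsilon A d aff (wprod A \<pi>) \<inter> pos_roots A"
    using D_multiple_imag D_nonneg
    by (auto simp: tube_cone_def tube_def Upsilon_def pos_roots_def roots_def U_c_eq[OF assms]
      euler_D_D[OF assms] nonneg_scale)
qed

lemma tube_cone_nonneg: "x \<in> tube_cone \<pi> \<Longrightarrow> nonneg x"
  by (auto simp: tube_cone_def tube_def D_nonneg nonneg_scale)

lemma tube_cone_integral: "x \<in> tube_cone \<pi> \<Longrightarrow> integral_vec x"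
  using D_integral real_integral by (auto simp: tube_cone_def tube_def integral_vec_def)

lemma tube_cone_nonzero: "x \<in> tube_cone \<pi> \<Longrightarrow> x \<noteq> 0"
proof
  assume "x \<in> tube_cone \<pi>" "x = 0"
  then show False
    using real_nonzero[of 0] D_pos[of aff] by (auto simp: tube_cone_def tube_def vec_eq_iff)
qed

definition height :: "real ^ 'i \<Rightarrow> nat" where
  "height x = nat \<lfloor>\<Sum>i\<in>UNIV. x $ i\<rfloor>"

lemma height_add:
  assumes "x \<in> tube_cone \<pi>" "y \<in> tube_cone \<pi>"
  shows "height x < height (x + y)" "height y < height (x + y)"
proof -
  have h: "\<exists>k::int. k > 0 \<and> (\<Sum>i\<in>UNIV. x $ i) = of_int k" if "x \<in> tube_cone \<pi>" for x
  proof -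
    have "(\<Sum>i\<in>UNIV. x $ i) \<in> \<int>" using tube_cone_integral[OF that] by (auto simp: integral_vec_def)
    then obtain k where k: "(\<Sum>i\<in>UNIV. x $ i) = of_int k" by (auto elim: Ints_cases)
    have nn: "\<forall>i\<in>UNIV. x $ i \<ge> 0" using tube_cone_nonneg[OF that] by (simp add: nonneg_def)
    have "(\<Sum>i\<in>UNIV. x $ i) \<noteq> 0"
      using tube_cone_nonzero[OF that] nn by (subst sum_nonneg_eq_0_iff) (auto simp: vec_eq_iff)
    moreover have "(\<Sum>i\<in>UNIV. x $ i) \<ge> 0" using nn by (intro sum_nonneg) auto
    ultimately show ?thesis using k by (intro exI[of _ k]) auto
  qed
  obtain k l :: int where "k > 0" "l > 0" "(\<Sum>i\<in>UNIV. x $ i) = of_int k" "(\<Sum>i\<in>UNIV. y $ i) = of_int l"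
    using h assms by metis
  then show "height x < height (x + y)" "height y < height (x + y)"
    by (simp_all add: height_def sum.distrib flip: of_int_add)
qed

lemma Pi0_tube: "x \<in> Pi0 \<pi> \<Longrightarrow> x \<in> tube \<pi>"
  by (simp add: Pi0_def)

lemma tube_real: "x \<in> tube \<pi> \<Longrightarrow> x \<in> real_roots A"
  by (simp add: tube_def)

lemma Pi0_real: "x \<in> Pi0 \<pi> \<Longrightarrow> x \<in> real_roots A"
  by (simp add: Pi0_def tube_def)

text \<open>Splitting as long as possible, which lowers the height, ends in indecomposable roots and
  multiples of D.\<close>

lemma tube_cone_functional:
  assumes L: "linear L" "L D \<le> (0::real)" "\<And>x. x \<in> Pi0 \<pi> \<Longrightarrow> L x \<le> 0" and "x \<in> tube_cone \<pi>"
  shows "L x \<le> 0"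
  using assms(4)
proof (induction "height x" arbitrary: x rule: less_induct)
  case less
  consider "x \<in> Pi0 \<pi>" | "\<exists>y\<in>tube_cone \<pi>. \<exists>z\<in>tube_cone \<pi>. x = y + z"
    | "\<exists>k::nat. x = of_nat k *\<^sub>R D"
    using less.prems by (auto simp: Pi0_def tube_cone_def)
  then show ?case
  proof cases
    case 1 then show ?thesis using L by blast
  next
    case 2
    then obtain y z where yz: "y \<in> tube_cone \<pi>" "z \<in> tube_cone \<pi>" "x = y + z" by blast
    then have "L y \<le> 0" "L z \<le> 0" using less.hyps height_add[OF yz(1,2)] by auto
    then show ?thesis using yz(3) L(1) by (simp add: linear_add)
  next
    case 3
    then show ?thesis using L(1,2) by (auto simp: linear_scale mult_nonneg_nonpos)
  qed
qed

lemma tube_cone_nnspan_D: "x \<in> tube_cone \<pi> \<Longrightarrow> x \<in> nnspan (insert D (Pi0 \<pi>))"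
proof (induction "height x" arbitrary: x rule: less_induct)
  case less
  consider "x \<in> Pi0 \<pi>" | "\<exists>y\<in>tube_cone \<pi>. \<exists>z\<in>tube_cone \<pi>. x = y + z"
    | "\<exists>k::nat. x = of_nat k *\<^sub>R D"
    using less.prems by (auto simp: Pi0_def tube_cone_def)
  then show ?case
  proof cases
    case 1 then show ?thesis by (auto intro: nnspan_base)
  next
    case 2
    then obtain y z where yz: "y \<in> tube_cone \<pi>" "z \<in> tube_cone \<pi>" "x = y + z" by blast
    then show ?thesis using less.hyps[of y] less.hyps[of z] height_add[OF yz(1,2)] by (auto intro: nnspan_add)
  next
    case 3
    then obtain k :: nat where k: "x = of_nat k *\<^sub>R D" by blast
    show ?thesis unfolding k by (intro nnspan_scale nnspan_base) auto
  qed
qed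

text \<open>If K(x, _) were nonpositive on all indecomposable roots, it would be nonpositive on
  \<open>x\<close> itself.\<close>

lemma tube_positive_partner:
  assumes "x \<in> tube \<pi>"
  obtains p where "p \<in> Pi0 \<pi>" "K x p > 0"
proof -
  have "\<exists>p\<in>Pi0 \<pi>. K x p > 0"
  proof (rule ccontr)
    assume n: "\<not> ?thesis"
    have "K x x \<le> 0"
    proof (rule tube_cone_functional[where L = "K x" and \<pi> = \<pi>])
      show "K x p \<le> 0" if "p \<in> Pi0 \<pi>" for p using n that by (meson not_less)
      show "x \<in> tube_cone \<pi>" using assms by (simp add: tube_cone_def)
    qed (simp_all add: K_linear_right)
    then show False using real_norm_pos[OF tube_real[OF assms]] by simp
  qed
  then show ?thesis using that by blast
qed

text \<open>With K(x, y) > 0 the difference is a real root or a multiple of D; taken with the right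
  sign it is in the cone and decomposes \<open>x\<close> or \<open>y\<close>.\<close>

lemma Pi0_obtuse:
  assumes "x \<in> Pi0 \<pi>" "y \<in> Pi0 \<pi>" "x \<noteq> y"
  shows "K x y \<le> 0"
proof (rule ccontr)
  assume "\<not> ?thesis"
  then have p: "K x y > 0" by simp
  have t: "x \<in> tube \<pi>" "y \<in> tube \<pi>" using assms Pi0_tube by auto
  have nodec: "\<And>u. u \<in> tube_cone \<pi> \<Longrightarrow> x \<noteq> y + u" "\<And>u. u \<in> tube_cone \<pi> \<Longrightarrow> y \<noteq> x + u"
    using assms(1,2) t by (auto simp: Pi0_def tube_cone_def)
  from root_difference[OF tube_real[OF t(1)] tube_real[OF t(2)] p] show False
  proof
    assume r: "x - y \<in> real_roots A"
    have e: "euler \<pi> D (x - y) = 0" "euler \<pi> D (y - x) = 0" using t by (auto simp: tube_def)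
    from root_sign[OF r] show False
    proof
      assume "nonneg (x - y)"
      then have "x - y \<in> tube_cone \<pi>" using r e by (simp add: tube_cone_def tube_def)
      then show False using nodec(1)[of "x - y"] by simp
    next
      assume "nonneg (- (x - y))"
      then have "y - x \<in> tube_cone \<pi>" using minus_real[OF r] e by (simp add: tube_cone_def tube_def)
      then show False using nodec(2)[of "y - x"] by simp
    qed
  next
    assume "\<exists>t. x - y = t *\<^sub>R D"
    then obtain r where r: "x - y = r *\<^sub>R D" by blast
    have "r = x $ aff - y $ aff" using arg_cong[OF r, of "\<lambda>v. v $ aff"] by (simp add: delta_aff)
    also have "\<dots> \<in> \<int>" using real_integral t tube_real by (auto simp: integral_vec_def)
    finally obtain k :: int where k: "r = of_int k" by (auto elim: Ints_cases)
    have "k \<noteq> 0" using r k assms(3) by auto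
    then consider "k > 0" | "k < 0" by linarith
    then show False
    proof cases
      case 1
      then have "x - y = of_nat (nat k) *\<^sub>R D" "nat k \<ge> 1" using r k by auto
      then have "x - y \<in> tube_cone \<pi>" unfolding tube_cone_def by blast
      then show False using nodec(1)[of "x - y"] by simp
    next
      case 2
      have "y - x = - (x - y)" by simp
      also have "\<dots> = of_nat (nat (- k)) *\<^sub>R D" unfolding r k using 2 by simp
      finally have "y - x = of_nat (nat (- k)) *\<^sub>R D" "nat (- k) \<ge> 1" using 2 by auto
      then have "y - x \<in> tube_cone \<pi>" unfolding tube_cone_def by blast
      then show False using nodec(2)[of "y - x"] by simp
    qed
  qed
qed

lemma tube_cone_move: "is_cox_word (s # \<rho>) \<Longrightarrow> S s x \<in> tube_cone (\<rho> @ [s]) \<longleftrightarrow> x \<in> tube_cone (s # \<rho>)"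
proof -
  assume c: "is_cox_word (s # \<rho>)"
  have "S s x = of_nat k *\<^sub>R D \<longleftrightarrow> x = of_nat k *\<^sub>R D" for k
    by (metis S_D S_S S_simps(3))
  then show ?thesis using tube_move[OF c, of x] by (auto simp: tube_cone_def)
qed

lemma Pi0_move: "is_cox_word (s # \<rho>) \<Longrightarrow> S s x \<in> Pi0 (\<rho> @ [s]) \<longleftrightarrow> x \<in> Pi0 (s # \<rho>)"
proof -
  assume c: "is_cox_word (s # \<rho>)"
  have "(\<exists>y\<in>tube_cone (\<rho> @ [s]). \<exists>z\<in>tube_cone (\<rho> @ [s]). S s x = y + z) \<longleftrightarrow>
     (\<exists>y\<in>tube_cone (s # \<rho>). \<exists>z\<in>tube_cone (s # \<rho>). x = y + z)" (is "?L \<longleftrightarrow> ?R")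
  proof
    assume ?L
    then obtain y z where yz: "y \<in> tube_cone (\<rho> @ [s])" "z \<in> tube_cone (\<rho> @ [s])" "S s x = y + z" by blast
    then have "S s y \<in> tube_cone (s # \<rho>)" "S s z \<in> tube_cone (s # \<rho>)"
      using tube_cone_move[OF c, of "S s y"] tube_cone_move[OF c, of "S s z"] by simp_all
    moreover have "x = S s y + S s z" using arg_cong[OF yz(3), of "S s"] by simp
    ultimately show ?R by blast
  next
    assume ?R
    then obtain y z where yz: "y \<in> tube_cone (s # \<rho>)" "z \<in> tube_cone (s # \<rho>)" "x = y + z" by blast
    then have "S s y \<in> tube_cone (\<rho> @ [s])" "S s z \<in> tube_cone (\<rho> @ [s])"
      using tube_cone_move[OF c] by simp_all
    moreover have "S s x = S s y + S s z" using yz(3) by simp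
    ultimately show ?L by blast
  qed
  then show ?thesis using tube_move[OF c, of x] by (auto simp: Pi0_def)
qed

lemma Pi0_rev: "is_cox_word \<pi> \<Longrightarrow> x \<in> Pi0 \<pi> \<Longrightarrow> wprod A (rev \<pi>) x \<in> Pi0 \<pi>"
proof -
  have "is_cox_word (a @ b) \<Longrightarrow> x \<in> Pi0 (a @ b) \<Longrightarrow> wprod A (rev a) x \<in> Pi0 (b @ a)" for a b x
  proof (induction a arbitrary: b x)
    case (Cons s a)
    then have "is_cox_word (s # (a @ b))" by simp
    moreover have "is_cox_word (a @ (b @ [s]))" using Cons.prems(1) cox_rotate[of s "a @ b"] by simp
    ultimately show ?case using Cons.IH[of "b @ [s]" "S s x"] Cons.prems(2) Pi0_move[of s "a @ b" x] by simp
  qed simp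
  from this[of \<pi> "[]" x] show "is_cox_word \<pi> \<Longrightarrow> x \<in> Pi0 \<pi> \<Longrightarrow> wprod A (rev \<pi>) x \<in> Pi0 \<pi>" by simp
qed

lemma Pi0_funpow: "is_cox_word \<pi> \<Longrightarrow> x \<in> Pi0 \<pi> \<Longrightarrow> (wprod A \<pi> ^^ k) x \<in> Pi0 \<pi>"
proof -
  assume c: "is_cox_word \<pi>" and x: "x \<in> Pi0 \<pi>"
  have r: "(wprod A (rev \<pi>) ^^ j) x \<in> Pi0 \<pi>" for j
    by (induction j) (simp_all add: x Pi0_rev[OF c])
  obtain m where m: "m > 0" "(wprod A \<pi> ^^ m) x = x"
    using return_inside[OF c] Pi0_tube[OF x] by (auto simp: tube_def)
  have mm: "(wprod A \<pi> ^^ (j * m)) x = x" for j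
    by (induction j) (simp_all add: funpow_add m(2))
  have "k \<le> k * m" using m(1) by simp
  then have "x = (wprod A \<pi> ^^ (k * m - k)) ((wprod A \<pi> ^^ k) x)"
    using mm[of k] by (metis comp_apply funpow_add le_add_diff_inverse2)
  then have "(wprod A \<pi> ^^ k) x = (wprod A (rev \<pi>) ^^ (k * m - k)) x" by (metis funpow_rev)
  then show ?thesis using r by simp
qed

lemma orbit_sum_D:
  assumes "is_cox_word \<pi>" "x \<in> tube \<pi>" "m > 0" "(wprod A \<pi> ^^ m) x = x"
  obtains t where "t > 0" "(\<Sum>k<m. (wprod A \<pi> ^^ k) x) = t *\<^sub>R D"
proof -
  obtain t where t: "(\<Sum>k<m. (wprod A \<pi> ^^ k) x) = t *\<^sub>R D"
    using fixed_multiple_D[OF assms(1) orbit_sum_fixed[OF assms(4)]] by blast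
  have nn: "nonneg ((wprod A \<pi> ^^ k) x)" for k
    using tube_funpow[OF assms(1,2)] by (simp add: tube_def)
  obtain i where i: "x $ i \<noteq> 0" using real_nonzero[OF tube_real[OF assms(2)]] by (auto simp: vec_eq_iff)
  then have xi: "x $ i > 0" using nn[of 0] by (simp add: nonneg_def order_less_le)
  have "t * D $ i = (\<Sum>k<m. (wprod A \<pi> ^^ k) x $ i)"
    using arg_cong[OF t, of "\<lambda>v. v $ i"] by simp
  also have "\<dots> \<ge> (wprod A \<pi> ^^ 0) x $ i"
    using nn assms(3) by (intro member_le_sum) (auto simp: nonneg_def)
  finally have "t * D $ i > 0" using xi by simp
  then have "t > 0" using D_pos[of i] by (simp add: zero_less_mult_iff)
  then show ?thesis using that t by blast
qed

lemma tube_cone_nnspan: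
  assumes "is_cox_word \<pi>" "tube \<pi> \<noteq> {}" "x \<in> tube_cone \<pi>"
  shows "x \<in> nnspan (Pi0 \<pi>)"
proof -
  obtain p where p: "p \<in> Pi0 \<pi>" using assms(2) tube_positive_partner by blast
  obtain m where m: "m > 0" "(wprod A \<pi> ^^ m) p = p"
    using return_inside[OF assms(1)] Pi0_tube[OF p] by (auto simp: tube_def)
  obtain t where t: "t > 0" "(\<Sum>k<m. (wprod A \<pi> ^^ k) p) = t *\<^sub>R D"
    using orbit_sum_D[OF assms(1) Pi0_tube[OF p] m] by blast
  have "t *\<^sub>R D \<in> nnspan (Pi0 \<pi>)"
    unfolding t(2)[symmetric] using Pi0_funpow[OF assms(1) p] by (intro nnspan_sum nnspan_base)
  from nnspan_scale[OF _ this, of "1 / t"] have D: "D \<in> nnspan (Pi0 \<pi>)" using t(1) by simp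
  obtain F f where F: "x = (\<Sum>y\<in>F. f y *\<^sub>R y)" "F \<subseteq> insert D (Pi0 \<pi>)" "\<forall>y. f y \<ge> 0"
    using tube_cone_nnspan_D[OF assms(3)] by (auto simp: nnspan_def)
  show ?thesis unfolding F(1) using F(2,3) D by (intro nnspan_sum nnspan_scale) (auto intro: nnspan_base)
qed

text \<open>Expanding each summand in indecomposable roots gives x = G x + Q with Q in the span of
  the others. Obtuseness yields G \<ge> 1 and nonnegativity G \<le> 1, so Q = 0; each summand that
  occurs is then a multiple of \<open>x\<close>, and equals it by reducedness.\<close>

lemma Pi0_extremal:
  assumes c: "is_cox_word \<pi>" and x: "x \<in> Pi0 \<pi>" and F: "finite F" "F \<subseteq> tube_cone \<pi>" "\<And>p. f p \<ge> (0::real)"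
    and e: "x = (\<Sum>p\<in>F. f p *\<^sub>R p)" and p: "p \<in> F" "f p > 0"
  shows "p = x"
proof -
  have ne: "tube \<pi> \<noteq> {}" using Pi0_tube[OF x] by blast
  have "\<exists>g q. p = g *\<^sub>R x + q \<and> g \<ge> 0 \<and> q \<in> nnspan (Pi0 \<pi> - {x})" if pX: "p \<in> tube_cone \<pi>" for p
  proof -
    obtain G h where G: "p = (\<Sum>y\<in>G. h y *\<^sub>R y)" "finite G" "G \<subseteq> Pi0 \<pi>" "\<forall>y. h y \<ge> 0"
      using tube_cone_nnspan[OF c ne pX] by (auto simp: nnspan_def)
    have "(\<Sum>y\<in>G - {x}. h y *\<^sub>R y) \<in> nnspan (Pi0 \<pi> - {x})"
      using G by (intro nnspan_sum nnspan_scale nnspan_base) auto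
    moreover have "p = (if x \<in> G then h x else 0) *\<^sub>R x + (\<Sum>y\<in>G - {x}. h y *\<^sub>R y)"
      using G(1,2) by (simp add: sum.remove)
    moreover have "(if x \<in> G then h x else 0) \<ge> 0" using G(4) by simp
    ultimately show ?thesis by blast
  qed
  then obtain g q where gq: "\<And>p. p \<in> tube_cone \<pi> \<Longrightarrow> p = g p *\<^sub>R x + q p"
    "\<And>p. p \<in> tube_cone \<pi> \<Longrightarrow> g p \<ge> 0" "\<And>p. p \<in> tube_cone \<pi> \<Longrightarrow> q p \<in> nnspan (Pi0 \<pi> - {x})" by metis
  define G where "G = (\<Sum>p\<in>F. f p * g p)"
  define Q where "Q = (\<Sum>p\<in>F. f p *\<^sub>R q p)"
  have "(\<Sum>p\<in>F. f p *\<^sub>R p) = (\<Sum>p\<in>F. f p *\<^sub>R (g p *\<^sub>R x + q p))"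
  proof (rule sum.cong[OF refl])
    fix p assume "p \<in> F"
    then have "p = g p *\<^sub>R x + q p" using gq(1) F(2) by blast
    then show "f p *\<^sub>R p = f p *\<^sub>R (g p *\<^sub>R x + q p)" by (rule arg_cong)
  qed
  then have "x = (\<Sum>p\<in>F. f p *\<^sub>R (g p *\<^sub>R x + q p))" using e by simp
  also have "\<dots> = G *\<^sub>R x + Q" by (simp add: G_def Q_def scaleR_right_distrib sum.distrib scaleR_sum_left)
  finally have xe: "x = G *\<^sub>R x + Q" .
  have nnq: "nonneg v \<and> K x v \<le> 0" if v: "v \<in> nnspan (Pi0 \<pi> - {x})" for v
  proof -
    obtain H h where H: "v = (\<Sum>y\<in>H. h y *\<^sub>R y)" "H \<subseteq> Pi0 \<pi> - {x}" "\<forall>y. h y \<ge> 0"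
      using v by (auto simp: nnspan_def)
    have "K x v = (\<Sum>y\<in>H. h y * K x y)" unfolding H(1) by (simp add: K_sum_right)
    also have "\<dots> \<le> 0" using H(2,3) Pi0_obtuse[OF x] by (intro sum_nonpos mult_nonneg_nonpos) auto
    finally have "K x v \<le> 0" .
    moreover have "nonneg v"
      unfolding H(1) nonneg_def using H(2,3) by (auto simp: Pi0_def tube_def nonneg_def intro!: sum_nonneg mult_nonneg_nonneg)
    ultimately show ?thesis by blast
  qed
  have Q: "Q \<in> nnspan (Pi0 \<pi> - {x})" unfolding Q_def using F gq(3) by (intro nnspan_sum nnspan_scale) auto
  have Qe: "Q = (1 - G) *\<^sub>R x" using xe by (simp add: algebra_simps)
  have xr: "K x x > 0" "nonneg x" using x by (auto simp: Pi0_def tube_def real_norm_pos)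
  have "(1 - G) * K x x \<le> 0" using nnq[OF Q] Qe by simp
  then have "G \<ge> 1" using xr(1) by (simp add: mult_le_0_iff)
  obtain i where "x $ i \<noteq> 0" using real_nonzero[OF Pi0_real[OF x]] by (auto simp: vec_eq_iff)
  then have xi: "x $ i > 0" using xr(2) by (simp add: nonneg_def order_less_le)
  have "(1 - G) * x $ i \<ge> 0" using nnq[OF Q] Qe by (simp add: nonneg_def)
  then have "G \<le> 1" using xi by (simp add: zero_le_mult_iff)
  then have "Q = 0" using \<open>G \<ge> 1\<close> Qe by simp
  have "q p = 0"
  proof -
    have "f p * q p $ j = 0" for j
    proof -
      have "(\<Sum>p\<in>F. f p * q p $ j) = 0" using \<open>Q = 0\<close> by (simp add: Q_def vec_eq_iff)
      moreover have "\<forall>p\<in>F. f p * q p $ j \<ge> 0"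
        using F(2,3) nnq gq(3) by (auto simp: nonneg_def subset_iff)
      ultimately show ?thesis using F(1) p(1) by (subst (asm) sum_nonneg_eq_0_iff) auto
    qed
    then show ?thesis using p(2) by (auto simp: vec_eq_iff)
  qed
  then have pg: "p = g p *\<^sub>R x" using gq(1) p(1) F(2) by (metis add.right_neutral subsetD)
  have "p \<in> tube_cone \<pi>" using p F by blast
  have "g p \<noteq> 0" using tube_cone_nonzero[OF \<open>p \<in> tube_cone \<pi>\<close>] pg by auto
  have "p \<in> tube \<pi>"
  proof (rule ccontr)
    assume "p \<notin> tube \<pi>"
    then obtain k :: nat where "p = of_nat k *\<^sub>R D" using \<open>p \<in> tube_cone \<pi>\<close> by (auto simp: tube_cone_def)
    then have "K p p = 0" by simp
    then show False using pg \<open>g p \<noteq> 0\<close> xr(1) by (metis K_left(3) K_right(3) less_irrefl mult_eq_0_iff)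
  qed
  then have "g p = 1 \<or> g p = - 1" using real_proportional[OF Pi0_real[OF x]] pg tube_real by metis
  moreover have "g p \<ge> 0" using gq(2) \<open>p \<in> tube_cone \<pi>\<close> by blast
  ultimately show ?thesis using pg by auto
qed

lemma Pi0_nnspan:
  assumes c: "is_cox_word \<pi>" and x: "x \<in> Pi0 \<pi>" and P: "P \<subseteq> tube_cone \<pi>" "x \<in> nnspan P"
  shows "x \<in> P"
proof -
  obtain F f where F: "x = (\<Sum>y\<in>F. f y *\<^sub>R y)" "finite F" "F \<subseteq> P" "\<And>y. f y \<ge> 0"
    using P(2) by (auto simp: nnspan_def)
  have "\<exists>y\<in>F. f y > 0"
  proof (rule ccontr)
    assume "\<not> ?thesis"
    then have "\<forall>y\<in>F. f y = 0" using F(4) by (meson order_antisym not_le_imp_less)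
    then have "x = 0" using F(1) by simp
    then show False using real_nonzero[OF Pi0_real[OF x]] by simp
  qed
  then obtain y where "y \<in> F" "f y > 0" by blast
  then have "y = x" using Pi0_extremal[OF c x F(2) _ F(4) F(1)] F(3) P(1) by blast
  then show ?thesis using \<open>y \<in> F\<close> F(3) by blast
qed

text \<open>By extremality the indecomposable roots lie in every generating subset of the cone, so
  they form the least one.\<close>

lemma Pi_c_eq:
  assumes c: "is_cox_word \<pi>" and ne: "tube \<pi> \<noteq> {}"
  shows "Pi_c A d aff (wprod A \<pi>) = Pi0 \<pi>"
proof -
  have sub: "Pi0 \<pi> \<subseteq> tube_cone \<pi>" by (auto simp: Pi0_def tube_cone_def)
  have gen: "tube_cone \<pi> \<subseteq> nnspan (Pi0 \<pi>)" using tube_cone_nnspan[OF c ne] by blast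
  have least: "Pi0 \<pi> \<subseteq> P" if "P \<subseteq> tube_cone \<pi>" "tube_cone \<pi> \<subseteq> nnspan P" for P
    using Pi0_nnspan[OF c _ that(1)] that(2) sub by blast
  show ?thesis
    unfolding Pi_c_def Let_def tube_cone_eq[OF c]
  proof (rule the_equality)
    show "Pi0 \<pi> \<subseteq> tube_cone \<pi> \<and> tube_cone \<pi> \<subseteq> nnspan (Pi0 \<pi>) \<and>
      (\<forall>Q. Q \<subset> Pi0 \<pi> \<longrightarrow> \<not> tube_cone \<pi> \<subseteq> nnspan Q)"
    proof (intro conjI allI impI notI)
      fix Q assume Q: "Q \<subset> Pi0 \<pi>" "tube_cone \<pi> \<subseteq> nnspan Q"
      then have "Pi0 \<pi> \<subseteq> Q" using least[of Q] sub by blast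
      then show False using Q(1) by blast
    qed (use sub gen in auto)
  next
    fix P assume P: "P \<subseteq> tube_cone \<pi> \<and> tube_cone \<pi> \<subseteq> nnspan P \<and>
      (\<forall>Q. Q \<subset> P \<longrightarrow> \<not> tube_cone \<pi> \<subseteq> nnspan Q)"
    then have "Pi0 \<pi> \<subseteq> P" using least by blast
    moreover have "\<not> Pi0 \<pi> \<subset> P" using P gen by blast
    ultimately show "P = Pi0 \<pi>" by blast
  qed
qed

end

section \<open>The rotation of an orbit\<close>

context affine_cartan begin

definition per :: "'i list \<Rightarrow> real ^ 'i \<Rightarrow> nat" where
  "per \<pi> x = (LEAST m. m > 0 \<and> (wprod A \<pi> ^^ m) x = x)"

definition orb :: "'i list \<Rightarrow> real ^ 'i \<Rightarrow> (real ^ 'i) set" where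
  "orb \<pi> x = range (\<lambda>k. (wprod A \<pi> ^^ k) x)"

context
  fixes \<pi> x
  assumes cx: "is_cox_word \<pi>" and xP: "x \<in> Pi0 \<pi>"
begin

abbreviation (input) "X k \<equiv> (wprod A \<pi> ^^ k) x"
abbreviation (input) "r \<equiv> per \<pi> x"

lemma per_props: "r > 0" "X r = x" "\<And>n. 0 < n \<Longrightarrow> n < r \<Longrightarrow> X n \<noteq> x"
proof -
  have "\<exists>m. m > 0 \<and> X m = x"
    using return_inside[OF cx] Pi0_tube[OF xP] by (auto simp: tube_def)
  from LeastI_ex[OF this] show "r > 0" "X r = x" by (auto simp: per_def)
  show "X n \<noteq> x" if "0 < n" "n < r" for n
    using not_less_Least[of n "\<lambda>m. m > 0 \<and> X m = x"] that by (auto simp: per_def)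
qed

lemma X_P: "X k \<in> Pi0 \<pi>"
  by (rule Pi0_funpow[OF cx xP])

lemma X_add: "X (a + b) = (wprod A \<pi> ^^ a) (X b)"
  by (simp add: funpow_add)

lemma X_mult: "X (k * r) = x"
  by (induction k) (simp_all add: funpow_add per_props(2))

lemma X_shift: "X (a + k * r) = X a"
  by (simp add: X_add X_mult)

lemma X_mod: "X (k mod r) = X k"
  using X_shift[of "k mod r" "k div r"] by simp

lemma X_eq: "X a = X b \<longleftrightarrow> a mod r = b mod r"
proof
  assume e: "X a = X b"
  have False if "a' < b'" "b' < r" "X a' = X b'" for a' b'
  proof -
    have "X b' = (wprod A \<pi> ^^ a') (X (b' - a'))" using X_add[of a' "b' - a'"] that by simp
    then have "X (b' - a') = x" using that(3) funpow_inj by metis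
    then show False using per_props(3)[of "b' - a'"] that by simp
  qed
  from this[of "a mod r" "b mod r"] this[of "b mod r" "a mod r"] show "a mod r = b mod r"
    using e X_mod[of a] X_mod[of b] mod_less_divisor[OF per_props(1)] by (metis linorder_neqE_nat)
qed (metis X_mod)

lemma per_ge2: "r \<ge> 2"
proof (rule ccontr)
  assume "\<not> ?thesis"
  then have "r = 1" using per_props(1) by simp
  then have "wprod A \<pi> x = x" using per_props(2) by simp
  then have "K x x = 0" using cox_fixed[OF cx] by blast
  then show False using real_norm_pos[OF Pi0_real[OF xP]] by simp
qed

lemma K_X: "K (X (a + m)) (X (a + n)) = K (X m) (X n)"
  by (simp add: X_add funpow_K)

lemma Kxx: "K x x > 0"
  using real_norm_pos[OF Pi0_real[OF xP]] .

lemma orbit_sum: "\<exists>t>0. (\<Sum>k<r. X k) = t *\<^sub>R D"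
  using orbit_sum_D[OF cx Pi0_tube[OF xP] per_props(1,2)] by blast

abbreviation (input) "kk n \<equiv> cartan_int x (X n)"

lemma kk_0: "kk 0 = 2"
  using cartan_int_self[OF Pi0_real[OF xP]] by simp

lemma kk_Ints: "kk n \<in> \<int>"
  using cartan_int_integral[OF Pi0_real[OF xP] real_integral[OF Pi0_real[OF X_P]]] .

lemma kk_nonpos: "0 < n \<Longrightarrow> n < r \<Longrightarrow> kk n \<le> 0"
  using Pi0_obtuse[OF xP X_P[of n]] per_props(3)[of n] Kxx by (simp add: cartan_int_def divide_le_0_iff)

lemma kk_sym: "n \<le> r \<Longrightarrow> kk (r - n) = kk n"
  using K_X[of n 0 "r - n"] per_props(2) by (simp add: cartan_int_def K_sym[of "X n" x])

lemma kk_sum: "(\<Sum>n<r. kk n) = 0"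
proof -
  obtain t where t: "(\<Sum>k<r. X k) = t *\<^sub>R D" using orbit_sum by blast
  have "(\<Sum>n<r. kk n) = 2 * K x (\<Sum>k<r. X k) / K x x"
    by (simp add: cartan_int_def K_sum_right sum_distrib_left sum_divide_distrib)
  then show ?thesis unfolding t by simp
qed

text \<open>The integers \<open>kk n\<close> are 2 at n = 0 and nonpositive afterwards, symmetric
  under n to r - n, and sum to 0. So the remaining -2 sits on one symmetric pair; if 2 j = r, both
  subtracted terms fall on \<open>j\<close>.\<close>

lemma kk_form:
  obtains j where "0 < j" "2 * j \<le> r"
    "\<And>n. n < r \<Longrightarrow> kk n = (if n = 0 then 2 else 0) - (if n = j then 1 else 0) - (if n = r - j then 1 else 0)"
proof -
  have split: "(\<Sum>n<r. kk n) = kk 0 + (\<Sum>n\<in>{0<..<r}. kk n)"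
  proof -
    have "{..<r} = insert 0 {0<..<r}" using per_props(1) by auto
    then show ?thesis by simp
  qed
  have s2: "(\<Sum>n\<in>{0<..<r}. kk n) = - 2" using split kk_sum kk_0 by simp
  have le: "(\<Sum>n\<in>N. kk n) \<ge> - 2" if "N \<subseteq> {0<..<r}" for N
  proof -
    have "(\<Sum>n\<in>{0<..<r}. kk n) \<le> (\<Sum>n\<in>N. kk n)"
      using that kk_nonpos by (subst sum.subset_diff[OF that]) (auto intro!: sum_nonpos)
    then show ?thesis using s2 by simp
  qed
  have m1: "kk n \<le> - 1" if "kk n < 0" for n
    using kk_Ints[of n] that by (auto elim!: Ints_cases)
  have "\<exists>n\<in>{0<..<r}. kk n < 0"
  proof (rule ccontr)
    assume "\<not> ?thesis"
    then have "(\<Sum>n\<in>{0<..<r}. kk n) \<ge> 0" by (intro sum_nonneg) (auto simp: not_less)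
    then show False using s2 by simp
  qed
  then obtain n0 where n0: "0 < n0" "n0 < r" "kk n0 < 0" by auto
  define j where "j = min n0 (r - n0)"
  have j: "0 < j" "2 * j \<le> r" "j < r" "kk j < 0"
    using n0 kk_sym[of n0] by (auto simp: j_def min_def)
  have zero: "kk n = 0" if n: "0 < n" "n < r" "n \<noteq> j" "n \<noteq> r - j" for n
  proof (rule ccontr)
    assume "kk n \<noteq> 0"
    then have kn: "kk n \<le> - 1" using kk_nonpos[OF n(1,2)] m1 by (meson order_less_le)
    have kj: "kk j \<le> - 1" using m1 j(4) by blast
    show False
    \<comment> \<open>A further nonzero entry overdraws the total -2: it is a third one if
      \<open>j\<close> and \<open>r - j\<close> differ, and it brings its own mirror image if they
      coincide.\<close>
    proof (cases "2 * j = r")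
      case False
      have "kk (r - j) \<le> - 1" using kk_sym[of j] j kj by simp
      moreover have "(\<Sum>n\<in>{j, r - j, n}. kk n) = kk j + kk (r - j) + kk n" using False n by auto
      moreover have "(\<Sum>n\<in>{j, r - j, n}. kk n) \<ge> - 2" using j n by (intro le) auto
      ultimately show False using kn kj by linarith
    next
      case True
      have "kk (r - n) \<le> - 1" using kk_sym[of n] n kn by simp
      moreover have "(\<Sum>n\<in>{j, r - n, n}. kk n) = kk j + kk (r - n) + kk n" using True n by auto
      moreover have "(\<Sum>n\<in>{j, r - n, n}. kk n) \<ge> - 2" using j n by (intro le) auto
      ultimately show False using kn kj by linarith
    qed
  qed
  have tot: "(\<Sum>n\<in>{j, r - j}. kk n) = - 2"
  proof -
    have "(\<Sum>n\<in>{0<..<r}. kk n) = (\<Sum>n\<in>{j, r - j}. kk n)"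
      using j zero by (intro sum.mono_neutral_right) auto
    then show ?thesis using s2 by simp
  qed
  have "kk n = (if n = 0 then 2 else 0) - (if n = j then 1 else 0) - (if n = r - j then 1 else 0)" if "n < r" for n
  proof (cases "2 * j = r")
    case True
    then have "r - j = j" by simp
    then show ?thesis using tot zero[of n] that kk_0 j by (cases "n = 0") auto
  next
    case False
    then have "j \<noteq> r - j" using j by auto
    then have "kk j + kk (r - j) = - 2" using tot by simp
    then have "kk j = - 1" "kk (r - j) = - 1" using kk_sym[of j] j by auto
    then show ?thesis using zero[of n] that kk_0 j \<open>j \<noteq> r - j\<close> by (cases "n = 0") auto
  qed
  then show ?thesis using that j by blast
qed

text \<open>The values along the orbit are nonpositive and add up to the pairing with a multiple of
  D, which is 0.\<close>

lemma K_outside_orbit: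
  assumes "p \<in> Pi0 \<pi>" "p \<notin> orb \<pi> x"
  shows "K p (X n) = 0"
proof -
  have le: "K p (X k) \<le> 0" for k
    using Pi0_obtuse[OF assms(1) X_P[of k]] assms(2) by (auto simp: orb_def)
  obtain t where t: "(\<Sum>k<r. X k) = t *\<^sub>R D" using orbit_sum by blast
  have "(\<Sum>k<r. - K p (X k)) = - K p (\<Sum>k<r. X k)" by (simp add: K_sum_right sum_negf)
  also have "\<dots> = 0" unfolding t by simp
  finally have "\<forall>k\<in>{..<r}. - K p (X k) = 0"
    using le by (subst (asm) sum_nonneg_eq_0_iff) auto
  then have "K p (X (n mod r)) = 0" using per_props(1) by simp
  then show ?thesis by (simp add: X_mod)
qed

abbreviation (input) "FF n \<equiv> 2 * euler \<pi> x (X n) / K x x"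

lemma FF_0: "FF 0 = 1"
  using euler_self[OF cx, of x] Kxx by simp

text \<open>From E(c u, x) = - E(x, u): the values of E along the orbit obey a first-order recursion
  driven by K. It shows that E(x, c^n x) stays constant until the first nonzero Cartan
  integer.\<close>

lemma FF_Suc: "FF (Suc n) = FF n + kk (Suc n)"
proof -
  have "euler \<pi> (X (Suc n)) x = - euler \<pi> x (X n)" by (simp add: euler_cox[OF cx])
  then have "euler \<pi> x (X (Suc n)) = euler \<pi> x (X n) + K x (X (Suc n))"
    using euler_add[OF cx, of x "X (Suc n)"] by linarith
  then show ?thesis by (simp add: cartan_int_def add_divide_distrib distrib_left)
qed

lemma euler_X: "euler \<pi> (X (a + m)) (X (a + n)) = euler \<pi> (X m) (X n)"
  by (induction a) (simp_all add: euler_cox_cox[OF cx])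

end

section \<open>The step of the rotation, with a special node in first position\<close>

context
  fixes \<pi> s \<rho> \<theta> k
  assumes pi: "\<pi> = s # \<rho>" and cs: "is_cox_word \<pi>" and th: "\<theta> \<in> real_roots A" "nonneg \<theta>" "\<theta> $ s = 0" and k: "k > (0::real)"
    and Dk: "D - D $ s *\<^sub>R sroot s = k *\<^sub>R \<theta>"
begin

text \<open>On vectors without coordinate at \<open>s\<close> the part of D along the first simple
  root pairs to 0, and the rest of D is \<open>k *\<^sub>R \<theta>\<close>. So \<open>U_c\<close>
  meets this hyperplane in the right perpendicular of \<theta> for the shorter word.\<close>

lemma special_Ef_D:
  assumes "v $ s = 0"
  shows "euler \<pi> D v = k * euler \<rho> \<theta> v"
proof -
  have s: "s \<notin> set \<rho>" using cox_ConsD(1)[OF cs[unfolded pi]] .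
  have D: "D = D $ s *\<^sub>R sroot s + k *\<^sub>R \<theta>" using Dk by (simp add: algebra_simps)
  have "euler \<pi> (sroot s) v = 0" "euler \<pi> \<theta> v = euler \<rho> \<theta> v"
    using assms unfolding pi by (simp_all only: euler_Cons_sroot[OF s] euler_Cons[OF s, of \<theta>])
  moreover have "euler \<pi> D v = D $ s * euler \<pi> (sroot s) v + k * euler \<pi> \<theta> v"
    by (subst D) simp
  ultimately show ?thesis by simp
qed

lemma special_simple_system: "\<exists>\<Delta>. simple_system \<rho> \<theta> \<Delta>"
proof -
  have s: "s \<notin> set \<rho>" "insert s (set \<rho>) = UNIV" using cox_ConsD[OF cs[unfolded pi]] .
  have dis: "distinct \<rho>" using cs pi by (simp add: is_cox_word_def)
  have sup: "supp_in (set \<rho>) \<theta>"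
    using th(3) s(2) unfolding supp_in_def by (metis UNIV_I insertE)
  have "set \<rho> \<noteq> UNIV" using s(1) by auto
  then have "\<exists>n. \<not> nonneg ((wprod A (rev \<rho>) ^^ n) \<theta>)"
    using positive_definite_orbit_negative[OF dis _ th(1) sup] positive_definite_proper[of "set \<rho>"] by metis
  then obtain n where "\<not> nonneg ((wprod A (rev \<rho>) ^^ n) \<theta>)" by blast
  then have "\<not> nonneg (snd ((source_move ^^ (n * length \<rho>)) (\<rho>, \<theta>)))" by (simp add: source_move_words)
  then show ?thesis using simple_system_exists[OF dis th(1,2) sup] by blast
qed

text \<open>Indecomposable roots with coordinate 0 at \<open>s\<close> belong to \<Delta> by
  extremality and inherit its signs. Conversely \<Delta> expands in such roots only, by
  nonnegativity at \<open>s\<close>, so together with D they span \<open>U_c\<close>.\<close>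

lemma special_Pi0:
  shows special_Pi0_sign: "\<And>x y. x \<in> Pi0 \<pi> \<Longrightarrow> y \<in> Pi0 \<pi> \<Longrightarrow> x $ s = 0 \<Longrightarrow> y $ s = 0 \<Longrightarrow> x \<noteq> y
      \<Longrightarrow> euler \<pi> x y \<le> 0"
    and special_Pi0_span: "\<And>v. tube \<pi> \<noteq> {} \<Longrightarrow> euler \<pi> D v = 0
      \<Longrightarrow> v \<in> span (insert D {p \<in> Pi0 \<pi>. p $ s = 0})"
proof -
  have s: "s \<notin> set \<rho>" "insert s (set \<rho>) = UNIV" using cox_ConsD[OF cs[unfolded pi]] .
  obtain \<Delta> where \<Delta>: "simple_system \<rho> \<theta> \<Delta>" using special_simple_system by blast
  have sup: "supp_in (set \<rho>) v \<longleftrightarrow> v $ s = 0" for v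
    using s unfolding supp_in_def by (metis UNIV_I insertE)
  have \<Delta>t: "y \<in> tube \<pi>" "y $ s = 0" if "y \<in> \<Delta>" for y
    using \<Delta> that special_Ef_D[of y] unfolding simple_system_def sup by (auto simp: tube_def)
  have in\<Delta>: "x \<in> \<Delta>" if x: "x \<in> Pi0 \<pi>" "x $ s = 0" for x
  proof (rule Pi0_nnspan[OF cs x(1)])
    show "\<Delta> \<subseteq> tube_cone \<pi>" using \<Delta>t by (auto simp: tube_cone_def)
    have "euler \<pi> D x = 0" using Pi0_tube[OF x(1)] by (simp add: tube_def)
    then have "euler \<rho> \<theta> x = 0" using special_Ef_D[OF x(2)] k by simp
    then show "x \<in> nnspan \<Delta>"
      using \<Delta> Pi0_tube[OF x(1)] x(2) unfolding simple_system_def sup by (simp add: tube_def)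
  qed
  show "euler \<pi> x y \<le> 0" if "x \<in> Pi0 \<pi>" "y \<in> Pi0 \<pi>" "x $ s = 0" "y $ s = 0" "x \<noteq> y" for x y
  proof -
    have "euler \<rho> x y \<le> 0" using \<Delta> in\<Delta> that unfolding simple_system_def by blast
    then show ?thesis using that(4) by (simp add: pi euler_Cons[OF s(1)])
  qed
  fix v assume ne: "tube \<pi> \<noteq> {}" and v: "euler \<pi> D v = 0"
  let ?P = "{p \<in> Pi0 \<pi>. p $ s = 0}"
  have \<Delta>s: "y \<in> span ?P" if "y \<in> \<Delta>" for y
  proof -
    have yc: "y \<in> tube_cone \<pi>" using \<Delta>t[OF that] by (simp add: tube_cone_def)
    obtain F f where F: "y = (\<Sum>p\<in>F. f p *\<^sub>R p)" "finite F" "F \<subseteq> Pi0 \<pi>" "\<forall>p. f p \<ge> 0"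
      using tube_cone_nnspan[OF cs ne yc] by (auto simp: nnspan_def)
    have "f p *\<^sub>R p \<in> span ?P" if p: "p \<in> F" for p
    proof -
      have "(\<Sum>p\<in>F. f p * p $ s) = 0" using \<Delta>t(2)[OF \<open>y \<in> \<Delta>\<close>] F(1) by simp
      moreover have "\<forall>p\<in>F. f p * p $ s \<ge> 0" using F(3,4) by (auto simp: Pi0_def tube_def nonneg_def)
      ultimately have "f p * p $ s = 0" using F(2) p by (subst (asm) sum_nonneg_eq_0_iff) auto
      then consider "f p = 0" | "p \<in> ?P" using F(3) p by auto
      then show ?thesis by cases (auto intro: span_scale span_base simp: span_zero)
    qed
    then show ?thesis unfolding F(1) by (rule span_sum)
  qed
  \<comment> \<open>Subtracting a multiple of D clears the coordinate at \<open>s\<close> without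
    leaving \<open>U_c\<close>.\<close>
  define w where "w = v - (v $ s / D $ s) *\<^sub>R D"
  have ws: "w $ s = 0" using D_pos[of s] by (simp add: w_def)
  have "euler \<pi> D w = 0" using v by (simp add: w_def euler_D_D[OF cs])
  then have "euler \<rho> \<theta> w = 0" using special_Ef_D[OF ws] k by simp
  then have "w \<in> span \<Delta>" using \<Delta> ws unfolding simple_system_def sup by blast
  also have "span \<Delta> \<subseteq> span ?P" using \<Delta>s by (intro span_minimal) auto
  finally have "w \<in> span (insert D ?P)" using span_mono[of ?P "insert D ?P"] by blast
  moreover have "(v $ s / D $ s) *\<^sub>R D \<in> span (insert D ?P)" by (intro span_scale span_base) simp
  ultimately have "w + (v $ s / D $ s) *\<^sub>R D \<in> span (insert D ?P)" by (rule span_add)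
  then show "v \<in> span (insert D ?P)" by (simp add: w_def)
qed

context
  fixes x j
  assumes xP: "x \<in> Pi0 \<pi>" and j: "0 < j" "2 * j \<le> per \<pi> x"
    and kf: "\<And>n. n < per \<pi> x \<Longrightarrow> cartan_int x ((wprod A \<pi> ^^ n) x) =
        (if n = 0 then 2 else 0) - (if n = j then 1 else 0) - (if n = per \<pi> x - j then 1 else 0)"
begin

abbreviation (input) "Y n \<equiv> (wprod A \<pi> ^^ n) x"
abbreviation (input) "q \<equiv> per \<pi> x"

text \<open>The chain \<open>Cs\<close> of step \<open>j\<close> through \<open>Y a\<close> is
  K-orthogonal to all other indecomposable roots. By the spanning statement \<open>Y a\<close> has
  the same K-pairings with the chain as a combination of chain elements with coordinate 0 at
  \<open>s\<close>. The coefficients of the difference are harmonic on a cycle, hence constant, yet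
  they are 1 at \<open>Y a\<close> and 0 at any other element with nonzero coordinate.\<close>

lemma missing_unique:
  assumes "Y a $ s \<noteq> 0" "Y (a + i0 * j) $ s \<noteq> 0"
  shows "Y (a + i0 * j) = Y a"
proof (rule ccontr)
  assume neq: "Y (a + i0 * j) \<noteq> Y a"
  note xx = cs xP
  let ?c = "wprod A \<pi>"
  have q2: "q \<ge> 2" by (rule per_ge2[OF xx])
  have jq: "j < q" using j q2 by simp
  define Cs where "Cs = range (\<lambda>i. Y (a + i * j))"
  have CsO: "Cs \<subseteq> Y ` {..<q}"
  proof
    fix y assume "y \<in> Cs"
    then obtain i where "y = Y (a + i * j)" by (auto simp: Cs_def)
    then have "y = Y ((a + i * j) mod q)" by (simp only: X_mod[OF xx])
    then show "y \<in> Y ` {..<q}" using per_props(1)[OF xx] by auto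
  qed
  then have finC: "finite Cs" by (rule finite_subset) simp
  have CsP: "y \<in> Pi0 \<pi>" if "y \<in> Cs" for y using that X_P[OF xx] by (auto simp: Cs_def)
  have cj: "(?c ^^ j) y \<in> Cs" if "y \<in> Cs" for y
  proof -
    obtain i where i: "y = Y (a + i * j)" using \<open>y \<in> Cs\<close> by (auto simp: Cs_def)
    have "(?c ^^ j) y = Y (a + Suc i * j)" unfolding i X_add[OF xx, symmetric] by (simp add: ac_simps)
    then show ?thesis unfolding Cs_def by (rule range_eqI)
  qed
  have cqj: "(?c ^^ (q - j)) y \<in> Cs" if "y \<in> Cs" for y
  proof -
    obtain i where i: "y = Y (a + i * j)" using \<open>y \<in> Cs\<close> by (auto simp: Cs_def)
    \<comment> \<open>One step of \<open>j\<close> backwards is q - 1 such steps forwards, up to a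
      multiple of q.\<close>
    have e: "q - j + (a + i * j) + (j - 1) * q = a + (i + (q - 1)) * j"
    proof -
      have "q - j + j * q = q + (q - 1) * j"
        using jq q2 by (cases q) (auto simp: algebra_simps)
      moreover have "(j - 1) * q + q = j * q" using j(1) by (cases j) auto
      ultimately have "q - j + (j - 1) * q = (q - 1) * j" by linarith
      then show ?thesis by (simp add: algebra_simps)
    qed
    have "(?c ^^ (q - j)) y = Y (q - j + (a + i * j))" unfolding i X_add[OF xx, symmetric] by simp
    also have "\<dots> = Y (q - j + (a + i * j) + (j - 1) * q)" by (simp only: X_shift[OF xx])
    finally show ?thesis unfolding e Cs_def by (rule range_eqI)
  qed
  have Kyc: "2 * K y ((?c ^^ n) y) / K x x = cartan_int x (Y n)" if y: "y \<in> Cs" for y n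
  proof -
    obtain m where m: "y = Y m" using y by (auto simp: Cs_def)
    have "K y ((?c ^^ n) y) = K (Y (m + 0)) (Y (m + n))" unfolding m X_add[OF xx, symmetric] by (simp add: add.commute)
    also have "\<dots> = K x (Y n)" unfolding K_X[OF xx] by simp
    finally show ?thesis by (simp add: cartan_int_def)
  qed
  have orbY: "\<exists>n<q. p = (?c ^^ n) y" if yC: "y \<in> Cs" and pO: "p \<in> orb \<pi> x" for y p
  proof -
    obtain m where m: "y = Y m" using yC by (auto simp: Cs_def)
    obtain l where l: "p = Y l" using pO by (auto simp: orb_def)
    define n where "n = (l + m * q - m)"
    have "m \<le> m * q" using q2 by simp
    then have "n + m = l + m * q" unfolding n_def by linarith
    then have "p = (?c ^^ n) y" unfolding m l X_add[OF xx, symmetric] using X_shift[OF xx, of l m] by simp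
    also have "\<dots> = Y (n + m)" unfolding m X_add[OF xx] ..
    also have "\<dots> = Y (n mod q + m)" unfolding X_eq[OF xx] by (simp add: mod_add_left_eq)
    also have "\<dots> = (?c ^^ (n mod q)) y" unfolding m X_add[OF xx] ..
    finally show ?thesis using per_props(1)[OF xx] by (intro exI[of _ "n mod q"]) simp
  qed
  have Kout: "K p y = 0" if pairing: "p \<in> Pi0 \<pi>" "p \<notin> Cs" "y \<in> Cs" for p y
  proof (cases "p \<in> orb \<pi> x")
    case False
    then show ?thesis using K_outside_orbit[OF xx pairing(1)] pairing(3) by (auto simp: Cs_def)
  next
    case True
    then obtain n where n: "n < q" "p = (?c ^^ n) y" using orbY[OF pairing(3)] by blast
    have "n \<noteq> 0" "n \<noteq> j" "n \<noteq> q - j" using n(2) pairing(2,3) cj cqj by (metis funpow_0)+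
    then have "K y p = 0" using kf[OF n(1)] Kyc[OF pairing(3), of n] Kxx[OF xx] n(2) by simp
    then show ?thesis by (simp add: K_sym)
  qed
  let ?P = "{p \<in> Pi0 \<pi>. p $ s = 0}"
  \<comment> \<open>Elements outside the chain do not affect pairings with it, so an expansion may
    be truncated to the chain.\<close>
  have dec: "\<exists>b. (\<forall>y. y $ s \<noteq> 0 \<longrightarrow> b y = 0) \<and> (\<forall>z\<in>Cs. K (v - (\<Sum>y\<in>Cs. b y *\<^sub>R y)) z = 0)"
    if "v \<in> span (insert D ?P)" for v
    using that
  proof (induction rule: span_induct_alt)
    case base
    show ?case by (intro exI[of _ "\<lambda>_. 0"]) simp
  next
    case (step t p u)
    then obtain b where b: "\<forall>y. y $ s \<noteq> 0 \<longrightarrow> b y = 0" "\<forall>z\<in>Cs. K (u - (\<Sum>y\<in>Cs. b y *\<^sub>R y)) z = 0" by blast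
    show ?case
    proof (cases "p \<in> Cs")
      case False
      then have "\<forall>z\<in>Cs. K p z = 0" using step(1) Kout by auto
      then show ?thesis using b by (intro exI[of _ b]) (auto simp: algebra_simps)
    next
      case True
      have ps: "p $ s = 0" using step(1) True CsP[OF True] Pi0_real[of D] D_not_real[of 1] by auto
      have "(\<Sum>y\<in>Cs. (b y + (if y = p then t else 0)) *\<^sub>R y) = (\<Sum>y\<in>Cs. b y *\<^sub>R y) + t *\<^sub>R p"
        using True finC by (simp add: scaleR_left_distrib sum.distrib if_distrib[of "\<lambda>c. c *\<^sub>R _"] cong: if_cong)
      then show ?thesis using b ps
        by (intro exI[of _ "\<lambda>y. b y + (if y = p then t else 0)"]) (auto simp: algebra_simps)
    qed
  qed
  have "Y a \<in> tube \<pi>" using Pi0_tube[OF X_P[OF xx]] .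
  then have "Y a \<in> span (insert D ?P)" by (intro special_Pi0_span) (auto simp: tube_def)
  then obtain b where b: "\<And>y. y $ s \<noteq> 0 \<Longrightarrow> b y = 0" "\<And>z. z \<in> Cs \<Longrightarrow> K (Y a - (\<Sum>y\<in>Cs. b y *\<^sub>R y)) z = 0"
    using dec by blast
  have aC: "Y a \<in> Cs" unfolding Cs_def by (rule image_eqI[of _ _ 0]) auto
  define g where "g y = (if y = Y a then 1 else 0) - b y" for y
  have gs: "(\<Sum>y\<in>Cs. g y *\<^sub>R y) = Y a - (\<Sum>y\<in>Cs. b y *\<^sub>R y)"
    using aC finC by (simp add: g_def scaleR_left_diff_distrib sum_subtractf if_distrib[of "\<lambda>c. c *\<^sub>R _"] cong: if_cong)
  have harm: "2 * g y = g ((?c ^^ j) y) + g ((?c ^^ (q - j)) y)" if y: "y \<in> Cs" for y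
  proof -
    have "0 = (\<Sum>z\<in>Cs. g z * (2 * K y z / K x x))"
    proof -
      have "(\<Sum>z\<in>Cs. g z * (2 * K y z / K x x)) = 2 / K x x * K y (\<Sum>z\<in>Cs. g z *\<^sub>R z)"
        by (simp add: K_sum_right sum_distrib_left mult.commute mult.left_commute)
      also have "K y (\<Sum>z\<in>Cs. g z *\<^sub>R z) = 0" unfolding gs using b(2)[OF y] by (metis K_sym)
      finally show ?thesis by simp
    qed
    also have "\<dots> = (\<Sum>z\<in>Cs. (if z = y then 2 * g z else 0) - (if z = (?c ^^ j) y then g z else 0)
        - (if z = (?c ^^ (q - j)) y then g z else 0))"
    proof (rule sum.cong[OF refl])
      fix z assume z: "z \<in> Cs"
      have "z \<in> orb \<pi> x" using z by (auto simp: Cs_def orb_def)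
      then obtain n where n: "n < q" "z = (?c ^^ n) y" using orbY[OF y] by blast
      obtain m where m: "y = Y m" using y by (auto simp: Cs_def)
      have eq: "(?c ^^ n) y = (?c ^^ n') y \<longleftrightarrow> n = n'" if "n' < q" for n'
      proof -
        have "(?c ^^ n) y = (?c ^^ n') y \<longleftrightarrow> Y (m + n) = Y (m + n')"
          unfolding m X_add[OF xx, symmetric] by (simp add: add.commute)
        also have "\<dots> \<longleftrightarrow> Y n = Y n'" unfolding X_add[OF xx] by (rule funpow_inj)
        also have "\<dots> \<longleftrightarrow> n = n'" unfolding X_eq[OF xx] using n(1) that by simp
        finally show ?thesis .
      qed
      have "2 * K y z / K x x = (if n = 0 then 2 else 0) - (if n = j then 1 else 0) - (if n = q - j then 1 else 0)"
        using Kyc[OF y, of n] kf[OF n(1)] n(2) by simp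
      moreover have "z = y \<longleftrightarrow> n = 0" using eq[of 0] n(2) per_props(1)[OF xx] by simp
      moreover have "z = (?c ^^ j) y \<longleftrightarrow> n = j" using eq[of j] n(2) jq by simp
      moreover have "z = (?c ^^ (q - j)) y \<longleftrightarrow> n = q - j" using eq[of "q - j"] n(2) j(1) q2 by simp
      ultimately show "g z * (2 * K y z / K x x) = (if z = y then 2 * g z else 0) - (if z = (?c ^^ j) y then g z else 0)
        - (if z = (?c ^^ (q - j)) y then g z else 0)" by simp
    qed
    also have "\<dots> = 2 * g y - g ((?c ^^ j) y) - g ((?c ^^ (q - j)) y)"
      unfolding sum_subtractf using finC y cj[OF y] cqj[OF y] by simp
    finally show ?thesis by simp
  qed
  \<comment> \<open>Along the chain, harmonic means arithmetic progression; q steps return to the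
    start, so the increment is 0.\<close>
  define h where "h i = g (Y (a + i * j))" for i
  have h2: "h (i + 2) - h (i + 1) = h (i + 1) - h i" for i
  proof -
    have y: "Y (a + (i + 1) * j) \<in> Cs" unfolding Cs_def by (rule rangeI)
    have "(?c ^^ j) (Y (a + (i + 1) * j)) = Y (a + (i + 2) * j)"
      unfolding X_add[OF xx, symmetric] by (simp add: algebra_simps)
    moreover have "(?c ^^ (q - j)) (Y (a + (i + 1) * j)) = Y (a + i * j)"
    proof -
      have "q - j + (a + (i + 1) * j) = a + i * j + 1 * q" using jq by (simp add: algebra_simps)
      then show ?thesis unfolding X_add[OF xx, symmetric] by (simp only: X_shift[OF xx])
    qed
    ultimately show ?thesis using harm[OF y] by (simp add: h_def)
  qed
  have hd: "h (i + 1) - h i = h 1 - h 0" for i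
  proof (induction i)
    case (Suc i) then show ?case using h2[of i] by (simp add: numeral_2_eq_2)
  qed simp
  have hl: "h i = h 0 + i * (h 1 - h 0)" for i
  proof (induction i)
    case (Suc i) then show ?case using hd[of i] by (simp add: algebra_simps)
  qed simp
  have "h q = h 0"
  proof -
    have "a + q * j = a + j * q" by simp
    then show ?thesis unfolding h_def by (simp only: X_shift[OF xx]) simp
  qed
  then have "real q * (h 1 - h 0) = 0" using hl[of q] by simp
  then have "h 1 - h 0 = 0" using per_props(1)[OF xx] by simp
  then have "h i0 = h 0" using hl[of i0] by simp
  moreover have "h 0 = 1" using b(1)[OF assms(1)] by (simp add: h_def g_def)
  moreover have "h i0 = 0" using b(1)[OF assms(2)] neq by (simp add: h_def g_def)
  ultimately show False by simp
qed

text \<open>Call an index marked if its element has a nonzero coordinate at \<open>s\<close>. For j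
  \<ge> 2, of two indices at distance 1 to j - 1 at least one is marked (\<open>pair\<close>), and
  of two at distance \<open>j\<close> at most one (\<open>AM1\<close>). These rules clash.\<close>

lemma step_one: "j = 1"
proof (rule ccontr)
  assume "j \<noteq> 1"
  then have j2: "j \<ge> 2" using j by simp
  note xx = cs xP
  have q4: "q \<ge> 4" using j j2 by simp
  have F1: "euler \<pi> x (Y n) > 0" if "n < j" for n
  proof -
    have "2 * euler \<pi> x (Y n) / K x x = 1" using that
    proof (induction n)
      case 0 then show ?case using FF_0[OF xx] by simp
    next
      case (Suc n)
      have "cartan_int x (Y (Suc n)) = 0" using kf[of "Suc n"] Suc.prems j by simp
      then show ?case using FF_Suc[OF xx, of n] Suc by (simp del: funpow.simps)
    qed
    then show ?thesis using Kxx[OF xx] by (simp add: field_simps)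
  qed
  define Ms where "Ms n \<longleftrightarrow> Y n $ s \<noteq> 0" for n
  have pair: "Ms a \<or> Ms (a + n)" if "0 < n" "n < j" for a n
  proof (rule ccontr)
    assume "\<not> ?thesis"
    then have z: "Y a $ s = 0" "Y (a + n) $ s = 0" by (auto simp: Ms_def)
    have "Y a \<noteq> Y (a + n)"
    proof
      assume "Y a = Y (a + n)"
      then have "Y 0 = Y n" using X_add[OF xx, of a 0] X_add[OF xx, of a n] funpow_inj by (metis add.right_neutral)
      then show False using per_props(3)[OF xx, of n] that j by simp
    qed
    then have "euler \<pi> (Y a) (Y (a + n)) \<le> 0"
      using special_Pi0_sign[OF X_P[OF xx] X_P[OF xx] z] by blast
    moreover have "euler \<pi> (Y a) (Y (a + n)) = euler \<pi> x (Y n)"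
      using euler_X[OF xx, of a 0 n] by simp
    ultimately show False using F1[OF that(2)] by simp
  qed
  have AM1: "\<not> (Ms a \<and> Ms (a + j))" for a
  proof
    assume "Ms a \<and> Ms (a + j)"
    then have "Y (a + j) = Y a" using missing_unique[of a 1] by (simp add: Ms_def)
    then have "Y j = Y 0" using X_add[OF xx, of a 0] X_add[OF xx, of a j] funpow_inj by (metis add.right_neutral)
    then show False using per_props(3)[OF xx, of j] j q4 by simp
  qed
  have Mq: "Ms (a + q) \<longleftrightarrow> Ms a" for a using X_shift[OF xx, of a 1] by (simp add: Ms_def)
  \<comment> \<open>From a marked m: m + j is unmarked, m + j + 1 marked, m + 1 and m + 2 j + 1
    unmarked, m + 2 j marked. So the chain closes after two steps and q = 2 j.\<close>
  obtain m where m: "Ms m" using pair[of 1 0] j2 by auto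
  have n1: "\<not> Ms (m + j)" using AM1 m by blast
  then have "Ms (m + j + 1)" using pair[of 1 "m + j"] j2 by simp
  then have n2: "\<not> Ms (m + 1)" and n3: "\<not> Ms (m + 2 * j + 1)"
  proof -
    have "m + j + 1 = m + 1 + j" "m + 2 * j + 1 = m + j + 1 + j" by simp_all
    then show "\<not> Ms (m + 1)" "\<not> Ms (m + 2 * j + 1)"
      using AM1[of "m + 1"] AM1[of "m + j + 1"] \<open>Ms (m + j + 1)\<close> by metis+
  qed
  have "Ms (m + 2 * j)" using n3 pair[of 1 "m + 2 * j"] j2 by simp
  then have "Y (m + 2 * j) = Y m" using missing_unique[of m 2] m by (simp add: Ms_def)
  then have "Y (2 * j) = Y 0" using X_add[OF xx, of m 0] X_add[OF xx, of m "2 * j"] funpow_inj by (metis add.right_neutral)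
  then have q: "q = 2 * j" using per_props(3)[OF xx, of "2 * j"] j by (metis funpow_0 le_neq_implies_less mult_pos_pos zero_less_numeral)
  show False
  proof (cases "j = 2")
    case True
    then show False using pair[of 1 "m + 1"] n1 n2 by simp
  next
    case False
    then have j3: "2 < j" using j2 by simp
    have "Ms (m + j - 1)" using pair[of 1 "m + j - 1"] n1 j2 by simp
    \<comment> \<open>Modulo q this is the index before m. Both neighbours of m are then unmarked
      although their distance 2 is below \<open>j\<close>.\<close>
    have "\<not> Ms (m + q - 1)"
    proof
      assume "Ms (m + q - 1)"
      moreover have "m + q - 1 + j = m + j - 1 + q" using j2 q4 by simp
      ultimately show False using AM1[of "m + q - 1"] Mq[of "m + j - 1"] \<open>Ms (m + j - 1)\<close> by simp
    qed
    moreover have "m + q - 1 + 2 = m + 1 + q" using q4 by simp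
    ultimately show False using pair[of 2 "m + q - 1"] Mq[of "m + 1"] n2 j3 by simp
  qed
qed

end

end

lemma Pi0_next_special:
  assumes "is_cox_word (s # \<rho>)" "\<theta> \<in> real_roots A" "nonneg \<theta>" "\<theta> $ s = 0" "k > 0"
    "D - D $ s *\<^sub>R sroot s = k *\<^sub>R \<theta>" "x \<in> Pi0 (s # \<rho>)"
  shows "K x (wprod A (s # \<rho>) x) < 0"
proof -
  obtain j where j: "0 < j" "2 * j \<le> per (s # \<rho>) x"
    "\<And>n. n < per (s # \<rho>) x \<Longrightarrow> cartan_int x ((wprod A (s # \<rho>) ^^ n) x) =
      (if n = 0 then 2 else 0) - (if n = j then 1 else 0) - (if n = per (s # \<rho>) x - j then 1 else 0)"
    using kk_form[OF assms(1,7)] by blast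
  have "j = 1" by (rule step_one[OF refl assms j])
  then have "cartan_int x ((wprod A (s # \<rho>) ^^ 1) x) < 0"
    using j(3)[of 1] per_ge2[OF assms(1,7)] by simp
  then show ?thesis using Kxx[OF assms(1,7)] by (simp add: cartan_int_def divide_less_0_iff del: wprod_Cons)
qed

text \<open>The claim and the set of indecomposable roots are carried along by moves, so the special
  node may be rotated to the front.\<close>

theorem Pi0_next:
  assumes "is_cox_word \<pi>" "x \<in> Pi0 \<pi>"
  shows "K x (wprod A \<pi> x) < 0"
proof -
  obtain s \<theta> k where sp: "\<theta> \<in> real_roots A" "nonneg \<theta>" "\<theta> $ s = 0" "k > 0"
    "D - D $ s *\<^sub>R sroot s = k *\<^sub>R \<theta>" by (rule special_node)
  have "is_cox_word (a @ s # b) \<Longrightarrow> x \<in> Pi0 (a @ s # b) \<Longrightarrow> K x (wprod A (a @ s # b) x) < 0" for a b x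
  proof (induction a arbitrary: b x)
    case Nil
    then show ?case using Pi0_next_special[of s b \<theta> k x] sp by simp
  next
    case (Cons t a)
    have c: "is_cox_word (t # (a @ s # b))" using Cons.prems by simp
    then have "is_cox_word (a @ s # (b @ [t]))" using cox_rotate[of t "a @ s # b"] by simp
    moreover have "S t x \<in> Pi0 (a @ s # (b @ [t]))" using Pi0_move[OF c, of x] Cons.prems(2) by simp
    ultimately have "K (S t x) (wprod A (a @ s # (b @ [t])) (S t x)) < 0" by (rule Cons.IH)
    then show ?case using K_S[of t x] by (simp add: K_S_left)
  qed
  moreover obtain a b where "\<pi> = a @ s # b" using assms(1) split_list[of s \<pi>] by (auto simp: is_cox_word_def)
  ultimately show ?thesis using assms by blast
qed

context
  fixes \<pi> x
  assumes cx: "is_cox_word \<pi>" and xP: "x \<in> Pi0 \<pi>"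
begin

text \<open>The Cartan integers of a cycle on which \<open>c\<close> rotates by one. For an orbit of
  length 2 both subtracted terms hit n = 1 and give -2.\<close>

lemma cartan_int_orbit:
  assumes "n < per \<pi> x"
  shows "cartan_int x ((wprod A \<pi> ^^ n) x) = (if n = 0 then 2 else 0) - (if n = 1 then 1 else 0) - (if n = per \<pi> x - 1 then 1 else 0)"
proof -
  obtain j where j: "0 < j" "2 * j \<le> per \<pi> x"
    "\<And>n. n < per \<pi> x \<Longrightarrow> cartan_int x ((wprod A \<pi> ^^ n) x) =
      (if n = 0 then 2 else 0) - (if n = j then 1 else 0) - (if n = per \<pi> x - j then 1 else 0)"
    using kk_form[OF cx xP] by blast
  have "cartan_int x ((wprod A \<pi> ^^ 1) x) < 0"
    using Pi0_next[OF cx xP] Kxx[OF cx xP] by (simp add: cartan_int_def divide_less_0_iff)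
  then have "j = 1 \<or> per \<pi> x - j = 1" using j(3)[of 1] per_ge2[OF cx xP] by (auto split: if_splits)
  then have "j = 1" using j(1,2) by auto
  then show ?thesis using j(3)[OF assms] by simp
qed

text \<open>E is oriented, unlike K: with \<open>x\<close> on the left it sees \<open>x\<close> and
  its predecessor, with \<open>x\<close> on the right \<open>x\<close> and its successor.\<close>

lemma euler_orbit:
  assumes "n < per \<pi> x"
  shows "euler \<pi> x ((wprod A \<pi> ^^ n) x) = K x x / 2 * ((if n = 0 then 1 else 0) - (if n = per \<pi> x - 1 then 1 else 0))"
    and "euler \<pi> ((wprod A \<pi> ^^ n) x) x = K x x / 2 * ((if n = 0 then 1 else 0) - (if n = 1 then 1 else 0))"
proof -
  have r2: "per \<pi> x \<ge> 2" by (rule per_ge2[OF cx xP])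
  have "2 * euler \<pi> x ((wprod A \<pi> ^^ n) x) / K x x = (if n = 0 then 1 else 0) - (if n = per \<pi> x - 1 then 1 else 0)"
    using assms
  proof (induction n)
    case 0 then show ?case using FF_0[OF cx xP] r2 by simp
  next
    case (Suc n)
    then show ?case using FF_Suc[OF cx xP, of n] cartan_int_orbit[of "Suc n"] r2 by (auto simp del: funpow.simps)
  qed
  then show 1: "euler \<pi> x ((wprod A \<pi> ^^ n) x) = K x x / 2 * ((if n = 0 then 1 else 0) - (if n = per \<pi> x - 1 then 1 else 0))"
    using Kxx[OF cx xP] by (simp add: field_simps)
  have "K x ((wprod A \<pi> ^^ n) x) = K x x / 2 * cartan_int x ((wprod A \<pi> ^^ n) x)"
    using Kxx[OF cx xP] by (simp add: cartan_int_def)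
  then have "euler \<pi> ((wprod A \<pi> ^^ n) x) x = K x x / 2 * cartan_int x ((wprod A \<pi> ^^ n) x)
      - K x x / 2 * ((if n = 0 then 1 else 0) - (if n = per \<pi> x - 1 then 1 else 0))"
    using euler_add[OF cx, of x "(wprod A \<pi> ^^ n) x"] 1 by linarith
  then show "euler \<pi> ((wprod A \<pi> ^^ n) x) x = K x x / 2 * ((if n = 0 then 1 else 0) - (if n = 1 then 1 else 0))"
    unfolding cartan_int_orbit[OF assms] right_diff_distrib[symmetric] by (auto simp: algebra_simps)
qed

text \<open>K vanishes between the orbits, which makes E(y, c^n x) independent of n; summing over
  the orbit gives a multiple of E(y, D) = 0.\<close>

lemma euler_outside:
  assumes y: "y \<in> Pi0 \<pi>" "y \<notin> orb \<pi> x"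
  shows "euler \<pi> y x = 0"
proof -
  have K0: "K y ((wprod A \<pi> ^^ n) x) = 0" for n by (rule K_outside_orbit[OF cx xP y])
  have c: "euler \<pi> y ((wprod A \<pi> ^^ n) x) = euler \<pi> y x" for n
  proof (induction n)
    case (Suc n)
    have "euler \<pi> ((wprod A \<pi> ^^ Suc n) x) y = - euler \<pi> y ((wprod A \<pi> ^^ n) x)" by (simp add: euler_cox[OF cx])
    then show ?case using euler_add[OF cx, of y "(wprod A \<pi> ^^ Suc n) x"] K0[of "Suc n"] Suc by linarith
  qed simp
  obtain t where t: "(\<Sum>k<per \<pi> x. (wprod A \<pi> ^^ k) x) = t *\<^sub>R D" using orbit_sum[OF cx xP] by blast
  have "per \<pi> x * euler \<pi> y x = euler \<pi> y (\<Sum>k<per \<pi> x. (wprod A \<pi> ^^ k) x)"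
    by (simp add: euler_sum_right c)
  also have "\<dots> = t * euler \<pi> y D" unfolding t by simp
  also have "euler \<pi> y D = 0" using euler_D_swap[OF cx, of y] Pi0_tube[OF y(1)] by (simp add: tube_def)
  finally show ?thesis using per_props(1)[OF cx xP] by simp
qed

end

end

section \<open>Arcs of orbits\<close>

context affine_cartan begin

lemma height_less:
  assumes "integral_vec a" "integral_vec b" "nonneg b" "nonneg (a - b)" "a \<noteq> b"
  shows "height b < height a"
proof -
  have ints: "(\<Sum>i\<in>UNIV. a $ i) \<in> \<int>" "(\<Sum>i\<in>UNIV. b $ i) \<in> \<int>"
    using assms(1,2) by (auto simp: integral_vec_def)
  then obtain k l :: int where kl: "(\<Sum>i\<in>UNIV. a $ i) = of_int k" "(\<Sum>i\<in>UNIV. b $ i) = of_int l"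
    by (auto elim!: Ints_cases)
  have "(\<Sum>i\<in>UNIV. (a - b) $ i) \<noteq> 0"
    using assms(4,5) by (subst sum_nonneg_eq_0_iff) (auto simp: nonneg_def vec_eq_iff)
  moreover have "(\<Sum>i\<in>UNIV. (a - b) $ i) \<ge> 0" using assms(4) by (intro sum_nonneg) (simp add: nonneg_def)
  ultimately have "(\<Sum>i\<in>UNIV. b $ i) < (\<Sum>i\<in>UNIV. a $ i)" by (simp add: sum_subtractf)
  moreover have "(\<Sum>i\<in>UNIV. b $ i) \<ge> 0" using assms(3) by (intro sum_nonneg) (simp add: nonneg_def)
  ultimately show ?thesis using kl by (simp add: height_def)
qed

text \<open>If the reflection made \<alpha> negative, the indecomposable \<open>p\<close> would be a
  positive combination of \<alpha> and another cone element, contrary to extremality.\<close>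

lemma tube_reflect:
  assumes c: "is_cox_word \<pi>" and a: "\<alpha> \<in> tube \<pi>" "\<alpha> \<notin> Pi0 \<pi>" and p: "p \<in> Pi0 \<pi>" "K \<alpha> p > 0"
  shows "reflect p \<alpha> \<in> tube \<pi>" "height (reflect p \<alpha>) < height \<alpha>"
proof -
  have r: "\<alpha> \<in> real_roots A" "p \<in> real_roots A" using tube_real[OF a(1)] Pi0_real[OF p(1)] by auto
  have t: "\<alpha> \<in> tube_cone \<pi>" using a by (simp add: tube_cone_def)
  define \<beta> where "\<beta> = reflect p \<alpha>"
  define e where "e = cartan_int p \<alpha>"
  have e: "e > 0" using p(2) real_norm_pos[OF r(2)] by (simp add: e_def cartan_int_def K_sym[of p \<alpha>])
  have be: "\<beta> = \<alpha> - e *\<^sub>R p" by (simp add: \<beta>_def reflect_def e_def)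
  have br: "\<beta> \<in> real_roots A" using reflect_real[OF r(2,1)] by (simp add: \<beta>_def)
  have E0: "euler \<pi> D \<alpha> = 0" "euler \<pi> D p = 0" using a Pi0_tube[OF p(1)] by (auto simp: tube_def)
  then have bE: "euler \<pi> D \<beta> = 0" by (simp add: be)
  have "nonneg \<beta>"
  proof (rule ccontr)
    assume "\<not> nonneg \<beta>"
    then have "nonneg (- \<beta>)" using root_sign[OF br] by blast
    then have mb: "- \<beta> \<in> tube_cone \<pi>" using br bE by (simp add: tube_cone_def tube_def)
    have "p = (1 / e) *\<^sub>R \<alpha> + (1 / e) *\<^sub>R (- \<beta>)" using e by (simp add: be algebra_simps)
    also have "\<dots> \<in> nnspan {\<alpha>, - \<beta>}"
      using e by (intro nnspan_add nnspan_scale nnspan_base) auto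
    finally have "p \<in> {\<alpha>, - \<beta>}" using Pi0_nnspan[OF c p(1), of "{\<alpha>, - \<beta>}"] t mb by blast
    then have "p = - \<beta>" using a(2) p(1) by auto
    then have "\<alpha> = (e - 1) *\<^sub>R p" by (simp add: be algebra_simps)
    then have "e - 1 = 1 \<or> e - 1 = - 1" using real_proportional[OF r(2), of "e - 1"] r(1) by simp
    then show False using \<open>\<alpha> = (e - 1) *\<^sub>R p\<close> a(2) p(1) e by auto
  qed
  then show "reflect p \<alpha> \<in> tube \<pi>" using br bE by (simp add: tube_def \<beta>_def)
  have "height \<beta> < height \<alpha>"
  proof (rule height_less)
    show "nonneg (\<alpha> - \<beta>)" using e Pi0_tube[OF p(1)] by (simp add: be tube_def nonneg_scale)
    show "\<alpha> \<noteq> \<beta>" using e real_nonzero[OF r(2)] by (simp add: be)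
  qed (use r br \<open>nonneg \<beta>\<close> real_integral in auto)
  then show "height (reflect p \<alpha>) < height \<alpha>" by (simp add: \<beta>_def)
qed

definition orbit_arc :: "'i list \<Rightarrow> real ^ 'i \<Rightarrow> nat \<Rightarrow> real ^ 'i" where
  "orbit_arc \<pi> x l = (\<Sum>i<l. (wprod A \<pi> ^^ i) x)"

lemma per_shift:
  assumes "is_cox_word \<pi>" "x \<in> Pi0 \<pi>"
  shows "per \<pi> ((wprod A \<pi> ^^ n) x) = per \<pi> x"
proof -
  have "(wprod A \<pi> ^^ m) ((wprod A \<pi> ^^ n) x) = (wprod A \<pi> ^^ n) x \<longleftrightarrow> (wprod A \<pi> ^^ m) x = x" for m
  proof -
    have "(wprod A \<pi> ^^ m) ((wprod A \<pi> ^^ n) x) = (wprod A \<pi> ^^ (m + n)) x" by (simp add: funpow_add)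
    also have "\<dots> = (wprod A \<pi> ^^ n) ((wprod A \<pi> ^^ m) x)" by (subst add.commute) (simp add: funpow_add)
    finally show ?thesis by (simp add: funpow_inj)
  qed
  then show ?thesis by (simp add: per_def)
qed

text \<open>The last two terms are the wrap-around of the cycle; for period 2 they add to the
  neighbour terms.\<close>

lemma cartan_int_pair:
  assumes "is_cox_word \<pi>" "x \<in> Pi0 \<pi>" "t < per \<pi> x" "i < per \<pi> x"
  shows "cartan_int ((wprod A \<pi> ^^ t) x) ((wprod A \<pi> ^^ i) x) =
    (if i = t then 2 else 0) - (if i = t + 1 then 1 else 0) - (if t = i + 1 then 1 else 0)
    - (if t = 0 \<and> i = per \<pi> x - 1 then 1 else 0) - (if i = 0 \<and> t = per \<pi> x - 1 then 1 else 0)"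
proof -
  let ?X = "\<lambda>n. (wprod A \<pi> ^^ n) x" and ?r = "per \<pi> x"
  have r2: "?r \<ge> 2" using per_ge2[OF assms(1,2)] .
  have n: "K (?X t) (?X t) = K x x" by (simp add: funpow_K)
  have s: "cartan_int (?X t) (?X i) = 2 * K (?X t) (?X i) / K x x" by (simp add: cartan_int_def n)
  show ?thesis
  proof (cases "t \<le> i")
    case True
    have "K (?X t) (?X i) = K x (?X (i - t))" using K_X[OF assms(1,2), of t 0 "i - t"] True by simp
    then have e: "cartan_int (?X t) (?X i) = cartan_int x (?X (i - t))" unfolding s cartan_int_def[of x] by simp
    have "i - t < ?r" using assms(4) by simp
    note o = cartan_int_orbit[OF assms(1,2) this]
    have "i - t = 0 \<longleftrightarrow> i = t" "i - t = 1 \<longleftrightarrow> i = t + 1" "i - t = ?r - 1 \<longleftrightarrow> t = 0 \<and> i = ?r - 1"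
      "\<not> t = i + 1" "\<not> (i = 0 \<and> t = ?r - 1)"
      using True assms(3,4) r2 by linarith+
    then show ?thesis unfolding e o by (simp only: if_False diff_zero)
  next
    case False
    have "K (?X t) (?X i) = K (?X (t - i)) x" using K_X[OF assms(1,2), of i "t - i" 0] False by simp
    then have e: "cartan_int (?X t) (?X i) = cartan_int x (?X (t - i))" unfolding s cartan_int_def[of x] by (simp add: K_sym[of "?X (t - i)" x])
    have "t - i < ?r" using assms(3) by simp
    note o = cartan_int_orbit[OF assms(1,2) this]
    have "\<not> t - i = 0" "\<not> i = t" "t - i = 1 \<longleftrightarrow> t = i + 1" "t - i = ?r - 1 \<longleftrightarrow> i = 0 \<and> t = ?r - 1"
      "\<not> i = t + 1" "\<not> (t = 0 \<and> i = ?r - 1)"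
      using False assms(3,4) r2 by linarith+
    then show ?thesis unfolding e o by (simp only: if_False diff_zero)
  qed
qed

lemma cartan_int_sum: "cartan_int x (sum g B) = (\<Sum>y\<in>B. cartan_int x (g y))"
  by (simp add: cartan_int_def K_sum_right sum_distrib_left sum_divide_distrib)

text \<open>Elements of the arc pair nonnegatively with it. Only the neighbours just after and just
  before it pair negatively, and they coincide exactly when the arc omits a single point.\<close>

lemma cartan_int_arc:
  assumes "is_cox_word \<pi>" "x \<in> Pi0 \<pi>" "t < per \<pi> x" "0 < l" "l < per \<pi> x" "cartan_int ((wprod A \<pi> ^^ t) x) (orbit_arc \<pi> x l) < 0"
  shows "t = l \<or> t = per \<pi> x - 1"
    and "cartan_int ((wprod A \<pi> ^^ t) x) (orbit_arc \<pi> x l) = (if l = per \<pi> x - 1 then - 2 else - 1)"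
proof -
  let ?r = "per \<pi> x"
  have r2: "?r \<ge> 2" using per_ge2[OF assms(1,2)] .
  have "cartan_int ((wprod A \<pi> ^^ t) x) (orbit_arc \<pi> x l) = (\<Sum>i<l.
    (if i = t then 2 else 0) - (if i = t + 1 then 1 else 0) - (if t = i + 1 then 1 else 0)
    - (if t = 0 \<and> i = ?r - 1 then 1 else 0) - (if i = 0 \<and> t = ?r - 1 then 1 else 0))"
    unfolding orbit_arc_def cartan_int_sum using assms by (intro sum.cong refl cartan_int_pair) auto
  also have "\<dots> = (\<Sum>i<l. if i = t then 2 else 0) - (\<Sum>i<l. if i = t + 1 then 1 else 0)
     - (\<Sum>i<l. if t = i + 1 then 1 else 0) - (\<Sum>i<l. if t = 0 \<and> i = ?r - 1 then 1 else 0)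
     - (\<Sum>i<l. if i = 0 \<and> t = ?r - 1 then 1 else 0)"
    by (simp only: sum_subtractf)
  also have "(\<Sum>i<l. if t = i + 1 then 1 else 0 :: real) = (if 0 < t \<and> t \<le> l then 1 else 0)"
  proof (cases t)
    case (Suc u) then show ?thesis by (simp add: Suc_le_eq)
  qed simp
  also have "(\<Sum>i<l. if t = 0 \<and> i = ?r - 1 then 1 else 0 :: real) = 0"
    using assms(5) by (intro sum.neutral) auto
  also have "(\<Sum>i<l. if i = 0 \<and> t = ?r - 1 then 1 else 0 :: real) = (if t = ?r - 1 then 1 else 0)"
    using assms(4) by (cases "t = ?r - 1") auto
  finally have e: "cartan_int ((wprod A \<pi> ^^ t) x) (orbit_arc \<pi> x l) = (if t < l then 2 else 0) - (if t + 1 < l then 1 else 0)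
      - (if 0 < t \<and> t \<le> l then 1 else 0) - (if t = ?r - 1 then 1 else 0)"
    by simp
  then show "t = l \<or> t = ?r - 1" using assms(3,5,6) r2 by (auto split: if_splits)
  then show "cartan_int ((wprod A \<pi> ^^ t) x) (orbit_arc \<pi> x l) = (if l = ?r - 1 then - 2 else - 1)"
    using e assms(3,4,5) r2 by auto
qed

lemma arc_tD: "is_cox_word \<pi> \<Longrightarrow> x \<in> Pi0 \<pi> \<Longrightarrow> \<exists>t>0. orbit_arc \<pi> x (per \<pi> x) = t *\<^sub>R D"
  using orbit_sum[of \<pi> x] by (simp add: orbit_arc_def)

text \<open>Lower \<alpha> by a reflection in an indecomposable \<open>p\<close>. The power of
  \<open>c\<close> that kills the affine coordinate of \<alpha> kills that of the smaller root too,
  so by induction that root is an arc, and \<open>p\<close> is one of its neighbours. Adding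
  \<open>p\<close> cannot close the cycle, because a full arc is a positive multiple of D and D has
  affine coordinate 1.\<close>

theorem Upsilon_re_arc:
  assumes c: "is_cox_word \<pi>" and "\<alpha> \<in> Upsilon_re A d aff (wprod A \<pi>)"
  obtains x l where "x \<in> Pi0 \<pi>" "0 < l" "l < per \<pi> x" "\<alpha> = orbit_arc \<pi> x l"
proof -
  let ?c = "wprod A \<pi>"
  have "\<exists>x l. x \<in> Pi0 \<pi> \<and> 0 < l \<and> l < per \<pi> x \<and> \<alpha> = orbit_arc \<pi> x l"
    if "\<alpha> \<in> tube \<pi>" "(?c ^^ n) \<alpha> $ aff = 0" for \<alpha> n
    using that
  proof (induction "height \<alpha>" arbitrary: \<alpha> rule: less_induct)
    case less
    show ?case
    proof (cases "\<alpha> \<in> Pi0 \<pi>")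
      case True
      then show ?thesis using per_ge2[OF c True] by (intro exI[of _ \<alpha>] exI[of _ 1]) (simp add: orbit_arc_def)
    next
      case False
      obtain p where p: "p \<in> Pi0 \<pi>" "K \<alpha> p > 0" using tube_positive_partner[OF less.prems(1)] by blast
      define \<beta> where "\<beta> = reflect p \<alpha>"
      define e where "e = cartan_int p \<alpha>"
      have pn: "K p p > 0" using real_norm_pos[OF Pi0_real[OF p(1)]] .
      have e0: "e > 0" using p(2) pn by (simp add: e_def cartan_int_def K_sym[of p \<alpha>])
      have ab: "\<alpha> = \<beta> + e *\<^sub>R p" by (simp add: \<beta>_def reflect_def e_def)
      have b: "\<beta> \<in> tube \<pi>" "height \<beta> < height \<alpha>" using tube_reflect[OF c less.prems(1) False p] by (auto simp: \<beta>_def)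
      have nn: "(?c ^^ n) y $ aff \<ge> 0" if "y \<in> tube \<pi>" for y
        using tube_funpow[OF c that, of n] by (simp add: tube_def nonneg_def)
      have "(?c ^^ n) \<alpha> $ aff = (?c ^^ n) \<beta> $ aff + e * (?c ^^ n) p $ aff"
        by (subst ab) (simp add: funpow_simps)
      moreover have "e * (?c ^^ n) p $ aff \<ge> 0" using nn[OF Pi0_tube[OF p(1)]] e0 by simp
      ultimately have bn: "(?c ^^ n) \<beta> $ aff = 0" "e * (?c ^^ n) p $ aff = 0"
        using nn[OF b(1)] less.prems(2) by linarith+
      obtain x l where xl: "x \<in> Pi0 \<pi>" "0 < l" "l < per \<pi> x" "\<beta> = orbit_arc \<pi> x l"
        using less.hyps[OF b(2,1) bn(1)] by blast
      have cb: "cartan_int p \<beta> = - e"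
        using cartan_int_self[OF Pi0_real[OF p(1)]] by (simp add: \<beta>_def reflect_def e_def)
      have "p \<in> orb \<pi> x"
      proof (rule ccontr)
        assume "p \<notin> orb \<pi> x"
        then have "K p \<beta> = 0"
          unfolding xl(4) orbit_arc_def K_sum_right using K_outside_orbit[OF c xl(1) p(1)] by simp
        then show False using cb e0 by (simp add: cartan_int_def)
      qed
      then obtain m where "p = (?c ^^ m) x" by (auto simp: orb_def)
      then have pt: "p = (?c ^^ (m mod per \<pi> x)) x" using X_mod[OF c xl(1), of m] by simp
      define t where "t = m mod per \<pi> x"
      have t: "t < per \<pi> x" "p = (?c ^^ t) x" using pt per_props(1)[OF c xl(1)] by (auto simp: t_def)
      have neg: "cartan_int ((?c ^^ t) x) (orbit_arc \<pi> x l) < 0" using cb e0 t(2) xl(4) by simp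
      note ca = cartan_int_arc[OF c xl(1) t(1) xl(2,3) neg]
      obtain w where w: "w > 0" "orbit_arc \<pi> x (per \<pi> x) = w *\<^sub>R D" using arc_tD[OF c xl(1)] by blast
      have arcS: "orbit_arc \<pi> x (Suc l) = orbit_arc \<pi> x l + (?c ^^ l) x" by (simp add: orbit_arc_def)
      have lr: "l \<noteq> per \<pi> x - 1"
      proof
        assume l: "l = per \<pi> x - 1"
        then have "t = l" using ca(1) by simp
        have "e = 2" using ca(2) cb l t(2) xl(4) by simp
        then have "\<alpha> = orbit_arc \<pi> x (Suc l) + p" using ab arcS t(2) xl(4) \<open>t = l\<close> by (simp add: scaleR_2)
        also have "Suc l = per \<pi> x" using l xl(3) by simp
        finally have "\<alpha> = w *\<^sub>R D + p" using w by simp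
        then have "(?c ^^ n) \<alpha> = w *\<^sub>R D + (?c ^^ n) p" by (simp add: funpow_simps) (simp add: funpow_wprod)
        then have "(?c ^^ n) \<alpha> $ aff = w + (?c ^^ n) p $ aff" by (simp add: delta_aff)
        then show False using w(1) nn[OF Pi0_tube[OF p(1)]] less.prems(2) by simp
      qed
      then have "e = 1" using ca(2) cb t(2) xl(4) by simp
      then have abp: "\<alpha> = orbit_arc \<pi> x l + p" using ab xl(4) by simp
      have lr': "Suc l < per \<pi> x" using lr xl(3) by simp
      from ca(1) show ?thesis
      proof
        assume "t = l"
        then have "\<alpha> = orbit_arc \<pi> x (Suc l)" using abp arcS t(2) by simp
        then show ?thesis using xl(1) lr' by blast
      next
        \<comment> \<open>Here \<open>p\<close> precedes the arc, so the longer arc is indexed from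
          \<open>p\<close>.\<close>
        assume t1: "t = per \<pi> x - 1"
        have cp': "?c p = x"
        proof -
          have "?c p = (?c ^^ Suc t) x" by (simp add: t(2))
          also have "Suc t = per \<pi> x" using t1 xl(3) by simp
          finally show ?thesis using per_props(2)[OF c xl(1)] by simp
        qed
        have "orbit_arc \<pi> p (Suc l) = p + (\<Sum>i<l. (?c ^^ Suc i) p)"
          unfolding orbit_arc_def by (subst sum.lessThan_Suc_shift) simp
        also have "(\<Sum>i<l. (?c ^^ Suc i) p) = orbit_arc \<pi> x l"
          unfolding orbit_arc_def by (intro sum.cong refl) (simp add: funpow_swap1 cp')
        finally have "\<alpha> = orbit_arc \<pi> p (Suc l)" using abp by simp
        moreover have "per \<pi> p = per \<pi> x" using per_shift[OF c xl(1), of t] t(2) by simp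
        ultimately show ?thesis using p(1) lr' by (intro exI[of _ p] exI[of _ "Suc l"]) simp
      qed
    qed
  qed
  then show ?thesis using that assms(2) unfolding Upsilon_re_iff[OF c] by blast
qed

section \<open>Components and tube supports as orbits and arcs\<close>

lemma orb_eq: "is_cox_word \<pi> \<Longrightarrow> x \<in> Pi0 \<pi> \<Longrightarrow> orb \<pi> x = (\<lambda>k. (wprod A \<pi> ^^ k) x) ` {..<per \<pi> x}"
proof (intro equalityI subsetI)
  assume a: "is_cox_word \<pi>" "x \<in> Pi0 \<pi>"
  fix y assume "y \<in> orb \<pi> x"
  then obtain k where "y = (wprod A \<pi> ^^ k) x" by (auto simp: orb_def)
  then have "y = (wprod A \<pi> ^^ (k mod per \<pi> x)) x" using X_mod[OF a, of k] by simp
  then show "y \<in> (\<lambda>k. (wprod A \<pi> ^^ k) x) ` {..<per \<pi> x}" using per_props(1)[OF a] by auto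
qed (auto simp: orb_def)

lemma orb_inj: "is_cox_word \<pi> \<Longrightarrow> x \<in> Pi0 \<pi> \<Longrightarrow> inj_on (\<lambda>k. (wprod A \<pi> ^^ k) x) {..<per \<pi> x}"
  by (rule inj_onI) (simp add: X_eq)

lemma orb_shift:
  assumes "is_cox_word \<pi>" "x \<in> Pi0 \<pi>"
  shows "orb \<pi> ((wprod A \<pi> ^^ n) x) = orb \<pi> x"
proof (intro equalityI subsetI)
  fix y assume "y \<in> orb \<pi> ((wprod A \<pi> ^^ n) x)"
  then show "y \<in> orb \<pi> x" by (auto simp: orb_def simp flip: funpow_add[unfolded comp_def, THEN fun_cong])
next
  fix y assume "y \<in> orb \<pi> x"
  then obtain k where k: "y = (wprod A \<pi> ^^ k) x" by (auto simp: orb_def)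
  define r where "r = per \<pi> x"
  have "r > 0" using per_props(1)[OF assms] by (simp add: r_def)
  then have "n \<le> n * r" by simp
  then have e: "(k + n * r - n) + n = k + n * r" by linarith
  have "y = (wprod A \<pi> ^^ (k + n * r)) x" using X_shift[OF assms, of k n] k by (simp add: r_def)
  also have "\<dots> = (wprod A \<pi> ^^ ((k + n * r - n) + n)) x" by (simp only: e)
  also have "\<dots> = (wprod A \<pi> ^^ (k + n * r - n)) ((wprod A \<pi> ^^ n) x)"
    by (simp only: funpow_add comp_apply)
  finally show "y \<in> orb \<pi> ((wprod A \<pi> ^^ n) x)" by (auto simp: orb_def)
qed

lemma orb_P: "is_cox_word \<pi> \<Longrightarrow> x \<in> Pi0 \<pi> \<Longrightarrow> y \<in> orb \<pi> x \<Longrightarrow> y \<in> Pi0 \<pi>"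
  by (auto simp: orb_def Pi0_funpow)

lemma orb_mem_eq: "is_cox_word \<pi> \<Longrightarrow> x \<in> Pi0 \<pi> \<Longrightarrow> y \<in> orb \<pi> x \<Longrightarrow> orb \<pi> y = orb \<pi> x"
  using orb_shift by (metis (no_types, lifting) orb_def rangeE)

lemma orb_self: "x \<in> orb \<pi> x"
  unfolding orb_def by (rule range_eqI[of _ _ 0]) simp

text \<open>Consecutive orbit elements are joined because the step is one; different orbits are
  K-orthogonal.\<close>

lemma tube_comps_eq:
  assumes c: "is_cox_word \<pi>" and ne: "tube \<pi> \<noteq> {}"
  shows "tube_comps A d aff (wprod A \<pi>) = orb \<pi> ` Pi0 \<pi>"
proof -
  define R where "R = (\<lambda>x y. x \<in> Pi0 \<pi> \<and> y \<in> Pi0 \<pi> \<and> K x y \<noteq> 0)"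
  have "{y \<in> Pi0 \<pi>. R\<^sup>*\<^sup>* x y} = orb \<pi> x" if x: "x \<in> Pi0 \<pi>" for x
  proof (intro equalityI subsetI)
    fix y assume "y \<in> {y \<in> Pi0 \<pi>. R\<^sup>*\<^sup>* x y}"
    then have "R\<^sup>*\<^sup>* x y" by simp
    then show "y \<in> orb \<pi> x"
    proof (induction rule: rtranclp_induct)
      case base show ?case by (rule orb_self)
    next
      case (step y z)
      show ?case
      proof (rule ccontr)
        assume "z \<notin> orb \<pi> x"
        moreover obtain n where "y = (wprod A \<pi> ^^ n) x" using step.IH by (auto simp: orb_def)
        ultimately have "K z y = 0" using K_outside_orbit[OF c x] step(2) by (auto simp: R_def)
        then show False using step(2) by (simp add: R_def K_sym[of z y])
      qed
    qed
  next
    fix y assume y: "y \<in> orb \<pi> x"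
    then obtain n where n: "y = (wprod A \<pi> ^^ n) x" by (auto simp: orb_def)
    have "R\<^sup>*\<^sup>* x ((wprod A \<pi> ^^ n) x)" for n
    proof (induction n)
      case (Suc n)
      have "R ((wprod A \<pi> ^^ n) x) ((wprod A \<pi> ^^ Suc n) x)"
        using Pi0_next[OF c Pi0_funpow[OF c x, of n]] Pi0_funpow[OF c x, of n] Pi0_funpow[OF c x, of "Suc n"]
        by (simp add: R_def)
      then show ?case using Suc by (meson rtranclp.rtrancl_into_rtrancl)
    qed simp
    then show "y \<in> {y \<in> Pi0 \<pi>. R\<^sup>*\<^sup>* x y}" using n orb_P[OF c x y] by simp
  qed
  then show ?thesis
    unfolding tube_comps_def Let_def Pi_c_eq[OF c ne] R_def[symmetric] by auto
qed

text \<open>Pairing a relation with the orbit makes its coefficients harmonic and periodic, hence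
  constant, and the orbit sum is a nonzero multiple of D.\<close>

lemma orb_independent:
  assumes c: "is_cox_word \<pi>" and x: "x \<in> Pi0 \<pi>" and z: "(\<Sum>y\<in>orb \<pi> x. g y *\<^sub>R y) = 0"
  shows "\<forall>y\<in>orb \<pi> x. g y = 0"
proof -
  let ?X = "\<lambda>n. (wprod A \<pi> ^^ n) x"
  define r where "r = per \<pi> x"
  have r2: "r \<ge> 2" using per_ge2[OF c x] by (simp add: r_def)
  define h where "h n = g (?X n)" for n
  have hp: "h (n mod r) = h n" for n using X_mod[OF c x, of n] by (simp add: h_def r_def)
  have s: "(\<Sum>i<r. h i *\<^sub>R ?X i) = 0"
    using z unfolding orb_eq[OF c x] by (subst (asm) sum.reindex[OF orb_inj[OF c x]]) (simp add: h_def r_def)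
  have pairs: "2 * h t = h (Suc t) + h (t + r - 1)" if t: "t < r" for t
  proof -
    have "0 = cartan_int (?X t) (\<Sum>i<r. h i *\<^sub>R ?X i)" unfolding s by simp
    also have "\<dots> = (\<Sum>i<r. h i * ((if i = t then 2 else 0) - (if i = t + 1 then 1 else 0) - (if t = i + 1 then 1 else 0)
      - (if t = 0 \<and> i = r - 1 then 1 else 0) - (if i = 0 \<and> t = r - 1 then 1 else 0)))"
      unfolding cartan_int_sum using t by (intro sum.cong refl) (simp add: cartan_int_pair[OF c x] r_def)
    also have "\<dots> = (\<Sum>i<r. if i = t then 2 * h i else 0) - (\<Sum>i<r. if i = t + 1 then h i else 0)
      - (\<Sum>i<r. if t = i + 1 then h i else 0) - (\<Sum>i<r. if t = 0 \<and> i = r - 1 then h i else 0)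
      - (\<Sum>i<r. if i = 0 \<and> t = r - 1 then h i else 0)"
      unfolding sum_subtractf[symmetric] by (intro sum.cong refl) auto
    also have "(\<Sum>i<r. if t = i + 1 then h i else 0) = (if 0 < t then h (t - 1) else 0)"
      using t by (cases t) auto
    also have "(\<Sum>i<r. if t = 0 \<and> i = r - 1 then h i else 0) = (if t = 0 then h (r - 1) else 0)"
      using r2 by (cases "t = 0") auto
    also have "(\<Sum>i<r. if i = 0 \<and> t = r - 1 then h i else 0) = (if t = r - 1 then h 0 else 0)"
      using r2 by (cases "t = r - 1") auto
    also have "(\<Sum>i<r. if i = t then 2 * h i else 0) = 2 * h t" using t by simp
    also have "(\<Sum>i<r. if i = t + 1 then h i else 0) = (if t + 1 < r then h (t + 1) else 0)" by simp
    finally have e: "0 = 2 * h t - (if t + 1 < r then h (t + 1) else 0) - (if 0 < t then h (t - 1) else 0)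
       - (if t = 0 then h (r - 1) else 0) - (if t = r - 1 then h 0 else 0)" .
    then have e: "2 * h t = (if t + 1 < r then h (t + 1) else 0) + (if 0 < t then h (t - 1) else 0)
       + (if t = 0 then h (r - 1) else 0) + (if t = r - 1 then h 0 else 0)" by linarith
    have tr: "t = r - 1 \<longleftrightarrow> \<not> t + 1 < r" using t by linarith
    have h1: "h (t + r - 1) = h (t - 1)" if "0 < t"
    proof -
      have "t + r - 1 = t - 1 + r" using that by simp
      then have "h (t + r - 1) = h ((t - 1 + r) mod r)" by (simp only: hp)
      also have "\<dots> = h (t - 1)" using hp[of "t - 1"] by simp
      finally show ?thesis .
    qed
    have h2: "h (Suc t) = h 0" if "\<not> t + 1 < r"
    proof -
      have "Suc t = r" using t that by simp
      then show ?thesis using hp[of r] by simp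
    qed
    show ?thesis
      using e h1 h2 unfolding tr by (cases "t = 0"; cases "t + 1 < r") simp_all
  qed
  have hpp: "h (n + r) = h n" for n using hp[of "n + r"] hp[of n] by simp
  have pairs': "2 * h (Suc n) = h (Suc (Suc n)) + h n" for n
  proof -
    define t where "t = Suc n mod r"
    have t: "t < r" using r2 by (simp add: t_def)
    have "h t = h (Suc n)" using hp[of "Suc n"] by (simp add: t_def)
    moreover have "h (Suc t) = h (Suc (Suc n))"
      by (metis hp mod_Suc_eq t_def)
    moreover have "h (t + r - 1) = h n"
    proof -
      have "(t + r - 1) mod r = (t + (r - 1)) mod r" using r2 by simp
      also have "\<dots> = (Suc n + (r - 1)) mod r" unfolding t_def by (rule mod_add_left_eq)
      also have "\<dots> = n mod r" using r2 by simp
      finally show ?thesis by (metis hp)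
    qed
    ultimately show ?thesis using pairs[OF t] by simp
  qed
  have hd: "h (Suc n) - h n = h 1 - h 0" for n
  proof (induction n)
    case (Suc n) then show ?case using pairs'[of n] by simp
  qed simp
  have hl: "h n = h 0 + n * (h 1 - h 0)" for n
  proof (induction n)
    case (Suc n) then show ?case using hd[of n] by (simp add: algebra_simps)
  qed simp
  have "real r * (h 1 - h 0) = 0" using hl[of r] hpp[of 0] by simp
  then have const: "h n = h 0" for n using hl[of n] r2 by simp
  obtain w where w: "w > 0" "(\<Sum>i<r. ?X i) = w *\<^sub>R D" using orbit_sum[OF c x] by (auto simp: r_def)
  have "(\<Sum>i<r. h i *\<^sub>R ?X i) = h 0 *\<^sub>R (\<Sum>i<r. ?X i)"
    unfolding scaleR_sum_right by (rule sum.cong[OF refl]) (metis const)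
  then have "h 0 *\<^sub>R (w *\<^sub>R D) = 0" using s w by simp
  then have "h 0 * w * D $ aff = 0" by (metis mult.assoc real_scaleR_def vector_scaleR_component zero_index)
  then have "h 0 = 0" using w(1) delta_aff by simp
  show ?thesis
  proof
    fix y assume "y \<in> orb \<pi> x"
    then obtain n where "y = ?X n" by (auto simp: orb_def)
    then show "g y = 0" using const[of n] \<open>h 0 = 0\<close> unfolding h_def by metis
  qed
qed

text \<open>Discharges the uniqueness in the definition of the support. Within one orbit it is
  linear independence; an expansion over another orbit would make \<alpha> K-orthogonal to
  itself.\<close>

lemma tube_supp_eq:
  assumes c: "is_cox_word \<pi>" and x: "x \<in> Pi0 \<pi>" and a: "\<alpha> = (\<Sum>y\<in>orb \<pi> x. f y *\<^sub>R y)" "K \<alpha> \<alpha> \<noteq> 0"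
  shows "tube_supp A d aff (wprod A \<pi>) \<alpha> = {y \<in> orb \<pi> x. f y \<noteq> 0}"
proof -
  have ne: "tube \<pi> \<noteq> {}" using Pi0_tube[OF x] by blast
  show ?thesis
    unfolding tube_supp_def tube_comps_eq[OF c ne]
  proof (rule the_equality)
    show "\<exists>C\<in>orb \<pi> ` Pi0 \<pi>. \<exists>g. \<alpha> = (\<Sum>x\<in>C. g x *\<^sub>R x) \<and> {y \<in> orb \<pi> x. f y \<noteq> 0} = {x \<in> C. g x \<noteq> 0}"
      using x a(1) by blast
  next
    fix T assume "\<exists>C\<in>orb \<pi> ` Pi0 \<pi>. \<exists>g. \<alpha> = (\<Sum>x\<in>C. g x *\<^sub>R x) \<and> T = {x \<in> C. g x \<noteq> 0}"
    then obtain x' g where g: "x' \<in> Pi0 \<pi>" "\<alpha> = (\<Sum>y\<in>orb \<pi> x'. g y *\<^sub>R y)" "T = {y \<in> orb \<pi> x'. g y \<noteq> 0}" by blast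
    show "T = {y \<in> orb \<pi> x. f y \<noteq> 0}"
    proof (cases "x' \<in> orb \<pi> x")
      case True
      then have o: "orb \<pi> x' = orb \<pi> x" using orb_mem_eq[OF c x] by blast
      have "(\<Sum>y\<in>orb \<pi> x. (g y - f y) *\<^sub>R y) = 0"
        using g(2) a(1) o by (simp add: scaleR_left_diff_distrib sum_subtractf)
      then have "\<forall>y\<in>orb \<pi> x. g y - f y = 0" by (rule orb_independent[OF c x])
      then show ?thesis using g(3) o by auto
    next
      case False
      have "K y z = 0" if "y \<in> orb \<pi> x'" "z \<in> orb \<pi> x" for y z
      proof -
        have "y \<in> Pi0 \<pi>" using orb_P[OF c g(1)] that by blast
        moreover have "y \<notin> orb \<pi> x"
        proof
          assume "y \<in> orb \<pi> x"
          then have "orb \<pi> x' = orb \<pi> x" using orb_mem_eq[OF c x, of y] orb_mem_eq[OF c g(1) that(1)] by simp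
          then show False using False orb_self by blast
        qed
        ultimately show ?thesis using K_outside_orbit[OF c x] that(2) by (auto simp: orb_def)
      qed
      then have "K (\<Sum>y\<in>orb \<pi> x'. g y *\<^sub>R y) (\<Sum>y\<in>orb \<pi> x. f y *\<^sub>R y) = 0"
        unfolding K_sum_left by (simp add: K_sum_right)
      then show ?thesis using a g(2) by simp
    qed
  qed
qed

end

section \<open>Compatibility degrees inside tubes\<close>

lemma interval_sum_telescope:
  fixes h :: "nat \<Rightarrow> real"
  shows "(\<Sum>k\<in>{b..<b + m}. h k - h (k + 1)) = h b - h (b + m)"
  by (induction m) simp_all

text \<open>The left side is what E gives after telescoping, the right side is the tube degree. Only
  the relative position of the end points matters: equal, nested, or overhanging on one side. The
  guards \<open>0 < b\<close> and \<open>0 < k\<close> compensate truncated subtraction.\<close>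

lemma interval_degree:
  fixes a l b m :: nat
  assumes "0 < l" "0 < m" and A: "A = {a..<a + l}" and B: "B = {b..<b + m}"
  shows "max (of_bool (b + m \<in> A) - of_bool (b \<in> A)) (of_bool (0 < b \<and> b - 1 \<in> A) - of_bool (b + m - 1 \<in> A))
    = (if A = B then - 1 else if A \<subset> B \<or> B \<subset> A then 0
       else real (card {k \<in> B. k \<notin> A \<and> (0 < k \<and> k - 1 \<in> A \<or> k + 1 \<in> A)}))"
proof -
  have eq: "A = B \<longleftrightarrow> a = b \<and> l = m"
  proof
    assume "A = B"
    then have "Min A = Min B" "card A = card B" by simp_all
    moreover have "Min A = a" "Min B = b"
      unfolding A B using assms(1,2) by (auto intro!: Min_eqI)
    ultimately show "a = b \<and> l = m" by (simp add: A B)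
  qed (simp add: A B)
  have sub: "A \<subseteq> B \<longleftrightarrow> b \<le> a \<and> a + l \<le> b + m" "B \<subseteq> A \<longleftrightarrow> a \<le> b \<and> b + m \<le> a + l"
    unfolding A B atLeastLessThan_subset_iff using assms(1,2) by auto
  have memA: "k \<in> A \<longleftrightarrow> a \<le> k \<and> k < a + l" and memB: "k \<in> B \<longleftrightarrow> b \<le> k \<and> k < b + m" for k
    by (auto simp: A B)
  have ends: "{k \<in> B. k \<notin> A \<and> (0 < k \<and> k - 1 \<in> A \<or> k + 1 \<in> A)}
      = (if a + l \<in> B then {a + l} else {}) \<union> (if 0 < a \<and> a - 1 \<in> B then {a - 1} else {})"
    using assms(1) by (auto simp: memA memB)
  have card: "card {k \<in> B. k \<notin> A \<and> (0 < k \<and> k - 1 \<in> A \<or> k + 1 \<in> A)}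
      = of_bool (a + l \<in> B) + of_bool (0 < a \<and> a - 1 \<in> B)"
    unfolding ends using assms(1) by auto
  consider (eq) "a = b" "l = m"
    | (sub) "b \<le> a" "a + l \<le> b + m" "\<not> (a = b \<and> l = m)"
    | (sup) "a \<le> b" "b + m \<le> a + l" "\<not> (a = b \<and> l = m)"
    | (left) "a < b" "a + l < b + m" | (right) "b < a" "b + m < a + l"
    by linarith
  then show ?thesis
  proof cases
    case eq
    then show ?thesis using assms(1,2) by (auto simp: \<open>A = B \<longleftrightarrow> a = b \<and> l = m\<close> memA)
  next
    case sub
    have "A \<noteq> B" "A \<subset> B" using sub \<open>A \<subseteq> B \<longleftrightarrow> _\<close> eq by auto
    then show ?thesis using sub assms(1,2) by (auto simp: memA)
  next
    case sup
    have "A \<noteq> B" "B \<subset> A" using sup \<open>B \<subseteq> A \<longleftrightarrow> _\<close> eq by auto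
    then show ?thesis using sup assms(1,2) by (auto simp: memA)
  next
    case left
    then have n: "A \<noteq> B" "\<not> A \<subset> B" "\<not> B \<subset> A" using eq sub by auto
    have "b + m \<notin> A" "b + m - 1 \<notin> A" "b \<in> A \<longleftrightarrow> b < a + l" "0 < b \<and> b - 1 \<in> A \<longleftrightarrow> b \<le> a + l"
      "a + l \<in> B \<longleftrightarrow> b \<le> a + l" "\<not> (0 < a \<and> a - 1 \<in> B)"
      unfolding memA memB using left assms(1,2) by linarith+
    then show ?thesis unfolding card using n by (cases "b < a + l"; cases "b \<le> a + l") simp_all
  next
    case right
    then have n: "A \<noteq> B" "\<not> A \<subset> B" "\<not> B \<subset> A" using eq sub by auto
    have "b \<notin> A" "\<not> (0 < b \<and> b - 1 \<in> A)" "b + m \<in> A \<longleftrightarrow> a \<le> b + m" "b + m - 1 \<in> A \<longleftrightarrow> a < b + m"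
      "a + l \<notin> B" "0 < a \<and> a - 1 \<in> B \<longleftrightarrow> a \<le> b + m"
      unfolding memA memB using right assms(1,2) by linarith+
    then show ?thesis unfolding card using n by (cases "a < b + m"; cases "a \<le> b + m") simp_all
  qed
qed

context affine_cartan begin

lemma arc_shift: "(wprod A \<pi> ^^ n) (orbit_arc \<pi> x l) = orbit_arc \<pi> ((wprod A \<pi> ^^ n) x) l"
proof -
  have "(wprod A \<pi> ^^ n) (orbit_arc \<pi> x l) = (\<Sum>i<l. (wprod A \<pi> ^^ n) ((wprod A \<pi> ^^ i) x))"
    unfolding orbit_arc_def using linear_sum[OF funpow_linear[OF wprod_linear]] by blast
  also have "\<dots> = (\<Sum>i<l. (wprod A \<pi> ^^ i) ((wprod A \<pi> ^^ n) x))"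
  proof (rule sum.cong[OF refl])
    fix i
    have "(wprod A \<pi> ^^ n) ((wprod A \<pi> ^^ i) x) = (wprod A \<pi> ^^ (n + i)) x" by (simp add: funpow_add)
    also have "\<dots> = (wprod A \<pi> ^^ i) ((wprod A \<pi> ^^ n) x)" by (subst add.commute) (simp add: funpow_add)
    finally show "(wprod A \<pi> ^^ n) ((wprod A \<pi> ^^ i) x) = (wprod A \<pi> ^^ i) ((wprod A \<pi> ^^ n) x)" .
  qed
  finally show ?thesis by (simp add: orbit_arc_def)
qed

lemma arc_cox: "wprod A \<pi> (orbit_arc \<pi> x l) = orbit_arc \<pi> (wprod A \<pi> x) l"
  using arc_shift[where n = 1] by simp

lemma arc_inv:
  assumes "is_cox_word \<pi>" "x \<in> Pi0 \<pi>"
  shows "inv (wprod A \<pi>) (orbit_arc \<pi> x l) = orbit_arc \<pi> ((wprod A \<pi> ^^ (per \<pi> x - 1)) x) l"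
proof -
  have "wprod A \<pi> ((wprod A \<pi> ^^ (per \<pi> x - 1)) x) = x"
    using per_props(1,2)[OF assms] by (metis Suc_diff_1 comp_apply funpow.simps(2))
  then have "wprod A \<pi> (orbit_arc \<pi> ((wprod A \<pi> ^^ (per \<pi> x - 1)) x) l) = orbit_arc \<pi> x l" by (simp add: arc_cox)
  then show ?thesis by (metis inv_wprod wprod_rev)
qed

definition asupp :: "'i list \<Rightarrow> real ^ 'i \<Rightarrow> nat \<Rightarrow> (real ^ 'i) set" where
  "asupp \<pi> x l = (\<lambda>i. (wprod A \<pi> ^^ i) x) ` {..<l}"

lemma tube_supp_arc:
  assumes c: "is_cox_word \<pi>" and x: "x \<in> Pi0 \<pi>" and l: "l < per \<pi> x" and r: "orbit_arc \<pi> x l \<in> real_roots A"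
  shows "tube_supp A d aff (wprod A \<pi>) (orbit_arc \<pi> x l) = asupp \<pi> x l"
proof -
  have fin: "finite (orb \<pi> x)" by (simp add: orb_eq[OF c x])
  have sub: "asupp \<pi> x l \<subseteq> orb \<pi> x" by (auto simp: asupp_def orb_def)
  have inj: "inj_on (\<lambda>i. (wprod A \<pi> ^^ i) x) {..<l}"
    using orb_inj[OF c x] by (rule inj_on_subset) (use l in auto)
  have "(\<Sum>y\<in>orb \<pi> x. of_bool (y \<in> asupp \<pi> x l) *\<^sub>R y) = (\<Sum>y\<in>asupp \<pi> x l. y)"
    using fin sub by (intro sum.mono_neutral_cong_right) auto
  also have "\<dots> = orbit_arc \<pi> x l" unfolding asupp_def orbit_arc_def by (subst sum.reindex[OF inj]) simp
  finally have e: "orbit_arc \<pi> x l = (\<Sum>y\<in>orb \<pi> x. of_bool (y \<in> asupp \<pi> x l) *\<^sub>R y)" by simp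
  have "K (orbit_arc \<pi> x l) (orbit_arc \<pi> x l) \<noteq> 0" using real_norm_pos[OF r] by simp
  from tube_supp_eq[OF c x e this] show ?thesis using sub by auto
qed

lemma Upsilon_re_real: "is_cox_word \<pi> \<Longrightarrow> \<alpha> \<in> Upsilon_re A d aff (wprod A \<pi>) \<Longrightarrow> \<alpha> \<in> real_roots A \<and> good \<alpha>"
  by (simp add: Upsilon_re_iff tube_def good_real)

lemma per_move: "per (\<rho> @ [s]) (S s x) = per (s # \<rho>) x"
  unfolding per_def funpow_move S_inj ..

lemma arc_move: "orbit_arc (\<rho> @ [s]) (S s x) l = S s (orbit_arc (s # \<rho>) x l)"
  unfolding orbit_arc_def funpow_move by (simp add: linear_sum[OF S_linear] del: wprod_Cons)

lemma asupp_move: "asupp (\<rho> @ [s]) (S s x) l = S s ` asupp (s # \<rho>) x l"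
  unfolding asupp_def funpow_move by (simp add: image_image del: wprod_Cons)

lemma tube_supp_arc_move:
  assumes c: "is_cox_word (s # \<rho>)" and x: "x \<in> Pi0 (s # \<rho>)" and l: "l < per (s # \<rho>) x"
    and r: "orbit_arc (s # \<rho>) x l \<in> real_roots A"
  shows "tube_supp A d aff (wprod A (\<rho> @ [s])) (S s (orbit_arc (s # \<rho>) x l))
    = S s ` tube_supp A d aff (wprod A (s # \<rho>)) (orbit_arc (s # \<rho>) x l)"
proof -
  have c': "is_cox_word (\<rho> @ [s])" using c cox_rotate by blast
  have "S s x \<in> Pi0 (\<rho> @ [s])" using Pi0_move[OF c] x by blast
  then show ?thesis
    using tube_supp_arc[OF c' _, of "S s x" l] l r
    unfolding per_move arc_move asupp_move tube_supp_arc[OF c x l r] by simp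
qed

text \<open>\<open>S s\<close> intertwines the two Coxeter elements and carries indecomposable roots
  and arcs of one word to those of the other. As elements of \<open>Upsilon_re\<close> are arcs, all
  supports in the definition are transported.\<close>

lemma compat_circ_move:
  assumes c: "is_cox_word (s # \<rho>)" and a: "\<alpha> \<in> Upsilon_re A d aff (wprod A (s # \<rho>))"
    and b: "\<beta> \<in> Upsilon_re A d aff (wprod A (s # \<rho>))"
  shows "compat_circ A d aff (wprod A (s # \<rho>)) \<alpha> \<beta> = compat_circ A d aff (wprod A (\<rho> @ [s])) (S s \<alpha>) (S s \<beta>)"
proof -
  let ?c = "wprod A (s # \<rho>)" and ?c' = "wprod A (\<rho> @ [s])"
  let ?T = "tube_supp A d aff ?c" and ?T' = "tube_supp A d aff ?c'"
  have c': "is_cox_word (\<rho> @ [s])" using c cox_rotate by blast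
  have T: "?T' (S s \<gamma>) = S s ` ?T \<gamma>" "?T' (?c' (S s \<gamma>)) = S s ` ?T (?c \<gamma>)"
    "?T' (inv ?c' (S s \<gamma>)) = S s ` ?T (inv ?c \<gamma>)" if g: "\<gamma> \<in> Upsilon_re A d aff ?c" for \<gamma>
  proof -
    obtain x l where x: "x \<in> Pi0 (s # \<rho>)" "l < per (s # \<rho>) x" "\<gamma> = orbit_arc (s # \<rho>) x l"
      using Upsilon_re_arc[OF c g] by blast
    have gr: "\<gamma> \<in> real_roots A" using Upsilon_re_real[OF c g] by blast
    show "?T' (S s \<gamma>) = S s ` ?T \<gamma>" using tube_supp_arc_move[OF c x(1,2)] gr x(3) by simp
    have m: "?T' (S s (orbit_arc (s # \<rho>) ((?c ^^ n) x) l)) = S s ` ?T (orbit_arc (s # \<rho>) ((?c ^^ n) x) l)"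
      if "orbit_arc (s # \<rho>) ((?c ^^ n) x) l \<in> real_roots A" for n
      using tube_supp_arc_move[OF c Pi0_funpow[OF c x(1), of n]] x(2) per_shift[OF c x(1), of n] that by metis
    have "?c' (S s \<gamma>) = S s (?c \<gamma>)" by simp
    moreover have "?c \<gamma> = orbit_arc (s # \<rho>) ((?c ^^ 1) x) l" unfolding x(3) arc_cox by simp
    moreover have "?c \<gamma> \<in> real_roots A" using gr wprod_real by blast
    ultimately show "?T' (?c' (S s \<gamma>)) = S s ` ?T (?c \<gamma>)" using m[of 1] by metis
    have "inv ?c' (S s \<gamma>) = S s (inv ?c \<gamma>)" unfolding inv_wprod by simp
    moreover have "inv ?c \<gamma> = orbit_arc (s # \<rho>) ((?c ^^ (per (s # \<rho>) x - 1)) x) l" unfolding x(3) by (rule arc_inv[OF c x(1)])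
    moreover have "inv ?c \<gamma> \<in> real_roots A" using gr wprod_real unfolding inv_wprod by blast
    ultimately show "?T' (inv ?c' (S s \<gamma>)) = S s ` ?T (inv ?c \<gamma>)" using m[of "per (s # \<rho>) x - 1"] by metis
  qed
  have inj: "inj (S s)" by (rule injI) (metis S_S)
  have tub: "tube (s # \<rho>) \<noteq> {}" "tube (\<rho> @ [s]) \<noteq> {}"
    using a Upsilon_re_move[OF c, of \<alpha>] unfolding Upsilon_re_iff[OF c] Upsilon_re_iff[OF c'] by blast+
  have Pm: "S s y \<in> Pi_c A d aff ?c' \<longleftrightarrow> y \<in> Pi_c A d aff ?c" for y
    unfolding Pi_c_eq[OF c tub(1)] Pi_c_eq[OF c' tub(2)] by (rule Pi0_move[OF c])
  have im: "S s y \<in> S s ` X \<longleftrightarrow> y \<in> X" for y X using inj by (simp add: inj_image_mem_iff)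
  have ad: "adjacent A d aff ?c' (S s \<alpha>) (S s y) \<longleftrightarrow> adjacent A d aff ?c \<alpha> y" for y
    unfolding adjacent_def T[OF a] Pm image_Un[symmetric] im ..
  have "{y \<in> S s ` ?T \<beta>. adjacent A d aff ?c' (S s \<alpha>) y} = S s ` {y \<in> ?T \<beta>. adjacent A d aff ?c \<alpha> y}"
    using ad by (auto simp del: wprod_Cons wprod_append)
  then have "adj A d aff ?c' (S s \<alpha>) (S s \<beta>) = adj A d aff ?c \<alpha> \<beta>"
    unfolding adj_def T(1)[OF b] using card_image[OF inj_on_subset[OF inj subset_UNIV]] by metis
  moreover have "S s ` X \<subset> S s ` Y \<longleftrightarrow> X \<subset> Y" for X Y
    using inj by (metis inj_image_subset_iff less_le_not_le)
  ultimately show ?thesis unfolding compat_circ_def T(1)[OF a] T(1)[OF b] S_inj by simp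
qed

section \<open>Two arcs: E against the adjacency count\<close>

context
  fixes \<pi> \<alpha> \<beta> x y l m
  assumes c: "is_cox_word \<pi>" and x: "x \<in> Pi0 \<pi>" "0 < l" "l < per \<pi> x" "\<alpha> = orbit_arc \<pi> x l" and ra: "\<alpha> \<in> real_roots A" "nonneg \<alpha>"
    and y: "y \<in> Pi0 \<pi>" "0 < m" "m < per \<pi> y" "\<beta> = orbit_arc \<pi> y m" and rb: "\<beta> \<in> real_roots A" "nonneg \<beta>"
begin

abbreviation (input) "cc \<equiv> wprod A \<pi>"

lemma arc_supps:
  "tube_supp A d aff cc \<alpha> = asupp \<pi> x l" "tube_supp A d aff cc \<beta> = asupp \<pi> y m"
  "tube_supp A d aff cc (cc \<alpha>) = asupp \<pi> (cc x) l"
  "tube_supp A d aff cc (inv cc \<alpha>) = asupp \<pi> ((cc ^^ (per \<pi> x - 1)) x) l"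
proof -
  show "tube_supp A d aff cc \<alpha> = asupp \<pi> x l" "tube_supp A d aff cc \<beta> = asupp \<pi> y m"
    using tube_supp_arc[OF c x(1,3)] tube_supp_arc[OF c y(1,3)] x(4) y(4) ra rb by auto
  have s: "tube_supp A d aff cc (orbit_arc \<pi> ((cc ^^ n) x) l) = asupp \<pi> ((cc ^^ n) x) l"
    if "orbit_arc \<pi> ((cc ^^ n) x) l \<in> real_roots A" for n
    using tube_supp_arc[OF c Pi0_funpow[OF c x(1), of n]] per_shift[OF c x(1), of n] x(3) that by simp
  have "cc \<alpha> = orbit_arc \<pi> ((cc ^^ 1) x) l" unfolding x(4) arc_cox by simp
  then show "tube_supp A d aff cc (cc \<alpha>) = asupp \<pi> (cc x) l"
    using s[of 1] wprod_real[OF ra(1), of \<pi>] by simp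
  have "inv cc \<alpha> = orbit_arc \<pi> ((cc ^^ (per \<pi> x - 1)) x) l" unfolding x(4) by (rule arc_inv[OF c x(1)])
  moreover have "inv cc \<alpha> \<in> real_roots A" using wprod_real[OF ra(1)] unfolding inv_wprod by blast
  ultimately show "tube_supp A d aff cc (inv cc \<alpha>) = asupp \<pi> ((cc ^^ (per \<pi> x - 1)) x) l"
    using s[of "per \<pi> x - 1"] by simp
qed

lemma asupp_orb: "asupp \<pi> x l \<subseteq> orb \<pi> x" "asupp \<pi> y m \<subseteq> orb \<pi> y"
  "asupp \<pi> (cc x) l \<subseteq> orb \<pi> x" "asupp \<pi> ((cc ^^ (per \<pi> x - 1)) x) l \<subseteq> orb \<pi> x"
proof -
  have o: "asupp \<pi> z k \<subseteq> orb \<pi> z" for z k by (auto simp: asupp_def orb_def)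
  show "asupp \<pi> x l \<subseteq> orb \<pi> x" "asupp \<pi> y m \<subseteq> orb \<pi> y" by (rule o)+
  show "asupp \<pi> (cc x) l \<subseteq> orb \<pi> x" using o[of "cc x" l] orb_shift[OF c x(1), of 1] by simp
  show "asupp \<pi> ((cc ^^ (per \<pi> x - 1)) x) l \<subseteq> orb \<pi> x"
    using o[of "(cc ^^ (per \<pi> x - 1)) x" l] orb_shift[OF c x(1), of "per \<pi> x - 1"] by simp
qed

lemma asupp_proper: "\<not> orb \<pi> x \<subseteq> asupp \<pi> x l"
proof
  assume "orb \<pi> x \<subseteq> asupp \<pi> x l"
  then obtain i where "i < l" "(cc ^^ l) x = (cc ^^ i) x" by (auto simp: orb_def asupp_def)
  then show False using X_eq[OF c x(1), of l i] x(3) by simp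
qed

lemma asupp_nonempty: "asupp \<pi> x l \<noteq> {}" "asupp \<pi> y m \<noteq> {}"
  using x(2) y(2) by (auto simp: asupp_def)

lemma tube_nonempty: "tube \<pi> \<noteq> {}"
  using Pi0_tube[OF x(1)] by blast

lemma component_full_arc:
  "component_full A d aff cc {\<alpha>, \<beta>} \<longleftrightarrow> (\<exists>z\<in>Pi0 \<pi>. orb \<pi> z \<subseteq> asupp \<pi> x l \<union> asupp \<pi> y m)"
  unfolding component_full_def tube_supp_set_def tube_comps_eq[OF c tube_nonempty] by (simp add: arc_supps)

lemma adj_arc: "adj A d aff cc \<alpha> \<beta> = real (card {z \<in> asupp \<pi> y m. z \<notin> asupp \<pi> x l \<and>
    (z \<in> asupp \<pi> (cc x) l \<or> z \<in> asupp \<pi> ((cc ^^ (per \<pi> x - 1)) x) l)})"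
proof -
  have "z \<in> Pi_c A d aff cc" if "z \<in> asupp \<pi> y m" for z
    unfolding Pi_c_eq[OF c tube_nonempty] using that asupp_orb(2) orb_P[OF c y(1)] by blast
  then show ?thesis
    unfolding adj_def adjacent_def arc_supps by (metis (no_types, lifting) Un_iff)
qed

lemma orbits_disjoint:
  assumes "orb \<pi> x \<noteq> orb \<pi> y" shows "orb \<pi> x \<inter> orb \<pi> y = {}"
  using assms orb_mem_eq[OF c x(1)] orb_mem_eq[OF c y(1)] by blast

text \<open>E vanishes between different orbits, disjoint supports leave nothing adjacent, and two
  proper arcs in different orbits cover neither orbit.\<close>

lemma degree_different:
  assumes o: "orb \<pi> x \<noteq> orb \<pi> y"
  shows "maxdeg cc \<alpha> \<beta> = 0" "compat_circ A d aff cc \<alpha> \<beta> = 0" "\<not> component_full A d aff cc {\<alpha>, \<beta>}"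
proof -
  note dj = orbits_disjoint[OF o]
  have E: "euler \<pi> u v = 0" "euler \<pi> v u = 0" if uv: "u \<in> orb \<pi> x" "v \<in> orb \<pi> y" for u v
  proof -
    have P: "u \<in> Pi0 \<pi>" "v \<in> Pi0 \<pi>" using uv orb_P[OF c x(1)] orb_P[OF c y(1)] by auto
    have "u \<notin> orb \<pi> v" "v \<notin> orb \<pi> u"
      using uv dj orb_mem_eq[OF c x(1) uv(1)] orb_mem_eq[OF c y(1) uv(2)] by auto
    then show "euler \<pi> u v = 0" "euler \<pi> v u = 0" using euler_outside[OF c] P by auto
  qed
  have xo: "(cc ^^ i) x \<in> orb \<pi> x" "(cc ^^ i) y \<in> orb \<pi> y" for i by (auto simp: orb_def)
  have "euler \<pi> \<alpha> \<beta> = 0" "euler \<pi> \<beta> \<alpha> = 0"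
    unfolding x(4) y(4) orbit_arc_def euler_sum_left by (simp_all add: euler_sum_right E xo)
  then show "maxdeg cc \<alpha> \<beta> = 0" using maxdeg_good[OF good_real[OF ra] good_real[OF rb] c] by simp
  have d1: "asupp \<pi> x l \<inter> asupp \<pi> y m = {}" using asupp_orb dj by blast
  have "\<alpha> \<noteq> \<beta>" using arc_supps(1,2) d1 asupp_nonempty by auto
  moreover have "\<not> asupp \<pi> x l \<subset> asupp \<pi> y m" "\<not> asupp \<pi> y m \<subset> asupp \<pi> x l"
    using d1 asupp_nonempty by blast+
  moreover have "adj A d aff cc \<alpha> \<beta> = 0"
  proof -
    have emp: "{z \<in> asupp \<pi> y m. z \<notin> asupp \<pi> x l \<and>
      (z \<in> asupp \<pi> (cc x) l \<or> z \<in> asupp \<pi> ((cc ^^ (per \<pi> x - 1)) x) l)} = {}"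
      using asupp_orb dj by blast
    show ?thesis unfolding adj_arc emp by simp
  qed
  ultimately show "compat_circ A d aff cc \<alpha> \<beta> = 0"
    unfolding compat_circ_def arc_supps(1,2) by simp
  show "\<not> component_full A d aff cc {\<alpha>, \<beta>}"
  proof
    assume "component_full A d aff cc {\<alpha>, \<beta>}"
    then obtain z where z: "z \<in> Pi0 \<pi>" "orb \<pi> z \<subseteq> asupp \<pi> x l \<union> asupp \<pi> y m"
      unfolding component_full_arc by blast
    have "z \<in> orb \<pi> x \<or> z \<in> orb \<pi> y" using z(2) orb_self[of z \<pi>] asupp_orb by blast
    then show False
    proof
      assume "z \<in> orb \<pi> x"
      then have "orb \<pi> z = orb \<pi> x" using orb_mem_eq[OF c x(1)] by blast
      then have "orb \<pi> x \<subseteq> asupp \<pi> x l" using z(2) asupp_orb(2) dj by blast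
      then show False using asupp_proper by blast
    next
      assume "z \<in> orb \<pi> y"
      then have e: "orb \<pi> z = orb \<pi> y" using orb_mem_eq[OF c y(1)] by blast
      then have s: "orb \<pi> y \<subseteq> asupp \<pi> y m" using z(2) asupp_orb(1) dj by blast
      obtain i where "i < m" "(cc ^^ m) y = (cc ^^ i) y" using s by (auto simp: orb_def asupp_def)
      then show False using X_eq[OF c y(1), of m i] y(3) by simp
    qed
  qed
qed

text \<open>Cut the cycle at \<open>p\<close>, a point outside both arcs. The arcs become intervals
  of indices, E becomes a difference of consecutive indicators without wrap-around, and the double
  sum telescopes to the end points.\<close>

lemma degree_same_gap:
  assumes o: "orb \<pi> x = orb \<pi> y" and gap: "p \<in> orb \<pi> x" "p \<notin> asupp \<pi> x l" "p \<notin> asupp \<pi> y m"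
  shows "maxdeg cc \<alpha> \<beta> = compat_circ A d aff cc \<alpha> \<beta>"
proof -
  \<comment> \<open>Counting starts just after \<open>p\<close>, so that \<open>p\<close> gets the
    last index \<open>r - 1\<close>.\<close>
  define z where "z = cc p"
  have pP: "p \<in> Pi0 \<pi>" using orb_P[OF c x(1) gap(1)] .
  have z: "z \<in> Pi0 \<pi>" unfolding z_def using Pi0_funpow[OF c pP, of 1] by simp
  define r where "r = per \<pi> z"
  have r2: "r \<ge> 2" unfolding r_def by (rule per_ge2[OF c z])
  let ?Z = "\<lambda>i. (cc ^^ i) z"
  have oz: "orb \<pi> z = orb \<pi> x" using orb_shift[OF c pP, of 1] orb_mem_eq[OF c x(1) gap(1)] by (simp add: z_def)
  have prx: "per \<pi> x = r"
  proof -
    have "x \<in> orb \<pi> z" using oz orb_self by blast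
    then show ?thesis using per_shift[OF c z] by (auto simp: orb_def r_def)
  qed
  have pairing: "per \<pi> p = r" using per_shift[OF c pP, of 1] by (simp add: z_def r_def)
  have pZ: "p = ?Z (r - 1)"
  proof -
    have "?Z (r - 1) = (cc ^^ Suc (r - 1)) p" by (simp add: z_def funpow_swap1)
    also have "Suc (r - 1) = r" using r2 by simp
    finally show ?thesis using per_props(2)[OF c pP] pairing by simp
  qed
  have Zeq: "?Z i = ?Z j \<longleftrightarrow> i mod r = j mod r" for i j using X_eq[OF c z] by (simp add: r_def)
  \<comment> \<open>An arc running past the last index would contain \<open>p\<close>.\<close>
  have place: "\<exists>a. w = ?Z a \<and> a + k \<le> r - 1" if w: "w \<in> orb \<pi> z" "p \<notin> asupp \<pi> w k" for w k
  proof -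
    obtain a where a: "a < r" "w = ?Z a" using w(1) unfolding orb_eq[OF c z] by (auto simp: r_def)
    have "a + k \<le> r - 1"
    proof (rule ccontr)
      assume "\<not> ?thesis"
      then have "r - 1 - a < k" using a(1) by linarith
      moreover have "p = (cc ^^ (r - 1 - a)) w"
      proof -
        have "(cc ^^ (r - 1 - a)) w = ?Z (r - 1 - a + a)" unfolding a(2) by (simp only: funpow_add comp_apply)
        also have "r - 1 - a + a = r - 1" using a(1) by simp
        finally show ?thesis using pZ by simp
      qed
      ultimately show False using w(2) by (auto simp: asupp_def)
    qed
    then show ?thesis using a by blast
  qed
  obtain a where a: "x = ?Z a" "a + l \<le> r - 1" using place[of x l] gap(2) oz orb_self by blast
  obtain b where b: "y = ?Z b" "b + m \<le> r - 1" using place[of y m] gap(3) oz o orb_self by blast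
  define I where "I = {a..<a + l}"
  define J where "J = {b..<b + m}"
  have IJ: "\<And>i. i \<in> I \<Longrightarrow> i < r - 1" "\<And>i. i \<in> J \<Longrightarrow> i < r - 1" using a(2) b(2) by (auto simp: I_def J_def)
  have arcI: "orbit_arc \<pi> (?Z e) k = (\<Sum>i\<in>{e..<e + k}. ?Z i)" for e k
  proof -
    have "orbit_arc \<pi> (?Z e) k = (\<Sum>i<k. ?Z (i + e))" unfolding orbit_arc_def by (simp add: funpow_add)
    also have "\<dots> = (\<Sum>i\<in>{0 + e..<k + e}. ?Z i)" unfolding sum.shift_bounds_nat_ivl by (simp add: lessThan_atLeast0)
    finally show ?thesis by (simp add: add.commute)
  qed
  have aI: "\<alpha> = (\<Sum>i\<in>I. ?Z i)" and bJ: "\<beta> = (\<Sum>i\<in>J. ?Z i)"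
    unfolding x(4) y(4) a(1) b(1) arcI I_def J_def by auto
  have suppI: "asupp \<pi> (?Z e) k = ?Z ` {e..<e + k}" for e k
  proof -
    have "asupp \<pi> (?Z e) k = (\<lambda>i. ?Z (i + e)) ` {..<k}" unfolding asupp_def by (simp add: funpow_add)
    also have "\<dots> = ?Z ` ((\<lambda>i. i + e) ` {..<k})" by (simp add: image_image)
    also have "(\<lambda>i. i + e) ` {..<k} = {e..<e + k}"
      using image_add_atLeastLessThan'[of e 0 k] by (simp add: lessThan_atLeast0 add.commute)
    finally show ?thesis .
  qed
  have sI: "asupp \<pi> x l = ?Z ` I" and sJ: "asupp \<pi> y m = ?Z ` J"
    unfolding a(1) b(1) suppI I_def J_def by auto
  define N where "N = K z z"
  have Np: "N > 0" using Kxx[OF c z] by (simp add: N_def)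
  \<comment> \<open>The wrap-around term needs index distance \<open>r - 1\<close>, which does not
    occur among indices below \<open>r - 1\<close>.\<close>
  have E: "euler \<pi> (?Z i) (?Z k) = N / 2 * (of_bool (i = k) - of_bool (i = k + 1))" if "i < r - 1" "k < r - 1" for i k
  proof (cases "k \<le> i")
    case True
    have "euler \<pi> (?Z i) (?Z k) = euler \<pi> (?Z (i - k)) z" using euler_X[OF c z, of k "i - k" 0] True by simp
    also have "\<dots> = N / 2 * ((if i - k = 0 then 1 else 0) - (if i - k = 1 then 1 else 0))"
      using euler_orbit(2)[OF c z, of "i - k"] that by (simp add: r_def N_def)
    finally show ?thesis using True by (auto simp: of_bool_def)
  next
    case False
    have "euler \<pi> (?Z i) (?Z k) = euler \<pi> z (?Z (k - i))" using euler_X[OF c z, of i 0 "k - i"] False by simp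
    also have "\<dots> = 0" using euler_orbit(1)[OF c z, of "k - i"] that False by (auto simp: r_def)
    finally show ?thesis using False by simp
  qed
  have fin: "finite I" "finite J" by (auto simp: I_def J_def)
  have EE: "euler \<pi> (\<Sum>i\<in>P. ?Z i) (\<Sum>k\<in>Q. ?Z k) = N / 2 * (\<Sum>k\<in>Q. of_bool (k \<in> P) - of_bool (k + 1 \<in> P))"
    if PQ: "finite P" "finite Q" "\<And>i. i \<in> P \<Longrightarrow> i < r - 1" "\<And>i. i \<in> Q \<Longrightarrow> i < r - 1" for P Q
  proof -
    have "euler \<pi> (\<Sum>i\<in>P. ?Z i) (\<Sum>k\<in>Q. ?Z k) = (\<Sum>k\<in>Q. \<Sum>i\<in>P. euler \<pi> (?Z i) (?Z k))"
      unfolding euler_sum_right euler_sum_left ..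
    also have "\<dots> = (\<Sum>k\<in>Q. \<Sum>i\<in>P. N / 2 * (of_bool (i = k) - of_bool (i = k + 1)))"
      using PQ E by (intro sum.cong refl) auto
    also have "\<dots> = (\<Sum>k\<in>Q. N / 2 * ((\<Sum>i\<in>P. of_bool (i = k)) - (\<Sum>i\<in>P. of_bool (i = k + 1))))"
      by (simp only: sum_distrib_left[symmetric] sum_subtractf)
    also have "\<dots> = (\<Sum>k\<in>Q. N / 2 * (of_bool (k \<in> P) - of_bool (k + 1 \<in> P)))"
      using PQ(1) by (simp add: of_bool_def)
    finally show ?thesis by (simp add: sum_distrib_left)
  qed
  have Eab: "euler \<pi> \<alpha> \<beta> = N / 2 * (of_bool (b \<in> I) - of_bool (b + m \<in> I))"
  proof -
    have "euler \<pi> \<alpha> \<beta> = N / 2 * (\<Sum>k\<in>J. of_bool (k \<in> I) - of_bool (k + 1 \<in> I))"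
      unfolding aI bJ by (rule EE[OF fin IJ])
    then show ?thesis unfolding J_def interval_sum_telescope[of "\<lambda>k. of_bool (k \<in> I)" b m] .
  qed
  have Eba: "euler \<pi> \<beta> \<alpha> = N / 2 * (of_bool (b + m - 1 \<in> I) - of_bool (0 < b \<and> b - 1 \<in> I))"
  proof -
    have "euler \<pi> \<beta> \<alpha> = (\<Sum>i\<in>J. \<Sum>k\<in>I. euler \<pi> (?Z i) (?Z k))"
      unfolding aI bJ euler_sum_left by (simp add: euler_sum_right)
    also have "\<dots> = (\<Sum>i\<in>J. \<Sum>k\<in>I. N / 2 * (of_bool (i = k) - of_bool (i = k + 1)))"
      using IJ E by (intro sum.cong refl) auto
    also have "\<dots> = (\<Sum>i\<in>J. N / 2 * ((\<Sum>k\<in>I. of_bool (i = k)) - (\<Sum>k\<in>I. of_bool (i = k + 1))))"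
      by (simp only: sum_distrib_left[symmetric] sum_subtractf)
    also have "\<dots> = (\<Sum>i\<in>J. N / 2 * (of_bool (i \<in> I) - of_bool (0 < i \<and> i - 1 \<in> I)))"
    proof (intro sum.cong refl arg_cong[where f = "\<lambda>v. N / 2 * v"] arg_cong2[where f = "(-)"])
      fix i
      show "(\<Sum>k\<in>I. of_bool (i = k)) = (of_bool (i \<in> I) :: real)" using fin(1) by (simp add: of_bool_def)
      show "(\<Sum>k\<in>I. of_bool (i = k + 1)) = (of_bool (0 < i \<and> i - 1 \<in> I) :: real)"
        using fin(1) by (cases i) (simp_all add: of_bool_def)
    qed
    also have "\<dots> = - (N / 2) * (\<Sum>i\<in>{b..<b + m}. of_bool (0 < i \<and> i - 1 \<in> I) - of_bool (0 < i + 1 \<and> i + 1 - 1 \<in> I))"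
      unfolding J_def sum_distrib_left by (intro sum.cong refl) (simp add: algebra_simps)
    also have "\<dots> = - (N / 2) * (of_bool (0 < b \<and> b - 1 \<in> I) - of_bool (0 < b + m \<and> b + m - 1 \<in> I))"
      unfolding interval_sum_telescope[of "\<lambda>i. of_bool (0 < i \<and> i - 1 \<in> I)" b m] ..
    finally show ?thesis using y(2) by (simp add: algebra_simps)
  qed
  have "euler \<pi> \<alpha> \<alpha> = N / 2 * (of_bool (a \<in> I) - of_bool (a + l \<in> I))"
  proof -
    have "euler \<pi> \<alpha> \<alpha> = N / 2 * (\<Sum>k\<in>I. of_bool (k \<in> I) - of_bool (k + 1 \<in> I))"
      unfolding aI by (rule EE[OF fin(1) fin(1) IJ(1) IJ(1)])
    also have "(\<Sum>k\<in>I. of_bool (k \<in> I) - of_bool (k + 1 \<in> I))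
        = (\<Sum>k\<in>{a..<a + l}. of_bool (k \<in> I) - (of_bool (k + 1 \<in> I) :: real))" by (simp add: I_def)
    finally show ?thesis unfolding interval_sum_telescope[of "\<lambda>k. of_bool (k \<in> I)" a l] .
  qed
  \<comment> \<open>A proper arc has the norm of its elements, so the coroot factor of \<alpha> is
    2/N and cancels the N/2 in E.\<close>
  then have "K \<alpha> \<alpha> = N" using euler_self[OF c, of \<alpha>] x(2) by (simp add: I_def)
  then have tca: "coscale \<alpha> = 2 / N" using ra by (simp add: coscale_def)
  have M: "maxdeg cc \<alpha> \<beta> = max (of_bool (b + m \<in> I) - of_bool (b \<in> I)) (of_bool (0 < b \<and> b - 1 \<in> I) - of_bool (b + m - 1 \<in> I))"
    unfolding maxdeg_good[OF good_real[OF ra] good_real[OF rb] c] tca Eab Eba using Np by simp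
  have injZ: "inj_on ?Z {..<r}" using orb_inj[OF c z] by (simp add: r_def)
  have IJr: "I \<subseteq> {..<r}" "J \<subseteq> {..<r}" using IJ by force+
  have mem: "?Z k \<in> ?Z ` P \<longleftrightarrow> k \<in> P" if "k < r" "P \<subseteq> {..<r}" for k P
    using inj_on_image_mem_iff[OF injZ, of k P] that by simp
  have sub: "?Z ` I \<subseteq> ?Z ` J \<longleftrightarrow> I \<subseteq> J" "?Z ` J \<subseteq> ?Z ` I \<longleftrightarrow> J \<subseteq> I"
    using inj_on_image_subset_iff[OF injZ] IJr by blast+
  have eq: "\<alpha> = \<beta> \<longleftrightarrow> I = J"
  proof
    assume "\<alpha> = \<beta>"
    then have "?Z ` I = ?Z ` J" using arc_supps(1,2) sI sJ by simp
    then show "I = J" using sub by blast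
  qed (simp add: aI bJ)
  have cx: "asupp \<pi> (cc x) l = ?Z ` {a + 1..<a + 1 + l}"
  proof -
    have "cc x = ?Z (a + 1)" by (simp add: a(1))
    then show ?thesis using suppI[of "a + 1" l] by simp
  qed
  \<comment> \<open>The predecessor of index \<open>a\<close> is represented by
    \<open>a + r - 1\<close> to stay within the natural numbers.\<close>
  have cix: "asupp \<pi> ((cc ^^ (per \<pi> x - 1)) x) l = ?Z ` {a + r - 1..<a + r - 1 + l}"
  proof -
    have "(cc ^^ (per \<pi> x - 1)) x = (cc ^^ (r - 1)) x" by (simp only: prx)
    also have "\<dots> = ?Z (r - 1 + a)" by (subst a(1)) (simp only: funpow_add comp_apply)
    also have "r - 1 + a = a + r - 1" using r2 by simp
    finally show ?thesis using suppI[of "a + r - 1" l] by simp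
  qed
  have n1: "?Z k \<in> ?Z ` {a + 1..<a + 1 + l} \<longleftrightarrow> 0 < k \<and> k - 1 \<in> I" if "k \<in> J" for k
  proof -
    have "?Z k \<in> ?Z ` {a + 1..<a + 1 + l} \<longleftrightarrow> k \<in> {a + 1..<a + 1 + l}"
      using IJ(2)[OF that] a(2) by (intro mem) auto
    then show ?thesis by (auto simp: I_def)
  qed
  have n2: "?Z k \<in> ?Z ` {a + r - 1..<a + r - 1 + l} \<longleftrightarrow> k + 1 \<in> I" if "k \<in> J" for k
  proof -
    have k: "k < r - 1" using IJ(2)[OF that] .
    have shift: "?Z (i + r) = ?Z i" for i using X_shift[OF c z, of i 1] by (simp add: r_def)
    show ?thesis
    proof
      assume "?Z k \<in> ?Z ` {a + r - 1..<a + r - 1 + l}"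
      then obtain i where i: "a + r - 1 \<le> i" "i < a + r - 1 + l" "?Z k = ?Z i" by auto
      have "k = i mod r" using i(3) k Zeq[of k i] by simp
      show "k + 1 \<in> I"
      proof (cases "i < r")
        case True
        then have "k = i" using \<open>k = i mod r\<close> by simp
        then show ?thesis using k i(1) by simp
      next
        case False
        then have "i - r < r" "i mod r = (i - r) mod r" using i(2) a(2) by (auto simp: le_mod_geq)
        then have "k = i - r" using \<open>k = i mod r\<close> by simp
        then show ?thesis using False i(1,2) r2 by (auto simp: I_def)
      qed
    next
      assume "k + 1 \<in> I"
      then have "k + r \<in> {a + r - 1..<a + r - 1 + l}" using r2 by (auto simp: I_def)
      then show "?Z k \<in> ?Z ` {a + r - 1..<a + r - 1 + l}" using shift[of k] by (metis image_eqI)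
    qed
  qed
  have "{w \<in> asupp \<pi> y m. w \<notin> asupp \<pi> x l \<and> (w \<in> asupp \<pi> (cc x) l \<or> w \<in> asupp \<pi> ((cc ^^ (per \<pi> x - 1)) x) l)}
     = ?Z ` {k \<in> J. k \<notin> I \<and> (0 < k \<and> k - 1 \<in> I \<or> k + 1 \<in> I)}"
  proof -
    have im: "{w \<in> h ` J. Q w} = h ` {k \<in> J. Q (h k)}" for h :: "nat \<Rightarrow> real ^ 'i" and Q by blast
    have "{k \<in> J. ?Z k \<notin> ?Z ` I \<and> (?Z k \<in> ?Z ` {a + 1..<a + 1 + l} \<or> ?Z k \<in> ?Z ` {a + r - 1..<a + r - 1 + l})}
       = {k \<in> J. k \<notin> I \<and> (0 < k \<and> k - 1 \<in> I \<or> k + 1 \<in> I)}"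
    proof (rule Collect_cong, rule conj_cong[OF refl])
      fix k assume k: "k \<in> J"
      then have "k < r" using IJr(2) by auto
      then show "(?Z k \<notin> ?Z ` I \<and> (?Z k \<in> ?Z ` {a + 1..<a + 1 + l} \<or> ?Z k \<in> ?Z ` {a + r - 1..<a + r - 1 + l}))
        = (k \<notin> I \<and> (0 < k \<and> k - 1 \<in> I \<or> k + 1 \<in> I))"
        unfolding n1[OF k] n2[OF k] mem[OF \<open>k < r\<close> IJr(1)] by blast
    qed
    then show ?thesis unfolding sI sJ cx cix im by simp
  qed
  then have adj: "adj A d aff cc \<alpha> \<beta> = real (card {k \<in> J. k \<notin> I \<and> (0 < k \<and> k - 1 \<in> I \<or> k + 1 \<in> I)})"
    unfolding adj_arc using card_image[OF inj_on_subset[OF injZ]] IJr(2) by (metis (no_types, lifting) mem_Collect_eq subset_iff)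
  have psub: "?Z ` I \<subset> ?Z ` J \<longleftrightarrow> I \<subset> J" "?Z ` J \<subset> ?Z ` I \<longleftrightarrow> J \<subset> I"
    using sub by (auto simp: less_le_not_le)
  show ?thesis
    unfolding M interval_degree[OF x(2) y(2) I_def J_def] compat_circ_def arc_supps(1,2) sI sJ psub eq adj ..
qed

text \<open>Proper arcs that together cover their orbit are neither equal nor nested, so both
  degrees are the adjacency count. Otherwise the orbits differ or some point lies outside both
  arcs.\<close>

lemma compat_circ_arc:
  "(if component_full A d aff cc {\<alpha>, \<beta>} then adj A d aff cc \<alpha> \<beta> else maxdeg cc \<alpha> \<beta>) = compat_circ A d aff cc \<alpha> \<beta>"
proof (cases "component_full A d aff cc {\<alpha>, \<beta>}")
  case True
  then have o: "orb \<pi> x = orb \<pi> y" using degree_different(3) by blast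
  obtain z where z: "z \<in> Pi0 \<pi>" "orb \<pi> z \<subseteq> asupp \<pi> x l \<union> asupp \<pi> y m"
    using True unfolding component_full_arc by blast
  have "z \<in> orb \<pi> x" using z(2) orb_self[of z \<pi>] asupp_orb o by blast
  then have full: "orb \<pi> x \<subseteq> asupp \<pi> x l \<union> asupp \<pi> y m" using z(2) orb_mem_eq[OF c x(1)] by blast
  have ny: "\<not> orb \<pi> y \<subseteq> asupp \<pi> y m"
  proof
    assume "orb \<pi> y \<subseteq> asupp \<pi> y m"
    then obtain i where "i < m" "(cc ^^ m) y = (cc ^^ i) y" by (auto simp: orb_def asupp_def)
    then show False using X_eq[OF c y(1), of m i] y(3) by simp
  qed
  have "\<alpha> \<noteq> \<beta>" using full asupp_proper arc_supps(1,2) by auto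
  moreover have "\<not> asupp \<pi> x l \<subset> asupp \<pi> y m" using full ny o by blast
  moreover have "\<not> asupp \<pi> y m \<subset> asupp \<pi> x l" using full asupp_proper by blast
  ultimately show ?thesis using True unfolding compat_circ_def arc_supps(1,2) by simp
next
  case nf: False
  show ?thesis
  proof (cases "orb \<pi> x = orb \<pi> y")
    case False
    then show ?thesis using degree_different[OF False] by simp
  next
    case True
    have "\<not> orb \<pi> x \<subseteq> asupp \<pi> x l \<union> asupp \<pi> y m" using nf x(1) unfolding component_full_arc by blast
    then obtain p where "p \<in> orb \<pi> x" "p \<notin> asupp \<pi> x l" "p \<notin> asupp \<pi> y m" by blast
    then show ?thesis using degree_same_gap[OF True] nf by simp
  qed
qed

end

theorem compat_circ_eq:
  assumes c: "is_cox_word \<pi>" and a: "\<alpha> \<in> Upsilon_re A d aff (wprod A \<pi>)" and b: "\<beta> \<in> Upsilon_re A d aff (wprod A \<pi>)"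
  shows "compat A d aff (wprod A \<pi>) \<alpha> \<beta> = compat_circ A d aff (wprod A \<pi>) \<alpha> \<beta>"
proof -
  obtain x l where x: "x \<in> Pi0 \<pi>" "0 < l" "l < per \<pi> x" "\<alpha> = orbit_arc \<pi> x l" using Upsilon_re_arc[OF c a] .
  obtain y m where y: "y \<in> Pi0 \<pi>" "0 < m" "m < per \<pi> y" "\<beta> = orbit_arc \<pi> y m" using Upsilon_re_arc[OF c b] .
  have r: "\<alpha> \<in> real_roots A" "nonneg \<alpha>" "\<beta> \<in> real_roots A" "nonneg \<beta>"
    using Upsilon_re_real[OF c a] Upsilon_re_real[OF c b] good_nonneg by auto
  from compat_circ_arc[OF c x r(1,2) y r(3,4)] show ?thesis
    using a b unfolding compat_def maxdeg_def by (simp split: if_splits)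
qed

end

section \<open>Existence and uniqueness\<close>

context cartan_psd begin

lemma props_move:
  assumes "satisfies_props A d aff f" "is_cox_word (s # \<rho>)"
    "\<alpha> \<in> Phi_c A d aff (wprod A (s # \<rho>))" "\<beta> \<in> Phi_c A d aff (wprod A (s # \<rho>))"
  shows "f (wprod A (s # \<rho>)) \<alpha> \<beta> = f (wprod A (\<rho> @ [s])) (sigma A s \<alpha>) (sigma A s \<beta>)"
  using assms initialI[OF assms(2)] coxeter_wprod[OF assms(2)] conj_by_initial[of s \<rho>]
  unfolding satisfies_props_def by metis

lemma props_move_back:
  assumes "satisfies_props A d aff f" "is_cox_word (s # \<rho>)"
    "\<alpha> \<in> Phi_c A d aff (wprod A (\<rho> @ [s]))" "\<beta> \<in> Phi_c A d aff (wprod A (\<rho> @ [s]))"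
  shows "f (wprod A (\<rho> @ [s])) \<alpha> \<beta> = f (wprod A (s # \<rho>)) (sigma A s \<alpha>) (sigma A s \<beta>)"
proof -
  have "is_cox_word (\<rho> @ [s])" using assms(2) cox_rotate by blast
  then show ?thesis
    using assms finalI[OF assms(2)] coxeter_wprod[of "\<rho> @ [s]"] conj_by_final[of s \<rho>]
    unfolding satisfies_props_def by metis
qed

text \<open>The relation transported along moves is agreement of \<open>f\<close> and
  \<open>g\<close> in both orders of the arguments; (i) and (ii) settle it at negative simple
  roots.\<close>

lemma props_unique_reach:
  assumes f: "satisfies_props A d aff f" and g: "satisfies_props A d aff g"
    and cl: "\<And>s \<rho> \<alpha>. is_cox_word (s # \<rho>) \<Longrightarrow> \<alpha> \<in> Phi_c A d aff (wprod A (s # \<rho>)) \<Longrightarrow>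
        sigma A s \<alpha> \<in> Phi_c A d aff (wprod A (\<rho> @ [s]))"
    and clb: "\<And>s \<rho> \<alpha>. is_cox_word (s # \<rho>) \<Longrightarrow> \<alpha> \<in> Phi_c A d aff (wprod A (\<rho> @ [s])) \<Longrightarrow>
        sigma A s \<alpha> \<in> Phi_c A d aff (wprod A (s # \<rho>))"
    and c: "is_cox_word \<pi>" and x: "x \<in> real_roots A" "nonneg x" "x \<in> Phi_c A d aff (wprod A \<pi>)"
    and b: "\<beta> \<in> Phi_c A d aff (wprod A \<pi>)"
    and neg: "\<not> nonneg ((wprod A \<pi> ^^ k) x) \<or> \<not> nonneg ((wprod A (rev \<pi>) ^^ k) x)"
  shows "f (wprod A \<pi>) x \<beta> = g (wprod A \<pi>) x \<beta>" "f (wprod A \<pi>) \<beta> x = g (wprod A \<pi>) \<beta> x"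
proof -
  let ?P = "\<lambda>\<pi>. Phi_c A d aff (wprod A \<pi>)"
  let ?Q = "\<lambda>\<pi> \<alpha> \<beta>. f (wprod A \<pi>) \<alpha> \<beta> = g (wprod A \<pi>) \<alpha> \<beta> \<and> f (wprod A \<pi>) \<beta> \<alpha> = g (wprod A \<pi>) \<beta> \<alpha>"
  have base: "?Q \<pi> (- sroot i) \<beta>" if "is_cox_word \<pi>" "\<beta> \<in> ?P \<pi>" for \<pi> i \<beta>
    using f g coxeter_wprod[OF that(1)] that(2) unfolding satisfies_props_def by simp
  have "?Q \<pi> x \<beta>"
  proof (cases "nonneg ((wprod A (rev \<pi>) ^^ k) x)")
    case False
    have "\<not> nonneg (snd ((source_move ^^ (k * length \<pi>)) (\<pi>, x)))" using False by (simp add: source_move_words)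
    then show ?thesis
      using props_move[OF f] props_move[OF g] cl base
      by (intro reach[where P = ?P and Q = ?Q, OF _ _ _ c x b]) auto
  next
    case True
    then have "\<not> nonneg (snd ((sink_move ^^ (k * length \<pi>)) (\<pi>, x)))" using neg by (simp add: sink_move_words)
    then show ?thesis
      using props_move_back[OF f] props_move_back[OF g] clb base
      by (intro reach_back[where P = ?P and Q = ?Q, OF _ _ _ c x b]) auto
  qed
  then show "f (wprod A \<pi>) x \<beta> = g (wprod A \<pi>) x \<beta>" "f (wprod A \<pi>) \<beta> x = g (wprod A \<pi>) \<beta> x" by auto
qed

lemma props_negative:
  assumes f: "satisfies_props A d aff f" and g: "satisfies_props A d aff g"
    and c: "is_cox_word \<pi>" and x: "x \<in> neg_simples" and b: "\<beta> \<in> Phi_c A d aff (wprod A \<pi>)"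
  shows "f (wprod A \<pi>) x \<beta> = g (wprod A \<pi>) x \<beta>" "f (wprod A \<pi>) \<beta> x = g (wprod A \<pi>) \<beta> x"
  using f g coxeter_wprod[OF c] x b unfolding satisfies_props_def neg_simples_def by auto

end

context affine_cartan begin

lemma Upsilon_re_sigma:
  assumes c: "is_cox_word (s # \<rho>)" and a: "\<alpha> \<in> almost_positive"
  shows "sigma A s \<alpha> \<in> Upsilon_re A d aff (wprod A (\<rho> @ [s])) \<longleftrightarrow> \<alpha> \<in> Upsilon_re A d aff (wprod A (s # \<rho>))"
proof -
  have c': "is_cox_word (\<rho> @ [s])" using c cox_rotate by blast
  have n: "- sroot i \<notin> Upsilon_re A d aff (wprod A \<pi>)" if "is_cox_word \<pi>" for i \<pi>
    by (simp add: Upsilon_re_iff[OF that] tube_def)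
  have e: "sroot s \<notin> Upsilon_re A d aff (wprod A (s # \<rho>))" "sroot s \<notin> Upsilon_re A d aff (wprod A (\<rho> @ [s]))"
    using euler_D_first[OF c] euler_D_last[OF c] by (simp_all add: Upsilon_re_iff[OF c] Upsilon_re_iff[OF c'] tube_def del: wprod_Cons wprod_append)
  show ?thesis
    using a
  proof (cases rule: almost_positiveE[of \<alpha> s])
    case pos
    then show ?thesis using Upsilon_re_move[OF c] by (simp add: sigma_good del: wprod_Cons wprod_append)
  qed (use n[OF c] n[OF c'] e in \<open>auto simp: sigma_minus sigma_good simp del: wprod_Cons wprod_append\<close>)
qed

lemma compat_maxdeg:
  "\<not> (\<alpha> \<in> Upsilon_re A d aff c \<and> \<beta> \<in> Upsilon_re A d aff c) \<Longrightarrow> compat A d aff c \<alpha> \<beta> = maxdeg c \<alpha> \<beta>"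
  by (auto simp: compat_def maxdeg_def)

text \<open>\<open>sigma\<close> preserves membership in \<open>Upsilon_re\<close>, so the cases do
  not mix: with both arguments inside the tube degree is transported, otherwise the maximum
  formula.\<close>

theorem compat_move:
  assumes c: "is_cox_word (s # \<rho>)" and a: "\<alpha> \<in> Phi_c A d aff (wprod A (s # \<rho>))" and b: "\<beta> \<in> Phi_c A d aff (wprod A (s # \<rho>))"
  shows "compat A d aff (wprod A (s # \<rho>)) \<alpha> \<beta> = compat A d aff (wprod A (\<rho> @ [s])) (sigma A s \<alpha>) (sigma A s \<beta>)"
proof -
  have c': "is_cox_word (\<rho> @ [s])" using c cox_rotate by blast
  have almost_positive: "\<alpha> \<in> almost_positive" "\<beta> \<in> almost_positive" using Phi_c_almost_positive[OF c] a b by auto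
  show ?thesis
  proof (cases "\<alpha> \<in> Upsilon_re A d aff (wprod A (s # \<rho>)) \<and> \<beta> \<in> Upsilon_re A d aff (wprod A (s # \<rho>))")
    case True
    then have U: "\<alpha> \<in> Upsilon_re A d aff (wprod A (s # \<rho>))" "\<beta> \<in> Upsilon_re A d aff (wprod A (s # \<rho>))" by auto
    have sg: "sigma A s \<alpha> = S s \<alpha>" "sigma A s \<beta> = S s \<beta>"
      using Upsilon_re_real[OF c U(1)] Upsilon_re_real[OF c U(2)] sigma_good by auto
    have U': "S s \<alpha> \<in> Upsilon_re A d aff (wprod A (\<rho> @ [s]))" "S s \<beta> \<in> Upsilon_re A d aff (wprod A (\<rho> @ [s]))"
      using Upsilon_re_move[OF c] U by blast+
    show ?thesis
      unfolding sg compat_circ_eq[OF c U] compat_circ_eq[OF c' U'] by (rule compat_circ_move[OF c U])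
  next
    case False
    then have "\<not> (sigma A s \<alpha> \<in> Upsilon_re A d aff (wprod A (\<rho> @ [s])) \<and> sigma A s \<beta> \<in> Upsilon_re A d aff (wprod A (\<rho> @ [s])))"
      unfolding Upsilon_re_sigma[OF c almost_positive(1)] Upsilon_re_sigma[OF c almost_positive(2)] .
    then show ?thesis unfolding compat_maxdeg[OF False] using maxdeg_move[OF c almost_positive] compat_maxdeg by metis
  qed
qed

lemma compat_D:
  assumes c: "is_cox_word \<pi>" and a: "\<alpha> \<in> Upsilon_re A d aff (wprod A \<pi>) \<union> {D}"
  shows "compat A d aff (wprod A \<pi>) D \<alpha> = 0" "compat A d aff (wprod A \<pi>) \<alpha> D = 0"
proof -
  have D: "D \<notin> Upsilon_re A d aff (wprod A \<pi>)"
    using D_not_real[of 1] by (simp add: Upsilon_re_iff[OF c] tube_def)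
  have g: "good \<alpha>" using a good_D Upsilon_re_real[OF c] by auto
  have "euler \<pi> D \<alpha> = 0" using a euler_D_D[OF c] by (auto simp: Upsilon_re_iff[OF c] tube_def)
  moreover from this have "euler \<pi> \<alpha> D = 0" using euler_D_swap[OF c, of \<alpha>] by simp
  ultimately show "compat A d aff (wprod A \<pi>) D \<alpha> = 0" "compat A d aff (wprod A \<pi>) \<alpha> D = 0"
    using maxdeg_good[OF good_D g c] maxdeg_good[OF g good_D c] compat_maxdeg D by simp_all
qed

theorem affine_props: "satisfies_props A d aff (compat A d aff)"
  unfolding satisfies_props_def
proof (intro allI impI conjI)
  fix c assume cx: "coxeter A c"
  obtain \<pi> where c: "is_cox_word \<pi>" "c = wprod A \<pi>" using cx by (elim coxeter_wordE) auto
  have n: "- sroot i \<notin> Upsilon_re A d aff c" for i by (simp add: c(2) Upsilon_re_iff[OF c(1)] tube_def)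
  show "compat A d aff c (- sroot i) \<beta> = \<beta> $ i" for i \<beta> using compat_maxdeg n maxdeg_minus_left by simp
  show "compat A d aff c \<beta> (- sroot i) = coroot_cocoords A d \<beta> $ i" for i \<beta>
    using compat_maxdeg n maxdeg_minus_right by (simp add: coroot_def)
  show "compat A d aff c \<alpha> \<beta> = compat_circ A d aff c \<alpha> \<beta>"
    if "\<alpha> \<in> Upsilon_re A d aff c \<and> \<beta> \<in> Upsilon_re A d aff c" for \<alpha> \<beta>
    using that compat_circ_eq[OF c(1)] c(2) by simp
  show "compat A d aff c D \<alpha> = 0" "compat A d aff c \<alpha> D = 0" if "\<alpha> \<in> Upsilon_re A d aff c \<union> {D}" for \<alpha>
    using compat_D[OF c(1)] that unfolding c(2) by blast+
  fix \<alpha> \<beta> s assume h: "\<alpha> \<in> Phi_c A d aff c \<and> \<beta> \<in> Phi_c A d aff c \<and> (initial A s c \<or> final A s c)"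
  then consider "initial A s c" | "final A s c" by blast
  then show "compat A d aff c \<alpha> \<beta> = compat A d aff (conj_by A s c) (sigma A s \<alpha>) (sigma A s \<beta>)"
  proof cases
    case 1
    then obtain \<rho> where r: "is_cox_word (s # \<rho>)" "wprod A (s # \<rho>) = c" using initialE[OF cx] by blast
    show ?thesis using compat_move[OF r(1)] h unfolding r(2)[symmetric] conj_by_initial by blast
  next
    case 2
    then obtain \<rho> where r: "is_cox_word (s # \<rho>)" "wprod A (\<rho> @ [s]) = c" using finalE[OF cx] by blast
    have c': "is_cox_word (\<rho> @ [s])" using r(1) cox_rotate by blast
    have P: "\<alpha> \<in> Phi_c A d aff (wprod A (\<rho> @ [s]))" "\<beta> \<in> Phi_c A d aff (wprod A (\<rho> @ [s]))"
      using h unfolding r(2) by auto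
    \<comment> \<open>A final letter is reduced to an initial one: the move is applied to the images
      and undone by the involution \<open>sigma\<close>.\<close>
    have "compat A d aff (wprod A (s # \<rho>)) (sigma A s \<alpha>) (sigma A s \<beta>) = compat A d aff (wprod A (\<rho> @ [s])) \<alpha> \<beta>"
      using compat_move[OF r(1) Phi_c_move_back[OF r(1) P(1)] Phi_c_move_back[OF r(1) P(2)]]
        sigma_sigma Phi_c_almost_positive[OF c'] P by simp
    then show ?thesis unfolding r(2)[symmetric] conj_by_final by simp
  qed
qed

text \<open>Some argument is a root outside \<open>U_c\<close>, which drifts until negative, or a
  negative simple root, covered by (i) and (ii); otherwise both are D or in
  \<open>Upsilon_re\<close>, where (iii) and (iv) prescribe the value.\<close>

theorem affine_unique:
  assumes f: "satisfies_props A d aff f" and cx: "coxeter A c"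
    and a: "\<alpha> \<in> Phi_c A d aff c" and b: "\<beta> \<in> Phi_c A d aff c"
  shows "f c \<alpha> \<beta> = compat A d aff c \<alpha> \<beta>"
proof -
  obtain \<pi> where c: "is_cox_word \<pi>" "c = wprod A \<pi>" using cx by (elim coxeter_wordE) auto
  note g = affine_props
  have a': "\<alpha> \<in> Phi_c A d aff (wprod A \<pi>)" and b': "\<beta> \<in> Phi_c A d aff (wprod A \<pi>)" using a b c(2) by auto
  have out: "f c x y = compat A d aff c x y" "f c y x = compat A d aff c y x"
    if x: "x \<in> real_roots A" "nonneg x" "euler \<pi> D x \<noteq> 0" and y: "y \<in> Phi_c A d aff c" for x y
  proof -
    obtain k where k: "\<not> nonneg ((wprod A \<pi> ^^ k) x) \<or> \<not> nonneg ((wprod A (rev \<pi>) ^^ k) x)"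
      using orbit_negative[OF c(1) x(1,3)] by blast
    have xP: "x \<in> Phi_c A d aff (wprod A \<pi>)" using x by (simp add: Phi_c_iff[OF c(1)])
    show "f c x y = compat A d aff c x y" unfolding c(2)
      by (rule props_unique_reach(1)[OF f g Phi_c_move Phi_c_move_back c(1) x(1,2) xP y[unfolded c(2)] k])
    show "f c y x = compat A d aff c y x" unfolding c(2)
      by (rule props_unique_reach(2)[OF f g Phi_c_move Phi_c_move_back c(1) x(1,2) xP y[unfolded c(2)] k])
  qed
  have neg: "f c x y = compat A d aff c x y" "f c y x = compat A d aff c y x"
    if "x \<in> neg_simples" "y \<in> Phi_c A d aff c" for x y
    using props_negative[OF f g c(1), of x y] that unfolding c(2) by blast+
  have inn: "f c \<alpha> \<beta> = compat A d aff c \<alpha> \<beta>"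
    if "\<alpha> = D \<or> \<alpha> \<in> Upsilon_re A d aff c" "\<beta> = D \<or> \<beta> \<in> Upsilon_re A d aff c"
    using f g cx affine that unfolding satisfies_props_def by (elim disjE) auto
  from a'[unfolded Phi_c_iff[OF c(1)]] b'[unfolded Phi_c_iff[OF c(1)]] show ?thesis
    using out neg inn a b unfolding c(2)[symmetric] by blast
qed

end

section \<open>Finite type\<close>

locale finite_cartan = cartan A d
  for A :: "'i::finite \<Rightarrow> 'i \<Rightarrow> int" and d :: "'i \<Rightarrow> real" +
  assumes fin: "finite_type A d"
begin

lemma K_definite: "v \<noteq> 0 \<Longrightarrow> K v v > 0"
  using fin by (simp add: finite_type_def pos_form_definite_def)

sublocale cartan_psd A d
proof unfold_locales
  show "K v v \<ge> 0" for v using K_definite[of v] by (cases "v = 0") (auto intro: less_imp_le)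
  show "\<exists>r. \<forall>v. K v v = 0 \<longrightarrow> (\<exists>t. v = t *\<^sub>R r)"
    using K_definite by (intro exI[of _ 0]) force
qed

lemma not_affine: "\<not> affine_type A d"
  using fin by (auto simp: affine_type_def finite_type_def)

lemma no_imag: "imag_roots A = {}"
proof -
  have False if "v \<in> imag_roots A" for v
  proof -
    have "pairing i v = 0" for i using that by (simp add: imag_roots_def pairing_def)
    then have "K v v = 0" by (rule pairing_rad)
    then show False using K_definite[of v] that by (auto simp: imag_roots_def)
  qed
  then show ?thesis by blast
qed

lemma Phi_finite: "Phi_c A d aff c = {x \<in> real_roots A. nonneg x} \<union> neg_simples"
  using not_affine by (auto simp: Phi_c_def pos_roots_def roots_def no_imag)

lemma compat_finite: "compat A d aff c \<alpha> \<beta> = maxdeg c \<alpha> \<beta>"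
  using not_affine by (simp add: compat_def Upsilon_re_def maxdeg_def)

lemma Phi_almost_positive: "Phi_c A d aff c \<subseteq> almost_positive"
  by (auto simp: Phi_finite almost_positive_def good_real)

lemma Phi_sigma: "x \<in> Phi_c A d aff c \<Longrightarrow> sigma A s x \<in> Phi_c A d aff c'"
proof -
  assume "x \<in> Phi_c A d aff c"
  then consider i where "x = - sroot i" | "x \<in> real_roots A" "nonneg x"
    by (auto simp: Phi_finite neg_simples_def)
  then show ?thesis
  proof cases
    case 1 then show ?thesis by (auto simp: Phi_finite sigma_minus neg_simples_def)
  next
    case 2
    then show ?thesis
      by (cases "x = sroot s") (auto simp: Phi_finite sigma_good good_real S_pos neg_simples_def)
  qed
qed

theorem finite_props: "satisfies_props A d aff (compat A d aff)"
  unfolding satisfies_props_def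
proof (intro allI impI conjI)
  fix c assume cx: "coxeter A c"
  show "compat A d aff c (- sroot i) \<beta> = \<beta> $ i" for i \<beta> by (simp add: compat_finite maxdeg_minus_left)
  show "compat A d aff c \<beta> (- sroot i) = coroot_cocoords A d \<beta> $ i" for i \<beta>
    by (simp add: compat_finite maxdeg_minus_right coroot_def)
  fix \<alpha> \<beta>
  show "\<alpha> \<in> Upsilon_re A d aff c \<and> \<beta> \<in> Upsilon_re A d aff c \<Longrightarrow> compat A d aff c \<alpha> \<beta> = compat_circ A d aff c \<alpha> \<beta>"
    using not_affine by (simp add: Upsilon_re_def)
  show "affine_type A d \<Longrightarrow> compat A d aff c (delta A) \<alpha> = 0" "affine_type A d \<Longrightarrow> compat A d aff c \<alpha> (delta A) = 0"
    using not_affine by auto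
  fix s assume h: "\<alpha> \<in> Phi_c A d aff c \<and> \<beta> \<in> Phi_c A d aff c \<and> (initial A s c \<or> final A s c)"
  then have almost_positive: "\<alpha> \<in> almost_positive" "\<beta> \<in> almost_positive" using Phi_almost_positive by blast+
  from h consider "initial A s c" | "final A s c" by blast
  then show "compat A d aff c \<alpha> \<beta> = compat A d aff (conj_by A s c) (sigma A s \<alpha>) (sigma A s \<beta>)"
  proof cases
    case 1
    then obtain \<rho> where r: "is_cox_word (s # \<rho>)" "wprod A (s # \<rho>) = c" using initialE[OF cx] by blast
    show ?thesis unfolding compat_finite using maxdeg_move[OF r(1) almost_positive] unfolding r(2)[symmetric] conj_by_initial .
  next
    case 2
    then obtain \<rho> where r: "is_cox_word (s # \<rho>)" "wprod A (\<rho> @ [s]) = c" using finalE[OF cx] by blast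
    show ?thesis
      unfolding compat_finite r(2)[symmetric] conj_by_final
      using maxdeg_move[OF r(1) sigma_almost_positive[OF almost_positive(1)] sigma_almost_positive[OF almost_positive(2)]] sigma_sigma[OF almost_positive(1)] sigma_sigma[OF almost_positive(2)] by simp
  qed
qed

text \<open>In definite type some power of the inverse Coxeter element makes any given positive root
  negative, so transport along moves determines every value.\<close>

theorem finite_unique:
  assumes f: "satisfies_props A d aff f" and cx: "coxeter A c"
    and a: "\<alpha> \<in> Phi_c A d aff c" and b: "\<beta> \<in> Phi_c A d aff c"
  shows "f c \<alpha> \<beta> = compat A d aff c \<alpha> \<beta>"
proof -
  obtain \<pi> where c: "is_cox_word \<pi>" "c = wprod A \<pi>" using cx by (elim coxeter_wordE) auto
  note g = finite_props
  show ?thesis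
  proof (cases "\<alpha> \<in> neg_simples")
    case True
    then show ?thesis using props_negative[OF f g c(1)] b unfolding c(2) by blast
  next
    case False
    then have x: "\<alpha> \<in> real_roots A" "nonneg \<alpha>" using a by (auto simp: Phi_finite)
    have "distinct \<pi>" using c(1) by (simp add: is_cox_word_def)
    then obtain k where "\<not> nonneg ((wprod A (rev \<pi>) ^^ k) \<alpha>)"
      using positive_definite_orbit_negative[of \<pi> \<alpha>] K_definite x(1) c(1) by (auto simp: is_cox_word_def)
    then have k: "\<not> nonneg ((wprod A \<pi> ^^ k) \<alpha>) \<or> \<not> nonneg ((wprod A (rev \<pi>) ^^ k) \<alpha>)" by blast
    show ?thesis
      unfolding c(2)
      by (rule props_unique_reach(1)[OF f g _ _ c(1) x _ _ k]) (use a b c(2) Phi_sigma in auto)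
  qed
qed

end

theorem theorem4p5:
  fixes A :: "'i::finite \<Rightarrow> 'i \<Rightarrow> int" and d :: "'i \<Rightarrow> real" and aff :: 'i
  assumes "finite_type A d \<or> affine_type A d"
    and "affine_type A d \<longrightarrow> delta A $ aff = 1"
  shows "satisfies_props A d aff (compat A d aff)
    \<and> (\<forall>f. satisfies_props A d aff f \<longrightarrow>
          (\<forall>c \<alpha> \<beta>. coxeter A c \<and> \<alpha> \<in> Phi_c A d aff c \<and> \<beta> \<in> Phi_c A d aff c
              \<longrightarrow> f c \<alpha> \<beta> = compat A d aff c \<alpha> \<beta>))"
  using assms(1)
proof
  assume f: "finite_type A d"
  interpret finite_cartan A d
    by unfold_locales (use f in \<open>simp_all add: finite_type_def\<close>)
  show ?thesis using finite_props finite_unique by blast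
next
  assume a: "affine_type A d"
  interpret affine_cartan A d aff
    by unfold_locales (use a assms(2) in \<open>simp_all add: affine_type_def\<close>)
  show ?thesis using affine_props affine_unique by blast
qed

end
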